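(* Let $\Omega\subset\mathbb{R}^2$ be a bounded Lipschitz domain, let $K=\{e^{(1)},e^{(2)},e^{(3)}\}$ be the set of three symmetric matrices given in the context, and let $M\in\mathbb{R}^{2\times 2}$ be such that $e(M):=\frac{M+M^T}{2}\in\operatorname{intconv}(K)$. Then there exist a value $\theta_0\in(0,1)$, depending only on $$\frac{\operatorname{dist}(e(M),\partial\operatorname{conv}(K))}{\operatorname{dist}(e(M),K)},$$ and a deformation $u:\mathbb{R}^2\to\mathbb{R}^2$ with $u\in W^{1,\infty}_{loc}(\mathbb{R}^2)$ such that $$\nabla u=M\ \text{ a.e. in }\mathbb{R}^2\setminus\Omega,\qquad \tfrac12\big(\nabla u+(\nabla u)^T\big)\in K\ \text{ a.e. in }\Omega,$$ and such that $\nabla u\in W^{s,p}_{loc}(\mathbb{R}^2)\cap L^\infty(\mathbb{R}^2)$ for all $s\in(0,1)$, $p\in(1,\infty)$ with $sp<\theta_0$.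
   Context: $K:=\{e^{(1)},e^{(2)},e^{(3)}\}$ with $$e^{(1)}=\begin{pmatrix}1&0\\0&-1\end{pmatrix},\quad e^{(2)}=\tfrac12\begin{pmatrix}-1&\sqrt3\\ \sqrt3&1\end{pmatrix},\quad e^{(3)}=\tfrac12\begin{pmatrix}-1&-\sqrt3\\-\sqrt3&1\end{pmatrix}.$$ These are trace-free symmetric matrices forming an equilateral triangle in the two-dimensional space of trace-free symmetric $2\times2$ matrices. $\operatorname{conv}(K)$ is the convex hull of $K$; $\operatorname{intconv}(K)$ and $\partial\operatorname{conv}(K)$ denote its interior and boundary relative to the two-dimensional space of trace-free symmetric matrices. $W^{s,p}$ with $s\in(0,1)$ is the fractional (Sobolev–Slobodeckij) space. *)

theory Defs
  imports "HOL-Analysis.Analysis"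
begin

text \<open>
  Near every boundary point the set is the strict epigraph of a Lipschitz function, in rotated
  coordinates whose last axis is the unit vector \<open>\<nu>\<close>; the remaining coordinates of \<open>y\<close> are its
  orthogonal projection \<open>y - (y \<bullet> \<nu>) *\<^sub>R \<nu>\<close> to the hyperplane \<open>\<nu>\<^sup>\<bottom>\<close>.
\<close>

definition lipschitz_boundary :: "'a::euclidean_space set \<Rightarrow> bool" where
  "lipschitz_boundary \<Omega> \<longleftrightarrow>
     (\<forall>x \<in> frontier \<Omega>. \<exists>\<nu> r L \<gamma>. norm \<nu> = 1 \<and> r > 0 \<and>
        L-lipschitz_on {y. y \<bullet> \<nu> = 0} (\<gamma> :: 'a \<Rightarrow> real) \<and>
        \<Omega> \<inter> ball x r = {y \<in> ball x r. y \<bullet> \<nu> > \<gamma> (y - (y \<bullet> \<nu>) *\<^sub>R \<nu>)})"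

definition bounded_lipschitz_domain :: "'a::euclidean_space set \<Rightarrow> bool" where
  "bounded_lipschitz_domain \<Omega> \<longleftrightarrow>
     open \<Omega> \<and> connected \<Omega> \<and> \<Omega> \<noteq> {} \<and> bounded \<Omega> \<and> lipschitz_boundary \<Omega>"

primrec C_diff :: "nat \<Rightarrow> ('a::euclidean_space \<Rightarrow> real) \<Rightarrow> bool" where
  "C_diff 0 f \<longleftrightarrow> continuous_on UNIV f"
| "C_diff (Suc k) f \<longleftrightarrow> (\<forall>x. f differentiable (at x)) \<and>
     (\<forall>b \<in> Basis. C_diff k (\<lambda>x. frechet_derivative f (at x) b))"

definition test_function_on :: "'a::euclidean_space set \<Rightarrow> ('a \<Rightarrow> real) \<Rightarrow> bool" where
  "test_function_on U \<phi> \<longleftrightarrow>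
     (\<forall>k. C_diff k \<phi>) \<and> (\<exists>C. compact C \<and> C \<subseteq> U \<and> (\<forall>x. x \<notin> C \<longrightarrow> \<phi> x = 0))"

definition locally_integrable_on ::
    "'a::euclidean_space set \<Rightarrow> ('a \<Rightarrow> 'b::euclidean_space) \<Rightarrow> bool" where
  "locally_integrable_on U f \<longleftrightarrow> (\<forall>C. compact C \<and> C \<subseteq> U \<longrightarrow> integrable (lebesgue_on C) f)"

text \<open>
  \<open>G\<close> is the weak gradient of \<open>u\<close> on the open set \<open>U\<close>; row \<open>i\<close> of \<open>G x\<close> is the gradient of the
  component \<open>u\<^sub>i\<close>, so that \<open>x \<mapsto> M *v x\<close> has gradient \<open>M\<close>.  Weak gradients are determined
  only up to null sets.
\<close>

definition has_weak_gradient ::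
    "(real^'n \<Rightarrow> real^'m) \<Rightarrow> (real^'n \<Rightarrow> real^'n^'m) \<Rightarrow> (real^'n) set \<Rightarrow> bool" where
  "has_weak_gradient u G U \<longleftrightarrow>
     locally_integrable_on U u \<and> locally_integrable_on U G \<and>
     (\<forall>\<phi>. test_function_on U \<phi> \<longrightarrow>
        (\<forall>i j. (LINT x|lebesgue_on U. u x $ i * frechet_derivative \<phi> (at x) (axis j 1))
             = - (LINT x|lebesgue_on U. G x $ i $ j * \<phi> x)))"

definition Linf_space ::
    "'a::euclidean_space set \<Rightarrow> ('a \<Rightarrow> 'b::euclidean_space) set" where
  "Linf_space U = {f. f \<in> borel_measurable (lebesgue_on U) \<and>
                      (\<exists>C. AE x in lebesgue_on U. norm (f x) \<le> C)}"

definition Lp_space ::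
    "real \<Rightarrow> 'a::euclidean_space set \<Rightarrow> ('a \<Rightarrow> 'b::euclidean_space) set" where
  "Lp_space p U = {f. f \<in> borel_measurable (lebesgue_on U) \<and>
                      (\<integral>\<^sup>+x. ennreal (norm (f x) powr p) \<partial>lebesgue_on U) < \<infinity>}"

definition W1inf_space :: "(real^'n) set \<Rightarrow> (real^'n \<Rightarrow> real^'m) set" where
  "W1inf_space U = {u \<in> Linf_space U. \<exists>G \<in> Linf_space U. has_weak_gradient u G U}"

text \<open>
  The fractional (Sobolev--Slobodeckij) space, for \<open>0 < s < 1\<close> and \<open>1 \<le> p < \<infinity>\<close>.  The integrand of
  the seminorm is \<open>0\<close> on the diagonal, which is a null set.
\<close>

definition Wsp_space ::
    "real \<Rightarrow> real \<Rightarrow> 'a::euclidean_space set \<Rightarrow> ('a \<Rightarrow> 'b::euclidean_space) set" where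
  "Wsp_space s p U = {f \<in> Lp_space p U.
     (\<integral>\<^sup>+x. (\<integral>\<^sup>+y. ennreal (norm (f x - f y) powr p / norm (x - y) powr (real DIM('a) + s * p))
        \<partial>lebesgue_on U) \<partial>lebesgue_on U) < \<infinity>}"

text \<open>
  \<open>loc_space X U\<close> is \<open>X\<^sub>l\<^sub>o\<^sub>c(U)\<close>: membership in \<open>X V\<close> for all open \<open>V\<close> compactly contained in \<open>U\<close>.
\<close>

definition loc_space ::
    "('a::euclidean_space set \<Rightarrow> ('a \<Rightarrow> 'b) set) \<Rightarrow> 'a set \<Rightarrow> ('a \<Rightarrow> 'b) set" where
  "loc_space X U = {f. \<forall>V. open V \<and> compact (closure V) \<and> closure V \<subseteq> U \<longrightarrow> f \<in> X V}"

definition sym_part :: "real^'n^'n \<Rightarrow> real^'n^'n" where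
  "sym_part A = (1/2) *\<^sub>R (A + transpose A)"

definition e1 :: "real^2^2" where
  "e1 = vector [vector [1, 0], vector [0, -1]]"

definition e2 :: "real^2^2" where
  "e2 = (1/2) *\<^sub>R vector [vector [-1, sqrt 3], vector [sqrt 3, 1]]"

definition e3 :: "real^2^2" where
  "e3 = (1/2) *\<^sub>R vector [vector [-1, - sqrt 3], vector [- sqrt 3, 1]]"

definition K :: "(real^2^2) set" where
  "K = {e1, e2, e3}"

definition tracefree_sym :: "(real^2^2) set" where
  "tracefree_sym = {A. transpose A = A \<and> trace A = 0}"

definition intconv :: "(real^2^2) set \<Rightarrow> (real^2^2) set" where
  "intconv S = top_of_set tracefree_sym interior_of (convex hull S)"

definition bdconv :: "(real^2^2) set \<Rightarrow> (real^2^2) set" where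
  "bdconv S = top_of_set tracefree_sym frontier_of (convex hull S)"

end

theory Submission
  imports Defs "HOL-Analysis.Analysis"
begin

text \<open>
  A trace-free symmetric matrix is identified with a complex number and a gradient with a pair
  \<open>(z, t)\<close> of its symmetric part and its skew part, acting on the plane by
  \<open>h \<mapsto> z * cnj h + \<i> * t * h\<close>; the set \<open>K\<close> becomes the set of third roots of unity.  The solution is
  obtained by iteration: a brick is a piecewise affine perturbation of a linear map supported in a
  thin rectangle, in which a fixed gradient is reached on the two short sides, while the remaining
  cells carry new gradients and are filled up to null sets with scaled copies of further bricks.
  Choosing the proportions of the brick suitably, the central cell carries any prescribed gradient
  on the line through the old gradient and a well, beyond the old gradient.  Two runs of such bricks
  reach a small neighbourhood of the centre of the triangle, where bricks of fixed shape resolve a fixed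
  fraction of the area.  Since the total weight
  \<open>\<Sum> r\<^sup>2\<^sup>-\<^sup>\<theta>\<close> of the copies with scales \<open>r\<close> stays bounded for a small universal exponent \<open>\<theta>\<close>, the
  translation modulus \<open>\<integral>\<bar>\<nabla>u(x + h) - \<nabla>u(x)\<bar>\<close> is of order \<open>\<bar>h\<bar>\<^sup>\<theta>\<close>, which together with the bound on \<open>\<nabla>u\<close>
  gives the fractional regularity by interpolation.  In particular the constant function \<open>\<theta>\<close> serves as
  \<open>\<theta>\<^sub>0\<close>.
\<close>

section \<open>Iterated perturbation\<close>

text \<open>The obstacle is the skew part: every brick changes \<open>t\<close>, and through
  infinitely many generations it has to stay bounded. A nonzero trace-free symmetric matrix is a
  symmetrized rank-one matrix in two ways, with opposite skew parts, so the sign of the drift is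
  free. Moreover, in the runs the drift in the central cells is, up to small errors, at least the
  loss of the gauge of the triangle, which is the maximum of \<open>- 2 * Re (cnj k * E)\<close>
  over the wells \<open>k\<close>. Hence a bound on the skew part of the form \<open>T\<close> plus
  gauge reproduces itself. The exponent can be universal because the dependence on \<open>M\<close>
  is one-way: states built for \<open>M\<close> lead to the centre, and the states at the centre
  never return to them. Their weights may be chosen after \<theta>, provided that such a weight
  re-enters its own inequality with a factor below 1 that does not depend on \<open>M\<close>. This
  is why the rectangles in a run become thinner: the gradient then drifts by a convergent series,
  the tilt between consecutive frames is of the order of the width, and the filling has uniform
  constants.\<close>

definition app :: "complex \<times> real \<Rightarrow> complex \<Rightarrow> complex" where
  "app A h = fst A * cnj h + \<i> * of_real (snd A) * h"

lemma app_add: "app A (x + y) = app A x + app A y"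
  by (simp add: app_def algebra_simps)

lemma app_diff: "app A (x - y) = app A x - app A y"
  by (simp add: app_def algebra_simps)

lemma app_scale: "app A (of_real r * x) = of_real r * app A x"
  by (simp add: app_def algebra_simps)

lemma continuous_on_app [continuous_intros]:
  "continuous_on X f \<Longrightarrow> continuous_on X (\<lambda>x. app A (f x))"
  unfolding app_def by (intro continuous_intros)

definition K3 :: "complex set" where
  "K3 = {1, Complex (-1/2) (sqrt 3 / 2), Complex (-1/2) (- sqrt 3 / 2)}"

text \<open>The data of one generation for every state: \<open>F\<close> perturbs the linear map on
  \<open>DD\<close>, \<open>fin\<close> is the part where a well is already reached, and copy
  \<open>i\<close> is the domain of the state \<open>s \<sigma> i\<close> scaled by \<open>r\<close>
  and moved by \<open>p\<close>. The exponent \<open>2 - \<theta>\<close> in \<open>weight\<close>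
  is forced by scaling: a copy of scale r contributes r^2 * (|h| / r)^\<theta> to the translation
  modulus. One constant \<open>L\<close> serves all states, so that no Lipschitz constant grows
  along the tree.\<close>

locale patched =
  fixes S :: "'s set" and AA :: "'s \<Rightarrow> complex \<times> real" and DD :: "'s \<Rightarrow> complex set"
    and ww :: "'s \<Rightarrow> real" and \<theta> L :: real
    and F :: "'s \<Rightarrow> complex \<Rightarrow> complex" and g :: "'s \<Rightarrow> complex \<Rightarrow> complex \<times> real"
    and fin :: "'s \<Rightarrow> complex set" and p :: "'s \<Rightarrow> nat \<Rightarrow> complex"
    and r :: "'s \<Rightarrow> nat \<Rightarrow> real" and s :: "'s \<Rightarrow> nat \<Rightarrow> 's"
    and I :: "'s \<Rightarrow> nat set" and c :: "'s \<Rightarrow> real"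
  assumes theta: "0 < \<theta>" "\<theta> < 1"
    and lin: "\<sigma> \<in> S \<Longrightarrow> norm (app (AA \<sigma>) h) \<le> L * norm h"
    and Dmeas: "\<sigma> \<in> S \<Longrightarrow> DD \<sigma> \<in> sets borel"
    and Flip: "\<sigma> \<in> S \<Longrightarrow> L-lipschitz_on UNIV (F \<sigma>)"
    and Foff: "\<sigma> \<in> S \<Longrightarrow> x \<notin> DD \<sigma> \<Longrightarrow> F \<sigma> x = app (AA \<sigma>) x"
    and fin_open: "\<sigma> \<in> S \<Longrightarrow> open (fin \<sigma>)"
    and fin_D: "\<sigma> \<in> S \<Longrightarrow> fin \<sigma> \<subseteq> DD \<sigma>"
    and fin_aff: "\<sigma> \<in> S \<Longrightarrow> x \<in> fin \<sigma> \<Longrightarrow>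
      fst (g \<sigma> x) \<in> K3 \<and> (\<exists>e>0. \<forall>y\<in>ball x e. F \<sigma> y = F \<sigma> x + app (g \<sigma> x) (y - x))"
    and child: "\<sigma> \<in> S \<Longrightarrow> i \<in> I \<sigma> \<Longrightarrow> 0 < r \<sigma> i \<and> r \<sigma> i \<le> 1 \<and> s \<sigma> i \<in> S"
    and child_D: "\<sigma> \<in> S \<Longrightarrow> i \<in> I \<sigma> \<Longrightarrow> y \<in> DD (s \<sigma> i) \<Longrightarrow>
       p \<sigma> i + of_real (r \<sigma> i) * y \<in> DD \<sigma> - fin \<sigma>"
    and child_disj: "\<sigma> \<in> S \<Longrightarrow> i \<in> I \<sigma> \<Longrightarrow> j \<in> I \<sigma> \<Longrightarrow> i \<noteq> j \<Longrightarrow>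
       (x - p \<sigma> i) / of_real (r \<sigma> i) \<in> DD (s \<sigma> i) \<Longrightarrow>
       (x - p \<sigma> j) / of_real (r \<sigma> j) \<notin> DD (s \<sigma> j)"
    and child_aff: "\<sigma> \<in> S \<Longrightarrow> i \<in> I \<sigma> \<Longrightarrow>
       \<exists>b. \<forall>x. (x - p \<sigma> i) / of_real (r \<sigma> i) \<in> DD (s \<sigma> i) \<longrightarrow> F \<sigma> x = app (AA (s \<sigma> i)) x + b"
    and cover: "\<sigma> \<in> S \<Longrightarrow> \<exists>N. N \<in> null_sets lborel \<and>
       DD \<sigma> \<subseteq> fin \<sigma> \<union> N \<union>
         (\<Union>i\<in>I \<sigma>. interior {x. (x - p \<sigma> i) / of_real (r \<sigma> i) \<in> DD (s \<sigma> i)})"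
    and gmeas: "\<sigma> \<in> S \<Longrightarrow> g \<sigma> \<in> borel_measurable borel"
    and goff: "\<sigma> \<in> S \<Longrightarrow> x \<notin> DD \<sigma> \<Longrightarrow> g \<sigma> x = AA \<sigma>"
    and gchild: "\<sigma> \<in> S \<Longrightarrow> i \<in> I \<sigma> \<Longrightarrow> (x - p \<sigma> i) / of_real (r \<sigma> i) \<in> DD (s \<sigma> i)
       \<Longrightarrow> g \<sigma> x = AA (s \<sigma> i)"
    and gbound: "\<sigma> \<in> S \<Longrightarrow> norm (g \<sigma> x) \<le> L"
    and cost: "\<sigma> \<in> S \<Longrightarrow>
       (\<integral>\<^sup>+x. ennreal (norm (g \<sigma> (x + h) - g \<sigma> x)) \<partial>lborel) \<le> ennreal (c \<sigma> * norm h powr \<theta>)"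
    and cD: "\<sigma> \<in> S \<Longrightarrow> emeasure lborel (DD \<sigma>) \<le> ennreal (c \<sigma>)"
    and cpos: "\<sigma> \<in> S \<Longrightarrow> 0 \<le> c \<sigma>"
    and wpos: "\<sigma> \<in> S \<Longrightarrow> 0 \<le> ww \<sigma>"
    and weight: "\<sigma> \<in> S \<Longrightarrow> ennreal (c \<sigma>) +
       (\<Sum>i. if i \<in> I \<sigma> then ennreal (r \<sigma> i powr (2 - \<theta>) * ww (s \<sigma> i)) else 0)
         \<le> ennreal (ww \<sigma>)"
begin

definition loc :: "'s \<Rightarrow> nat \<Rightarrow> complex \<Rightarrow> complex" where
  "loc \<sigma> i x = (x - p \<sigma> i) / of_real (r \<sigma> i)"

definition Oc :: "'s \<Rightarrow> nat \<Rightarrow> complex set" where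
  "Oc \<sigma> i = {x. loc \<sigma> i x \<in> DD (s \<sigma> i)}"

definition nd :: "'s \<Rightarrow> complex \<Rightarrow> nat option" where
  "nd \<sigma> x = (if \<exists>i\<in>I \<sigma>. x \<in> Oc \<sigma> i then Some (SOME i. i \<in> I \<sigma> \<and> x \<in> Oc \<sigma> i) else None)"

text \<open>Stage \<open>n + 1\<close> replaces \<open>F\<close>, which is affine on each copy, by
  the rescaled stage \<open>n\<close> of the child. Only the difference from the linear map of the
  child is added, so the additive constants of the affine pieces need not be recorded.\<close>

primrec V :: "nat \<Rightarrow> 's \<Rightarrow> complex \<Rightarrow> complex" where
  "V 0 = (\<lambda>\<sigma> x. app (AA \<sigma>) x)"
| "V (Suc n) = (\<lambda>\<sigma> x. case nd \<sigma> x of None \<Rightarrow> F \<sigma> x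
     | Some i \<Rightarrow> F \<sigma> x + of_real (r \<sigma> i) * (V n (s \<sigma> i) (loc \<sigma> i x) - app (AA (s \<sigma> i)) (loc \<sigma> i x)))"

primrec GG :: "nat \<Rightarrow> 's \<Rightarrow> complex \<Rightarrow> complex \<times> real" where
  "GG 0 = (\<lambda>\<sigma> x. AA \<sigma>)"
| "GG (Suc n) = (\<lambda>\<sigma> x. case nd \<sigma> x of None \<Rightarrow> g \<sigma> x | Some i \<Rightarrow> GG n (s \<sigma> i) (loc \<sigma> i x))"

text \<open>Points at which a well is reached within \<open>n\<close> generations. Interiors of the
  copies make these sets open, so that a whole neighbourhood of such a point is settled.\<close>

primrec Gd :: "nat \<Rightarrow> 's \<Rightarrow> complex set" where
  "Gd 0 = (\<lambda>\<sigma>. {})"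
| "Gd (Suc n) = (\<lambda>\<sigma>. fin \<sigma> \<union> (\<Union>i\<in>I \<sigma>. {x \<in> interior (Oc \<sigma> i). loc \<sigma> i x \<in> Gd n (s \<sigma> i)}))"

lemma Oc_D: "\<sigma> \<in> S \<Longrightarrow> i \<in> I \<sigma> \<Longrightarrow> Oc \<sigma> i \<subseteq> DD \<sigma> - fin \<sigma>"
proof
  fix x assume "\<sigma> \<in> S" "i \<in> I \<sigma>" "x \<in> Oc \<sigma> i"
  then have "p \<sigma> i + of_real (r \<sigma> i) * loc \<sigma> i x \<in> DD \<sigma> - fin \<sigma>"
    using child_D Oc_def by blast
  then show "x \<in> DD \<sigma> - fin \<sigma>" using child[OF \<open>\<sigma> \<in> S\<close> \<open>i \<in> I \<sigma>\<close>] by (simp add: loc_def)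
qed

lemma Oc_disj: "\<sigma> \<in> S \<Longrightarrow> i \<in> I \<sigma> \<Longrightarrow> j \<in> I \<sigma> \<Longrightarrow> x \<in> Oc \<sigma> i \<Longrightarrow> x \<in> Oc \<sigma> j \<Longrightarrow> i = j"
  using child_disj[of \<sigma> i j x] by (auto simp: Oc_def loc_def)

lemma nd_in: "\<sigma> \<in> S \<Longrightarrow> i \<in> I \<sigma> \<Longrightarrow> x \<in> Oc \<sigma> i \<Longrightarrow> nd \<sigma> x = Some i"
  unfolding nd_def using Oc_disj[of \<sigma>] by (auto intro!: some_equality)

lemma nd_out: "\<forall>i\<in>I \<sigma>. x \<notin> Oc \<sigma> i \<Longrightarrow> nd \<sigma> x = None"
  by (auto simp: nd_def)

lemma V_off: "\<sigma> \<in> S \<Longrightarrow> x \<notin> DD \<sigma> \<Longrightarrow> V n \<sigma> x = app (AA \<sigma>) x"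
proof (cases n)
  case (Suc m)
  assume "\<sigma> \<in> S" "x \<notin> DD \<sigma>"
  then have "\<forall>i\<in>I \<sigma>. x \<notin> Oc \<sigma> i" using Oc_D by blast
  then show ?thesis using Suc Foff \<open>\<sigma> \<in> S\<close> \<open>x \<notin> DD \<sigma>\<close> by (simp add: nd_out)
qed simp

lemma GG_off: "\<sigma> \<in> S \<Longrightarrow> x \<notin> DD \<sigma> \<Longrightarrow> GG n \<sigma> x = AA \<sigma>"
proof (cases n)
  case (Suc m)
  assume "\<sigma> \<in> S" "x \<notin> DD \<sigma>"
  then have "\<forall>i\<in>I \<sigma>. x \<notin> Oc \<sigma> i" using Oc_D by blast
  then show ?thesis using Suc goff \<open>\<sigma> \<in> S\<close> \<open>x \<notin> DD \<sigma>\<close> by (simp add: nd_out)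
qed simp

text \<open>The term \<open>norm (AA \<sigma>)\<close> accounts for the root; the gradient of a
  nonempty copy is a value of \<open>g\<close> of its parent and is bounded by \<open>L\<close>, so
  nothing accumulates.\<close>

lemma GG_bound: "\<sigma> \<in> S \<Longrightarrow> norm (GG n \<sigma> x) \<le> max L (norm (AA \<sigma>))"
proof (induction n arbitrary: \<sigma> x)
  case (Suc n)
  show ?case
  proof (cases "\<exists>i\<in>I \<sigma>. x \<in> Oc \<sigma> i")
    case True
    then obtain i where i: "i \<in> I \<sigma>" "x \<in> Oc \<sigma> i" by blast
    then have "norm (AA (s \<sigma> i)) \<le> L"
      using gchild[of \<sigma> i x] gbound[of \<sigma> x] Suc.prems by (auto simp: Oc_def loc_def)
    then show ?thesis using Suc.IH[of "s \<sigma> i" "loc \<sigma> i x"] child[OF Suc.prems i(1)] i Suc.prems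
      by (simp add: nd_in)
  next
    case False
    then show ?thesis using gbound[OF Suc.prems] by (simp add: nd_out max.coboundedI1)
  qed
qed simp

lemma L_nonneg: "\<sigma> \<in> S \<Longrightarrow> 0 \<le> L"
  using Flip lipschitz_on_nonneg by blast

text \<open>Infinitely many copies are glued without loss in the constant. On each copy the new map
  is the restriction of a globally \<open>L\<close>-Lipschitz map that equals \<open>F\<close> on
  the boundary of the copy. A segment between two points is cut where it leaves the copy of its
  first end and where it enters the copy of its second end; between the cuts only \<open>F\<close>
  is compared, and the lengths add up.\<close>

lemma V_lip: "\<sigma> \<in> S \<Longrightarrow> L-lipschitz_on UNIV (V n \<sigma>)"
proof (induction n arbitrary: \<sigma>)
  case 0
  then show ?case using lin L_nonneg
    by (intro lipschitz_onI) (auto simp: dist_norm app_diff[symmetric])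
next
  case (Suc n)
  note sS = Suc.prems
  let ?V = "V (Suc n) \<sigma>"
  have contF: "continuous_on UNIV (F \<sigma>)" using Flip[OF sS] lipschitz_on_continuous_on by blast
  have FL: "norm (F \<sigma> x - F \<sigma> y) \<le> L * norm (x - y)" for x y
    using lipschitz_onD[OF Flip[OF sS], of x y] by (simp add: dist_norm)
  \<comment> \<open>The witness is the formula of the new map on copy \<open>i\<close>, continued to
    the whole plane.\<close>
  have "\<forall>i\<in>I \<sigma>. \<exists>f. L-lipschitz_on UNIV f \<and> (\<forall>x\<in>Oc \<sigma> i. ?V x = f x) \<and>
     (\<forall>x. x \<in> closure (Oc \<sigma> i) \<longrightarrow> x \<in> closure (- Oc \<sigma> i) \<longrightarrow> f x = F \<sigma> x)"
  proof
    fix i assume i: "i \<in> I \<sigma>"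
    note ch = child[OF sS i]
    let ?B = "AA (s \<sigma> i)"
    obtain b where b: "\<And>x. x \<in> Oc \<sigma> i \<Longrightarrow> F \<sigma> x = app ?B x + b"
      using child_aff[OF sS i] by (auto simp: Oc_def loc_def)
    define f where "f x = app ?B x + b + of_real (r \<sigma> i) * (V n (s \<sigma> i) (loc \<sigma> i x) - app ?B (loc \<sigma> i x))" for x
    have rl: "of_real (r \<sigma> i) * app ?B (loc \<sigma> i x) = app ?B x - app ?B (p \<sigma> i)" for x
      using ch by (simp add: app_scale[symmetric] app_diff[symmetric] loc_def)
    have f2: "f x = (b + app ?B (p \<sigma> i)) + of_real (r \<sigma> i) * V n (s \<sigma> i) (loc \<sigma> i x)" for x
      unfolding f_def by (simp add: right_diff_distrib rl)
    have VL: "norm (V n (s \<sigma> i) x - V n (s \<sigma> i) y) \<le> L * norm (x - y)" for x y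
      using lipschitz_onD[OF Suc.IH[of "s \<sigma> i"], of x y] ch by (simp add: dist_norm)
    have "norm (f x - f y) \<le> L * norm (x - y)" for x y
    proof -
      have "f x - f y = of_real (r \<sigma> i) * (V n (s \<sigma> i) (loc \<sigma> i x) - V n (s \<sigma> i) (loc \<sigma> i y))"
        by (simp add: f2 algebra_simps)
      then have "norm (f x - f y) \<le> r \<sigma> i * (L * norm (loc \<sigma> i x - loc \<sigma> i y))"
        using VL ch by (simp add: norm_mult mult_left_mono)
      also have "norm (loc \<sigma> i x - loc \<sigma> i y) = norm (x - y) / r \<sigma> i"
        using ch by (simp add: loc_def diff_divide_distrib[symmetric] norm_divide)
      finally show ?thesis using ch by simp
    qed
    then have fL: "L-lipschitz_on UNIV f"
      using L_nonneg[OF sS] by (intro lipschitz_onI) (auto simp: dist_norm)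
    then have contf: "continuous_on UNIV f" using lipschitz_on_continuous_on by blast
    have fV: "\<forall>x\<in>Oc \<sigma> i. ?V x = f x"
      using b by (simp add: nd_in[OF sS i] f_def)
    \<comment> \<open>On the closure of the copy \<open>F\<close> equals its affine formula, on the
      closure of the complement \<open>f\<close> does, both by continuity. The copies are neither
      open nor closed in general, so boundary points may belong to either side.\<close>
    have "f x = F \<sigma> x" if x: "x \<in> closure (Oc \<sigma> i)" "x \<in> closure (- Oc \<sigma> i)" for x
    proof -
      have "f y - (app ?B y + b) = 0" if "y \<in> closure (- Oc \<sigma> i)" for y
      proof (rule continuous_constant_on_closure[OF _ _ that])
        show "continuous_on (closure (- Oc \<sigma> i)) (\<lambda>y. f y - (app ?B y + b))"
          using continuous_on_subset[OF contf] by (intro continuous_intros) auto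
        fix y assume "y \<in> - Oc \<sigma> i"
        then have "loc \<sigma> i y \<notin> DD (s \<sigma> i)" by (simp add: Oc_def)
        then show "f y - (app ?B y + b) = 0" using ch by (simp add: f_def V_off)
      qed
      moreover have "F \<sigma> y - (app ?B y + b) = 0" if "y \<in> closure (Oc \<sigma> i)" for y
      proof (rule continuous_constant_on_closure[OF _ _ that])
        show "continuous_on (closure (Oc \<sigma> i)) (\<lambda>y. F \<sigma> y - (app ?B y + b))"
          using continuous_on_subset[OF contF] by (intro continuous_intros) auto
      qed (use b in auto)
      ultimately show ?thesis using x by (metis eq_iff_diff_eq_0)
    qed
    with fL fV show "\<exists>f. L-lipschitz_on UNIV f \<and> (\<forall>x\<in>Oc \<sigma> i. ?V x = f x) \<and>
     (\<forall>x. x \<in> closure (Oc \<sigma> i) \<longrightarrow> x \<in> closure (- Oc \<sigma> i) \<longrightarrow> f x = F \<sigma> x)" by blast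
  qed
  then obtain f where fL: "\<And>i. i \<in> I \<sigma> \<Longrightarrow> L-lipschitz_on UNIV (f i)"
    and fV: "\<And>i x. i \<in> I \<sigma> \<Longrightarrow> x \<in> Oc \<sigma> i \<Longrightarrow> ?V x = f i x"
    and fF: "\<And>i x. i \<in> I \<sigma> \<Longrightarrow> x \<in> closure (Oc \<sigma> i) \<Longrightarrow> x \<in> closure (- Oc \<sigma> i) \<Longrightarrow> f i x = F \<sigma> x"
    by (metis (no_types, lifting))
  have fL': "norm (f i x - f i y) \<le> L * norm (x - y)" if "i \<in> I \<sigma>" for i x y
    using lipschitz_onD[OF fL[OF that], of x y] by (simp add: dist_norm)
  have Vout: "?V x = F \<sigma> x" if "\<forall>i\<in>I \<sigma>. x \<notin> Oc \<sigma> i" for x using that by (simp add: nd_out)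
  have bd: "\<exists>z. z \<in> closed_segment x y \<and> z \<in> closure X \<and> z \<in> closure (- X)"
    if "x \<in> X" "y \<notin> X" for x y :: complex and X
  proof -
    have "closed_segment x y \<inter> frontier X \<noteq> {}"
      using that by (intro connected_Int_frontier) (auto simp: connected_segment)
    then show ?thesis by (auto simp: frontier_closures)
  qed
  have seg: "norm (x - z) + norm (z - y) = norm (x - y)" if "z \<in> closed_segment x y" for x y z :: complex
    using that by (metis between between_mem_segment dist_norm)
  \<comment> \<open>The point \<open>z\<close> is interior to no copy. Seen from such a point, only
    the copy that contains \<open>y\<close> matters.\<close>
  have A: "norm (F \<sigma> z - ?V y) \<le> L * norm (z - y)"
    if z: "\<forall>j\<in>I \<sigma>. z \<in> closure (- Oc \<sigma> j)" for z y
  proof (cases "\<exists>j\<in>I \<sigma>. y \<in> Oc \<sigma> j")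
    case False
    then show ?thesis using Vout FL by (simp del: V.simps)
  next
    case True
    then obtain j where j: "j \<in> I \<sigma>" "y \<in> Oc \<sigma> j" by blast
    have "\<exists>z'. z' \<in> closed_segment y z \<and> z' \<in> closure (Oc \<sigma> j) \<and> z' \<in> closure (- Oc \<sigma> j)"
    proof (cases "z \<in> Oc \<sigma> j")
      case True
      then show ?thesis using z j closure_subset by (intro exI[of _ z]) auto
    next
      case False
      then show ?thesis using bd j by blast
    qed
    then obtain z' where z': "z' \<in> closed_segment y z" "z' \<in> closure (Oc \<sigma> j)" "z' \<in> closure (- Oc \<sigma> j)"
      by blast
    have "norm (F \<sigma> z - ?V y) \<le> norm (F \<sigma> z - F \<sigma> z') + norm (f j z' - f j y)"
      using norm_triangle_ineq[of "F \<sigma> z - F \<sigma> z'" "f j z' - f j y"] fF[OF j(1) z'(2,3)] fV[OF j]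
      by (simp del: V.simps)
    also have "\<dots> \<le> L * norm (z - z') + L * norm (z' - y)"
      using FL fL' j by (intro add_mono) auto
    also have "\<dots> = L * norm (z - y)"
      using seg[OF z'(1)] by (metis distrib_left norm_minus_commute add.commute)
    finally show ?thesis .
  qed
  show ?case
  proof (rule lipschitz_onI[OF _ L_nonneg[OF sS]])
    fix x y :: complex
    show "dist (?V x) (?V y) \<le> L * dist x y"
    proof (cases "\<exists>i\<in>I \<sigma>. x \<in> Oc \<sigma> i")
      case False
      then have "\<forall>j\<in>I \<sigma>. x \<in> closure (- Oc \<sigma> j)" using closure_subset by fastforce
      then show ?thesis using A[of x y] Vout[of x] False by (simp add: dist_norm del: V.simps)
    next
      case True
      then obtain i where i: "i \<in> I \<sigma>" "x \<in> Oc \<sigma> i" by blast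
      show ?thesis
      proof (cases "y \<in> Oc \<sigma> i")
        case True
        then show ?thesis using fV i fL' by (simp add: dist_norm del: V.simps)
      next
        case False
        then obtain z where z: "z \<in> closed_segment x y" "z \<in> closure (Oc \<sigma> i)" "z \<in> closure (- Oc \<sigma> i)"
          using bd i by blast
        \<comment> \<open>The exit point of copy \<open>i\<close> is a limit of points of copy
          \<open>i\<close>, and these avoid every other copy.\<close>
        have "\<forall>j\<in>I \<sigma>. z \<in> closure (- Oc \<sigma> j)"
        proof
          fix j assume j: "j \<in> I \<sigma>"
          show "z \<in> closure (- Oc \<sigma> j)"
          proof (cases "j = i")
            case False
            then have "Oc \<sigma> i \<subseteq> - Oc \<sigma> j" using Oc_disj[OF sS i(1) j] by auto
            then show ?thesis using z(2) closure_mono by blast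
          qed (use z in auto)
        qed
        then have 1: "norm (F \<sigma> z - ?V y) \<le> L * norm (z - y)" by (rule A)
        have 2: "norm (?V x - F \<sigma> z) \<le> L * norm (x - z)"
          using fL'[OF i(1), of x z] fF[OF i(1) z(2,3)] fV[OF i] by (simp del: V.simps)
        have "norm (?V x - ?V y) \<le> L * norm (x - z) + L * norm (z - y)"
          using norm_triangle_ineq[of "?V x - F \<sigma> z" "F \<sigma> z - ?V y"] 1 2 by (simp del: V.simps)
        also have "\<dots> = L * norm (x - y)" using seg[OF z(1)] by (metis distrib_left)
        finally show ?thesis by (simp add: dist_norm)
      qed
    qed
  qed
qed

lemma loc_cont: "continuous_on X (loc \<sigma> i)"
proof (cases "r \<sigma> i = 0")
  case True then show ?thesis by (simp add: loc_def[abs_def])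
next
  case False then show ?thesis unfolding loc_def[abs_def] by (intro continuous_intros) auto
qed

lemma loc_open: "open U \<Longrightarrow> open (loc \<sigma> i -` U)"
  using loc_cont[of UNIV] by (simp add: open_vimage)

lemma loc_meas [measurable]: "loc \<sigma> i \<in> borel_measurable borel"
  by (intro borel_measurable_continuous_onI loc_cont)

lemma Gd_open: "\<sigma> \<in> S \<Longrightarrow> open (Gd n \<sigma>)"
proof (induction n arbitrary: \<sigma>)
  case (Suc n)
  have "{x \<in> interior (Oc \<sigma> i). loc \<sigma> i x \<in> Gd n (s \<sigma> i)} = interior (Oc \<sigma> i) \<inter> loc \<sigma> i -` Gd n (s \<sigma> i)" for i
    by auto
  moreover have "open (interior (Oc \<sigma> i) \<inter> loc \<sigma> i -` Gd n (s \<sigma> i))" if "i \<in> I \<sigma>" for i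
    using Suc.IH child[OF Suc.prems that] by (intro open_Int open_interior loc_open) blast
  ultimately show ?case using fin_open[OF Suc.prems] by (simp add: open_Un open_UN)
qed simp

lemma Gd_D: "\<sigma> \<in> S \<Longrightarrow> Gd n \<sigma> \<subseteq> DD \<sigma>"
proof (cases n)
  case (Suc m)
  assume a: "\<sigma> \<in> S"
  have "x \<in> DD \<sigma>" if "i \<in> I \<sigma>" "x \<in> interior (Oc \<sigma> i)" for i x
    using Oc_D[OF a that(1)] interior_subset[of "Oc \<sigma> i"] that(2) by blast
  then show ?thesis using Suc fin_D[OF a] by auto
qed simp

lemma Gd_mono: "\<sigma> \<in> S \<Longrightarrow> Gd n \<sigma> \<subseteq> Gd (Suc n) \<sigma>"
proof (induction n arbitrary: \<sigma>)
  case (Suc n)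
  show ?case
  proof
    fix x assume "x \<in> Gd (Suc n) \<sigma>"
    then consider "x \<in> fin \<sigma>" | i where "i \<in> I \<sigma>" "x \<in> interior (Oc \<sigma> i)" "loc \<sigma> i x \<in> Gd n (s \<sigma> i)"
      by auto
    then show "x \<in> Gd (Suc (Suc n)) \<sigma>"
    proof cases
      case 2
      then have "loc \<sigma> i x \<in> Gd (Suc n) (s \<sigma> i)" using Suc child by blast
      then show ?thesis using 2 by (subst Gd.simps(2)) blast
    qed simp
  qed
qed simp

text \<open>Stabilization: near a resolved point all later stages coincide with one affine map, so
  the limit and its gradient can be read off there without any rate of convergence.\<close>

lemma Gd_aff: "\<sigma> \<in> S \<Longrightarrow> x \<in> Gd n \<sigma> \<Longrightarrow> \<exists>e a B. 0 < e \<and> fst B \<in> K3 \<and>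
   (\<forall>m\<ge>n. GG m \<sigma> x = B \<and> (\<forall>y\<in>ball x e. V m \<sigma> y = a + app B (y - x)))"
proof (induction n arbitrary: \<sigma> x)
  case (Suc n)
  note sS = Suc.prems(1)
  consider "x \<in> fin \<sigma>" | i where "i \<in> I \<sigma>" "x \<in> interior (Oc \<sigma> i)" "loc \<sigma> i x \<in> Gd n (s \<sigma> i)"
    using Suc.prems(2) by auto
  then show ?case
  proof cases
    case 1
    obtain e where e: "0 < e" "\<And>y. y \<in> ball x e \<Longrightarrow> F \<sigma> y = F \<sigma> x + app (g \<sigma> x) (y - x)"
      using fin_aff[OF sS 1] by blast
    obtain e' where e': "0 < e'" "ball x e' \<subseteq> fin \<sigma>" using fin_open[OF sS] 1 open_contains_ball by blast
    have out: "nd \<sigma> y = None" if "y \<in> fin \<sigma>" for y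
      using Oc_D[OF sS] that by (intro nd_out) blast
    show ?thesis
    proof (intro exI[of _ "min e e'"] exI[of _ "F \<sigma> x"] exI[of _ "g \<sigma> x"] conjI allI impI ballI)
      show "fst (g \<sigma> x) \<in> K3" using fin_aff[OF sS 1] by blast
      fix m assume "Suc n \<le> m"
      then obtain m' where m: "m = Suc m'" by (cases m) auto
      show "GG m \<sigma> x = g \<sigma> x" using m out 1 by simp
      fix y assume y: "y \<in> ball x (min e e')"
      then have "y \<in> fin \<sigma>" using e' by auto
      then show "V m \<sigma> y = F \<sigma> x + app (g \<sigma> x) (y - x)" using m out e(2)[of y] y by simp
    qed (use e e' in auto)
  next
    case 2
    note ch = child[OF sS 2(1)]
    let ?t = "s \<sigma> i"
    obtain e a B where e: "0 < e" "fst B \<in> K3" and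
       eq: "\<And>m. m \<ge> n \<Longrightarrow> GG m ?t (loc \<sigma> i x) = B \<and> (\<forall>y\<in>ball (loc \<sigma> i x) e. V m ?t y = a + app B (y - loc \<sigma> i x))"
      using Suc.IH[of ?t "loc \<sigma> i x"] ch 2 by blast
    obtain e' where e': "0 < e'" "ball x e' \<subseteq> Oc \<sigma> i"
      using 2(2) by (meson mem_interior)
    obtain b where b: "\<And>y. y \<in> Oc \<sigma> i \<Longrightarrow> F \<sigma> y = app (AA ?t) y + b"
      using child_aff[OF sS 2(1)] by (auto simp: Oc_def loc_def)
    let ?e = "min e' (r \<sigma> i * e)"
    define a' where "a' = b + app (AA ?t) (p \<sigma> i) + of_real (r \<sigma> i) * a"
    show ?thesis
    proof (intro exI[of _ ?e] exI[of _ a'] exI[of _ B] conjI allI impI ballI)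
      fix m assume "Suc n \<le> m"
      then obtain m' where m: "m = Suc m'" "n \<le> m'" by (cases m) auto
      have xO: "x \<in> Oc \<sigma> i" using e' by auto
      show "GG m \<sigma> x = B" using m eq nd_in[OF sS 2(1) xO] by simp
      fix y assume y: "y \<in> ball x ?e"
      then have yO: "y \<in> Oc \<sigma> i" using e' by auto
      have d: "loc \<sigma> i y - loc \<sigma> i x = (y - x) / of_real (r \<sigma> i)"
        by (simp add: loc_def diff_divide_distrib[symmetric])
      have "norm (loc \<sigma> i y - loc \<sigma> i x) = norm (y - x) / r \<sigma> i"
        unfolding d using ch by (simp add: norm_divide)
      also have "\<dots> < e"
        using y ch by (simp add: dist_norm norm_minus_commute[of x] pos_divide_less_eq mult.commute)
      finally have "norm (loc \<sigma> i x - loc \<sigma> i y) < e" by (simp add: norm_minus_commute)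
      then have v: "V m' ?t (loc \<sigma> i y) = a + app B ((y - x) / of_real (r \<sigma> i))"
        using eq[OF m(2)] d by (simp add: dist_norm)
      have rl: "of_real (r \<sigma> i) * app (AA ?t) (loc \<sigma> i y) = app (AA ?t) y - app (AA ?t) (p \<sigma> i)"
        using ch by (simp add: app_scale[symmetric] app_diff[symmetric] loc_def)
      have rb: "of_real (r \<sigma> i) * app B ((y - x) / of_real (r \<sigma> i)) = app B (y - x)"
        using ch by (simp add: app_scale[symmetric])
      have "V m \<sigma> y = F \<sigma> y + of_real (r \<sigma> i) * (V m' ?t (loc \<sigma> i y) - app (AA ?t) (loc \<sigma> i y))"
        using m nd_in[OF sS 2(1) yO] by simp
      also have "\<dots> = a' + app B (y - x)"
        unfolding v right_diff_distrib rl b[OF yO] distrib_left rb a'_def by simp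
      finally show "V m \<sigma> y = a' + app B (y - x)" .
    qed (use e e' ch in auto)
  qed
qed simp

definition Good :: "'s \<Rightarrow> complex set" where "Good \<sigma> = (\<Union>n. Gd n \<sigma>)"

lemma Gd_Good: "x \<in> Gd n \<sigma> \<Longrightarrow> x \<in> Good \<sigma>"
  unfolding Good_def by (rule UN_I[OF UNIV_I])

lemma fin_Good: "fin \<sigma> \<subseteq> Good \<sigma>"
proof
  fix x assume "x \<in> fin \<sigma>"
  then have "x \<in> Gd (Suc 0) \<sigma>" by simp
  then show "x \<in> Good \<sigma>" by (rule Gd_Good)
qed

lemma Oc_meas: "\<sigma> \<in> S \<Longrightarrow> i \<in> I \<sigma> \<Longrightarrow> Oc \<sigma> i \<in> sets borel"
  using measurable_sets[OF loc_meas Dmeas, of "s \<sigma> i" \<sigma> i] child by (simp add: Oc_def vimage_def)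

lemma Good_open: "\<sigma> \<in> S \<Longrightarrow> open (Good \<sigma>)"
  using Gd_open by (auto simp: Good_def)

lemma nn_integral_loc:
  assumes "\<sigma> \<in> S" "i \<in> I \<sigma>" and [measurable]: "f \<in> borel_measurable borel"
  shows "(\<integral>\<^sup>+x. f (loc \<sigma> i x) \<partial>lborel) = ennreal ((r \<sigma> i)\<^sup>2) * (\<integral>\<^sup>+y. f y \<partial>lborel)"
proof -
  let ?r = "r \<sigma> i"
  have r0: "0 < ?r" using child assms by blast
  have l: "loc \<sigma> i (p \<sigma> i + ?r *\<^sub>R y) = y" for y
    using r0 by (simp add: loc_def scaleR_conv_of_real)
  have "(\<integral>\<^sup>+x. f (loc \<sigma> i x) \<partial>lborel) =
    (\<integral>\<^sup>+x. f (loc \<sigma> i x) \<partial>density (distr lborel borel (\<lambda>x. p \<sigma> i + ?r *\<^sub>R x)) (\<lambda>_. ennreal (\<bar>?r\<bar> ^ DIM(complex))))"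
    using lborel_affine[of ?r "p \<sigma> i"] r0 by simp
  also have "\<dots> = (\<integral>\<^sup>+y. ennreal (?r ^ 2) * f y \<partial>lborel)"
    using r0 by (simp add: nn_integral_density nn_integral_distr l DIM_complex power2_eq_square)
  finally show ?thesis by (simp add: nn_integral_cmult)
qed

text \<open>The recursion \<open>step\<close> alone does not make the unresolved area vanish, since
  the copies may fill most of the domain. The weights bound the number of generations on average:
  \<open>c\<close> dominates the area and r^2 \<le> r^(2 - \<theta>), so every multiple of the
  unresolved area is at most \<open>ww\<close>.\<close>

lemma Good_null: "\<sigma> \<in> S \<Longrightarrow> emeasure lborel (DD \<sigma> - Good \<sigma>) = 0"
proof -
  have meas: "DD \<sigma> - Good \<sigma> \<in> sets borel" if "\<sigma> \<in> S" for \<sigma>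
    using Dmeas Good_open that by (intro sets.Diff) auto
  have step: "emeasure lborel (DD \<sigma> - Good \<sigma>) \<le>
     (\<Sum>i. if i \<in> I \<sigma> then ennreal ((r \<sigma> i)\<^sup>2) * emeasure lborel (DD (s \<sigma> i) - Good (s \<sigma> i)) else 0)" 
    if sS: "\<sigma> \<in> S" for \<sigma>
  proof -
    obtain N where N: "N \<in> null_sets lborel" "DD \<sigma> \<subseteq> fin \<sigma> \<union> N \<union> (\<Union>i\<in>I \<sigma>. interior (Oc \<sigma> i))"
      using cover[OF sS] by (auto simp: Oc_def loc_def)
    define B where "B i = (if i \<in> I \<sigma> then loc \<sigma> i -` (DD (s \<sigma> i) - Good (s \<sigma> i)) else {})" for i
    have Bm: "B i \<in> sets borel" for i
      unfolding B_def using measurable_sets[OF loc_meas meas, of "s \<sigma> i" \<sigma> i] child[OF sS] by auto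
    have "DD \<sigma> - Good \<sigma> \<subseteq> N \<union> (\<Union>i. B i)"
    proof
      fix x assume x: "x \<in> DD \<sigma> - Good \<sigma>"
      then have "x \<notin> fin \<sigma>" using fin_Good by blast
      then consider "x \<in> N" | i where "i \<in> I \<sigma>" "x \<in> interior (Oc \<sigma> i)" using N x by blast
      then show "x \<in> N \<union> (\<Union>i. B i)"
      proof cases
        case 2
        have "loc \<sigma> i x \<notin> Good (s \<sigma> i)"
        proof
          assume "loc \<sigma> i x \<in> Good (s \<sigma> i)"
          then obtain n where "loc \<sigma> i x \<in> Gd n (s \<sigma> i)" by (auto simp: Good_def)
          then have "x \<in> Gd (Suc n) \<sigma>" using 2 by auto
          then show False using x Gd_Good by blast
        qed
        moreover have "loc \<sigma> i x \<in> DD (s \<sigma> i)" using 2 interior_subset[of "Oc \<sigma> i"] by (auto simp: Oc_def)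
        ultimately show ?thesis using 2 by (auto simp: B_def)
      qed simp
    qed
    then have "emeasure lborel (DD \<sigma> - Good \<sigma>) \<le> emeasure lborel (N \<union> (\<Union>i. B i))"
      using N Bm by (intro emeasure_mono) auto
    also have "\<dots> \<le> emeasure lborel N + emeasure lborel (\<Union>i. B i)"
      using N Bm by (intro emeasure_subadditive) auto
    also have "\<dots> \<le> 0 + (\<Sum>i. emeasure lborel (B i))"
      using N Bm by (intro add_mono emeasure_subadditive_countably) (auto simp: null_setsD1)
    also have "(\<Sum>i. emeasure lborel (B i)) =
       (\<Sum>i. if i \<in> I \<sigma> then ennreal ((r \<sigma> i)\<^sup>2) * emeasure lborel (DD (s \<sigma> i) - Good (s \<sigma> i)) else 0)"
    proof (rule suminf_cong)
      fix i
      show "emeasure lborel (B i) = (if i \<in> I \<sigma> then ennreal ((r \<sigma> i)\<^sup>2) * emeasure lborel (DD (s \<sigma> i) - Good (s \<sigma> i)) else 0)"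
      proof (cases "i \<in> I \<sigma>")
        case True
        have m: "DD (s \<sigma> i) - Good (s \<sigma> i) \<in> sets borel" using meas child[OF sS True] by blast
        have "emeasure lborel (B i) = (\<integral>\<^sup>+x. indicator (B i) x \<partial>lborel)" using Bm by simp
        also have "\<dots> = (\<integral>\<^sup>+x. indicator (DD (s \<sigma> i) - Good (s \<sigma> i)) (loc \<sigma> i x) \<partial>lborel)"
          using True by (intro nn_integral_cong) (auto simp: B_def indicator_def)
        also have "\<dots> = ennreal ((r \<sigma> i)\<^sup>2) * (\<integral>\<^sup>+x. indicator (DD (s \<sigma> i) - Good (s \<sigma> i)) x \<partial>lborel)"
          using m by (intro nn_integral_loc[OF sS True]) auto
        finally show ?thesis using True m by simp
      qed (simp add: B_def)
    qed
    finally show ?thesis by simp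
  qed
  \<comment> \<open>One of the \<open>n + 1\<close> summands is paid by \<open>c \<sigma>\<close>;
    the other \<open>n\<close> are distributed over the children and paid by their weights.\<close>
  have bound: "\<sigma> \<in> S \<Longrightarrow> of_nat n * emeasure lborel (DD \<sigma> - Good \<sigma>) \<le> ennreal (ww \<sigma>)" for n \<sigma>
  proof (induction n arbitrary: \<sigma>)
    case (Suc n)
    note sS = Suc.prems
    have "of_nat (Suc n) * emeasure lborel (DD \<sigma> - Good \<sigma>) =
      emeasure lborel (DD \<sigma> - Good \<sigma>) + of_nat n * emeasure lborel (DD \<sigma> - Good \<sigma>)"
      by (simp add: distrib_right)
    also have "\<dots> \<le> ennreal (c \<sigma>) + of_nat n * (\<Sum>i. if i \<in> I \<sigma> then ennreal ((r \<sigma> i)\<^sup>2) * emeasure lborel (DD (s \<sigma> i) - Good (s \<sigma> i)) else 0)"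
    proof (intro add_mono mult_left_mono step[OF sS])
      have "emeasure lborel (DD \<sigma> - Good \<sigma>) \<le> emeasure lborel (DD \<sigma>)"
        using Dmeas[OF sS] by (intro emeasure_mono) auto
      then show "emeasure lborel (DD \<sigma> - Good \<sigma>) \<le> ennreal (c \<sigma>)" using cD[OF sS] by simp
    qed simp
    also have "of_nat n * (\<Sum>i. if i \<in> I \<sigma> then ennreal ((r \<sigma> i)\<^sup>2) * emeasure lborel (DD (s \<sigma> i) - Good (s \<sigma> i)) else 0)
      = (\<Sum>i. of_nat n * (if i \<in> I \<sigma> then ennreal ((r \<sigma> i)\<^sup>2) * emeasure lborel (DD (s \<sigma> i) - Good (s \<sigma> i)) else 0))"
      by (simp add: ennreal_suminf_cmult)
    also have "\<dots> \<le> (\<Sum>i. if i \<in> I \<sigma> then ennreal (r \<sigma> i powr (2 - \<theta>) * ww (s \<sigma> i)) else 0)"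
    proof (intro suminf_le)
      fix i
      show "of_nat n * (if i \<in> I \<sigma> then ennreal ((r \<sigma> i)\<^sup>2) * emeasure lborel (DD (s \<sigma> i) - Good (s \<sigma> i)) else 0)
        \<le> (if i \<in> I \<sigma> then ennreal (r \<sigma> i powr (2 - \<theta>) * ww (s \<sigma> i)) else 0)"
      proof (cases "i \<in> I \<sigma>")
        case True
        note ch = child[OF sS True]
        have "of_nat n * (ennreal ((r \<sigma> i)\<^sup>2) * emeasure lborel (DD (s \<sigma> i) - Good (s \<sigma> i)))
           = ennreal ((r \<sigma> i)\<^sup>2) * (of_nat n * emeasure lborel (DD (s \<sigma> i) - Good (s \<sigma> i)))"
          by (simp add: mult_ac)
        also have "\<dots> \<le> ennreal ((r \<sigma> i)\<^sup>2) * ennreal (ww (s \<sigma> i))"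
          using Suc.IH ch by (intro mult_left_mono) auto
        also have "\<dots> \<le> ennreal (r \<sigma> i powr (2 - \<theta>) * ww (s \<sigma> i))"
        proof -
          have "(r \<sigma> i)\<^sup>2 = r \<sigma> i powr 2" using ch by (simp add: powr_numeral)
          also have "\<dots> \<le> r \<sigma> i powr (2 - \<theta>)" using ch theta by (intro powr_mono') auto
          finally show ?thesis using wpos ch
            by (simp add: ennreal_mult[symmetric] ennreal_leI mult_right_mono)
        qed
        finally show ?thesis using True by simp
      qed simp
    qed auto
    also have "ennreal (c \<sigma>) + \<dots> \<le> ennreal (ww \<sigma>)" by (rule weight[OF sS])
    finally show ?case by (simp add: add_mono)
  qed (simp)
  assume sS: "\<sigma> \<in> S"
  show ?thesis
  proof (rule ccontr)
    assume "emeasure lborel (DD \<sigma> - Good \<sigma>) \<noteq> 0"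
    then consider "emeasure lborel (DD \<sigma> - Good \<sigma>) = \<infinity>" | b where "0 < b" "emeasure lborel (DD \<sigma> - Good \<sigma>) = ennreal b"
      by (cases "emeasure lborel (DD \<sigma> - Good \<sigma>)") (auto simp: less_le)
    then show False
    proof cases
      case 1
      then show False using bound[OF sS, of 1] by (simp add: top_unique)
    next
      case 2
      then obtain n where n: "ww \<sigma> < real n * b" using reals_Archimedean3 by blast
      have "ennreal (real n * b) \<le> ennreal (ww \<sigma>)"
        using bound[OF sS, of n] 2 by (simp add: ennreal_of_nat_eq_real_of_nat ennreal_mult)
      then show False using n wpos[OF sS] by (simp add: ennreal_le_iff)
    qed
  qed
qed

end

section \<open>Translation estimate and limit of the stages\<close>

context patched
begin

lemma nd_some: "\<sigma> \<in> S \<Longrightarrow> nd \<sigma> x = Some i \<longleftrightarrow> i \<in> I \<sigma> \<and> x \<in> Oc \<sigma> i"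
  using nd_in nd_out by (metis option.distinct(1) option.inject)

lemma nd_meas: "\<sigma> \<in> S \<Longrightarrow> nd \<sigma> \<in> measurable borel (count_space UNIV)"
proof (rule measurable_count_space_eq2_countable[THEN iffD2], intro conjI ballI)
  assume sS: "\<sigma> \<in> S"
  fix a :: "nat option"
  have "nd \<sigma> -` {Some i} \<in> sets borel" for i
  proof (cases "i \<in> I \<sigma>")
    case True
    then have "nd \<sigma> -` {Some i} = Oc \<sigma> i" using nd_some[OF sS] by auto
    then show ?thesis using Oc_meas[OF sS True] by simp
  next
    case False
    then have "nd \<sigma> -` {Some i} = {}" using nd_some[OF sS] by auto
    then show ?thesis by simp
  qed
  moreover have "nd \<sigma> -` {None} = - (\<Union>i. nd \<sigma> -` {Some i})"
    by (auto simp: option.exhaust[of "nd \<sigma> _"])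
  ultimately have "nd \<sigma> -` {a} \<in> sets borel"
    by (cases a) (auto intro!: sets.countable_UN sets.compl_sets[of _ borel, simplified])
  then show "nd \<sigma> -` {a} \<inter> space borel \<in> sets borel" by simp
qed auto

lemma GG_meas: "\<sigma> \<in> S \<Longrightarrow> GG n \<sigma> \<in> borel_measurable borel"
proof (induction n arbitrary: \<sigma>)
  case (Suc n)
  define h where "h a x = (case a of None \<Rightarrow> g \<sigma> x
     | Some i \<Rightarrow> if i \<in> I \<sigma> then GG n (s \<sigma> i) (loc \<sigma> i x) else 0)" for a x
  have "h a \<in> borel_measurable borel" for a
  proof (cases a)
    case None
    then show ?thesis using gmeas[OF Suc.prems] by (simp add: h_def[abs_def])
  next
    case (Some i)
    show ?thesis
    proof (cases "i \<in> I \<sigma>")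
      case True
      then have "GG n (s \<sigma> i) \<in> borel_measurable borel" using Suc.IH child[OF Suc.prems] by blast
      then show ?thesis using Some True measurable_compose[OF loc_meas] by (simp add: h_def[abs_def])
    qed (use Some in \<open>simp add: h_def[abs_def]\<close>)
  qed
  then have "(\<lambda>x. h (nd \<sigma> x) x) \<in> borel_measurable borel"
    using measurable_compose_countable[OF _ nd_meas[OF Suc.prems], of h borel] by blast
  moreover have "(\<lambda>x. h (nd \<sigma> x) x) = GG (Suc n) \<sigma>"
  proof
    show "h (nd \<sigma> x) x = GG (Suc n) \<sigma> x" for x
    proof (cases "nd \<sigma> x")
      case (Some i)
      then have "i \<in> I \<sigma>" using nd_some[OF Suc.prems] by blast
      then show ?thesis using Some by (simp add: h_def)
    qed (simp add: h_def)
  qed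
  ultimately show ?case by simp
qed simp

text \<open>The weight is a supersolution of the recursion for the translation modulus. A stage is
  \<open>g\<close> plus corrections supported in the disjoint copies; the correction in copy
  \<open>i\<close> rescales to the child and obeys the induction hypothesis with the factor r^(2 -
  \<theta>).\<close>

lemma GG_shift:
  "\<sigma> \<in> S \<Longrightarrow> (\<integral>\<^sup>+x. ennreal (norm (GG n \<sigma> (x + h) - GG n \<sigma> x)) \<partial>lborel) \<le> ennreal (ww \<sigma> * norm h powr \<theta>)"
proof (induction n arbitrary: \<sigma> h)
  case (Suc n)
  note sS = Suc.prems
  define q where "q i x = (if i \<in> I \<sigma> then GG n (s \<sigma> i) (loc \<sigma> i x) - AA (s \<sigma> i) else 0)" for i x
  have q0: "q i x = 0" if "nd \<sigma> x \<noteq> Some i" for i x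
  proof (cases "i \<in> I \<sigma>")
    case True
    then have "loc \<sigma> i x \<notin> DD (s \<sigma> i)" using that nd_some[OF sS] by (auto simp: Oc_def)
    then show ?thesis using GG_off child[OF sS True] by (simp add: q_def)
  qed (simp add: q_def)
  \<comment> \<open>Only the copy that contains \<open>x\<close> contributes, so any finite index
    set that includes it gives the same sum. One set can thus serve \<open>x\<close> and
    \<open>x + h\<close> together.\<close>
  have eq: "GG (Suc n) \<sigma> x = g \<sigma> x + sum (\<lambda>i. q i x) A" if "finite A" "set_option (nd \<sigma> x) \<subseteq> A" for x A
  proof (cases "nd \<sigma> x")
    case None
    then show ?thesis using q0 by simp
  next
    case (Some i)
    then have i: "i \<in> I \<sigma>" "x \<in> Oc \<sigma> i" using nd_some[OF sS] by auto
    have "sum (\<lambda>i. q i x) A = sum (\<lambda>i. q i x) {i}"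
      using that Some q0 by (intro sum.mono_neutral_right) auto
    then show ?thesis using Some i gchild[OF sS i(1), of x] by (simp add: q_def Oc_def loc_def)
  qed
  have qm: "q i \<in> borel_measurable borel" for i
    unfolding q_def[abs_def] using GG_meas child[OF sS]
    by (cases "i \<in> I \<sigma>") (auto intro!: borel_measurable_diff measurable_compose[OF loc_meas])
  have gm: "g \<sigma> \<in> borel_measurable borel" by (rule gmeas[OF sS])
  have pt: "ennreal (norm (GG (Suc n) \<sigma> (x + h) - GG (Suc n) \<sigma> x)) \<le>
     ennreal (norm (g \<sigma> (x + h) - g \<sigma> x)) + (\<Sum>i. ennreal (norm (q i (x + h) - q i x)))" for x
  proof -
    define A where "A = set_option (nd \<sigma> x) \<union> set_option (nd \<sigma> (x + h))"
    have fA: "finite A" by (simp add: A_def)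
    have "GG (Suc n) \<sigma> (x + h) - GG (Suc n) \<sigma> x =
      (g \<sigma> (x + h) - g \<sigma> x) + (\<Sum>i\<in>A. q i (x + h) - q i x)"
      using eq[OF fA, of x] eq[OF fA, of "x + h"] by (simp add: A_def sum_subtractf del: GG.simps)
    then have "norm (GG (Suc n) \<sigma> (x + h) - GG (Suc n) \<sigma> x) \<le>
      norm (g \<sigma> (x + h) - g \<sigma> x) + norm (\<Sum>i\<in>A. q i (x + h) - q i x)"
      by (simp only: norm_triangle_ineq)
    also have "\<dots> \<le> norm (g \<sigma> (x + h) - g \<sigma> x) + (\<Sum>i\<in>A. norm (q i (x + h) - q i x))"
      by (intro add_left_mono norm_sum)
    finally have "norm (GG (Suc n) \<sigma> (x + h) - GG (Suc n) \<sigma> x) \<le>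
      norm (g \<sigma> (x + h) - g \<sigma> x) + (\<Sum>i\<in>A. norm (q i (x + h) - q i x))" .
    then have "ennreal (norm (GG (Suc n) \<sigma> (x + h) - GG (Suc n) \<sigma> x)) \<le>
      ennreal (norm (g \<sigma> (x + h) - g \<sigma> x) + (\<Sum>i\<in>A. norm (q i (x + h) - q i x)))"
      by (rule ennreal_leI)
    also have "\<dots> = ennreal (norm (g \<sigma> (x + h) - g \<sigma> x)) + (\<Sum>i\<in>A. ennreal (norm (q i (x + h) - q i x)))"
      by (simp add: sum_nonneg)
    also have "\<dots> \<le> ennreal (norm (g \<sigma> (x + h) - g \<sigma> x)) + (\<Sum>i. ennreal (norm (q i (x + h) - q i x)))"
      using fA by (intro add_left_mono sum_le_suminf) auto
    finally show ?thesis .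
  qed
  have shift: "(\<lambda>x. x + h) \<in> borel_measurable borel" by measurable
  have m1: "(\<lambda>x. ennreal (norm (g \<sigma> (x + h) - g \<sigma> x))) \<in> borel_measurable borel"
    using measurable_compose[OF shift gm] gm by measurable
  have m2: "(\<lambda>x. ennreal (norm (q i (x + h) - q i x))) \<in> borel_measurable borel" for i
    using measurable_compose[OF shift qm[of i]] qm[of i] by measurable
  have each: "(\<integral>\<^sup>+x. ennreal (norm (q i (x + h) - q i x)) \<partial>lborel) \<le>
     ennreal (norm h powr \<theta>) * (if i \<in> I \<sigma> then ennreal (r \<sigma> i powr (2 - \<theta>) * ww (s \<sigma> i)) else 0)" for i
  proof (cases "i \<in> I \<sigma>")
    case True
    note ch = child[OF sS True]
    have Gm: "GG n (s \<sigma> i) \<in> borel_measurable borel" using GG_meas ch by blast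
    let ?h = "h / of_real (r \<sigma> i)"
    have sm: "(\<lambda>y. ennreal (norm (GG n (s \<sigma> i) (y + ?h) - GG n (s \<sigma> i) y))) \<in> borel_measurable borel"
      using measurable_compose[OF _ Gm, of "\<lambda>y. y + ?h" borel] Gm by measurable
    have "loc \<sigma> i (x + h) = loc \<sigma> i x + ?h" for x
      by (simp add: loc_def add_divide_distrib[symmetric])
    then have "(\<integral>\<^sup>+x. ennreal (norm (q i (x + h) - q i x)) \<partial>lborel) =
       (\<integral>\<^sup>+x. ennreal (norm (GG n (s \<sigma> i) (loc \<sigma> i x + ?h) - GG n (s \<sigma> i) (loc \<sigma> i x))) \<partial>lborel)"
      using True by (simp add: q_def)
    also have "\<dots> = ennreal ((r \<sigma> i)\<^sup>2) * (\<integral>\<^sup>+y. ennreal (norm (GG n (s \<sigma> i) (y + ?h) - GG n (s \<sigma> i) y)) \<partial>lborel)"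
      by (rule nn_integral_loc[OF sS True sm])
    also have "\<dots> \<le> ennreal ((r \<sigma> i)\<^sup>2) * ennreal (ww (s \<sigma> i) * norm ?h powr \<theta>)"
      using Suc.IH ch by (intro mult_left_mono) auto
    also have "\<dots> = ennreal ((r \<sigma> i)\<^sup>2 * (ww (s \<sigma> i) * norm ?h powr \<theta>))"
      using wpos ch by (simp add: ennreal_mult)
    also have "(r \<sigma> i)\<^sup>2 * (ww (s \<sigma> i) * norm ?h powr \<theta>) = norm h powr \<theta> * (r \<sigma> i powr (2 - \<theta>) * ww (s \<sigma> i))"
      using ch by (simp add: norm_divide powr_divide powr_diff powr_numeral)
    finally show ?thesis using True wpos ch by (simp add: ennreal_mult)
  qed (simp add: q_def)
  have "(\<integral>\<^sup>+x. ennreal (norm (GG (Suc n) \<sigma> (x + h) - GG (Suc n) \<sigma> x)) \<partial>lborel) \<le>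
    (\<integral>\<^sup>+x. ennreal (norm (g \<sigma> (x + h) - g \<sigma> x)) + (\<Sum>i. ennreal (norm (q i (x + h) - q i x))) \<partial>lborel)"
    by (rule nn_integral_mono) (rule pt)
  also have "\<dots> = (\<integral>\<^sup>+x. ennreal (norm (g \<sigma> (x + h) - g \<sigma> x)) \<partial>lborel) +
     (\<Sum>i. \<integral>\<^sup>+x. ennreal (norm (q i (x + h) - q i x)) \<partial>lborel)"
    using m1 m2 by (simp add: nn_integral_add nn_integral_suminf)
  also have "\<dots> \<le> ennreal (norm h powr \<theta>) * ennreal (c \<sigma>) + (\<Sum>i. ennreal (norm h powr \<theta>) *
     (if i \<in> I \<sigma> then ennreal (r \<sigma> i powr (2 - \<theta>) * ww (s \<sigma> i)) else 0))"
    using each cost[OF sS, of h] cpos[OF sS]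
    by (intro add_mono suminf_le) (auto simp: ennreal_mult mult.commute)
  also have "\<dots> = ennreal (norm h powr \<theta>) * (ennreal (c \<sigma>) + (\<Sum>i. 
     (if i \<in> I \<sigma> then ennreal (r \<sigma> i powr (2 - \<theta>) * ww (s \<sigma> i)) else 0)))"
    by (simp add: ennreal_suminf_cmult distrib_left)
  also have "\<dots> \<le> ennreal (norm h powr \<theta>) * ennreal (ww \<sigma>)"
    by (intro mult_left_mono weight sS) simp
  finally show ?case using wpos[OF sS] by (simp add: ennreal_mult mult.commute)
qed (use wpos in simp)

text \<open>The stages stabilize off a null set by \<open>Good_null\<close>, hence on a dense set.
  The common Lipschitz constant extends the convergence to every point, and the translation bound
  passes to the limit by Fatou's lemma.\<close>

theorem tree_solution:
  assumes sS: "\<sigma> \<in> S"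
  shows "\<exists>v G. L-lipschitz_on UNIV v \<and> (\<forall>x. x \<notin> DD \<sigma> \<longrightarrow> v x = app (AA \<sigma>) x \<and> G x = AA \<sigma>) \<and>
    G \<in> borel_measurable borel \<and> (\<forall>x. norm (G x) \<le> max L (norm (AA \<sigma>))) \<and>
    (AE x in lborel. x \<in> DD \<sigma> \<longrightarrow> fst (G x) \<in> K3 \<and>
       (\<exists>e>0. \<forall>y\<in>ball x e. v y = v x + app (G x) (y - x))) \<and>
    (\<forall>h. (\<integral>\<^sup>+x. ennreal (norm (G (x + h) - G x)) \<partial>lborel) \<le> ennreal (ww \<sigma> * norm h powr \<theta>))"
proof -
  have good: "\<exists>e a B. 0 < e \<and> fst B \<in> K3 \<and> (\<forall>\<^sub>F m in sequentially. GG m \<sigma> x = B) \<and>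
     (\<forall>y\<in>ball x e. \<forall>\<^sub>F m in sequentially. V m \<sigma> y = a + app B (y - x))" if xG: "x \<in> Good \<sigma>" for x
  proof -
    obtain n where "x \<in> Gd n \<sigma>" using xG by (auto simp: Good_def)
    from Gd_aff[OF sS this] show ?thesis unfolding eventually_sequentially by blast
  qed
  have off: "V m \<sigma> x = app (AA \<sigma>) x" "GG m \<sigma> x = AA \<sigma>" if "x \<notin> DD \<sigma>" for m x
    using V_off[OF sS that] GG_off[OF sS that] by auto
  have GD: "Good \<sigma> \<subseteq> DD \<sigma>" using Gd_D[OF sS] by (auto simp: Good_def)
  have ev: "convergent (\<lambda>m. V m \<sigma> x)" if "x \<in> Good \<sigma> \<union> - DD \<sigma>" for x
  proof (cases "x \<in> Good \<sigma>")
    case True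
    from good[OF this] obtain e a B where "0 < e" "\<forall>y\<in>ball x e. \<forall>\<^sub>F m in sequentially. V m \<sigma> y = a + app B (y - x)"
      by blast
    then have "\<forall>\<^sub>F m in sequentially. V m \<sigma> x = a + app B (x - x)" using centre_in_ball by blast
    then show ?thesis by (rule convergentI[OF tendsto_eventually])
  next
    case False
    then show ?thesis using that off by (simp add: convergent_const)
  qed
  have dense: "\<exists>y\<in>Good \<sigma> \<union> - DD \<sigma>. dist x y < e" if "0 < e" for x e
  proof (rule ccontr)
    assume "\<not> ?thesis"
    then have "ball x e \<subseteq> DD \<sigma> - Good \<sigma>" by auto
    then have "emeasure lborel (ball x e) \<le> emeasure lborel (DD \<sigma> - Good \<sigma>)"
      using Dmeas[OF sS] Good_open[OF sS] by (intro emeasure_mono) auto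
    then have "ball x e \<in> null_sets lborel" using Good_null[OF sS] by (intro null_setsI) auto
    then have "negligible (ball x e)"
      by (metis negligible_iff_null_sets null_sets_completionI)
    then show False using open_not_negligible[of "ball x e"] that by simp
  qed
  have VL: "norm (V m \<sigma> x - V m \<sigma> y) \<le> L * norm (x - y)" for m x y
    using lipschitz_onD[OF V_lip[OF sS], of x y m] by (simp add: dist_norm)
  have L0: "0 \<le> L" by (rule L_nonneg[OF sS])
  have conv: "convergent (\<lambda>m. V m \<sigma> x)" for x
  proof (rule Cauchy_convergent, rule metric_CauchyI)
    fix e :: real assume e: "0 < e"
    from dense[of "e / (3 * (L + 1))" x] e L0 obtain y where y: "y \<in> Good \<sigma> \<union> - DD \<sigma>" "dist x y < e / (3 * (L + 1))"
      by auto
    have Ly: "L * norm (x - y) \<le> e / 3"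
    proof -
      have "L * norm (x - y) \<le> (L + 1) * (e / (3 * (L + 1)))"
        using y(2) L0 by (intro mult_mono) (auto simp: dist_norm)
      also have "\<dots> = e / 3" using L0 by (simp add: divide_simps)
      finally show ?thesis .
    qed
    have "Cauchy (\<lambda>m. V m \<sigma> y)" by (rule convergent_Cauchy[OF ev[OF y(1)]])
    then have "\<exists>M. \<forall>m\<ge>M. \<forall>n\<ge>M. dist (V m \<sigma> y) (V n \<sigma> y) < e / 3"
      using e by (intro metric_CauchyD) auto
    then obtain M where M: "\<And>m n. m \<ge> M \<Longrightarrow> n \<ge> M \<Longrightarrow> dist (V m \<sigma> y) (V n \<sigma> y) < e / 3"
      by blast
    show "\<exists>M. \<forall>m\<ge>M. \<forall>n\<ge>M. dist (V m \<sigma> x) (V n \<sigma> x) < e"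
    proof (intro exI allI impI)
      fix m n assume mn: "M \<le> m" "M \<le> n"
      have "dist (V m \<sigma> x) (V n \<sigma> x) \<le> dist (V m \<sigma> x) (V m \<sigma> y) + (dist (V m \<sigma> y) (V n \<sigma> y) + dist (V n \<sigma> y) (V n \<sigma> x))"
        using dist_triangle[of "V m \<sigma> x" "V n \<sigma> x" "V m \<sigma> y"] dist_triangle[of "V m \<sigma> y" "V n \<sigma> x" "V n \<sigma> y"]
          by linarith
      also have "\<dots> < e / 3 + (e / 3 + e / 3)"
      proof -
        have "dist (V m \<sigma> x) (V m \<sigma> y) \<le> e / 3" using VL[of m x y] Ly by (simp add: dist_norm)
        moreover have "dist (V n \<sigma> y) (V n \<sigma> x) \<le> e / 3" using VL[of n y x] Ly by (simp add: dist_norm norm_minus_commute)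
        ultimately show ?thesis using M[OF mn] by linarith
      qed
      finally show "dist (V m \<sigma> x) (V n \<sigma> x) < e" by simp
    qed
  qed
  define v where "v x = lim (\<lambda>m. V m \<sigma> x)" for x
  have vlim: "(\<lambda>m. V m \<sigma> x) \<longlonglongrightarrow> v x" for x
    using conv by (simp add: v_def convergent_LIMSEQ_iff)
  \<comment> \<open>The value \<open>AA \<sigma>\<close> on the unresolved null set is a default
    that respects the bound on \<open>G\<close> and agrees with the values off
    \<open>DD \<sigma>\<close>.\<close>
  define G where "G x = (if x \<in> Good \<sigma> then lim (\<lambda>m. GG m \<sigma> x) else AA \<sigma>)" for x
  have Gev: "\<forall>\<^sub>F m in sequentially. GG m \<sigma> x = G x" if "x \<in> Good \<sigma> \<union> - DD \<sigma>" for x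
  proof (cases "x \<in> Good \<sigma>")
    case True
    from good[OF this] obtain B where B: "\<forall>\<^sub>F m in sequentially. GG m \<sigma> x = B" by blast
    then have "lim (\<lambda>m. GG m \<sigma> x) = B" by (intro limI tendsto_eventually)
    then show ?thesis using B True by (simp add: G_def)
  next
    case False
    then show ?thesis using that off by (simp add: G_def)
  qed
  have meas: "G \<in> borel_measurable borel"
  proof -
    have "(\<lambda>x. lim (\<lambda>m. GG m \<sigma> x)) \<in> borel_measurable borel"
      using GG_meas[OF sS] by (intro borel_measurable_lim_metric) auto
    moreover have [measurable]: "Good \<sigma> \<in> sets borel" using Good_open[OF sS] by simp
    ultimately show ?thesis unfolding G_def[abs_def] by measurable
  qed
  have AEgood: "AE x in lborel. x \<in> Good \<sigma> \<union> - DD \<sigma>"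
  proof (rule AE_I)
    show "{x \<in> space lborel. \<not> x \<in> Good \<sigma> \<union> - DD \<sigma>} \<subseteq> DD \<sigma> - Good \<sigma>" by auto
  qed (use Good_null[OF sS] Dmeas[OF sS] Good_open[OF sS] in auto)
  have lip: "L-lipschitz_on UNIV v"
  proof (rule lipschitz_onI[OF _ L0])
    fix x y
    have "(\<lambda>m. norm (V m \<sigma> x - V m \<sigma> y)) \<longlonglongrightarrow> norm (v x - v y)" by (intro tendsto_intros vlim)
    then have "norm (v x - v y) \<le> L * norm (x - y)"
      using VL by (intro LIMSEQ_le_const2) auto
    then show "dist (v x) (v y) \<le> L * dist x y" by (simp add: dist_norm)
  qed
  have loca: "fst (G x) \<in> K3 \<and> (\<exists>e>0. \<forall>y\<in>ball x e. v y = v x + app (G x) (y - x))" if xG: "x \<in> Good \<sigma>" for x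
  proof -
    obtain e a B where e: "0 < e" "fst B \<in> K3" "\<forall>\<^sub>F m in sequentially. GG m \<sigma> x = B"
       and a: "\<And>y. y \<in> ball x e \<Longrightarrow> \<forall>\<^sub>F m in sequentially. V m \<sigma> y = a + app B (y - x)"
      using good[OF xG] by blast
    have va: "v y = a + app B (y - x)" if "y \<in> ball x e" for y
      by (rule LIMSEQ_unique[OF vlim tendsto_eventually[OF a[OF that]]])
    have "\<forall>\<^sub>F m in sequentially. GG m \<sigma> x = B \<and> GG m \<sigma> x = G x"
      using e(3) Gev[of x] xG by (intro eventually_conj) auto
    then obtain m where "GG m \<sigma> x = B \<and> GG m \<sigma> x = G x" using eventually_happens'[OF sequentially_bot] by fast
    then have "G x = B" by metis
    moreover have "v x = a" using va[of x] e(1) by (simp add: app_def)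
    ultimately show ?thesis using va e by auto
  qed
  have shift: "(\<integral>\<^sup>+x. ennreal (norm (G (x + h) - G x)) \<partial>lborel) \<le> ennreal (ww \<sigma> * norm h powr \<theta>)" for h
  proof -
    have sm: "(\<lambda>x. x + h) \<in> borel_measurable borel" by measurable
    have mm: "(\<lambda>x. ennreal (norm (GG m \<sigma> (x + h) - GG m \<sigma> x))) \<in> borel_measurable borel" for m
      using measurable_compose[OF sm GG_meas[OF sS, of m]] GG_meas[OF sS, of m] by measurable
    have "Good \<sigma> \<union> - DD \<sigma> \<in> sets borel"
      using Dmeas[OF sS] Good_open[OF sS] by auto
    then have [measurable]: "{x. x \<in> Good \<sigma> \<or> x \<notin> DD \<sigma>} \<in> sets borel"
      by (simp add: Un_def)
    \<comment> \<open>Translations preserve null sets, so almost every \<open>x\<close> has both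
      \<open>x\<close> and \<open>x + h\<close> among the points where the stages stabilize.\<close>
    have "AE x in distr lborel borel ((+) h). x \<in> Good \<sigma> \<union> - DD \<sigma>"
      by (subst lborel_distr_plus) (rule AEgood)
    then have AEh: "AE x in lborel. x + h \<in> Good \<sigma> \<union> - DD \<sigma>"
      by (subst (asm) AE_distr_iff) (simp_all add: add.commute)
    from AEgood AEh have "AE x in lborel. ennreal (norm (G (x + h) - G x)) =
       liminf (\<lambda>m. ennreal (norm (GG m \<sigma> (x + h) - GG m \<sigma> x)))"
    proof eventually_elim
      case (elim x)
      have "\<forall>\<^sub>F m in sequentially. ennreal (norm (GG m \<sigma> (x + h) - GG m \<sigma> x)) = ennreal (norm (G (x + h) - G x))"
        using Gev[OF elim(2)] Gev[OF elim(1)] by eventually_elim simp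
      then have "(\<lambda>m. ennreal (norm (GG m \<sigma> (x + h) - GG m \<sigma> x))) \<longlonglongrightarrow> ennreal (norm (G (x + h) - G x))"
        by (rule tendsto_eventually)
      then show ?case by (intro lim_imp_Liminf[OF sequentially_bot, symmetric])
    qed
    then have "(\<integral>\<^sup>+x. ennreal (norm (G (x + h) - G x)) \<partial>lborel) =
      (\<integral>\<^sup>+x. liminf (\<lambda>m. ennreal (norm (GG m \<sigma> (x + h) - GG m \<sigma> x))) \<partial>lborel)"
      by (rule nn_integral_cong_AE)
    also have "\<dots> \<le> liminf (\<lambda>m. \<integral>\<^sup>+x. ennreal (norm (GG m \<sigma> (x + h) - GG m \<sigma> x)) \<partial>lborel)"
      using mm by (intro nn_integral_liminf) auto
    also have "\<dots> \<le> liminf (\<lambda>m::nat. ennreal (ww \<sigma> * norm h powr \<theta>))"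
      using GG_shift[OF sS] by (intro Liminf_mono always_eventually) auto
    also have "\<dots> = ennreal (ww \<sigma> * norm h powr \<theta>)" by (simp add: Liminf_const)
    finally show ?thesis .
  qed
  have bnd: "norm (G x) \<le> max L (norm (AA \<sigma>))" for x
  proof (cases "x \<in> Good \<sigma>")
    case True
    then have "\<forall>\<^sub>F m in sequentially. GG m \<sigma> x = G x" using Gev by blast
    then obtain m where "GG m \<sigma> x = G x" using eventually_happens'[OF sequentially_bot] by fast
    then show ?thesis using GG_bound[OF sS, of m x] by simp
  qed (simp add: G_def)
  have offv: "v x = app (AA \<sigma>) x \<and> G x = AA \<sigma>" if "x \<notin> DD \<sigma>" for x
    using that off GD by (auto simp: v_def G_def)
  show ?thesis
    using lip offv meas bnd shift AEgood loca by (intro exI[of _ v] exI[of _ G]) (auto elim: eventually_mono)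
qed

end

section \<open>Filling open sets with small squares\<close>

text \<open>About 1 / d disjoint translates of \<open>X\<close> fit into a slightly larger ball.
  This one argument serves strips along lines as well as strips along Lipschitz graphs.\<close>

lemma packing_bound:
  fixes X :: "'a::euclidean_space set"
  assumes X: "X \<in> sets borel" "X \<subseteq> ball z R" and u: "norm u = 1" and d: "0 < d"
    and shift: "\<And>y k. y \<in> X \<Longrightarrow> 0 < k \<Longrightarrow> y + (real k * d) *\<^sub>R u \<notin> X"
  shows "emeasure lborel X \<le> ennreal (d * measure lborel (ball z (R + 2)))"
proof -
  \<comment> \<open>For \<open>d \<le> 1\<close> the translates move by at most
    \<open>N * d \<le> 1 + d \<le> 2\<close>, whence the radius \<open>R + 2\<close>; for larger
    \<open>d\<close> inclusion in the ball suffices.\<close>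
  define N where "N = nat \<lceil>1 / d\<rceil>"
  have N: "1 \<le> real N * d" "real N * d \<le> 1 + d"
  proof -
    have "1 / d \<le> real N" unfolding N_def by linarith
    then show "1 \<le> real N * d" using d by (simp add: divide_le_eq)
    have "real N \<le> 1 / d + 1" unfolding N_def using d by (simp add: of_nat_nat less_imp_le)
    then have "real N * d \<le> (1 / d + 1) * d" using d by (intro mult_right_mono) auto
    then show "real N * d \<le> 1 + d" using d by (simp add: algebra_simps)
  qed
  define Y where "Y k = (\<lambda>y. (real k * d) *\<^sub>R u + y) ` X" for k
  have Ym: "Y k \<in> sets borel" "emeasure lborel (Y k) = emeasure lborel X" for k
  proof -
    let ?t = "(real k * d) *\<^sub>R u"
    have e: "Y k = (+) (- ?t) -` X" by (force simp: Y_def)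
    show m: "Y k \<in> sets borel" unfolding e using measurable_sets[of "(+) (- ?t)" borel borel X] X(1) by auto
    have "emeasure lborel X = emeasure (distr lborel borel ((+) (- ?t))) X" by (simp add: lborel_distr_plus)
    also have "\<dots> = emeasure lborel (Y k)" using X(1) by (subst emeasure_distr) (auto simp: e)
    finally show "emeasure lborel (Y k) = emeasure lborel X" by simp
  qed
  have disj: "disjoint_family_on Y {..<N}"
  proof -
    have "Y k \<inter> Y l = {}" if "k < l" for k l
    proof (rule ccontr)
      assume "Y k \<inter> Y l \<noteq> {}"
      then obtain a b where ab: "a \<in> X" "b \<in> X" "(real k * d) *\<^sub>R u + a = (real l * d) *\<^sub>R u + b"
        by (auto simp: Y_def)
      then have "a = b + (real (l - k) * d) *\<^sub>R u" using that
        by (simp add: of_nat_diff algebra_simps)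
      then show False using shift[OF ab(2), of "l - k"] ab(1) that by simp
    qed
    then show ?thesis unfolding disjoint_family_on_def by (metis inf_commute linorder_neqE_nat)
  qed
  have R: "emeasure lborel (ball z (R + 2)) = ennreal (measure lborel (ball z (R + 2)))"
    using emeasure_lborel_ball_finite[of z "R + 2"] by (intro emeasure_eq_ennreal_measure) (auto simp: less_top)
  show ?thesis
  proof (cases "d \<le> 1")
    case True
    have "of_nat N * emeasure lborel X = (\<Sum>k<N. emeasure lborel (Y k))" using Ym by simp
    also have "\<dots> = emeasure lborel (\<Union>k<N. Y k)" using Ym disj by (intro sum_emeasure) auto
    also have "\<dots> \<le> emeasure lborel (ball z (R + 2))"
    proof (intro emeasure_mono subsetI)
      fix x assume "x \<in> (\<Union>k<N. Y k)"
      then obtain k y where ky: "k < N" "y \<in> X" "x = (real k * d) *\<^sub>R u + y" by (auto simp: Y_def)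
      have "real k * d \<le> real N * d" using ky d by (intro mult_right_mono) auto
      then have kd: "real k * d \<le> 2" using N True by linarith
      have "dist z x \<le> dist z y + norm ((real k * d) *\<^sub>R u)"
      proof -
        have e: "z - x = (z - y) - (real k * d) *\<^sub>R u" using ky by (simp add: algebra_simps)
        show ?thesis unfolding dist_norm e by (rule norm_triangle_ineq4)
      qed
      also have "\<dots> < R + 2" using ky X(2) kd u d by auto
      finally show "x \<in> ball z (R + 2)" by simp
    qed simp
    finally have "of_nat N * emeasure lborel X \<le> emeasure lborel (ball z (R + 2))" .
    then have "ennreal d * (of_nat N * emeasure lborel X) \<le> ennreal d * ennreal (measure lborel (ball z (R + 2)))"
      unfolding R by (rule mult_left_mono) simp
    moreover have "1 * emeasure lborel X \<le> ennreal d * of_nat N * emeasure lborel X"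
      using N d by (intro mult_right_mono)
        (simp_all add: ennreal_of_nat_eq_real_of_nat ennreal_mult[symmetric] mult.commute)
    ultimately show ?thesis using d by (simp add: ennreal_mult mult.assoc)
  next
    case False
    have "emeasure lborel X \<le> emeasure lborel (ball z (R + 2))"
      using X(2) by (intro emeasure_mono) auto
    also have "\<dots> \<le> ennreal (d * measure lborel (ball z (R + 2)))"
      unfolding R using False by (intro ennreal_leI) (simp add: mult_le_cancel_right1)
    finally show ?thesis .
  qed
qed

section \<open>Boundary layers of polygons\<close>

text \<open>A one-sided bound of Minkowski type: the part of \<open>U\<close> within distance
  \<open>d\<close> of the complement has area of order \<open>d\<close>. It controls both the number
  of small squares in a filling and the translation modulus of the indicator. The Borel superset
  makes measurability of the layer no issue.\<close>

definition collar :: "complex set \<Rightarrow> real \<Rightarrow> bool" where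
  "collar U C \<longleftrightarrow> (\<forall>d>0. \<exists>B\<in>sets borel. {y \<in> U. \<exists>y'. y' \<notin> U \<and> dist y y' \<le> d} \<subseteq> B \<and>
     emeasure lborel B \<le> ennreal (C * d))"

definition half :: "complex \<times> real \<Rightarrow> complex \<Rightarrow> real" where
  "half l y = Re (cnj (fst l) * y) + snd l"

lemma half_diff: "half l x - half l y = Re (cnj (fst l) * (x - y))"
  by (simp add: half_def algebra_simps)

lemma half_lip: "\<bar>half l x - half l y\<bar> \<le> norm (fst l) * dist x y"
  unfolding half_diff by (metis abs_Re_le_cmod complex_mod_cnj dist_norm norm_mult)

lemma half_cont [continuous_intros]: "continuous_on X (half l)"
  unfolding half_def[abs_def] by (intro continuous_intros)

lemma half_meas [measurable]: "half l \<in> borel_measurable borel"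
  by (intro borel_measurable_continuous_onI half_cont)

definition poly :: "(complex \<times> real) list \<Rightarrow> complex set" where
  "poly ls = {y. \<forall>l\<in>set ls. 0 < half l y}"

lemma poly_open: "open (poly ls)"
proof -
  have "poly ls = (\<Inter>l\<in>set ls. half l -` {0<..})" by (auto simp: poly_def)
  then show ?thesis using open_vimage[OF open_greaterThan half_cont] by (auto intro!: open_INT)
qed

text \<open>Shifts by multiples of \<open>d\<close> along the normal leave the strip. The lower
  inequality is strict, so a shift by exactly \<open>d\<close> already does.\<close>

lemma strip_bound:
  assumes "0 < d"
  shows "emeasure lborel ({y \<in> ball z R. 0 < half l y \<and> half l y \<le> d * norm (fst l)})
    \<le> ennreal (d * measure lborel (ball z (R + 2)))"
proof (cases "fst l = 0")
  case True
  then have "{y \<in> ball z R. 0 < half l y \<and> half l y \<le> d * norm (fst l)} = {}" by (auto simp: half_def)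
  then show ?thesis by (metis emeasure_empty zero_le)
next
  case False
  let ?u = "fst l / of_real (norm (fst l))"
  show ?thesis
  proof (rule packing_bound[where u = ?u])
    show "{y \<in> ball z R. 0 < half l y \<and> half l y \<le> d * norm (fst l)} \<in> sets borel"
      by measurable
    show "norm ?u = 1" using False by (simp add: norm_divide)
    fix y and k :: nat
    assume y: "y \<in> {y \<in> ball z R. 0 < half l y \<and> half l y \<le> d * norm (fst l)}" and k: "0 < k"
    have "fst l * cnj (fst l) = of_real (norm (fst l)) * of_real (norm (fst l))"
      by (simp add: complex_norm_square[symmetric] power2_eq_square)
    moreover have "cnj (fst l) * ((real k * d) *\<^sub>R ?u) =
      of_real (real k * d) * (fst l * cnj (fst l)) / of_real (norm (fst l))"
      by (simp add: scaleR_conv_of_real mult_ac)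
    ultimately have "cnj (fst l) * ((real k * d) *\<^sub>R ?u) = of_real (real k * d * norm (fst l))"
      using False by simp
    then have "half l (y + (real k * d) *\<^sub>R ?u) = half l y + real k * d * norm (fst l)"
      by (simp add: half_def distrib_left)
    moreover have "1 * (d * norm (fst l)) \<le> real k * (d * norm (fst l))"
      using k assms by (intro mult_right_mono) auto
    ultimately show "y + (real k * d) *\<^sub>R ?u \<notin> {y \<in> ball z R. 0 < half l y \<and> half l y \<le> d * norm (fst l)}"
      using y by auto
  qed (use assms in auto)
qed

lemma poly_collar:
  assumes "poly ls \<subseteq> ball z R"
  shows "collar (poly ls) (length ls * measure lborel (ball z (R + 2)))"
  unfolding collar_def
proof (intro allI impI)
  fix d :: real assume d: "0 < d"
  define B where "B l = {y \<in> ball z R. 0 < half l y \<and> half l y \<le> d * norm (fst l)}" for l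
  have Bm: "B l \<in> sets borel" for l unfolding B_def by measurable
  have "{y \<in> poly ls. \<exists>y'. y' \<notin> poly ls \<and> dist y y' \<le> d} \<subseteq> (\<Union>l\<in>set ls. B l)"
  proof
    fix y assume y: "y \<in> {y \<in> poly ls. \<exists>y'. y' \<notin> poly ls \<and> dist y y' \<le> d}"
    then obtain y' l where l: "l \<in> set ls" "half l y' \<le> 0" "dist y y' \<le> d" "0 < half l y"
      by (auto simp: poly_def not_less)
    have "half l y \<le> norm (fst l) * dist y y'" using half_lip[of l y y'] l by linarith
    also have "\<dots> \<le> norm (fst l) * d" using l by (intro mult_left_mono) auto
    finally show "y \<in> (\<Union>l\<in>set ls. B l)" using y l assms by (auto simp: B_def mult.commute)
  qed
  moreover have "emeasure lborel (\<Union>l\<in>set ls. B l) \<le> ennreal (length ls * measure lborel (ball z (R + 2)) * d)"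
  proof -
    have "emeasure lborel (\<Union>l\<in>set ls. B l) \<le> (\<Sum>l\<in>set ls. emeasure lborel (B l))"
      using Bm by (intro emeasure_subadditive_finite) auto
    also have "\<dots> \<le> (\<Sum>l\<in>set ls. ennreal (d * measure lborel (ball z (R + 2))))"
      unfolding B_def by (intro sum_mono strip_bound d)
    also have "\<dots> = ennreal (real (card (set ls)) * (d * measure lborel (ball z (R + 2))))"
      by (simp add: ennreal_mult' ennreal_of_nat_eq_real_of_nat)
    also have "\<dots> \<le> ennreal (real (length ls) * (d * measure lborel (ball z (R + 2))))"
      using d by (intro ennreal_leI mult_right_mono) (auto simp: card_length)
    finally show ?thesis by (simp add: mult_ac)
  qed
  ultimately show "\<exists>B\<in>sets borel. {y \<in> poly ls. \<exists>y'. y' \<notin> poly ls \<and> dist y y' \<le> d} \<subseteq> B \<and>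
     emeasure lborel B \<le> ennreal (real (length ls) * measure lborel (ball z (R + 2)) * d)"
    using Bm by (intro bexI[of _ "\<Union>l\<in>set ls. B l"]) auto
qed

section \<open>Maximal dyadic squares\<close>

text \<open>Half-open, so that the squares of one level partition the plane.\<close>

definition sq :: "nat \<Rightarrow> int \<Rightarrow> int \<Rightarrow> complex set" where
  "sq j m n = {y. \<lfloor>2 ^ j * Re y\<rfloor> = m \<and> \<lfloor>2 ^ j * Im y\<rfloor> = n}"

text \<open>The maximal dyadic squares in \<open>U\<close> among those of side at most 1. A selected
  square of positive level has a parent that meets the complement of \<open>U\<close>, which keeps
  it close to the boundary.\<close>

definition sel :: "complex set \<Rightarrow> (nat \<times> int \<times> int) set" where
  "sel U = {(j, m, n). sq j m n \<subseteq> U \<and> (j = 0 \<or> \<not> sq (j - 1) (m div 2) (n div 2) \<subseteq> U)}"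

text \<open>Rounding down is compatible with passing to a coarser grid, so integer division of the
  indices yields the ancestor of a square.\<close>

lemma sq_coarse:
  assumes "j \<le> k" "y \<in> sq k a b"
  shows "y \<in> sq j (a div 2 ^ (k - j)) (b div 2 ^ (k - j))"
proof -
  have "\<lfloor>2 ^ j * t\<rfloor> = \<lfloor>2 ^ k * t\<rfloor> div 2 ^ (k - j)" for t :: real
  proof -
    have "(2::real) ^ k = 2 ^ j * 2 ^ (k - j)" using assms(1) by (simp add: power_add[symmetric])
    then have "2 ^ j * t = (2 ^ k * t) / real_of_int (2 ^ (k - j))" by simp
    then show ?thesis using floor_divide_real_eq_div[of "2 ^ (k - j)" "2 ^ k * t"] by simp
  qed
  then show ?thesis using assms(2) by (auto simp: sq_def)
qed

lemma sq_nested: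
  assumes "j \<le> k" "y \<in> sq j m n" "y \<in> sq k a b"
  shows "sq k a b \<subseteq> sq j m n"
proof
  fix z assume "z \<in> sq k a b"
  then have "z \<in> sq j (a div 2 ^ (k - j)) (b div 2 ^ (k - j))" using sq_coarse assms(1) by blast
  moreover have "y \<in> sq j (a div 2 ^ (k - j)) (b div 2 ^ (k - j))" using sq_coarse assms by blast
  ultimately show "z \<in> sq j m n" using assms(2) by (auto simp: sq_def)
qed

lemma sq_dist:
  assumes "y \<in> sq j m n" "z \<in> sq j m n"
  shows "dist y z \<le> 2 / 2 ^ j"
proof -
  have *: "\<bar>s - t\<bar> \<le> 1 / 2 ^ j" if "\<lfloor>2 ^ j * s\<rfloor> = \<lfloor>2 ^ j * t\<rfloor>" for s t :: real
  proof -
    have "\<bar>2 ^ j * s - 2 ^ j * t\<bar> \<le> 1" using that by linarith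
    then have "\<bar>2 ^ j * (s - t)\<bar> \<le> 1" by (simp only: right_diff_distrib)
    then show ?thesis by (simp add: abs_mult le_divide_eq mult.commute)
  qed
  have "dist y z \<le> \<bar>Re (y - z)\<bar> + \<bar>Im (y - z)\<bar>"
    unfolding dist_norm by (rule cmod_le)
  also have "\<dots> \<le> 1 / 2 ^ j + 1 / 2 ^ j" using assms * by (intro add_mono) (auto simp: sq_def)
  finally show ?thesis by simp
qed

text \<open>Two selected squares with a common point are nested. Were their levels different, the
  parent of the smaller one would lie in the larger one and hence in \<open>U\<close>.\<close>

lemma sel_unique:
  assumes "(j, m, n) \<in> sel U" "(k, a, b) \<in> sel U" "y \<in> sq j m n" "y \<in> sq k a b"
  shows "(j, m, n) = (k, a, b)"
proof -
  have *: "j = k" if "j \<le> k" "(j, m, n) \<in> sel U" "(k, a, b) \<in> sel U" "y \<in> sq j m n" "y \<in> sq k a b"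
    for j m n k a b
  proof (rule ccontr)
    assume "j \<noteq> k"
    then have jk: "j \<le> k - 1" "1 \<le> k" using that(1) by auto
    have "y \<in> sq (k - 1) (a div 2) (b div 2)" using sq_coarse[of "k - 1" k y a b] that(5) jk by simp
    then have "sq (k - 1) (a div 2) (b div 2) \<subseteq> sq j m n" by (rule sq_nested[OF jk(1) that(4)])
    then show False using that(2,3) jk by (auto simp: sel_def)
  qed
  have "j = k" using *[of j k] *[of k j] assms by (cases "j \<le> k") auto
  then show ?thesis using assms by (auto simp: sq_def)
qed

lemma sel_cover:
  assumes "open U" "y \<in> U"
  shows "\<exists>j m n. (j, m, n) \<in> sel U \<and> y \<in> sq j m n"
proof -
  let ?q = "\<lambda>j. sq j \<lfloor>2 ^ j * Re y\<rfloor> \<lfloor>2 ^ j * Im y\<rfloor>"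
  have yq: "y \<in> ?q j" for j by (simp add: sq_def)
  obtain e where e: "0 < e" "ball y e \<subseteq> U" using assms open_contains_ball by blast
  obtain j where j: "2 / e < 2 ^ j" using real_arch_pow[of 2 "2 / e"] by auto
  have "?q j \<subseteq> U"
  proof
    fix z assume "z \<in> ?q j"
    then have "dist y z \<le> 2 / 2 ^ j" using sq_dist yq by blast
    also have "\<dots> < e" using j e by (simp add: field_simps)
    finally show "z \<in> U" using e by auto
  qed
  then have ex: "\<exists>j. ?q j \<subseteq> U" by blast
  define k where "k = (LEAST j. ?q j \<subseteq> U)"
  have k: "?q k \<subseteq> U" "\<And>i. i < k \<Longrightarrow> \<not> ?q i \<subseteq> U"
    using LeastI_ex[OF ex] not_less_Least unfolding k_def by blast+
  have "k = 0 \<or> \<not> sq (k - 1) (\<lfloor>2 ^ k * Re y\<rfloor> div 2) (\<lfloor>2 ^ k * Im y\<rfloor> div 2) \<subseteq> U"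
  proof (cases "k = 0")
    case False
    have "y \<in> sq (k - 1) (\<lfloor>2 ^ k * Re y\<rfloor> div 2) (\<lfloor>2 ^ k * Im y\<rfloor> div 2)"
      using sq_coarse[of "k - 1" k y] yq[of k] False by simp
    then have "sq (k - 1) (\<lfloor>2 ^ k * Re y\<rfloor> div 2) (\<lfloor>2 ^ k * Im y\<rfloor> div 2) = ?q (k - 1)"
      by (auto simp: sq_def)
    then show ?thesis using k(2)[of "k - 1"] False by simp
  qed simp
  then show ?thesis using k(1) yq[of k]
    by (intro exI[of _ k] exI[of _ "\<lfloor>2 ^ k * Re y\<rfloor>"] exI[of _ "\<lfloor>2 ^ k * Im y\<rfloor>"]) (simp add: sel_def)
qed

lemma sq_box: "box (Complex (of_int m / 2 ^ j) (of_int n / 2 ^ j)) (Complex ((of_int m + 1) / 2 ^ j) ((of_int n + 1) / 2 ^ j)) \<subseteq> sq j m n"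
  "sq j m n \<subseteq> cbox (Complex (of_int m / 2 ^ j) (of_int n / 2 ^ j)) (Complex ((of_int m + 1) / 2 ^ j) ((of_int n + 1) / 2 ^ j))"
proof -
  show "box (Complex (of_int m / 2 ^ j) (of_int n / 2 ^ j)) (Complex ((of_int m + 1) / 2 ^ j) ((of_int n + 1) / 2 ^ j)) \<subseteq> sq j m n"
    by (auto simp: sq_def in_box_complex_iff floor_eq_iff field_simps)
  have "of_int m / 2 ^ j \<le> t \<and> t \<le> (of_int m + 1) / 2 ^ j" if "\<lfloor>2 ^ j * t\<rfloor> = m" for t :: real and m
    using that by (simp add: floor_eq_iff field_simps)
  then show "sq j m n \<subseteq> cbox (Complex (of_int m / 2 ^ j) (of_int n / 2 ^ j)) (Complex ((of_int m + 1) / 2 ^ j) ((of_int n + 1) / 2 ^ j))"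
    by (auto simp: sq_def in_cbox_complex_iff)
qed

lemma sq_meas [measurable]: "sq j m n \<in> sets borel"
  unfolding sq_def by measurable

lemma sq_measure: "emeasure lborel (sq j m n) = ennreal (1 / 4 ^ j)"
proof (rule antisym)
  let ?a = "Complex (of_int m / 2 ^ j) (of_int n / 2 ^ j)" and ?b = "Complex ((of_int m + 1) / 2 ^ j) ((of_int n + 1) / 2 ^ j)"
  have le: "\<forall>b\<in>Basis. ?a \<bullet> b \<le> ?b \<bullet> b" by (auto simp: Basis_complex_def divide_right_mono)
  have p: "(\<Prod>b\<in>Basis. (?b - ?a) \<bullet> b) = 1 / 4 ^ j"
    by (simp add: Basis_complex_def diff_divide_distrib[symmetric] power_mult_distrib[symmetric])
  have "emeasure lborel (sq j m n) \<le> emeasure lborel (cbox ?a ?b)" using sq_box by (intro emeasure_mono) auto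
  then show "emeasure lborel (sq j m n) \<le> ennreal (1 / 4 ^ j)" using le p by (simp add: emeasure_lborel_cbox_eq)
  have "emeasure lborel (box ?a ?b) \<le> emeasure lborel (sq j m n)" using sq_box by (intro emeasure_mono) auto
  then show "ennreal (1 / 4 ^ j) \<le> emeasure lborel (sq j m n)" using le p by (simp add: emeasure_lborel_box_eq)
qed

lemma sq_interior: "sq j m n - interior (sq j m n) \<in> null_sets lborel"
proof -
  let ?a = "Complex (of_int m / 2 ^ j) (of_int n / 2 ^ j)" and ?b = "Complex ((of_int m + 1) / 2 ^ j) ((of_int n + 1) / 2 ^ j)"
  have "box ?a ?b \<subseteq> interior (sq j m n)" using sq_box by (intro interior_maximal) auto
  then have "sq j m n - interior (sq j m n) \<subseteq> cbox ?a ?b - box ?a ?b" using sq_box by blast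
  moreover have "cbox ?a ?b - box ?a ?b \<in> null_sets lborel"
    using negligible_frontier_interval[of ?a ?b] by (auto simp: negligible_iff_null_sets null_sets_completion_iff)
  ultimately show ?thesis using sq_meas
    by (auto intro: null_sets_subset)
qed

text \<open>The surplus of the exponent 2 - \<theta> over area, for a unit collar constant: a square
  of side r = 2^-j satisfies r^(2 - \<theta>) = r^2 * 2^(j * \<theta>), and for positive j it lies
  in a layer of width 4 / 2^j. It is a difference of geometric series and tends to 0 with
  \<theta>.\<close>

definition eta :: "real \<Rightarrow> real" where
  "eta \<theta> = (\<Sum>j. (2 powr (real j * \<theta>) - 1) * (4 / 2 ^ j))"

lemma eta_sums:
  assumes "\<theta> < 1"
  shows "(\<lambda>j. (2 powr (real j * \<theta>) - 1) * (4 / 2 ^ j)) sums (4 / (1 - 2 powr (\<theta> - 1)) - 8)"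
proof -
  have p: "(2::real) powr (\<theta> - 1) < 1" using assms powr_less_mono[of "\<theta> - 1" 0 2] by simp
  have "(2 powr (real j * \<theta>) - 1) * (4 / 2 ^ j) = 4 * (2 powr (\<theta> - 1)) ^ j - 4 * (1 / 2) ^ j" for j
  proof -
    have "(2 powr (\<theta> - 1)) ^ j = 2 powr (real j * (\<theta> - 1))"
      by (simp add: powr_powr mult.commute flip: powr_realpow)
    also have "\<dots> = 2 powr (real j * \<theta>) / 2 ^ j"
      by (simp add: right_diff_distrib powr_diff powr_realpow)
    finally show ?thesis by (simp add: power_divide field_simps)
  qed
  moreover have "(\<lambda>j. 4 * (2 powr (\<theta> - 1)) ^ j - 4 * (1 / 2) ^ j) sums (4 * (1 / (1 - 2 powr (\<theta> - 1))) - 4 * (1 / (1 - 1 / 2)))"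
    using p by (intro sums_diff sums_mult geometric_sums) auto
  ultimately show ?thesis by simp
qed

lemma eta_small:
  assumes "0 < e" shows "\<exists>\<theta>. 0 < \<theta> \<and> \<theta> < 1 \<and> eta \<theta> < e"
proof -
  have "((\<lambda>\<theta>. 4 / (1 - 2 powr (\<theta> - 1)) - 8) \<longlongrightarrow> 4 / (1 - 2 powr (0 - 1)) - 8) (at_right (0::real))"
    by (intro tendsto_intros) (auto simp: powr_minus)
  then have "((\<lambda>\<theta>. 4 / (1 - 2 powr (\<theta> - 1)) - 8) \<longlongrightarrow> 0) (at_right (0::real))"
    by (simp add: powr_minus)
  then have "\<forall>\<^sub>F \<theta> in at_right (0::real). 4 / (1 - 2 powr (\<theta> - 1)) - 8 < e"
    using assms order_tendstoD(2) by blast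
  moreover have "\<forall>\<^sub>F \<theta> in at_right (0::real). \<theta> \<in> {0<..<1}"
    by (rule eventually_at_right_real) simp
  ultimately have "\<forall>\<^sub>F \<theta> in at_right (0::real). \<theta> \<in> {0<..<1} \<and> 4 / (1 - 2 powr (\<theta> - 1)) - 8 < e"
    by eventually_elim simp
  then obtain \<theta> :: real where "\<theta> \<in> {0<..<1}" "4 / (1 - 2 powr (\<theta> - 1)) - 8 < e"
    using eventually_happens'[OF trivial_limit_at_right_real] by blast
  then show ?thesis using eta_sums[of \<theta>] by (auto simp: eta_def sums_iff)
qed

section \<open>Filling by scaled copies\<close>

lemma nn_integral_affine_complex:
  assumes "0 < r" and [measurable]: "f \<in> borel_measurable borel"
  shows "(\<integral>\<^sup>+x. f ((x - p) / of_real r) \<partial>lborel) = ennreal (r\<^sup>2) * (\<integral>\<^sup>+y. f y \<partial>(lborel :: complex measure))"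
proof -
  have l: "r *\<^sub>R y / of_real r = y" for y :: complex
    using assms by (simp add: scaleR_conv_of_real)
  have m: "(\<lambda>x. (x - p) / of_real r) \<in> borel_measurable borel"
    using assms(1) by (intro borel_measurable_continuous_onI continuous_intros) auto
  have "(\<integral>\<^sup>+x. f ((x - p) / of_real r) \<partial>lborel) =
    (\<integral>\<^sup>+x. f ((x - p) / of_real r) \<partial>density (distr lborel borel (\<lambda>x. p + r *\<^sub>R x)) (\<lambda>_. ennreal (\<bar>r\<bar> ^ DIM(complex))))"
    using lborel_affine[of r p] assms by simp
  also have "\<dots> = (\<integral>\<^sup>+y. ennreal (r ^ 2) * f y \<partial>lborel)"
    using assms measurable_compose[OF m, of f] by (simp add: nn_integral_density nn_integral_distr l DIM_complex power2_eq_square)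
  finally show ?thesis by (simp add: nn_integral_cmult)
qed

lemma emeasure_affine_complex:
  assumes "0 < r" and D: "D \<in> sets borel"
  shows "{x. (x - p) / of_real r \<in> D} \<in> sets borel"
    "emeasure lborel {x. (x - p) / of_real r \<in> D} = ennreal (r\<^sup>2) * emeasure lborel (D :: complex set)"
proof -
  have m: "(\<lambda>x. (x - p) / of_real r) \<in> borel_measurable borel"
    using assms(1) by (intro borel_measurable_continuous_onI continuous_intros) auto
  show 1: "{x. (x - p) / of_real r \<in> D} \<in> sets borel"
    using measurable_sets[OF m D] by (simp add: vimage_def)
  have "emeasure lborel {x. (x - p) / of_real r \<in> D} = (\<integral>\<^sup>+x. indicator D ((x - p) / of_real r) \<partial>lborel)"
  proof -
    have "(\<lambda>x. indicator D ((x - p) / of_real r)) = (indicator {x. (x - p) / of_real r \<in> D} :: complex \<Rightarrow> ennreal)"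
      by (auto simp: indicator_def fun_eq_iff)
    then show ?thesis using 1 by simp
  qed
  then show "emeasure lborel {x. (x - p) / of_real r \<in> D} = ennreal (r\<^sup>2) * emeasure lborel D"
    using nn_integral_affine_complex[OF assms(1), of "indicator D" p] D by simp
qed

text \<open>The maximal dyadic squares in the image of \<open>X\<close> under
  \<open>\<kappa>\<close> are pulled back to copies of \<open>D\<close>, the preimage of a
  translated unit square. In the sum of r^(2 - \<theta>) the area accounts for
  \<open>mx / md\<close>; the surplus comes from small squares, which lie near the boundary of the
  image, and is at most \<open>C * eta \<theta>\<close>. The collar is that of the image because the
  squares live there.\<close>

lemma fill:
  fixes \<kappa> \<kappa>i :: "complex \<Rightarrow> complex"
  assumes lin: "linear \<kappa>" "linear \<kappa>i" and inv: "\<And>y. \<kappa> (\<kappa>i y) = y" "\<And>x. \<kappa>i (\<kappa> x) = x"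
    and X: "open X" and col: "collar (\<kappa> ` X) C" "0 \<le> C" and th: "0 < \<theta>" "\<theta> < 1"
    and D: "D = {x. \<kappa> x + q \<in> sq 0 0 0}"
    and md: "emeasure lborel D = ennreal md" "0 < md" and mx: "emeasure lborel X \<le> ennreal mx" "0 \<le> mx"
  obtains p :: "nat \<Rightarrow> complex" and r :: "nat \<Rightarrow> real" and I where
    "\<And>i. i \<in> I \<Longrightarrow> 0 < r i \<and> r i \<le> 1"
    "\<And>x. x \<in> X \<longleftrightarrow> (\<exists>i\<in>I. (x - p i) / of_real (r i) \<in> D)"
    "\<And>i j x. i \<in> I \<Longrightarrow> j \<in> I \<Longrightarrow> i \<noteq> j \<Longrightarrow> (x - p i) / of_real (r i) \<in> D \<Longrightarrow> (x - p j) / of_real (r j) \<notin> D"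
    "(\<Sum>i. if i \<in> I then ennreal (r i powr (2 - \<theta>)) else 0) \<le> ennreal (mx / md + C * eta \<theta>)"
proof -
  define U where "U = \<kappa> ` X"
  have Uv: "U = \<kappa>i -` X" unfolding U_def
  proof (intro set_eqI iffI)
    fix y assume "y \<in> \<kappa>i -` X"
    then show "y \<in> \<kappa> ` X" using inv(1)[of y] by (intro image_eqI[of y \<kappa> "\<kappa>i y"]) auto
  qed (use inv in auto)
  have oU: "open U" unfolding Uv using X linear_continuous_on[of \<kappa>i UNIV] lin(2)
    by (intro open_vimage) (auto simp: linear_conv_bounded_linear)
  have kc: "continuous_on UNIV \<kappa>" using linear_continuous_on[of \<kappa> UNIV] lin(1) by (auto simp: linear_conv_bounded_linear)
  then have km: "\<kappa> \<in> borel_measurable borel" by (rule borel_measurable_continuous_onI)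
  have Dm: "D \<in> sets borel"
  proof -
    have "(\<lambda>x. \<kappa> x + q) \<in> borel_measurable borel"
      using km by (intro borel_measurable_add borel_measurable_const)
    then have "(\<lambda>x. \<kappa> x + q) -` sq 0 0 0 \<inter> space borel \<in> sets borel"
      by (rule measurable_sets[OF _ sq_meas])
    then show ?thesis by (simp add: D vimage_def)
  qed
  define dec :: "nat \<Rightarrow> nat \<times> int \<times> int" where "dec = from_nat"
  \<comment> \<open>\<open>from_nat\<close> may take a value several times; the second condition
    keeps one index for each square.\<close>
  define I where "I = {i. dec i \<in> sel U \<and> to_nat (dec i) = i}"
  define lv where "lv i = fst (dec i)" for i
  define Q where "Q i = sq (lv i) (fst (snd (dec i))) (snd (snd (dec i)))" for i
  define r :: "nat \<Rightarrow> real" where "r i = 1 / 2 ^ lv i" for i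
  \<comment> \<open>Chosen so that copy \<open>i\<close> of \<open>D\<close> is exactly the preimage
    of \<open>Q i\<close>, as \<open>inD\<close> confirms; the offset \<open>q\<close> scales with
    the copy.\<close>
  define p where "p i = \<kappa>i ((1 / 2 ^ lv i) *\<^sub>R (Complex (of_int (fst (snd (dec i)))) (of_int (snd (snd (dec i)))) + q))" for i
  have r: "0 < r i" "r i \<le> 1" for i by (auto simp: r_def)
  have inD: "(x - p i) / of_real (r i) \<in> D \<longleftrightarrow> \<kappa> x \<in> Q i" for x i
  proof -
    let ?M = "Complex (of_int (fst (snd (dec i)))) (of_int (snd (snd (dec i))))"
    have "(x - p i) / of_real (r i) = (2 ^ lv i) *\<^sub>R (x - p i)"
      by (simp add: r_def scaleR_conv_of_real)
    then have "\<kappa> ((x - p i) / of_real (r i)) = (2 ^ lv i) *\<^sub>R \<kappa> x - (2 ^ lv i) *\<^sub>R \<kappa> (p i)"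
      by (simp add: linear_cmul[OF lin(1)] linear_diff[OF lin(1)] scaleR_diff_right)
    also have "(2 ^ lv i) *\<^sub>R \<kappa> (p i) = ?M + q" by (simp add: p_def inv)
    finally have "\<kappa> ((x - p i) / of_real (r i)) + q = (2 ^ lv i) *\<^sub>R \<kappa> x - ?M" by simp
    then have "(x - p i) / of_real (r i) \<in> D \<longleftrightarrow> (2 ^ lv i) *\<^sub>R \<kappa> x - ?M \<in> sq 0 0 0"
      by (simp only: D mem_Collect_eq)
    then show ?thesis by (simp add: Q_def sq_def)
  qed
  have QU: "i \<in> I \<Longrightarrow> Q i \<subseteq> U" for i by (auto simp: I_def Q_def lv_def sel_def split: prod.splits)
  have disj: "i = j" if "i \<in> I" "j \<in> I" "y \<in> Q i" "y \<in> Q j" for i j y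
  proof -
    have "dec i = dec j"
      using sel_unique[of "fst (dec i)" "fst (snd (dec i))" "snd (snd (dec i))" U "fst (dec j)" "fst (snd (dec j))" "snd (snd (dec j))" y]
        that by (auto simp: I_def Q_def lv_def prod_eq_iff)
    then show ?thesis using that by (auto simp: I_def)
  qed
  have cov: "\<exists>i\<in>I. y \<in> Q i" if "y \<in> U" for y
  proof -
    obtain j m n where "(j, m, n) \<in> sel U" "y \<in> sq j m n" using sel_cover[OF oU \<open>y \<in> U\<close>] by blast
    then show ?thesis by (intro bexI[of _ "to_nat (j, m, n)"]) (auto simp: I_def Q_def lv_def dec_def)
  qed
  have inX: "x \<in> X \<longleftrightarrow> (\<exists>i\<in>I. (x - p i) / of_real (r i) \<in> D)" for x
  proof -
    have "x \<in> X \<longleftrightarrow> \<kappa> x \<in> U" by (simp add: Uv inv)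
    then show ?thesis unfolding inD using cov[of "\<kappa> x"] QU by blast
  qed
  have dj: "(x - p j) / of_real (r j) \<notin> D" if "i \<in> I" "j \<in> I" "i \<noteq> j" "(x - p i) / of_real (r i) \<in> D" for i j x
    using that disj unfolding inD by blast
  have Xm: "X \<in> sets borel" using X by simp
  have S1: "(\<Sum>i. if i \<in> I then ennreal ((r i)\<^sup>2) else 0) \<le> ennreal (mx / md)"
  proof -
    define Y where "Y i = (if i \<in> I then {x. (x - p i) / of_real (r i) \<in> D} else {})" for i
    have Ym: "Y i \<in> sets borel" "emeasure lborel (Y i) = (if i \<in> I then ennreal ((r i)\<^sup>2) else 0) * ennreal md" for i
      using emeasure_affine_complex[OF r(1)[of i] Dm, of "p i"] md by (auto simp: Y_def)
    have "disjoint_family Y" unfolding disjoint_family_on_def using dj by (auto simp: Y_def)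
    then have "(\<Sum>i. emeasure lborel (Y i)) = emeasure lborel (\<Union>i. Y i)" using Ym by (intro suminf_emeasure) auto
    also have "(\<Union>i. Y i) = X" using inX by (auto simp: Y_def)
    finally have "(\<Sum>i. if i \<in> I then ennreal ((r i)\<^sup>2) else 0) * ennreal md \<le> ennreal mx"
      using mx by (simp add: Ym ennreal_suminf_multc)
    then have "(\<Sum>i. if i \<in> I then ennreal ((r i)\<^sup>2) else 0) * ennreal md * ennreal (1 / md) \<le> ennreal mx * ennreal (1 / md)"
      by (rule mult_right_mono) simp
    then show ?thesis using md(2) mx(2) by (simp add: mult.assoc ennreal_mult[symmetric])
  qed
  have cf: "0 \<le> (2::real) powr (real j * \<theta>) - 1" for j
    using th ge_one_powr_ge_zero[of 2 "real j * \<theta>"] by simp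
  \<comment> \<open>The surplus is integrated pointwise. A point of a selected square of level j
    \<ge> 1 has a point of the complement in the parent square, at distance at most 2 / 2^(j - 1) =
    4 / 2^j, so it lies in the layer \<open>B j\<close>; level 0 has no surplus.\<close>
  have S2: "(\<Sum>i. if i \<in> I then ennreal ((r i)\<^sup>2 * (2 powr (real (lv i) * \<theta>) - 1)) else 0) \<le> ennreal (C * eta \<theta>)"
  proof -
    have "\<forall>j::nat. \<exists>B. B \<in> sets borel \<and> {y \<in> U. \<exists>y'. y' \<notin> U \<and> dist y y' \<le> 4 / 2 ^ j} \<subseteq> B \<and>
     emeasure lborel B \<le> ennreal (C * (4 / 2 ^ j))"
    proof
      fix j :: nat
      have "0 < (4::real) / 2 ^ j" by simp
      then show "\<exists>B. B \<in> sets borel \<and> {y \<in> U. \<exists>y'. y' \<notin> U \<and> dist y y' \<le> 4 / 2 ^ j} \<subseteq> B \<and>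
        emeasure lborel B \<le> ennreal (C * (4 / 2 ^ j))"
        using col(1) unfolding collar_def U_def[symmetric] by blast
    qed
    from choice[OF this] obtain B where B': "\<And>j. B j \<in> sets borel \<and> {y \<in> U. \<exists>y'. y' \<notin> U \<and> dist y y' \<le> 4 / 2 ^ j} \<subseteq> B j \<and>
        emeasure lborel (B j) \<le> ennreal (C * (4 / 2 ^ j))" by blast
    then have Bm: "\<And>j. B j \<in> sets borel"
      and B: "\<And>j y y'. y \<in> U \<Longrightarrow> y' \<notin> U \<Longrightarrow> dist y y' \<le> 4 / 2 ^ j \<Longrightarrow> y \<in> B j"
      and Be: "\<And>j. emeasure lborel (B j) \<le> ennreal (C * (4 / 2 ^ j))"
      by blast+
    define a where "a j = ennreal (2 powr (real j * \<theta>) - 1)" for j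
    have Qm: "Q i \<in> sets borel" for i by (simp add: Q_def)
    have Qe: "emeasure lborel (Q i) = ennreal ((r i)\<^sup>2)" for i
      by (simp add: Q_def sq_measure r_def power_divide power_mult_distrib[symmetric] power2_eq_square)
    have "(\<Sum>i. if i \<in> I then ennreal ((r i)\<^sup>2 * (2 powr (real (lv i) * \<theta>) - 1)) else 0)
      = (\<Sum>i. \<integral>\<^sup>+y. (if i \<in> I then a (lv i) * indicator (Q i) y else 0) \<partial>lborel)"
    proof (intro suminf_cong)
      fix i
      have "(\<integral>\<^sup>+y. a (lv i) * indicator (Q i) y \<partial>lborel) = a (lv i) * emeasure lborel (Q i)"
        using Qm by (intro nn_integral_cmult_indicator) simp
      also have "\<dots> = ennreal ((r i)\<^sup>2 * (2 powr (real (lv i) * \<theta>) - 1))"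
        unfolding Qe a_def using cf by (simp only: ennreal_mult[symmetric] zero_le_power2 mult.commute)
      finally show "(if i \<in> I then ennreal ((r i)\<^sup>2 * (2 powr (real (lv i) * \<theta>) - 1)) else 0) =
        (\<integral>\<^sup>+y. (if i \<in> I then a (lv i) * indicator (Q i) y else 0) \<partial>lborel)" by simp
    qed
    also have "\<dots> = (\<integral>\<^sup>+y. (\<Sum>i. if i \<in> I then a (lv i) * indicator (Q i) y else 0) \<partial>lborel)"
    proof (rule nn_integral_suminf[symmetric])
      show "(\<lambda>y. if i \<in> I then a (lv i) * indicator (Q i) y else 0) \<in> borel_measurable lborel" for i
        using Qm[of i] by (cases "i \<in> I") auto
    qed
    also have "\<dots> \<le> (\<integral>\<^sup>+y. (\<Sum>j. a j * indicator (B j) y) \<partial>lborel)"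
    proof (intro nn_integral_mono)
      fix y
      show "(\<Sum>i. if i \<in> I then a (lv i) * indicator (Q i) y else 0) \<le> (\<Sum>j. a j * indicator (B j) y)"
      proof (cases "\<exists>i\<in>I. y \<in> Q i")
        case False
        then have "(\<lambda>i. if i \<in> I then a (lv i) * indicator (Q i) y else 0) = (\<lambda>i. 0)" by auto
        then show ?thesis by simp
      next
        case True
        then obtain i where i: "i \<in> I" "y \<in> Q i" by blast
        have "(\<Sum>i. if i \<in> I then a (lv i) * indicator (Q i) y else 0) =
          (\<Sum>i\<in>{i}. if i \<in> I then a (lv i) * indicator (Q i) y else 0)"
        proof (rule suminf_finite)
          fix k assume "k \<notin> {i}"
          then have "k \<notin> I \<or> y \<notin> Q k" using disj[of k i y] i by blast
          then show "(if k \<in> I then a (lv k) * indicator (Q k) y else 0) = 0" by auto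
        qed simp
        then have "(\<Sum>i. if i \<in> I then a (lv i) * indicator (Q i) y else 0) = a (lv i)" using i by simp
        also have "\<dots> \<le> (\<Sum>j. a j * indicator (B j) y)"
        proof (cases "lv i = 0")
          case False
          have "\<not> sq (lv i - 1) (fst (snd (dec i)) div 2) (snd (snd (dec i)) div 2) \<subseteq> U"
            using i(1) False by (auto simp: I_def sel_def lv_def split: prod.splits)
          then obtain y' where y': "y' \<in> sq (lv i - 1) (fst (snd (dec i)) div 2) (snd (snd (dec i)) div 2)" "y' \<notin> U" by blast
          moreover have "y \<in> sq (lv i - 1) (fst (snd (dec i)) div 2) (snd (snd (dec i)) div 2)"
            using sq_coarse[of "lv i - 1" "lv i" y] i(2) False by (simp add: Q_def)
          ultimately have "dist y y' \<le> 2 / 2 ^ (lv i - 1)" using sq_dist by blast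
          also have "\<dots> = 4 / 2 ^ lv i" using False by (cases "lv i") auto
          finally have "y \<in> B (lv i)" using B QU i y'(2) by blast
          then have "a (lv i) \<le> sum (\<lambda>j. a j * indicator (B j) y) {lv i}" by simp
          also have "\<dots> \<le> (\<Sum>j. a j * indicator (B j) y)" by (rule sum_le_suminf) auto
          finally show ?thesis .
        qed (simp add: a_def)
        finally show ?thesis .
      qed
    qed
    also have "\<dots> = (\<Sum>j. a j * emeasure lborel (B j))"
      using Bm by (subst nn_integral_suminf) (auto intro!: suminf_cong nn_integral_cmult_indicator)
    also have "\<dots> \<le> (\<Sum>j. ennreal (C * ((2 powr (real j * \<theta>) - 1) * (4 / 2 ^ j))))"
    proof (intro suminf_le)
      fix j
      have "a j * emeasure lborel (B j) \<le> a j * ennreal (C * (4 / 2 ^ j))" by (intro mult_left_mono Be) simp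
      also have "\<dots> = ennreal (C * ((2 powr (real j * \<theta>) - 1) * (4 / 2 ^ j)))"
        using cf col(2) by (simp add: a_def ennreal_mult[symmetric] mult_ac)
      finally show "a j * emeasure lborel (B j) \<le> ennreal (C * ((2 powr (real j * \<theta>) - 1) * (4 / 2 ^ j)))" .
    qed auto
    also have "\<dots> = ennreal (C * eta \<theta>)"
    proof (rule suminf_ennreal_eq)
      have "eta \<theta> = 4 / (1 - 2 powr (\<theta> - 1)) - 8"
        unfolding eta_def by (rule sums_unique[OF eta_sums[OF th(2)], symmetric])
      then show "(\<lambda>j. C * ((2 powr (real j * \<theta>) - 1) * (4 / 2 ^ j))) sums (C * eta \<theta>)"
        using sums_mult[OF eta_sums[OF th(2)], of C] by simp
      show "0 \<le> C * ((2 powr (real j * \<theta>) - 1) * (4 / 2 ^ j))" for j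
        using cf[of j] col(2) by (intro mult_nonneg_nonneg) auto
    qed
    finally show ?thesis .
  qed
  have "(\<Sum>i. if i \<in> I then ennreal (r i powr (2 - \<theta>)) else 0) =
    (\<Sum>i. (if i \<in> I then ennreal ((r i)\<^sup>2) else 0) + (if i \<in> I then ennreal ((r i)\<^sup>2 * (2 powr (real (lv i) * \<theta>) - 1)) else 0))"
  proof (intro suminf_cong)
    fix i
    have "r i powr (2 - \<theta>) = (r i)\<^sup>2 * 2 powr (real (lv i) * \<theta>)"
    proof -
      have ri: "r i = 2 powr (- real (lv i))" by (simp add: r_def powr_minus powr_realpow divide_inverse)
      then have "r i powr (2 - \<theta>) = 2 powr (- real (lv i) * 2 + real (lv i) * \<theta>)"
        by (simp add: powr_powr algebra_simps)
      also have "\<dots> = (2 powr (- real (lv i))) powr 2 * 2 powr (real (lv i) * \<theta>)"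
        by (simp only: powr_add powr_powr)
      finally show ?thesis using r(1)[of i] unfolding ri[symmetric] by (simp add: powr_numeral)
    qed
    then have "r i powr (2 - \<theta>) = (r i)\<^sup>2 + (r i)\<^sup>2 * (2 powr (real (lv i) * \<theta>) - 1)" by (simp add: algebra_simps)
    then show "(if i \<in> I then ennreal (r i powr (2 - \<theta>)) else 0) = (if i \<in> I then ennreal ((r i)\<^sup>2) else 0) + (if i \<in> I then ennreal ((r i)\<^sup>2 * (2 powr (real (lv i) * \<theta>) - 1)) else 0)"
      using cf by simp
  qed
  also have "\<dots> = (\<Sum>i. if i \<in> I then ennreal ((r i)\<^sup>2) else 0) + (\<Sum>i. if i \<in> I then ennreal ((r i)\<^sup>2 * (2 powr (real (lv i) * \<theta>) - 1)) else 0)"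
    by (intro suminf_add[symmetric]) auto
  also have "\<dots> \<le> ennreal (mx / md) + ennreal (C * eta \<theta>)" by (intro add_mono S1 S2)
  also have "\<dots> = ennreal (mx / md + C * eta \<theta>)"
  proof -
    have "0 \<le> eta \<theta>" unfolding eta_def using eta_sums[OF th(2)] cf by (intro suminf_nonneg) (auto simp: sums_iff)
    then show ?thesis using md mx col(2) by simp
  qed
  finally have "(\<Sum>i. if i \<in> I then ennreal (r i powr (2 - \<theta>)) else 0) \<le> ennreal (mx / md + C * eta \<theta>)" .
  with r inX dj show thesis by (intro that[of I r p]) auto
qed

section \<open>Patches\<close>

text \<open>For \<open>norm h \<le> 1\<close> only points in a layer of width \<open>norm h\<close>
  change sides, and \<open>norm h \<le> norm h powr \<theta>\<close>. For longer shifts the area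
  itself is enough.\<close>

lemma indicator_shift:
  assumes X: "X \<in> sets borel" and col: "collar X C" "0 \<le> C" and m: "emeasure lborel X \<le> ennreal m" "0 \<le> m"
    and th: "0 < \<theta>" "\<theta> < 1"
  shows "(\<integral>\<^sup>+x. ennreal \<bar>indicator X (x + h) - indicator X x\<bar> \<partial>lborel) \<le> ennreal (2 * (C + m) * norm h powr \<theta>)"
proof (cases "h = 0")
  case True
  then show ?thesis by simp
next
  case False
  have sh: "(\<integral>\<^sup>+x. indicator Y (x + h) \<partial>lborel) = emeasure lborel Y" if "Y \<in> sets borel" for Y :: "complex set"
  proof -
    have "emeasure lborel Y = (\<integral>\<^sup>+x. indicator Y x \<partial>distr lborel borel ((+) h))"
      using that by (simp add: lborel_distr_plus)
    also have "\<dots> = (\<integral>\<^sup>+x. indicator Y (h + x) \<partial>lborel)" using that by (subst nn_integral_distr) auto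
    finally show ?thesis by (simp add: add.commute)
  qed
  have split: "(\<integral>\<^sup>+x. ennreal \<bar>indicator X (x + h) - indicator X x\<bar> \<partial>lborel) \<le> 2 * ennreal M"
    if B: "\<And>x. x \<in> X \<Longrightarrow> x + h \<notin> X \<Longrightarrow> x \<in> B" "\<And>x. x \<in> X \<Longrightarrow> x - h \<notin> X \<Longrightarrow> x \<in> B" "B \<in> sets borel"
      "emeasure lborel B \<le> ennreal M" for B M
  proof -
    have "(\<integral>\<^sup>+x. ennreal \<bar>indicator X (x + h) - indicator X x\<bar> \<partial>lborel) \<le>
      (\<integral>\<^sup>+x. indicator B x + indicator B (x + h) \<partial>lborel)"
    proof (rule nn_integral_mono)
      fix x
      show "ennreal \<bar>indicator X (x + h) - indicator X x\<bar> \<le> indicator B x + indicator B (x + h)"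
        using B(1)[of x] B(2)[of "x + h"] by (auto simp: indicator_def)
    qed
    also have "\<dots> = (\<integral>\<^sup>+x. indicator B x \<partial>lborel) + (\<integral>\<^sup>+x. indicator B (x + h) \<partial>lborel)"
    proof (rule nn_integral_add)
      have "(\<lambda>x. x + h) \<in> borel_measurable borel" by measurable
      then show "(\<lambda>x. indicator B (x + h) :: ennreal) \<in> borel_measurable lborel"
        using measurable_compose[of "\<lambda>x. x + h" borel borel "indicator B"] B(3) by simp
    qed (use B(3) in simp)
    also have "\<dots> = emeasure lborel B + emeasure lborel B" using B(3) sh by simp
    also have "\<dots> \<le> ennreal M + ennreal M" using B(4) by (intro add_mono)
    finally show ?thesis by (simp add: mult_2)
  qed
  have two: "2 * ennreal M = ennreal (2 * M)" if "0 \<le> M" for M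
    using that by (simp add: ennreal_mult)
  show ?thesis
  proof (cases "norm h \<le> 1")
    case True
    obtain B where B: "B \<in> sets borel" "{y \<in> X. \<exists>y'. y' \<notin> X \<and> dist y y' \<le> norm h} \<subseteq> B"
      "emeasure lborel B \<le> ennreal (C * norm h)"
      using col(1) False unfolding collar_def by (meson zero_less_norm_iff)
    have "(\<integral>\<^sup>+x. ennreal \<bar>indicator X (x + h) - indicator X x\<bar> \<partial>lborel) \<le> 2 * ennreal (C * norm h)"
    proof (rule split[OF _ _ B(1,3)])
      show "x \<in> B" if "x \<in> X" "x + h \<notin> X" for x
        using that B(2) by (auto simp: dist_norm intro!: subsetD[OF B(2)] exI[of _ "x + h"])
      show "x \<in> B" if "x \<in> X" "x - h \<notin> X" for x
        using that B(2) by (auto simp: dist_norm intro!: subsetD[OF B(2)] exI[of _ "x - h"])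
    qed
    also have "\<dots> \<le> ennreal (2 * (C + m) * norm h powr \<theta>)"
    proof -
      have "norm h powr 1 \<le> norm h powr \<theta>" using True th by (intro powr_mono') auto
      then have "norm h \<le> norm h powr \<theta>" by simp
      then have "C * norm h \<le> (C + m) * norm h powr \<theta>" using col m by (intro mult_mono) auto
      then have "2 * (C * norm h) \<le> 2 * (C + m) * norm h powr \<theta>" by linarith
      then show ?thesis unfolding two[OF mult_nonneg_nonneg[OF col(2) norm_ge_zero]] by (rule ennreal_leI)
    qed
    finally show ?thesis .
  next
    case False
    have "(\<integral>\<^sup>+x. ennreal \<bar>indicator X (x + h) - indicator X x\<bar> \<partial>lborel) \<le> 2 * ennreal m"
      by (rule split[OF _ _ X m(1)])
    also have "\<dots> \<le> ennreal (2 * (C + m) * norm h powr \<theta>)"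
    proof -
      have "1 \<le> norm h powr \<theta>" using False th by (intro ge_one_powr_ge_zero) auto
      then have "m * 1 \<le> (C + m) * norm h powr \<theta>" using col m by (intro mult_mono) auto
      then have "2 * m \<le> 2 * (C + m) * norm h powr \<theta>" by linarith
      then show ?thesis unfolding two[OF m(2)] by (rule ennreal_leI)
    qed
    finally show ?thesis .
  qed
qed

type_synonym state = "(complex \<times> real) \<times> complex set \<times> real"

text \<open>The locale assumptions for a single state, with the data of its patch in one tuple. In
  this form patches are constructed state by state and afterwards selected simultaneously by
  choice.\<close>

definition patch :: "state set \<Rightarrow> real \<Rightarrow> real \<Rightarrow> state \<Rightarrow>
    (complex \<Rightarrow> complex) \<times> (complex \<Rightarrow> complex \<times> real) \<times> complex set \<times> (nat \<Rightarrow> complex) \<times>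
    (nat \<Rightarrow> real) \<times> (nat \<Rightarrow> state) \<times> nat set \<times> real \<Rightarrow> bool" where
  "patch S \<theta> L \<sigma> = (\<lambda>(F, g, fin, p, r, s, I, c).
     (\<forall>h. norm (app (fst \<sigma>) h) \<le> L * norm h) \<and> fst (snd \<sigma>) \<in> sets borel \<and> L-lipschitz_on UNIV F \<and>
     (\<forall>x. x \<notin> fst (snd \<sigma>) \<longrightarrow> F x = app (fst \<sigma>) x) \<and> open fin \<and> fin \<subseteq> fst (snd \<sigma>) \<and>
     (\<forall>x\<in>fin. fst (g x) \<in> K3 \<and> (\<exists>e>0. \<forall>y\<in>ball x e. F y = F x + app (g x) (y - x))) \<and>
     (\<forall>i\<in>I. 0 < r i \<and> r i \<le> 1 \<and> s i \<in> S) \<and>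
     (\<forall>i\<in>I. \<forall>x. (x - p i) / of_real (r i) \<in> fst (snd (s i)) \<longrightarrow> x \<in> fst (snd \<sigma>) - fin) \<and>
     (\<forall>i\<in>I. \<forall>j\<in>I. \<forall>x. i \<noteq> j \<longrightarrow> (x - p i) / of_real (r i) \<in> fst (snd (s i)) \<longrightarrow>
        (x - p j) / of_real (r j) \<notin> fst (snd (s j))) \<and>
     (\<forall>i\<in>I. \<exists>b. \<forall>x. (x - p i) / of_real (r i) \<in> fst (snd (s i)) \<longrightarrow> F x = app (fst (s i)) x + b) \<and>
     (\<exists>N. N \<in> null_sets lborel \<and> fst (snd \<sigma>) \<subseteq> fin \<union> N \<union>
         (\<Union>i\<in>I. interior {x. (x - p i) / of_real (r i) \<in> fst (snd (s i))})) \<and>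
     g \<in> borel_measurable borel \<and> (\<forall>x. x \<notin> fst (snd \<sigma>) \<longrightarrow> g x = fst \<sigma>) \<and>
     (\<forall>i\<in>I. \<forall>x. (x - p i) / of_real (r i) \<in> fst (snd (s i)) \<longrightarrow> g x = fst (s i)) \<and>
     (\<forall>x. norm (g x) \<le> L) \<and>
     (\<forall>h. (\<integral>\<^sup>+x. ennreal (norm (g (x + h) - g x)) \<partial>lborel) \<le> ennreal (c * norm h powr \<theta>)) \<and>
     emeasure lborel (fst (snd \<sigma>)) \<le> ennreal c \<and> 0 \<le> c \<and> 0 \<le> snd (snd \<sigma>) \<and>
     ennreal c + (\<Sum>i. if i \<in> I then ennreal (r i powr (2 - \<theta>) * snd (snd (s i))) else 0)
         \<le> ennreal (snd (snd \<sigma>)))"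

theorem patch_solution:
  assumes th: "0 < \<theta>" "\<theta> < 1" and ex: "\<And>\<sigma>. \<sigma> \<in> S \<Longrightarrow> \<exists>d. patch S \<theta> L \<sigma> d" and sS: "(A, D, w) \<in> S"
  shows "\<exists>v G. L-lipschitz_on UNIV v \<and> (\<forall>x. x \<notin> D \<longrightarrow> v x = app A x \<and> G x = A) \<and>
    G \<in> borel_measurable borel \<and> (\<forall>x. norm (G x) \<le> max L (norm A)) \<and>
    (AE x in lborel. x \<in> D \<longrightarrow> fst (G x) \<in> K3 \<and>
       (\<exists>e>0. \<forall>y\<in>ball x e. v y = v x + app (G x) (y - x))) \<and>
    (\<forall>h. (\<integral>\<^sup>+x. ennreal (norm (G (x + h) - G x)) \<partial>lborel) \<le> ennreal (w * norm h powr \<theta>))"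
proof -
  obtain d where d: "\<And>\<sigma>. \<sigma> \<in> S \<Longrightarrow> patch S \<theta> L \<sigma> (d \<sigma>)" using ex by metis
  define F g fin p r s I c where defs: "F = (\<lambda>\<sigma>. fst (d \<sigma>))" "g = (\<lambda>\<sigma>. fst (snd (d \<sigma>)))"
    "fin = (\<lambda>\<sigma>. fst (snd (snd (d \<sigma>))))" "p = (\<lambda>\<sigma>. fst (snd (snd (snd (d \<sigma>)))))"
    "r = (\<lambda>\<sigma>. fst (snd (snd (snd (snd (d \<sigma>))))))" "s = (\<lambda>\<sigma>. fst (snd (snd (snd (snd (snd (d \<sigma>)))))))"
    "I = (\<lambda>\<sigma>. fst (snd (snd (snd (snd (snd (snd (d \<sigma>))))))))"
    "c = (\<lambda>\<sigma>. snd (snd (snd (snd (snd (snd (snd (d \<sigma>))))))))"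
  have P: "patch S \<theta> L \<sigma> (F \<sigma>, g \<sigma>, fin \<sigma>, p \<sigma>, r \<sigma>, s \<sigma>, I \<sigma>, c \<sigma>)" if "\<sigma> \<in> S" for \<sigma>
    using d[OF that] by (simp add: defs)
  note P' = P[unfolded patch_def split_conv]
  note Q1 = P'[THEN conjunct1]
  note Q2 = P'[THEN conjunct2, THEN conjunct1]
  note Q3 = P'[THEN conjunct2, THEN conjunct2, THEN conjunct1]
  note Q4 = P'[THEN conjunct2, THEN conjunct2, THEN conjunct2, THEN conjunct1]
  note Q5 = P'[THEN conjunct2, THEN conjunct2, THEN conjunct2, THEN conjunct2, THEN conjunct1]
  note Q6 = P'[THEN conjunct2, THEN conjunct2, THEN conjunct2, THEN conjunct2, THEN conjunct2, THEN conjunct1]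
  note Q7 = P'[THEN conjunct2, THEN conjunct2, THEN conjunct2, THEN conjunct2, THEN conjunct2, THEN conjunct2, THEN conjunct1]
  note Q8 = P'[THEN conjunct2, THEN conjunct2, THEN conjunct2, THEN conjunct2, THEN conjunct2, THEN conjunct2, THEN conjunct2, THEN conjunct1]
  note Q9 = P'[THEN conjunct2, THEN conjunct2, THEN conjunct2, THEN conjunct2, THEN conjunct2, THEN conjunct2, THEN conjunct2, THEN conjunct2, THEN conjunct1]
  note Q10 = P'[THEN conjunct2, THEN conjunct2, THEN conjunct2, THEN conjunct2, THEN conjunct2, THEN conjunct2, THEN conjunct2, THEN conjunct2, THEN conjunct2, THEN conjunct1]
  note Q11 = P'[THEN conjunct2, THEN conjunct2, THEN conjunct2, THEN conjunct2, THEN conjunct2, THEN conjunct2, THEN conjunct2, THEN conjunct2, THEN conjunct2, THEN conjunct2, THEN conjunct1]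
  note Q12 = P'[THEN conjunct2, THEN conjunct2, THEN conjunct2, THEN conjunct2, THEN conjunct2, THEN conjunct2, THEN conjunct2, THEN conjunct2, THEN conjunct2, THEN conjunct2, THEN conjunct2, THEN conjunct1]
  note Q13 = P'[THEN conjunct2, THEN conjunct2, THEN conjunct2, THEN conjunct2, THEN conjunct2, THEN conjunct2, THEN conjunct2, THEN conjunct2, THEN conjunct2, THEN conjunct2, THEN conjunct2, THEN conjunct2, THEN conjunct1]
  note Q14 = P'[THEN conjunct2, THEN conjunct2, THEN conjunct2, THEN conjunct2, THEN conjunct2, THEN conjunct2, THEN conjunct2, THEN conjunct2, THEN conjunct2, THEN conjunct2, THEN conjunct2, THEN conjunct2, THEN conjunct2, THEN conjunct1]
  note Q15 = P'[THEN conjunct2, THEN conjunct2, THEN conjunct2, THEN conjunct2, THEN conjunct2, THEN conjunct2, THEN conjunct2, THEN conjunct2, THEN conjunct2, THEN conjunct2, THEN conjunct2, THEN conjunct2, THEN conjunct2, THEN conjunct2, THEN conjunct1]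
  note Q16 = P'[THEN conjunct2, THEN conjunct2, THEN conjunct2, THEN conjunct2, THEN conjunct2, THEN conjunct2, THEN conjunct2, THEN conjunct2, THEN conjunct2, THEN conjunct2, THEN conjunct2, THEN conjunct2, THEN conjunct2, THEN conjunct2, THEN conjunct2, THEN conjunct1]
  note Q17 = P'[THEN conjunct2, THEN conjunct2, THEN conjunct2, THEN conjunct2, THEN conjunct2, THEN conjunct2, THEN conjunct2, THEN conjunct2, THEN conjunct2, THEN conjunct2, THEN conjunct2, THEN conjunct2, THEN conjunct2, THEN conjunct2, THEN conjunct2, THEN conjunct2, THEN conjunct1]
  note Q18 = P'[THEN conjunct2, THEN conjunct2, THEN conjunct2, THEN conjunct2, THEN conjunct2, THEN conjunct2, THEN conjunct2, THEN conjunct2, THEN conjunct2, THEN conjunct2, THEN conjunct2, THEN conjunct2, THEN conjunct2, THEN conjunct2, THEN conjunct2, THEN conjunct2, THEN conjunct2, THEN conjunct1]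
  note Q19 = P'[THEN conjunct2, THEN conjunct2, THEN conjunct2, THEN conjunct2, THEN conjunct2, THEN conjunct2, THEN conjunct2, THEN conjunct2, THEN conjunct2, THEN conjunct2, THEN conjunct2, THEN conjunct2, THEN conjunct2, THEN conjunct2, THEN conjunct2, THEN conjunct2, THEN conjunct2, THEN conjunct2, THEN conjunct1]
  note Q20 = P'[THEN conjunct2, THEN conjunct2, THEN conjunct2, THEN conjunct2, THEN conjunct2, THEN conjunct2, THEN conjunct2, THEN conjunct2, THEN conjunct2, THEN conjunct2, THEN conjunct2, THEN conjunct2, THEN conjunct2, THEN conjunct2, THEN conjunct2, THEN conjunct2, THEN conjunct2, THEN conjunct2, THEN conjunct2, THEN conjunct1]
  note Q21 = P'[THEN conjunct2, THEN conjunct2, THEN conjunct2, THEN conjunct2, THEN conjunct2, THEN conjunct2, THEN conjunct2, THEN conjunct2, THEN conjunct2, THEN conjunct2, THEN conjunct2, THEN conjunct2, THEN conjunct2, THEN conjunct2, THEN conjunct2, THEN conjunct2, THEN conjunct2, THEN conjunct2, THEN conjunct2, THEN conjunct2]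
  interpret patched S fst "\<lambda>\<sigma>. fst (snd \<sigma>)" "\<lambda>\<sigma>. snd (snd \<sigma>)" \<theta> L F g fin p r s I c
  proof (unfold_locales, goal_cases)
    case 1 show ?case by (rule th)
  next
    case 2 show ?case by (rule th)
  next
    case (3 \<sigma>) show ?case using Q1[OF 3(1)] by (rule spec)
  next
    case (4 \<sigma>) show ?case using Q2[OF 4(1)] by simp
  next
    case (5 \<sigma>) show ?case using Q3[OF 5(1)] by simp
  next
    case (6 \<sigma>) then show ?case using Q4[of \<sigma>] by blast
  next
    case (7 \<sigma>) show ?case using Q5[OF 7(1)] by simp
  next
    case (8 \<sigma>) show ?case using Q6[OF 8(1)] by simp
  next
    case (9 \<sigma>) then show ?case using Q7[of \<sigma>] by blast
  next
    case (10 \<sigma>) then show ?case using Q8[of \<sigma>] by blast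
  next
    case (11 \<sigma> i y)
    have "0 < r \<sigma> i" using Q8[OF 11(1)] 11(2) by blast
    then show ?case using bspec[OF Q9[OF 11(1)] 11(2), THEN spec, of "p \<sigma> i + of_real (r \<sigma> i) * y"] 11(3) by simp
  next
    case (12 \<sigma>) then show ?case using Q10[of \<sigma>] by blast
  next
    case (13 \<sigma>) then show ?case using Q11[of \<sigma>] by blast
  next
    case (14 \<sigma>) show ?case using Q12[OF 14(1)] by assumption
  next
    case (15 \<sigma>) show ?case using Q13[OF 15(1)] by simp
  next
    case (16 \<sigma>) then show ?case using Q14[of \<sigma>] by blast
  next
    case (17 \<sigma>) then show ?case using Q15[of \<sigma>] by blast
  next
    case (18 \<sigma>) show ?case using Q16[OF 18(1)] by (rule spec)
  next
    case (19 \<sigma>) show ?case using Q17[OF 19(1)] by (rule spec)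
  next
    case (20 \<sigma>) show ?case using Q18[OF 20(1)] by simp
  next
    case (21 \<sigma>) show ?case using Q19[OF 21(1)] by simp
  next
    case (22 \<sigma>) show ?case using Q20[OF 22(1)] by simp
  next
    case (23 \<sigma>) show ?case using Q21[OF 23(1)] by simp
  qed
  show ?thesis using tree_solution[OF sS] by simp
qed

section \<open>Patches from finitely many affine cells\<close>

text \<open>The cells outside \<open>NF\<close> are finished; each cell in \<open>NF\<close> is
  filled with copies of one shape that carries the gradient of the cell. The costs separate. The
  jumps of the gradient and the collars of all cells enter \<open>c\<close>, while a filled cell is
  charged its area ratio \<open>m k / md k\<close> and the surplus of its normalized collar, times
  the weight of the child.\<close>

lemma cells_patch:
  fixes X :: "nat \<Rightarrow> complex set" and B :: "nat \<Rightarrow> complex \<times> real" and \<kappa> \<kappa>i :: "nat \<Rightarrow> complex \<Rightarrow> complex"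
  assumes th: "0 < \<theta>" "\<theta> < 1"
    and lin: "\<And>h. norm (app A h) \<le> L * norm h" "norm A \<le> L"
    and D: "D \<in> sets borel" and F: "L-lipschitz_on UNIV F" "\<And>x. x \<notin> D \<Longrightarrow> F x = app A x"
    and X: "\<And>k. k < N \<Longrightarrow> open (X k)" "\<And>k. k < N \<Longrightarrow> X k \<subseteq> D"
    and Xd: "\<And>k l x. k < N \<Longrightarrow> l < N \<Longrightarrow> x \<in> X k \<Longrightarrow> x \<in> X l \<Longrightarrow> k = l"
    and cov: "D - (\<Union>k<N. X k) \<in> null_sets lborel"
    and FX: "\<And>k x. k < N \<Longrightarrow> x \<in> X k \<Longrightarrow> F x = app (B k) x + b k"
    and BL: "\<And>k. k < N \<Longrightarrow> norm (B k) \<le> L"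
    and NF: "NF \<subseteq> {..<N}" and fin: "\<And>k. k < N \<Longrightarrow> k \<notin> NF \<Longrightarrow> fst (B k) \<in> K3"
    and ch: "\<And>k. k \<in> NF \<Longrightarrow> (B k, Dk k, wk k) \<in> S" "\<And>k. k \<in> NF \<Longrightarrow> 0 \<le> wk k"
    and shape: "\<And>k. k \<in> NF \<Longrightarrow> linear (\<kappa> k) \<and> linear (\<kappa>i k) \<and> (\<forall>y. \<kappa> k (\<kappa>i k y) = y) \<and> (\<forall>y. \<kappa>i k (\<kappa> k y) = y)"
      "\<And>k. k \<in> NF \<Longrightarrow> Dk k = {x. \<kappa> k x + q k \<in> sq 0 0 0}"
      "\<And>k. k \<in> NF \<Longrightarrow> emeasure lborel (Dk k) = ennreal (md k) \<and> 0 < md k"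
      "\<And>k. k \<in> NF \<Longrightarrow> collar (\<kappa> k ` X k) (C' k) \<and> 0 \<le> C' k"
    and col: "\<And>k. k < N \<Longrightarrow> collar (X k) (C k) \<and> 0 \<le> C k"
    and m: "\<And>k. k < N \<Longrightarrow> emeasure lborel (X k) \<le> ennreal (m k) \<and> 0 \<le> m k"
    and c: "(\<Sum>k<N. norm (B k - A) * (2 * (C k + m k))) \<le> c" "emeasure lborel D \<le> ennreal c" "0 \<le> c"
    and w: "c + (\<Sum>k\<in>NF. (m k / md k + C' k * eta \<theta>) * wk k) \<le> w"
  shows "\<exists>d. patch S \<theta> L (A, D, w) d"
proof -
  have "\<forall>k. \<exists>p r I. k \<in> NF \<longrightarrow> (\<forall>i\<in>I. 0 < r i \<and> r i \<le> (1::real)) \<and>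
    (\<forall>x. x \<in> X k \<longleftrightarrow> (\<exists>i\<in>I. (x - p i) / of_real (r i) \<in> Dk k)) \<and>
    (\<forall>i\<in>I. \<forall>j\<in>I. \<forall>x. i \<noteq> j \<longrightarrow> (x - p i) / of_real (r i) \<in> Dk k \<longrightarrow> (x - p j) / of_real (r j) \<notin> Dk k) \<and>
    (\<Sum>i::nat. if i \<in> I then ennreal (r i powr (2 - \<theta>)) else 0) \<le> ennreal (m k / md k + C' k * eta \<theta>)"
  proof (intro allI)
    fix k
    show "\<exists>p r I. k \<in> NF \<longrightarrow> (\<forall>i\<in>I. 0 < r i \<and> r i \<le> (1::real)) \<and>
    (\<forall>x. x \<in> X k \<longleftrightarrow> (\<exists>i\<in>I. (x - p i) / of_real (r i) \<in> Dk k)) \<and>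
    (\<forall>i\<in>I. \<forall>j\<in>I. \<forall>x. i \<noteq> j \<longrightarrow> (x - p i) / of_real (r i) \<in> Dk k \<longrightarrow> (x - p j) / of_real (r j) \<notin> Dk k) \<and>
    (\<Sum>i::nat. if i \<in> I then ennreal (r i powr (2 - \<theta>)) else 0) \<le> ennreal (m k / md k + C' k * eta \<theta>)"
    proof (cases "k \<in> NF")
      case True
      then have k: "k < N" using NF by auto
      show ?thesis
      proof (rule fill[of "\<kappa> k" "\<kappa>i k" "X k" "C' k" \<theta> "Dk k" "q k" "md k" "m k"])
        fix p r I
        assume "\<And>i. i \<in> I \<Longrightarrow> 0 < r i \<and> r i \<le> (1::real)"
          "\<And>x. x \<in> X k \<longleftrightarrow> (\<exists>i\<in>I. (x - p i) / of_real (r i) \<in> Dk k)"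
          "\<And>i j x. i \<in> I \<Longrightarrow> j \<in> I \<Longrightarrow> i \<noteq> j \<Longrightarrow> (x - p i) / of_real (r i) \<in> Dk k \<Longrightarrow> (x - p j) / of_real (r j) \<notin> Dk k"
          "(\<Sum>i::nat. if i \<in> I then ennreal (r i powr (2 - \<theta>)) else 0) \<le> ennreal (m k / md k + C' k * eta \<theta>)"
        then show ?thesis by (intro exI[of _ p] exI[of _ r] exI[of _ I]) simp
      qed (use shape(1)[OF True] shape(2)[OF True] shape(3)[OF True] shape(4)[OF True] X(1)[OF k] m[OF k] th in simp_all)
    qed simp
  qed
  from this[unfolded choice_iff] obtain p r I where PR: "\<And>k. k \<in> NF \<Longrightarrow> (\<forall>i\<in>I k. 0 < r k i \<and> r k i \<le> (1::real)) \<and>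
    (\<forall>x. x \<in> X k \<longleftrightarrow> (\<exists>i\<in>I k. (x - p k i) / of_real (r k i) \<in> Dk k)) \<and>
    (\<forall>i\<in>I k. \<forall>j\<in>I k. \<forall>x. i \<noteq> j \<longrightarrow> (x - p k i) / of_real (r k i) \<in> Dk k \<longrightarrow> (x - p k j) / of_real (r k j) \<notin> Dk k) \<and>
    (\<Sum>i::nat. if i \<in> I k then ennreal (r k i powr (2 - \<theta>)) else 0) \<le> ennreal (m k / md k + C' k * eta \<theta>)"
    by blast
  have rr: "\<And>k i. k \<in> NF \<Longrightarrow> i \<in> I k \<Longrightarrow> 0 < r k i \<and> r k i \<le> 1"
    and inX: "\<And>k x. k \<in> NF \<Longrightarrow> x \<in> X k \<longleftrightarrow> (\<exists>i\<in>I k. (x - p k i) / of_real (r k i) \<in> Dk k)"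
    and dj: "\<And>k i j x. k \<in> NF \<Longrightarrow> i \<in> I k \<Longrightarrow> j \<in> I k \<Longrightarrow> i \<noteq> j \<Longrightarrow> (x - p k i) / of_real (r k i) \<in> Dk k \<Longrightarrow> (x - p k j) / of_real (r k j) \<notin> Dk k"
    and su: "\<And>k. k \<in> NF \<Longrightarrow> (\<Sum>i::nat. if i \<in> I k then ennreal (r k i powr (2 - \<theta>)) else 0) \<le> ennreal (m k / md k + C' k * eta \<theta>)"
    using PR by blast+
  \<comment> \<open>A cell and an index within its filling are coded by one natural number.\<close>
  define J where "J = {i. fst (prod_decode i) \<in> NF \<and> snd (prod_decode i) \<in> I (fst (prod_decode i))}"
  define ki where "ki i = fst (prod_decode i)" for i
  define p' where "p' i = p (ki i) (snd (prod_decode i))" for i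
  define r' where "r' i = r (ki i) (snd (prod_decode i))" for i
  define s' where "s' i = (B (ki i), Dk (ki i), wk (ki i))" for i
  \<comment> \<open>Off the cells, in particular on the null set between them, \<open>g\<close>
    takes the value \<open>A\<close>.\<close>
  define g where "g x = A + (\<Sum>k<N. indicator (X k) x *\<^sub>R (B k - A))" for x
  define fn where "fn = (\<Union>k\<in>{..<N} - NF. X k)"
  have J: "ki i \<in> NF" "snd (prod_decode i) \<in> I (ki i)" "ki i < N" if "i \<in> J" for i
    using that NF by (auto simp: J_def ki_def)
  have sX: "x \<in> X (ki i)" if "i \<in> J" "(x - p' i) / of_real (r' i) \<in> fst (snd (s' i))" for i x
    using inX[OF J(1)[OF that(1)]] J(2)[OF that(1)] that(2) by (auto simp: p'_def r'_def s'_def)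
  have gX: "g x = B k" if "k < N" "x \<in> X k" for k x
  proof -
    have "(\<Sum>l<N. indicator (X l) x *\<^sub>R (B l - A)) = (\<Sum>l\<in>{k}. indicator (X l) x *\<^sub>R (B l - A))"
    proof (rule sum.mono_neutral_right)
      show "\<forall>l\<in>{..<N} - {k}. indicator (X l) x *\<^sub>R (B l - A) = 0"
      proof
        fix l assume "l \<in> {..<N} - {k}"
        then have "x \<notin> X l" using Xd[of l k x] that by blast
        then show "indicator (X l) x *\<^sub>R (B l - A) = 0" by simp
      qed
    qed (use that in auto)
    then show ?thesis using that by (simp add: g_def)
  qed
  have g0: "g x = A" if "\<And>k. k < N \<Longrightarrow> x \<notin> X k" for x
    using that by (simp add: g_def)
  have "patch S \<theta> L (A, D, w) (F, g, fn, p', r', s', J, c)"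
    unfolding patch_def split_conv
  proof (intro conjI allI ballI impI)
    show "norm (app (fst (A, D, w)) h) \<le> L * norm h" for h using lin by simp
    show "open fn" using X by (auto simp: fn_def)
    show "fn \<subseteq> fst (snd (A, D, w))" using X by (auto simp: fn_def)
    fix x
    show "F x = app (fst (A, D, w)) x" if "x \<notin> fst (snd (A, D, w))" using F(2) that by simp
    show "g x = fst (A, D, w)" if "x \<notin> fst (snd (A, D, w))" using g0[of x] X(2) that by fastforce
    show "norm (g x) \<le> L"
    proof (cases "\<exists>k<N. x \<in> X k")
      case True then show ?thesis using gX BL by auto
    next
      case False then show ?thesis using g0[of x] lin(2) by auto
    qed
  next
    fix x assume "x \<in> fn"
    then obtain k where k: "k < N" "k \<notin> NF" "x \<in> X k" by (auto simp: fn_def)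
    then show "fst (g x) \<in> K3" using gX fin by simp
    obtain e where "0 < e" "ball x e \<subseteq> X k" using X(1)[OF k(1)] k(3) open_contains_ball by blast
    then show "\<exists>e>0. \<forall>y\<in>ball x e. F y = F x + app (g x) (y - x)"
      using FX[OF k(1)] k gX by (intro exI[of _ e]) (auto simp: app_diff subset_iff)
  next
    fix i assume i: "i \<in> J"
    note Ji = J[OF i]
    show "0 < r' i" "r' i \<le> 1" using rr Ji by (auto simp: r'_def)
    show "s' i \<in> S" using ch Ji by (simp add: s'_def)
    fix x assume x: "(x - p' i) / of_real (r' i) \<in> fst (snd (s' i))"
    show "x \<in> fst (snd (A, D, w)) - fn"
      using sX[OF i x] X(2)[OF Ji(3)] Xd[OF Ji(3)] Ji(1) by (auto simp: fn_def)
    show "g x = fst (s' i)" using gX[OF Ji(3) sX[OF i x]] by (simp add: s'_def)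
    fix j assume j: "j \<in> J" "i \<noteq> j"
    show "(x - p' j) / of_real (r' j) \<notin> fst (snd (s' j))"
    proof
      assume xj: "(x - p' j) / of_real (r' j) \<in> fst (snd (s' j))"
      then have e: "ki i = ki j" using Xd[OF Ji(3) J(3)[OF j(1)] sX[OF i x] sX[OF j(1)]] by blast
      then have "snd (prod_decode i) \<noteq> snd (prod_decode j)"
        using j(2) unfolding ki_def by (metis prod_decode_inverse prod_eqI)
      then show False using dj[OF Ji(1,2), of "snd (prod_decode j)" x] J[OF j(1)] x xj e
        by (auto simp: p'_def r'_def s'_def)
    qed
  next
    fix i assume i: "i \<in> J"
    show "\<exists>b. \<forall>x. (x - p' i) / of_real (r' i) \<in> fst (snd (s' i)) \<longrightarrow> F x = app (fst (s' i)) x + b"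
      using FX[OF J(3)[OF i]] sX[OF i] by (intro exI[of _ "b (ki i)"]) (auto simp: s'_def)
  next
    \<comment> \<open>The covering condition of a patch speaks of interiors of copies. The boundary
      points contained in a copy come from the boundary of a square by an affine map and form a null
      set.\<close>
    have Dkm: "Dk k - interior (Dk k) \<in> null_sets lborel" if k: "k \<in> NF" for k
    proof -
      note s1 = shape(1)[OF k]
      have kc: "continuous_on UNIV (\<lambda>x. \<kappa> k x + q k)"
        using s1 by (intro continuous_intros linear_continuous_on) (auto simp: linear_conv_bounded_linear)
      have kic: "continuous_on UNIV (\<lambda>y. \<kappa>i k (y - q k))"
        using s1 linear_continuous_on[of "\<kappa>i k" UNIV]
        by (intro continuous_on_compose2[of UNIV "\<kappa>i k" UNIV "\<lambda>y. y - q k"] continuous_intros) (auto simp: linear_conv_bounded_linear)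
      have "(\<lambda>x. \<kappa> k x + q k) -` interior (sq 0 0 0) \<subseteq> interior (Dk k)"
        using open_vimage[OF open_interior kc] interior_subset[of "sq 0 0 0"]
        by (intro interior_maximal) (auto simp: shape(2)[OF k])
      then have sub: "Dk k - interior (Dk k) \<subseteq> (\<lambda>y. \<kappa>i k (y - q k)) ` (sq 0 0 0 - interior (sq 0 0 0))"
        using s1 by (force simp: shape(2)[OF k] image_iff intro!: bexI[of _ "\<kappa> k _ + q k"])
      have "negligible (sq 0 0 0 - interior (sq 0 0 0))"
        using sq_interior[of 0 0 0] by (simp add: negligible_iff_null_sets null_sets_completionI)
      then have "negligible ((\<lambda>y. y - q k) ` (sq 0 0 0 - interior (sq 0 0 0)))"
      proof -
        assume "negligible (sq 0 0 0 - interior (sq 0 0 0))"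
        then have "negligible ((+) (- q k) ` (sq 0 0 0 - interior (sq 0 0 0)))" by (rule negligible_translation)
        moreover have "(+) (- q k) = (\<lambda>y. y - q k)" by auto
        ultimately show ?thesis by simp
      qed
      then have "negligible (\<kappa>i k ` ((\<lambda>y. y - q k) ` (sq 0 0 0 - interior (sq 0 0 0))))"
      proof (rule negligible_differentiable_image_negligible[OF order_refl])
        show "\<kappa>i k differentiable_on (\<lambda>y. y - q k) ` (sq 0 0 0 - interior (sq 0 0 0))"
          using s1 by (intro linear_imp_differentiable_on) blast
      qed
      then have "negligible (Dk k - interior (Dk k))"
        using negligible_subset[OF _ sub] by (simp add: image_image)
      moreover have "Dk k \<in> sets borel"
        using measurable_sets[OF borel_measurable_continuous_onI[OF kc] sq_meas[of 0 0 0]]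
        by (simp add: shape(2)[OF k] vimage_def)
      ultimately show ?thesis by (simp add: negligible_iff_null_sets null_sets_completion_iff)
    qed
    define Z where "Z i = (if i \<in> J then {x. (x - p' i) / of_real (r' i) \<in> Dk (ki i) - interior (Dk (ki i))} else {})" for i
    have Z: "Z i \<in> null_sets lborel" for i
    proof (cases "i \<in> J")
      case True
      have "0 < r' i" using rr J[OF True] by (auto simp: r'_def)
      from emeasure_affine_complex[OF this, of "Dk (ki i) - interior (Dk (ki i))" "p' i"] Dkm[OF J(1)[OF True]]
      show ?thesis using True by (auto simp: Z_def null_sets_def)
    qed (simp add: Z_def)
    have zi: "x \<in> interior {x. (x - p' i) / of_real (r' i) \<in> Dk (ki i)}"
      if i: "i \<in> J" and x: "(x - p' i) / of_real (r' i) \<in> interior (Dk (ki i))" for i x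
    proof -
      have "0 < r' i" using rr J[OF i] by (auto simp: r'_def)
      then have "continuous_on UNIV (\<lambda>x. (x - p' i) / of_real (r' i))" by (intro continuous_intros) auto
      then have "open ((\<lambda>x. (x - p' i) / of_real (r' i)) -` interior (Dk (ki i)))" by (intro open_vimage) auto
      moreover have "(\<lambda>x. (x - p' i) / of_real (r' i)) -` interior (Dk (ki i)) \<subseteq> {x. (x - p' i) / of_real (r' i) \<in> Dk (ki i)}"
        using interior_subset by auto
      ultimately show ?thesis using x by (meson interior_maximal subsetD vimageI)
    qed
    have "fst (snd (A, D, w)) \<subseteq> fn \<union> ((D - (\<Union>k<N. X k)) \<union> (\<Union>i. Z i)) \<union>
         (\<Union>i\<in>J. interior {x. (x - p' i) / of_real (r' i) \<in> fst (snd (s' i))})"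
    proof
      fix x assume "x \<in> fst (snd (A, D, w))"
      then have xD: "x \<in> D" by simp
      show "x \<in> fn \<union> ((D - (\<Union>k<N. X k)) \<union> (\<Union>i. Z i)) \<union>
         (\<Union>i\<in>J. interior {x. (x - p' i) / of_real (r' i) \<in> fst (snd (s' i))})"
      proof (cases "x \<in> fn \<or> x \<notin> (\<Union>k<N. X k)")
        case False
        then obtain k where k: "k \<in> NF" "x \<in> X k" by (auto simp: fn_def)
        then obtain j where j: "j \<in> I k" "(x - p k j) / of_real (r k j) \<in> Dk k" using inX by blast
        define i where "i = prod_encode (k, j)"
        have i: "i \<in> J" "ki i = k" "(x - p' i) / of_real (r' i) \<in> Dk (ki i)"
          using k j by (auto simp: i_def J_def ki_def p'_def r'_def)
        show ?thesis
        proof (cases "(x - p' i) / of_real (r' i) \<in> interior (Dk (ki i))")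
          case True
          then show ?thesis using zi[OF i(1) True] i(1) by (auto simp: s'_def)
        next
          case False
          then have "x \<in> Z i" using i by (simp add: Z_def)
          then show ?thesis by blast
        qed
      qed (use xD in auto)
    qed
    moreover have "(D - (\<Union>k<N. X k)) \<union> (\<Union>i. Z i) \<in> null_sets lborel" using cov Z by auto
    ultimately show "\<exists>Na. Na \<in> null_sets lborel \<and> fst (snd (A, D, w)) \<subseteq> fn \<union> Na \<union>
         (\<Union>i\<in>J. interior {x. (x - p' i) / of_real (r' i) \<in> fst (snd (s' i))})" by blast
  next
    have Xm: "X k \<in> sets borel" if "k < N" for k using X(1)[OF that] by simp
    show gm: "g \<in> borel_measurable borel"
      unfolding g_def[abs_def] using Xm by (intro borel_measurable_add borel_measurable_sum borel_measurable_scaleR) auto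
    fix h
    have im: "(\<lambda>x. ennreal \<bar>indicator (X k) (x + h) - indicator (X k) x\<bar>) \<in> borel_measurable lborel" if "k < N" for k
    proof -
      have "(\<lambda>x. x + h) \<in> borel_measurable borel" by measurable
      then have "(\<lambda>x. indicator (X k) (x + h) :: real) \<in> borel_measurable borel"
        using measurable_compose[of "\<lambda>x. x + h" borel borel "indicator (X k)"] Xm[OF that] by simp
      moreover have "(indicator (X k) :: complex \<Rightarrow> real) \<in> borel_measurable borel" using Xm[OF that] by simp
      ultimately show ?thesis by simp
    qed
    have "(\<integral>\<^sup>+x. ennreal (norm (g (x + h) - g x)) \<partial>lborel) \<le>
      (\<integral>\<^sup>+x. (\<Sum>k<N. ennreal (norm (B k - A)) * ennreal \<bar>indicator (X k) (x + h) - indicator (X k) x\<bar>) \<partial>lborel)"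
    proof (rule nn_integral_mono)
      fix x
      have "g (x + h) - g x = (\<Sum>k<N. (indicator (X k) (x + h) - indicator (X k) x) *\<^sub>R (B k - A))"
        by (simp add: g_def sum_subtractf scaleR_left_diff_distrib)
      then have "norm (g (x + h) - g x) \<le> (\<Sum>k<N. norm (B k - A) * \<bar>indicator (X k) (x + h) - indicator (X k) x\<bar>)"
        using norm_sum[of "\<lambda>k. (indicator (X k) (x + h) - indicator (X k) x) *\<^sub>R (B k - A)" "{..<N}"]
        by (simp add: mult.commute)
      then have "ennreal (norm (g (x + h) - g x)) \<le> ennreal (\<Sum>k<N. norm (B k - A) * \<bar>indicator (X k) (x + h) - indicator (X k) x\<bar>)"
        by (rule ennreal_leI)
      also have "\<dots> = (\<Sum>k<N. ennreal (norm (B k - A)) * ennreal \<bar>indicator (X k) (x + h) - indicator (X k) x\<bar>)"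
        by (simp add: sum_ennreal[symmetric] ennreal_mult)
      finally show "ennreal (norm (g (x + h) - g x)) \<le> (\<Sum>k<N. ennreal (norm (B k - A)) * ennreal \<bar>indicator (X k) (x + h) - indicator (X k) x\<bar>)" .
    qed
    also have "\<dots> = (\<Sum>k<N. ennreal (norm (B k - A)) * (\<integral>\<^sup>+x. ennreal \<bar>indicator (X k) (x + h) - indicator (X k) x\<bar> \<partial>lborel))"
      using im by (subst nn_integral_sum) (auto intro!: sum.cong nn_integral_cmult)
    also have "\<dots> \<le> (\<Sum>k<N. ennreal (norm (B k - A)) * ennreal (2 * (C k + m k) * norm h powr \<theta>))"
      using Xm col m th by (intro sum_mono mult_left_mono indicator_shift) auto
    also have "\<dots> = ennreal (\<Sum>k<N. norm (B k - A) * (2 * (C k + m k) * norm h powr \<theta>))"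
      using col m by (subst sum_ennreal[symmetric]) (auto intro!: sum.cong ennreal_mult[symmetric] mult_nonneg_nonneg)
    also have "(\<Sum>k<N. norm (B k - A) * (2 * (C k + m k) * norm h powr \<theta>)) = (\<Sum>k<N. norm (B k - A) * (2 * (C k + m k))) * norm h powr \<theta>"
      by (simp add: sum_distrib_right mult.assoc)
    also have "ennreal \<dots> \<le> ennreal (c * norm h powr \<theta>)" using c by (intro ennreal_leI mult_right_mono) auto
    finally show "(\<integral>\<^sup>+x. ennreal (norm (g (x + h) - g x)) \<partial>lborel) \<le> ennreal (c * norm h powr \<theta>)" .
  next
    have fNF: "finite NF" using NF finite_subset by blast
    have e0: "0 \<le> eta \<theta>"
    proof -
      have "0 \<le> (2::real) powr (real j * \<theta>) - 1" for j
        using th ge_one_powr_ge_zero[of 2 "real j * \<theta>"] by simp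
      then show ?thesis unfolding eta_def using eta_sums[OF th(2)] by (intro suminf_nonneg) (auto simp: sums_iff)
    qed
    have t0: "0 \<le> (m k / md k + C' k * eta \<theta>) * wk k" if "k \<in> NF" for k
    proof -
      have "k < N" using that NF by auto
      then have "0 \<le> m k / md k" "0 \<le> C' k * eta \<theta>" using m shape(3)[OF that] shape(4)[OF that] e0 by auto
      then show ?thesis using ch(2)[OF that] by simp
    qed
    have t1: "0 \<le> (\<Sum>k\<in>NF. (m k / md k + C' k * eta \<theta>) * wk k)" by (intro sum_nonneg t0)
    show wp: "0 \<le> snd (snd (A, D, w))" using w c(3) t1 by simp
    define f where "f = (\<lambda>(k, j). if k \<in> NF \<and> j \<in> I k then ennreal (r k j powr (2 - \<theta>) * wk k) else 0)"
    have "(\<Sum>i. if i \<in> J then ennreal (r' i powr (2 - \<theta>) * snd (snd (s' i))) else 0) = (\<Sum>i. f (prod_decode i))"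
      by (intro suminf_cong) (auto simp: f_def J_def r'_def s'_def ki_def split: prod.splits)
    also have "\<dots> = (\<Sum>k. \<Sum>j. f (k, j))" by (rule suminf_ennreal_2dimen) simp
    also have "\<dots> = (\<Sum>k\<in>NF. \<Sum>j. f (k, j))"
      using fNF by (intro suminf_finite) (auto simp: f_def)
    also have "\<dots> \<le> (\<Sum>k\<in>NF. ennreal ((m k / md k + C' k * eta \<theta>) * wk k))"
    proof (rule sum_mono)
      fix k assume k: "k \<in> NF"
      have "(\<Sum>j. f (k, j)) = (\<Sum>j. (if j \<in> I k then ennreal (r k j powr (2 - \<theta>)) else 0) * ennreal (wk k))"
        using k ch(2)[OF k] by (intro suminf_cong) (auto simp: f_def ennreal_mult)
      also have "\<dots> = (\<Sum>j. (if j \<in> I k then ennreal (r k j powr (2 - \<theta>)) else 0)) * ennreal (wk k)" by simp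
      also have "\<dots> \<le> ennreal (m k / md k + C' k * eta \<theta>) * ennreal (wk k)" by (intro mult_right_mono su k) simp
      also have "\<dots> = ennreal ((m k / md k + C' k * eta \<theta>) * wk k)" using ch(2)[OF k] by (simp add: ennreal_mult'')
      finally show "(\<Sum>j. f (k, j)) \<le> ennreal ((m k / md k + C' k * eta \<theta>) * wk k)" .
    qed
    also have "\<dots> = ennreal (\<Sum>k\<in>NF. (m k / md k + C' k * eta \<theta>) * wk k)" using t0 by simp
    finally have "ennreal c + (\<Sum>i. if i \<in> J then ennreal (r' i powr (2 - \<theta>) * snd (snd (s' i))) else 0)
      \<le> ennreal c + ennreal (\<Sum>k\<in>NF. (m k / md k + C' k * eta \<theta>) * wk k)" by (rule add_left_mono)
    also have "\<dots> = ennreal (c + (\<Sum>k\<in>NF. (m k / md k + C' k * eta \<theta>) * wk k))"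
      using c(3) t1 by simp
    also have "\<dots> \<le> ennreal (snd (snd (A, D, w)))" using w by (simp add: ennreal_leI)
    finally show "ennreal c + (\<Sum>i. if i \<in> J then ennreal (r' i powr (2 - \<theta>) * snd (snd (s' i))) else 0)
         \<le> ennreal (snd (snd (A, D, w)))" .
  qed (use D F(1) c in auto)
  then show ?thesis by blast
qed

section \<open>Rotated rectangles\<close>

text \<open>The construction lives in \<open>complex\<close>, the theorem in \<open>real^2\<close>.
  The identification is used for the final transfer and to apply facts on orthogonal maps of
  \<open>real^2\<close>.\<close>

definition c2v :: "complex \<Rightarrow> real^2" where "c2v x = vector [Re x, Im x]"
definition v2c :: "real^2 \<Rightarrow> complex" where "v2c y = Complex (y $ 1) (y $ 2)"

lemma c2v_nth [simp]: "c2v x $ 1 = Re x" "c2v x $ 2 = Im x"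
  by (simp_all add: c2v_def)

lemma v2c_c2v [simp]: "v2c (c2v x) = x"
  by (simp add: v2c_def)

lemma c2v_v2c [simp]: "c2v (v2c y) = y"
  by (simp add: vec_eq_iff forall_2 v2c_def)

lemma linear_c2v: "linear c2v"
  by (rule linearI) (simp_all add: vec_eq_iff forall_2)

lemma linear_v2c: "linear v2c"
  by (rule linearI) (simp_all add: v2c_def complex_eq_iff)

lemma norm_c2v [simp]: "norm (c2v x) = norm x"
  by (simp add: norm_vec_def L2_set_def sum_2 cmod_def)

lemma norm_v2c [simp]: "norm (v2c y) = norm y"
  by (metis c2v_v2c norm_c2v)

lemma c2v_meas [measurable]: "c2v \<in> borel_measurable borel"
  using linear_c2v by (intro borel_measurable_continuous_onI linear_continuous_on) (simp add: linear_conv_bounded_linear)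

lemma v2c_meas [measurable]: "v2c \<in> borel_measurable borel"
  using linear_v2c by (intro borel_measurable_continuous_onI linear_continuous_on) (simp add: linear_conv_bounded_linear)

lemma lborel_c2v: "distr lborel borel c2v = lborel"
proof (rule lborel_eqI[symmetric])
  fix l u :: "real^2" assume le: "\<And>b. b \<in> Basis \<Longrightarrow> l \<bullet> b \<le> u \<bullet> b"
  have ax: "axis 1 1 \<noteq> (axis 2 1 :: real^2)" by (simp add: axis_eq_axis)
  have B: "(Basis :: (real^2) set) = {axis 1 1, axis 2 1}" by (auto simp: Basis_vec_def UNIV_2)
  have le': "l $ 1 \<le> u $ 1" "l $ 2 \<le> u $ 2"
    using le[of "axis 1 1"] le[of "axis 2 1"] by (auto simp: B inner_axis)
  have e: "c2v -` box l u = box (v2c l) (v2c u)"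
    by (auto simp: box_def B inner_axis Basis_complex_def v2c_def)
  have "emeasure (distr lborel borel c2v) (box l u) = emeasure lborel (c2v -` box l u)"
    by (simp add: emeasure_distr)
  also have "\<dots> = ennreal ((u $ 1 - l $ 1) * (u $ 2 - l $ 2))"
    unfolding e using le' by (subst emeasure_lborel_box) (auto simp: Basis_complex_def v2c_def)
  also have "(u $ 1 - l $ 1) * (u $ 2 - l $ 2) = (\<Prod>b\<in>Basis. (u - l) \<bullet> b)"
    using ax by (simp add: B inner_axis)
  finally show "emeasure (distr lborel borel c2v) (box l u) = ennreal (\<Prod>b\<in>Basis. (u - l) \<bullet> b)" .
qed simp

lemma emeasure_c2v: "X \<in> sets borel \<Longrightarrow> emeasure lborel (c2v -` X) = emeasure lborel X"
  using emeasure_distr[of c2v lborel borel X] lborel_c2v by simp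

text \<open>For bounded sets, multiplication by \<open>\<nu>\<close> is viewed as an orthogonal
  transformation of \<open>real^2\<close>; general sets are exhausted by balls.\<close>

lemma rotation_measure:
  assumes n: "norm \<nu> = 1" and X: "X \<in> sets borel"
  shows "emeasure lborel {x. cnj \<nu> * x \<in> X} = emeasure lborel (X :: complex set)"
proof -
  have vv: "\<nu> * cnj \<nu> = 1" using n by (simp add: complex_norm_square[symmetric])
  have v1: "cnj \<nu> * (\<nu> * z) = z" for z using vv by (simp add: mult.assoc[symmetric] mult.commute[of "cnj \<nu>"])
  have main: "emeasure lborel {x. cnj \<nu> * x \<in> Y} = emeasure lborel Y"
    if Y: "Y \<in> sets borel" "bounded Y" for Y :: "complex set"
  proof -
    define f where "f y = c2v (\<nu> * v2c y)" for y :: "real^2"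
    have lf: "linear f" unfolding f_def
      by (rule linearI) (simp_all add: linear_add[OF linear_c2v] linear_add[OF linear_v2c] linear_cmul[OF linear_v2c]
         linear_cmul[OF linear_c2v] distrib_left)
    then have of: "orthogonal_transformation f"
      using n by (simp add: orthogonal_transformation f_def norm_mult)
    define Z where "Z = v2c -` Y"
    have Zb: "Z \<in> sets borel" using measurable_sets[OF v2c_meas Y(1)] by (simp add: Z_def)
    have bZ: "bounded Z"
    proof -
      obtain b where "\<forall>x\<in>Y. norm x \<le> b" using Y(2) bounded_iff by blast
      then show ?thesis unfolding bounded_iff Z_def by (intro exI[of _ b]) (metis norm_v2c vimageE)
    qed
    then have Zl: "Z \<in> lmeasurable" using Zb by (intro bounded_set_imp_lmeasurable) auto
    have m: "measure lebesgue (f ` Z) = measure lebesgue Z" "f ` Z \<in> lmeasurable"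
      using measure_orthogonal_image[OF of Zl] measurable_orthogonal_image[OF of Zl] by auto
    have fZ: "f ` Z = v2c -` {x. cnj \<nu> * x \<in> Y}"
    proof (intro set_eqI iffI)
      fix y assume "y \<in> v2c -` {x. cnj \<nu> * x \<in> Y}"
      then have "c2v (cnj \<nu> * v2c y) \<in> Z" by (simp add: Z_def)
      moreover have "f (c2v (cnj \<nu> * v2c y)) = y"
        using vv by (simp add: f_def mult.assoc[symmetric])
      ultimately show "y \<in> f ` Z" by (metis imageI)
    next
      fix y assume "y \<in> f ` Z"
      then show "y \<in> v2c -` {x. cnj \<nu> * x \<in> Y}"
        by (auto simp: f_def Z_def v1)
    qed
    have "(\<lambda>x. cnj \<nu> * x) -` Y \<in> sets borel"
      using measurable_sets[of "\<lambda>x. cnj \<nu> * x" borel borel Y] Y(1) by simp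
    then have Rb: "{x. cnj \<nu> * x \<in> Y} \<in> sets borel" by (simp add: vimage_def)
    have fZb: "f ` Z \<in> sets borel" using measurable_sets[OF v2c_meas Rb] by (simp add: fZ)
    have "emeasure lborel (f ` Z) = emeasure lebesgue (f ` Z)" using fZb by simp
    also have "\<dots> = ennreal (measure lebesgue (f ` Z))" by (rule emeasure_eq_measure2[OF m(2)])
    also have "\<dots> = emeasure lebesgue Z" unfolding m(1) by (rule emeasure_eq_measure2[OF Zl, symmetric])
    also have "\<dots> = emeasure lborel Z" using Zb by simp
    finally have "emeasure lborel (f ` Z) = emeasure lborel Z" .
    moreover have "emeasure lborel (f ` Z) = emeasure lborel {x. cnj \<nu> * x \<in> Y}"
      using emeasure_c2v[OF fZb] by (simp add: fZ vimage_def)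
    moreover have "emeasure lborel Z = emeasure lborel Y"
      using emeasure_c2v[OF Zb] by (simp add: Z_def vimage_def)
    ultimately show ?thesis by simp
  qed
  have Xn: "X \<inter> ball 0 (real n) \<in> sets borel" for n using X by auto
  have m: "(\<lambda>x. cnj \<nu> * x) \<in> borel_measurable borel" by measurable
  have Rn: "{x. cnj \<nu> * x \<in> X \<inter> ball 0 (real n)} \<in> sets borel" for n
    using measurable_sets[OF m Xn[of n]] by (simp add: vimage_def)
  have U: "(\<Union>n. X \<inter> ball 0 (real n)) = X" using reals_Archimedean2 by fastforce
  have U2: "(\<Union>n. {x. cnj \<nu> * x \<in> X \<inter> ball 0 (real n)}) = {x. cnj \<nu> * x \<in> X}"
    using reals_Archimedean2 by fastforce
  have "(\<lambda>n. emeasure lborel (X \<inter> ball 0 (real n))) \<longlonglongrightarrow> emeasure lborel (\<Union>n. X \<inter> ball 0 (real n))"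
    using Xn by (intro Lim_emeasure_incseq) (auto simp: incseq_def)
  moreover have "(\<lambda>n. emeasure lborel {x. cnj \<nu> * x \<in> X \<inter> ball 0 (real n)}) \<longlonglongrightarrow> emeasure lborel (\<Union>n. {x. cnj \<nu> * x \<in> X \<inter> ball 0 (real n)})"
    using Rn by (intro Lim_emeasure_incseq) (auto simp: incseq_def)
  moreover have "emeasure lborel {x. cnj \<nu> * x \<in> X \<inter> ball 0 (real n)} = emeasure lborel (X \<inter> ball 0 (real n))" for n
    using Xn by (intro main) auto
  ultimately show ?thesis unfolding U U2 using LIMSEQ_unique by fastforce
qed

lemma frame_measure:
  assumes n: "norm \<nu> = 1" and le: "l1 \<le> u1" "l2 \<le> u2"
  shows "emeasure lborel {x. l1 < Re (cnj \<nu> * x) \<and> Re (cnj \<nu> * x) < u1 \<and> l2 < Im (cnj \<nu> * x) \<and> Im (cnj \<nu> * x) < u2}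
    = ennreal ((u1 - l1) * (u2 - l2))"
proof -
  have "{x. l1 < Re (cnj \<nu> * x) \<and> Re (cnj \<nu> * x) < u1 \<and> l2 < Im (cnj \<nu> * x) \<and> Im (cnj \<nu> * x) < u2}
    = {x. cnj \<nu> * x \<in> box (Complex l1 l2) (Complex u1 u2)}"
    by (auto simp: in_box_complex_iff)
  also have "emeasure lborel \<dots> = emeasure lborel (box (Complex l1 l2) (Complex u1 u2))"
    by (rule rotation_measure[OF n]) simp
  also have "\<dots> = ennreal ((u1 - l1) * (u2 - l2))"
    using le by (subst emeasure_lborel_box) (auto simp: Basis_complex_def)
  finally show ?thesis .
qed

section \<open>Rectangles and polygons in a rotated frame\<close>

text \<open>Normalized coordinates of the centred rectangle with half-sides \<open>a\<close> along
  \<open>\<nu>\<close> and \<open>b\<close> along \<open>\<i> * \<nu>\<close>: up to the half-open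
  boundary it becomes the centred unit square.\<close>

definition rk :: "complex \<Rightarrow> real \<Rightarrow> real \<Rightarrow> complex \<Rightarrow> complex" where
  "rk \<nu> a b x = Complex (Re (cnj \<nu> * x) / (2 * a)) (Im (cnj \<nu> * x) / (2 * b))"
definition rki :: "complex \<Rightarrow> real \<Rightarrow> real \<Rightarrow> complex \<Rightarrow> complex" where
  "rki \<nu> a b y = \<nu> * Complex (2 * a * Re y) (2 * b * Im y)"
text \<open>Defined through \<open>sq 0 0 0\<close> to have the form required of a shape in
  \<open>fill\<close>; hence it is half-open.\<close>

definition rect :: "complex \<Rightarrow> real \<Rightarrow> real \<Rightarrow> complex set" where
  "rect \<nu> a b = {x. rk \<nu> a b x + Complex (1/2) (1/2) \<in> sq 0 0 0}"

lemma rect_iff: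
  assumes "0 < a" "0 < b"
  shows "x \<in> rect \<nu> a b \<longleftrightarrow> - a \<le> Re (cnj \<nu> * x) \<and> Re (cnj \<nu> * x) < a \<and> - b \<le> Im (cnj \<nu> * x) \<and> Im (cnj \<nu> * x) < b"
proof -
  have "\<lfloor>t / (2 * c) + 1 / 2\<rfloor> = 0 \<longleftrightarrow> - c \<le> t \<and> t < c" if "0 < c" for t c :: real
    using that by (auto simp: floor_eq_iff field_simps)
  from this[OF assms(1)] this[OF assms(2)] show ?thesis by (simp add: rect_def rk_def sq_def)
qed

lemma rk_lin: "linear (rk \<nu> a b)" "linear (rki \<nu> a b)"
  by (rule linearI; simp add: rk_def rki_def complex_eq_iff algebra_simps add_divide_distrib diff_divide_distrib)+

lemma rk_inv:
  assumes "norm \<nu> = 1" "0 < a" "0 < b"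
  shows "rk \<nu> a b (rki \<nu> a b y) = y" "rki \<nu> a b (rk \<nu> a b y) = y"
proof -
  have vv: "\<nu> * cnj \<nu> = 1" using assms by (simp add: complex_norm_square[symmetric])
  have 1: "cnj \<nu> * (\<nu> * z) = z" "\<nu> * (cnj \<nu> * z) = z" for z
    using vv by (simp_all add: mult.assoc[symmetric] mult.commute[of "cnj \<nu>"])
  show "rk \<nu> a b (rki \<nu> a b y) = y" using assms by (simp add: rk_def rki_def 1 complex_eq_iff)
  have "Complex (2 * a * Re (rk \<nu> a b y)) (2 * b * Im (rk \<nu> a b y)) = cnj \<nu> * y"
    using assms by (simp add: rk_def complex_eq_iff)
  then show "rki \<nu> a b (rk \<nu> a b y) = y" by (simp add: rki_def 1)
qed

lemma half_line_null: "fst l \<noteq> 0 \<Longrightarrow> {x. half l x = 0} \<in> null_sets lborel"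
proof -
  assume "fst l \<noteq> 0"
  then have "negligible {x. fst l \<bullet> x = - snd l}" by (intro negligible_hyperplane) auto
  moreover have "{x. fst l \<bullet> x = - snd l} = {x. half l x = 0}"
    by (auto simp: half_def inner_complex_def)
  moreover have "{x. half l x = 0} \<in> sets borel" by measurable
  ultimately show ?thesis by (simp add: negligible_iff_null_sets null_sets_completion_iff)
qed

lemma rect_meas: "rect \<nu> a b \<in> sets borel"
proof -
  have "rk \<nu> a b \<in> borel_measurable borel" using rk_lin(1)[of \<nu> a b]
    by (intro borel_measurable_continuous_onI linear_continuous_on) (simp add: linear_conv_bounded_linear)
  then have "(\<lambda>x. rk \<nu> a b x + Complex (1/2) (1/2)) \<in> borel_measurable borel"
    by (intro borel_measurable_add borel_measurable_const)
  from measurable_sets[OF this sq_meas[of 0 0 0]] show ?thesis by (simp add: rect_def vimage_def)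
qed

lemma rect_measure:
  assumes n: "norm \<nu> = 1" and ab: "0 < a" "0 < b"
  shows "emeasure lborel (rect \<nu> a b) = ennreal (4 * a * b)"
proof -
  let ?B = "{x. - a < Re (cnj \<nu> * x) \<and> Re (cnj \<nu> * x) < a \<and> - b < Im (cnj \<nu> * x) \<and> Im (cnj \<nu> * x) < b}"
  have n0: "\<nu> \<noteq> 0" using n by auto
  have "rect \<nu> a b \<subseteq> ?B \<union> ({x. half (\<nu>, a) x = 0} \<union> {x. half (\<i> * \<nu>, b) x = 0})"
    using ab by (auto simp: rect_iff half_def)
  moreover have N: "{x. half (\<nu>, a) x = 0} \<union> {x. half (\<i> * \<nu>, b) x = 0} \<in> null_sets lborel"
    using n0 by (intro null_sets.Un half_line_null) auto
  moreover have Bm: "?B \<in> sets borel" by measurable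
  ultimately have "emeasure lborel (rect \<nu> a b) \<le> emeasure lborel (?B \<union> ({x. half (\<nu>, a) x = 0} \<union> {x. half (\<i> * \<nu>, b) x = 0}))"
    by (intro emeasure_mono) auto
  also have "\<dots> = emeasure lborel ?B" using N Bm by (intro emeasure_Un_null_set) auto
  also have "\<dots> = ennreal (4 * a * b)" using frame_measure[OF n, of "- a" a "- b" b] ab by simp
  finally have 1: "emeasure lborel (rect \<nu> a b) \<le> ennreal (4 * a * b)" .
  have "emeasure lborel ?B \<le> emeasure lborel (rect \<nu> a b)"
    using ab by (intro emeasure_mono) (auto simp: rect_iff rect_meas)
  then have "ennreal (4 * a * b) \<le> emeasure lborel (rect \<nu> a b)"
    using frame_measure[OF n, of "- a" a "- b" b] ab by (simp add: mult.assoc)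
  then show ?thesis using 1 by (rule antisym[rotated])
qed

text \<open>In the normalized coordinates of a child a cell remains a polygon with the same number
  of half-planes, so \<open>poly_collar\<close> bounds its collar there too.\<close>

lemma poly_image:
  assumes "\<And>y. \<kappa> (\<kappa>i y) = y" "\<And>y. \<kappa>i (\<kappa> y) = y" "linear \<kappa>i"
  shows "\<exists>ls'. length ls' = length ls \<and> \<kappa> ` poly ls = poly ls'"
proof -
  define tr where "tr l = (Complex (Re (cnj (fst l) * \<kappa>i 1)) (Re (cnj (fst l) * \<kappa>i \<i>)), snd l)" for l :: "complex \<times> real"
  have h: "half (tr l) y = half l (\<kappa>i y)" for l y
  proof -
    have "y = Re y *\<^sub>R 1 + Im y *\<^sub>R \<i>" by (simp add: complex_eq_iff)
    then have "\<kappa>i y = Re y *\<^sub>R \<kappa>i 1 + Im y *\<^sub>R \<kappa>i \<i>"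
      using linear_add[OF assms(3)] linear_cmul[OF assms(3)] by metis
    then show ?thesis by (simp add: half_def tr_def algebra_simps)
  qed
  have "\<kappa> ` poly ls = poly (map tr ls)"
  proof (intro set_eqI iffI)
    fix y assume "y \<in> poly (map tr ls)"
    then have "\<kappa>i y \<in> poly ls" by (simp add: poly_def h)
    then show "y \<in> \<kappa> ` poly ls" using assms(1) by (metis imageI)
  next
    fix y assume "y \<in> \<kappa> ` poly ls"
    then show "y \<in> poly (map tr ls)" by (auto simp: poly_def h assms(2))
  qed
  then show ?thesis by (metis length_map)
qed

definition mb :: "real \<Rightarrow> real" where "mb R = measure lborel (ball (0::complex) (R + 2))"

lemma mb: "0 \<le> mb R" "emeasure lborel (ball (0::complex) (R + 2)) = ennreal (mb R)"
  using emeasure_lborel_ball_finite[of "0::complex" "R + 2"]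
  by (auto simp: mb_def emeasure_eq_ennreal_measure less_top)

lemma collar_mono: "collar X C \<Longrightarrow> C \<le> C' \<Longrightarrow> collar X C'"
  unfolding collar_def by (meson ennreal_leI less_imp_le mult_right_mono order_trans)

text \<open>With at most 8 half-planes per cell all collar constants become 8 times the area of a
  ball. The shape of a child enters the weight through its area and through the radius
  \<open>r k\<close> of the parent domain in the normalized coordinates of the child.\<close>

lemma poly_patch:
  fixes ls :: "nat \<Rightarrow> (complex \<times> real) list"
  assumes th: "0 < \<theta>" "\<theta> < 1"
    and lin: "\<And>h. norm (app A h) \<le> L * norm h" "norm A \<le> L"
    and D: "D \<in> sets borel" "D \<subseteq> ball 0 R" and F: "L-lipschitz_on UNIV F" "\<And>x. x \<notin> D \<Longrightarrow> F x = app A x"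
    and X: "\<And>k. k < N \<Longrightarrow> poly (ls k) \<subseteq> D" "\<And>k. k < N \<Longrightarrow> length (ls k) \<le> 8"
    and Xd: "\<And>k l x. k < N \<Longrightarrow> l < N \<Longrightarrow> x \<in> poly (ls k) \<Longrightarrow> x \<in> poly (ls l) \<Longrightarrow> k = l"
    and cov: "D - (\<Union>k<N. poly (ls k)) \<in> null_sets lborel"
    and FX: "\<And>k x. k < N \<Longrightarrow> x \<in> poly (ls k) \<Longrightarrow> F x = app (B k) x + b k"
    and BL: "\<And>k. k < N \<Longrightarrow> norm (B k) \<le> L" "\<And>k. k < N \<Longrightarrow> norm (B k - A) \<le> Q"
    and NF: "NF \<subseteq> {..<N}" and fin: "\<And>k. k < N \<Longrightarrow> k \<notin> NF \<Longrightarrow> fst (B k) \<in> K3"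
    and ch: "\<And>k. k \<in> NF \<Longrightarrow> (B k, rect (\<nu> k) (a k) (a' k), wk k) \<in> S" "\<And>k. k \<in> NF \<Longrightarrow> 0 \<le> wk k"
    and shape: "\<And>k. k \<in> NF \<Longrightarrow> norm (\<nu> k) = 1 \<and> 0 < a k \<and> 0 < a' k"
      "\<And>k x. k \<in> NF \<Longrightarrow> x \<in> D \<Longrightarrow> rk (\<nu> k) (a k) (a' k) x \<in> ball 0 (r k)"
    and m: "\<And>k. k < N \<Longrightarrow> measure lborel (poly (ls k)) \<le> m k"
    and w: "(real N * (Q * (2 * (8 * mb R + mb R))) + mb R) +
       (\<Sum>k\<in>NF. (m k / (4 * a k * a' k) + 8 * mb (r k) * eta \<theta>) * wk k) \<le> w"
  shows "\<exists>d. patch S \<theta> L (A, D, w) d"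
proof -
  have Db: "emeasure lborel Y \<le> ennreal (mb R)" if "Y \<subseteq> D" for Y
  proof -
    have "Y \<subseteq> ball 0 (R + 2)" using D(2) that by (auto simp: subset_iff)
    then show ?thesis using emeasure_mono[of Y "ball 0 (R + 2)" lborel] mb(2)[of R] by simp
  qed
  have Xf: "emeasure lborel (poly (ls k)) = ennreal (measure lborel (poly (ls k)))" if "k < N" for k
    using Db[OF X(1)[OF that]] by (intro emeasure_eq_ennreal_measure) (auto simp: top_unique)
  have Xle: "measure lborel (poly (ls k)) \<le> mb R" if "k < N" for k
    using Db[OF X(1)[OF that]] mb(1)[of R] unfolding Xf[OF that] by simp
  have len: "real (length (ls k)) * mb R \<le> 8 * mb R" if "k < N" for k
    using X(2)[OF that] mb(1) by (intro mult_right_mono) auto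
  show ?thesis
  proof (rule cells_patch[where X = "\<lambda>k. poly (ls k)" and N = N and NF = NF and C' = "\<lambda>k. 8 * mb (r k)"
        and C = "\<lambda>k. 8 * mb R" and m = "\<lambda>k. measure lborel (poly (ls k))" and q = "\<lambda>k. Complex (1/2) (1/2)"
        and \<kappa> = "\<lambda>k. rk (\<nu> k) (a k) (a' k)" and \<kappa>i = "\<lambda>k. rki (\<nu> k) (a k) (a' k)" and md = "\<lambda>k. 4 * a k * a' k"
        and Dk = "\<lambda>k. rect (\<nu> k) (a k) (a' k)" and wk = wk and B = B and b = b and F = F
        and c = "real N * (Q * (2 * (8 * mb R + mb R))) + mb R"])
    show "k < N \<Longrightarrow> open (poly (ls k))" for k by (rule poly_open)
    show "rect (\<nu> k) (a k) (a' k) = {x. rk (\<nu> k) (a k) (a' k) x + Complex (1/2) (1/2) \<in> sq 0 0 0}" for k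
      by (rule rect_def)
    fix k
    show "collar (poly (ls k)) (8 * mb R) \<and> 0 \<le> 8 * mb R" if "k < N"
    proof -
      have "collar (poly (ls k)) (length (ls k) * mb R)"
        unfolding mb_def using X(1)[OF that] D(2) by (intro poly_collar) blast
      then show ?thesis using len[OF that] mb(1)[of R] collar_mono by auto
    qed
    assume k: "k \<in> NF"
    then have kN: "k < N" using NF by auto
    note sh = shape(1)[OF k]
    show "linear (rk (\<nu> k) (a k) (a' k)) \<and> linear (rki (\<nu> k) (a k) (a' k)) \<and>
      (\<forall>y. rk (\<nu> k) (a k) (a' k) (rki (\<nu> k) (a k) (a' k) y) = y) \<and> (\<forall>y. rki (\<nu> k) (a k) (a' k) (rk (\<nu> k) (a k) (a' k) y) = y)"
      using sh rk_lin rk_inv by auto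
    show "emeasure lborel (rect (\<nu> k) (a k) (a' k)) = ennreal (4 * a k * a' k) \<and> 0 < 4 * a k * a' k"
      using sh rect_measure by simp
    obtain ls' where ls': "length ls' = length (ls k)" "rk (\<nu> k) (a k) (a' k) ` poly (ls k) = poly ls'"
      using poly_image[of "rk (\<nu> k) (a k) (a' k)" "rki (\<nu> k) (a k) (a' k)" "ls k"] rk_inv sh rk_lin by blast
    have "poly ls' \<subseteq> ball 0 (r k)" unfolding ls'(2)[symmetric] using shape(2)[OF k] X(1)[OF kN] by blast
    then have c: "collar (poly ls') (length ls' * mb (r k))" unfolding mb_def by (rule poly_collar)
    have "real (length ls') * mb (r k) \<le> 8 * mb (r k)"
      unfolding ls'(1) using X(2)[OF kN] mb(1) by (intro mult_right_mono) auto
    then show "collar (rk (\<nu> k) (a k) (a' k) ` poly (ls k)) (8 * mb (r k)) \<and> 0 \<le> 8 * mb (r k)"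
      unfolding ls'(2) using c mb(1)[of "r k"] collar_mono by auto
  next
    show "emeasure lborel D \<le> ennreal (real N * (Q * (2 * (8 * mb R + mb R))) + mb R)"
    proof (cases "N = 0")
      case False
      then have "0 \<le> Q" using BL(2)[of 0] by (meson norm_ge_zero order_trans neq0_conv)
      then have "mb R \<le> real N * (Q * (2 * (8 * mb R + mb R))) + mb R" using mb(1)[of R] by simp
      then show ?thesis using Db[of D] by (meson ennreal_leI order_refl order_trans)
    qed (use Db[of D] in simp)
    show "0 \<le> real N * (Q * (2 * (8 * mb R + mb R))) + mb R"
    proof (cases "N = 0")
      case False
      then have "0 \<le> Q" using BL(2)[of 0] by (meson norm_ge_zero order_trans neq0_conv)
      then show ?thesis using mb(1)[of R] by simp
    qed (simp add: mb(1))
    have "(\<Sum>k<N. norm (B k - A) * (2 * (8 * mb R + measure lborel (poly (ls k))))) \<le> (\<Sum>k<N. Q * (2 * (8 * mb R + mb R)))"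
      using BL(2) Xle mb(1)[of R] by (intro sum_mono mult_mono) (auto intro: order_trans[OF norm_ge_zero])
    then show "(\<Sum>k<N. norm (B k - A) * (2 * (8 * mb R + measure lborel (poly (ls k)))))
      \<le> real N * (Q * (2 * (8 * mb R + mb R))) + mb R" using mb(1)[of R] by simp
    have "(\<Sum>k\<in>NF. (measure lborel (poly (ls k)) / (4 * a k * a' k) + 8 * mb (r k) * eta \<theta>) * wk k)
      \<le> (\<Sum>k\<in>NF. (m k / (4 * a k * a' k) + 8 * mb (r k) * eta \<theta>) * wk k)"
    proof (rule sum_mono)
      fix k assume k: "k \<in> NF"
      then have "measure lborel (poly (ls k)) \<le> m k" using m NF by auto
      then show "(measure lborel (poly (ls k)) / (4 * a k * a' k) + 8 * mb (r k) * eta \<theta>) * wk k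
        \<le> (m k / (4 * a k * a' k) + 8 * mb (r k) * eta \<theta>) * wk k"
        using shape(1)[OF k] ch(2)[OF k] by (intro mult_right_mono add_right_mono divide_right_mono) auto
    qed
    then show "real N * (Q * (2 * (8 * mb R + mb R))) + mb R +
       (\<Sum>k\<in>NF. (measure lborel (poly (ls k)) / (4 * a k * a' k) + 8 * mb (r k) * eta \<theta>) * wk k) \<le> w"
      using w by linarith
  qed ((fact assms | (rule assms; assumption) | simp add: Xf)+)
qed

text \<open>A point reflection maps the complement of the triangle in the box into the triangle.\<close>

lemma half_box_lower:
  assumes n: "norm \<nu> = 1" and le: "l1 \<le> u1" "l2 \<le> u2" and X: "X \<in> sets borel" "emeasure lborel X = ennreal m" "0 \<le> m"
    and l: "fst l \<noteq> 0"
    and refl: "\<And>x. l1 < Re (cnj \<nu> * x) \<Longrightarrow> Re (cnj \<nu> * x) < u1 \<Longrightarrow> l2 < Im (cnj \<nu> * x) \<Longrightarrow> Im (cnj \<nu> * x) < u2 \<Longrightarrow>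
       half l x \<noteq> 0 \<Longrightarrow> x \<in> X \<or> z - x \<in> X"
  shows "(u1 - l1) * (u2 - l2) / 2 \<le> m"
proof -
  let ?B = "{x. l1 < Re (cnj \<nu> * x) \<and> Re (cnj \<nu> * x) < u1 \<and> l2 < Im (cnj \<nu> * x) \<and> Im (cnj \<nu> * x) < u2}"
  define Y where "Y = {x. z - x \<in> X}"
  have fm: "(\<lambda>x. z - x) \<in> borel_measurable borel" by measurable
  have Ym: "Y \<in> sets borel" using measurable_sets[OF fm X(1)] by (simp add: Y_def vimage_def)
  have Ye: "emeasure lborel Y = emeasure lborel X"
  proof -
    have d: "distr lborel borel (\<lambda>x::complex. z + (- 1) *\<^sub>R x) = lborel"
    proof -
      have "density (distr lborel borel (\<lambda>x::complex. z + (- 1) *\<^sub>R x)) (\<lambda>_. 1) = lborel"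
        using lborel_affine[of "- 1" z] by simp
      then show ?thesis by (simp add: density_1)
    qed
    have "emeasure lborel X = emeasure (distr lborel borel (\<lambda>x::complex. z + (- 1) *\<^sub>R x)) X" unfolding d ..
    also have "\<dots> = emeasure lborel Y" using X(1) fm by (subst emeasure_distr) (auto simp: Y_def vimage_def)
    finally show ?thesis by simp
  qed
  have N: "{x. half l x = 0} \<in> null_sets lborel" using l by (rule half_line_null)
  have "ennreal ((u1 - l1) * (u2 - l2)) = emeasure lborel ?B" using frame_measure[OF n le] by simp
  also have "\<dots> \<le> emeasure lborel (X \<union> Y \<union> {x. half l x = 0})"
    using refl X(1) Ym N by (intro emeasure_mono) (auto simp: Y_def)
  also have "\<dots> = emeasure lborel (X \<union> Y)" using X(1) Ym N by (intro emeasure_Un_null_set) auto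
  also have "\<dots> \<le> emeasure lborel X + emeasure lborel Y" using X(1) Ym by (intro emeasure_subadditive) auto
  also have "\<dots> = ennreal (2 * m)" using X(2,3) Ye by (simp add: ennreal_plus[symmetric] del: ennreal_plus)
  finally show ?thesis using X(3) by (simp add: ennreal_le_iff)
qed

section \<open>The brick\<close>

definition aff :: "complex \<Rightarrow> real \<Rightarrow> real \<Rightarrow> real \<Rightarrow> complex \<times> real" where
  "aff \<nu> \<alpha> \<beta> c = (of_real \<alpha> * \<nu> + of_real \<beta> * (\<i> * \<nu>), c)"

lemma half_aff: "half (aff \<nu> \<alpha> \<beta> c) x = \<alpha> * Re (cnj \<nu> * x) + \<beta> * Im (cnj \<nu> * x) + c"
  by (simp add: half_def aff_def algebra_simps)

lemma aff_zero_iff: "\<nu> \<noteq> 0 \<Longrightarrow> fst (aff \<nu> \<alpha> \<beta> c) = 0 \<longleftrightarrow> \<alpha> = 0 \<and> \<beta> = 0"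
proof -
  assume a: "\<nu> \<noteq> 0"
  have e: "fst (aff \<nu> \<alpha> \<beta> c) = \<nu> * Complex \<alpha> \<beta>" by (simp add: aff_def complex_eq_iff algebra_simps)
  have "Complex \<alpha> \<beta> = 0 \<longleftrightarrow> \<alpha> = 0 \<and> \<beta> = 0" by (simp add: complex_eq_iff)
  then show ?thesis using a unfolding e mult_eq_0_iff by blast
qed

text \<open>The perturbation is the rotated gradient of a potential with second derivatives
  \<alpha>, \<gamma>, \<beta>, hence divergence-free. The common mixed derivative \<gamma> is what
  keeps gradients trace-free; up to rotation the symmetric part changes by the trace-free Hessian
  and the skew part by the Laplacian.\<close>

lemma frame_app:
  assumes "norm \<nu> = 1"
  shows "of_real s * (of_real (\<gamma> * Re (cnj \<nu> * x) + \<beta> * Im (cnj \<nu> * x) + c2) * \<nu>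
      - of_real (\<alpha> * Re (cnj \<nu> * x) + \<gamma> * Im (cnj \<nu> * x) + c1) * (\<i> * \<nu>))
    = app (of_real (s / 2) * \<i> * \<nu>\<^sup>2 * of_real (\<beta> - \<alpha>) - 2 * \<i> * of_real \<gamma> * (of_real (s / 2) * \<i> * \<nu>\<^sup>2), - s * (\<alpha> + \<beta>) / 2) x
      + of_real s * (of_real c2 * \<nu> - of_real c1 * (\<i> * \<nu>))"
proof -
  have vv: "\<nu> * cnj \<nu> = 1" using assms by (simp add: complex_norm_square[symmetric])
  define y where "y = cnj \<nu> * x"
  have x: "x = \<nu> * y" using vv by (simp add: y_def mult.assoc[symmetric])
  have cx: "\<nu>\<^sup>2 * cnj x = \<nu> * cnj y" using vv by (simp add: x power2_eq_square mult.assoc[symmetric] mult.left_commute)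
  have re: "complex_of_real (Re y) = (y + cnj y) / 2" "complex_of_real (Im y) = (y - cnj y) / (2 * \<i>)"
    by (simp_all add: complex_eq_iff)
  have "app (of_real (s / 2) * \<i> * \<nu>\<^sup>2 * of_real (\<beta> - \<alpha>) - 2 * \<i> * of_real \<gamma> * (of_real (s / 2) * \<i> * \<nu>\<^sup>2), - s * (\<alpha> + \<beta>) / 2) x
    = (of_real (s / 2) * \<i> * of_real (\<beta> - \<alpha>) - 2 * \<i> * of_real \<gamma> * (of_real (s / 2) * \<i>)) * (\<nu>\<^sup>2 * cnj x)
      + \<i> * of_real (- s * (\<alpha> + \<beta>) / 2) * x"
    by (simp add: app_def algebra_simps)
  also have "\<dots> = \<nu> * ((of_real (s / 2) * \<i> * of_real (\<beta> - \<alpha>) - 2 * \<i> * of_real \<gamma> * (of_real (s / 2) * \<i>)) * cnj y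
      + \<i> * of_real (- s * (\<alpha> + \<beta>) / 2) * y)"
    unfolding cx by (simp add: x algebra_simps)
  also have "(of_real (s / 2) * \<i> * of_real (\<beta> - \<alpha>) - 2 * \<i> * of_real \<gamma> * (of_real (s / 2) * \<i>)) * cnj y
      + \<i> * of_real (- s * (\<alpha> + \<beta>) / 2) * y
    = of_real s * (of_real (\<gamma> * Re y + \<beta> * Im y) - of_real (\<alpha> * Re y + \<gamma> * Im y) * \<i>)"
    by (simp add: complex_eq_iff) (simp add: field_simps)
  finally show ?thesis by (simp add: y_def algebra_simps)
qed

lemma app_plus: "app (A + B) x = app A x + app B x"
  by (simp add: app_def algebra_simps)

lemma app_norm: "norm (app A h) \<le> (norm (fst A) + \<bar>snd A\<bar>) * norm h"
proof -
  have "norm (app A h) \<le> norm (fst A * cnj h) + norm (\<i> * of_real (snd A) * h)"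
    unfolding app_def by (rule norm_triangle_ineq)
  then show ?thesis by (simp add: norm_mult algebra_simps)
qed

lemma minmax_lip:
  fixes a b c d M :: real
  assumes "\<bar>a - c\<bar> \<le> M" "\<bar>b - d\<bar> \<le> M"
  shows "\<bar>min a b - min c d\<bar> \<le> M" "\<bar>max a b - max c d\<bar> \<le> M"
  using assms by (auto simp: min_def max_def abs_le_iff)

lemma abs_comb:
  fixes p :: real
  shows "\<bar>p - p'\<bar> \<le> d \<Longrightarrow> \<bar>q - q'\<bar> \<le> e \<Longrightarrow> \<bar>((c - p) - (g - q)) - ((c - p') - (g - q'))\<bar> \<le> d + e"
  by linarith

lemma clamp_sign:
  fixes e m v :: real
  assumes "e = 1 \<or> e = -1" "0 \<le> m" "0 \<le> v"
  shows "max (- m) (min m (e * v)) = e * min m v"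
  using assms by (auto simp: min_def max_def)

text \<open>The half-sides are \<open>A\<close> and 1. In the positive quadrant of the frame there
  are four triangles: (P, 0), (A, 0), (A, 1) on one side; (0, Q), (0, 1), (A, 1) on the other; the
  intermediate (P, 0), (0, Q), (A, 1); and the inner (0, 0), (P, 0), (0, Q). Thus \<tau> and
  \<open>\<sigma> * A\<close> are the heights of the two outer triangles.\<close>

locale rectangle =
  fixes \<nu> :: complex and A \<tau> \<sigma> s t :: real and E :: complex
  assumes n: "norm \<nu> = 1" and tau: "0 < \<tau>" "\<tau> < A" and sigma: "0 < \<sigma>" "\<sigma> * A < 1" and A1: "A \<le> 1"
begin

definition "\<Delta> = 1 - \<tau> * \<sigma>"
definition "P = A - \<tau>"
definition "Q = 1 - \<sigma> * A"
definition "k1 = \<tau> / P"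
definition "k2 = \<tau> * A / Q"
definition e1 :: "nat \<Rightarrow> real" where "e1 k = (if even k then 1 else - 1)"
definition e2 :: "nat \<Rightarrow> real" where "e2 k = (if even (k div 2) then 1 else - 1)"
text \<open>Second derivatives of the potential; \<open>k mod 4\<close> is the quadrant, and
  \<open>k div 4\<close> is the kind of cell: the two outer ones, the intermediate one, the inner
  one. In the positive quadrant the first derivatives are (A - \<xi>, 0) and (0, \<tau> / \<sigma> *
  (1 - \<eta>)) in the outer cells, zero at the centre, and interpolated linearly elsewhere from
  (\<tau>, 0) at (P, 0), (0, \<tau> * A) at (0, Q) and zero at the corner. The slope \<tau> /
  \<sigma> is the one for which the two mixed derivatives of the interpolation in the intermediate
  cell agree.\<close>

definition al :: "nat \<Rightarrow> real" where "al k = (if k < 4 then - 1 else if k < 8 then 0 else if k < 12 then \<tau> * \<sigma> / \<Delta> else k1)"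
definition be :: "nat \<Rightarrow> real" where "be k = (if k < 4 then 0 else if k < 8 then - (\<tau> / \<sigma>) else if k < 12 then \<tau>\<^sup>2 / \<Delta> else k2)"
definition ga :: "nat \<Rightarrow> real" where "ga k = (if 8 \<le> k \<and> k < 12 then - (e1 k * e2 k * \<tau> / \<Delta>) else 0)"
text \<open>The change of the symmetric part in the cells \<open>k < 4\<close>, where the Hessian is
  diagonal with entries -1 and 0. These are the cells that are to reach a well.\<close>

definition "D0 = of_real (s / 2) * \<i> * \<nu>\<^sup>2"
definition B :: "nat \<Rightarrow> complex \<times> real" where
  "B k = (E + D0 * of_real (be k - al k) - 2 * \<i> * of_real (ga k) * D0, t - s * (al k + be k) / 2)"
definition ls :: "nat \<Rightarrow> (complex \<times> real) list" where
  "ls k = [aff \<nu> (e1 k) 0 0, aff \<nu> 0 (e2 k) 0, aff \<nu> (- e1 k) 0 A, aff \<nu> 0 (- e2 k) 1] @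
    (if k < 4 then [aff \<nu> (e1 k) (- \<tau> * e2 k) (\<tau> - A)]
     else if k < 8 then [aff \<nu> (- \<sigma> * e1 k) (e2 k) (\<sigma> * A - 1)]
     else if k < 12 then [aff \<nu> (- e1 k) (\<tau> * e2 k) (A - \<tau>), aff \<nu> (\<sigma> * e1 k) (- e2 k) (1 - \<sigma> * A), aff \<nu> (e1 k / P) (e2 k / Q) (-1)]
     else [aff \<nu> (- e1 k / P) (- e2 k / Q) 1])"

text \<open>A single formula with minima and maxima for all sixteen cells makes continuity and the
  Lipschitz bound direct. \<open>cX\<close>, \<open>cY\<close> are the interpolations of the
  intermediate cells, \<open>mX\<close>, \<open>mY\<close> join them to the outer cells, and the
  slopes \<open>k1\<close>, \<open>k2\<close> truncate the result near the centre.\<close>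

definition "cX u = \<tau> * ((1 - \<bar>Im u\<bar>) - \<sigma> * (A - \<bar>Re u\<bar>)) / \<Delta>" for u :: complex
definition "cY u = \<tau> * ((A - \<bar>Re u\<bar>) - \<tau> * (1 - \<bar>Im u\<bar>)) / \<Delta>" for u :: complex
definition "mX u = max 0 (min (A - \<bar>Re u\<bar>) (cX u))"
definition "mY u = max 0 (min (\<tau> / \<sigma> * (1 - \<bar>Im u\<bar>)) (cY u))"
definition "fX u = max (- mX u) (min (mX u) (k1 * Re u))" for u :: complex
definition "fY u = max (- mY u) (min (mY u) (k2 * Im u))" for u :: complex
definition "F x = app (E, t) x + of_real s * (of_real (fY (cnj \<nu> * x)) * \<nu> - of_real (fX (cnj \<nu> * x)) * (\<i> * \<nu>))"
text \<open>One number for two purposes: it bounds the Lipschitz constant of the perturbation and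
  all changes of the gradient.\<close>

definition "\<Lambda> = \<bar>s\<bar> * ((1 + \<tau> * (1 + \<sigma>) / \<Delta> + k1) + (\<tau> / \<sigma> + \<tau> * (1 + \<tau>) / \<Delta> + k2))"

lemma pos: "0 < \<Delta>" "0 < P" "0 < Q" "0 < A" "\<tau> * \<sigma> < 1" "0 < k1" "0 < k2"
proof -
  have "\<tau> * \<sigma> < A * \<sigma>" using tau sigma by (intro mult_strict_right_mono) auto
  then show "\<tau> * \<sigma> < 1" using sigma mult.commute[of A \<sigma>] by linarith
  then show "0 < \<Delta>" "0 < P" "0 < Q" "0 < A" using tau sigma by (auto simp: \<Delta>_def P_def Q_def)
  then show "0 < k1" "0 < k2" using tau by (auto simp: k1_def k2_def)
qed

lemma e12: "e1 k = 1 \<or> e1 k = - 1" "e2 k = 1 \<or> e2 k = - 1" "e1 k * e1 k = 1" "e2 k * e2 k = 1" "e1 k \<noteq> 0" "e2 k \<noteq> 0"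
  by (auto simp: e1_def e2_def)

lemma in_cell: "x \<in> poly (ls k) \<longleftrightarrow> (let a = e1 k * Re (cnj \<nu> * x); b = e2 k * Im (cnj \<nu> * x) in
    0 < a \<and> 0 < b \<and> a < A \<and> b < 1 \<and>
    (if k < 4 then A - a < \<tau> * (1 - b) else if k < 8 then 1 - b < \<sigma> * (A - a)
     else if k < 12 then \<tau> * (1 - b) < A - a \<and> \<sigma> * (A - a) < 1 - b \<and> 1 < a / P + b / Q
     else a / P + b / Q < 1))"
proof -
  define \<xi> where "\<xi> = Re (cnj \<nu> * x)"
  define \<eta> where "\<eta> = Im (cnj \<nu> * x)"
  have h: "half (aff \<nu> \<alpha> \<beta> c) x = \<alpha> * \<xi> + \<beta> * \<eta> + c" for \<alpha> \<beta> c by (simp only: half_aff \<xi>_def \<eta>_def)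
  show ?thesis
    unfolding poly_def ls_def Let_def \<xi>_def[symmetric] \<eta>_def[symmetric]
    by (auto simp: h algebra_simps)
qed

section \<open>The brick cell by cell\<close>

text \<open>Each difference of competing branches is a multiple of an affine function whose sign is
  known in every cell where that comparison is made. So the minima and maxima in \<open>fX\<close>
  and \<open>fY\<close> are decided by signs alone.\<close>

lemma ids:
  fixes a b :: real
  defines "X \<equiv> A - a" and "Y \<equiv> 1 - b"
  shows "k1 * a - \<tau> * (Y - \<sigma> * X) / \<Delta> = \<tau> * Q / \<Delta> * (a / P + b / Q - 1)"
    "k2 * b - \<tau> * (X - \<tau> * Y) / \<Delta> = \<tau> * P / \<Delta> * (a / P + b / Q - 1)"
    "X - \<tau> * (Y - \<sigma> * X) / \<Delta> = (X - \<tau> * Y) / \<Delta>"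
    "\<tau> / \<sigma> * Y - \<tau> * (X - \<tau> * Y) / \<Delta> = \<tau> / (\<sigma> * \<Delta>) * (Y - \<sigma> * X)"
    "X - k1 * a = A * (P - a) / P" "\<tau> / \<sigma> * Y - k2 * b = \<tau> / (\<sigma> * Q) * (Q - b)"
proof -
  note p = pos(1-3) sigma(1)
  have 1: "\<Delta> - \<sigma> * P = Q" "A * \<Delta> - \<tau> * Q = P" by (simp_all add: \<Delta>_def P_def Q_def algebra_simps)
  have "k1 * a - \<tau> * (Y - \<sigma> * X) / \<Delta> = \<tau> / \<Delta> * (a * (\<Delta> - \<sigma> * P) / P - (Q - b))"
    using p by (simp add: k1_def X_def Y_def Q_def field_simps)
  also have "\<dots> = \<tau> * Q / \<Delta> * (a / P + b / Q - 1)" unfolding 1 using p by (simp add: field_simps)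
  finally show "k1 * a - \<tau> * (Y - \<sigma> * X) / \<Delta> = \<tau> * Q / \<Delta> * (a / P + b / Q - 1)" .
  have "k2 * b - \<tau> * (X - \<tau> * Y) / \<Delta> = \<tau> / \<Delta> * (b * (A * \<Delta> - \<tau> * Q) / Q - (P - a))"
    using p by (simp add: k2_def X_def Y_def P_def field_simps)
  also have "\<dots> = \<tau> * P / \<Delta> * (a / P + b / Q - 1)" unfolding 1 using p by (simp add: field_simps)
  finally show "k2 * b - \<tau> * (X - \<tau> * Y) / \<Delta> = \<tau> * P / \<Delta> * (a / P + b / Q - 1)" .
  show "X - \<tau> * (Y - \<sigma> * X) / \<Delta> = (X - \<tau> * Y) / \<Delta>" using p by (simp add: \<Delta>_def field_simps)
  show "\<tau> / \<sigma> * Y - \<tau> * (X - \<tau> * Y) / \<Delta> = \<tau> / (\<sigma> * \<Delta>) * (Y - \<sigma> * X)"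
    using p by (simp add: divide_simps) (simp add: \<Delta>_def algebra_simps)
  show "X - k1 * a = A * (P - a) / P" using p by (simp add: k1_def X_def divide_simps) (simp add: P_def algebra_simps)
  show "\<tau> / \<sigma> * Y - k2 * b = \<tau> / (\<sigma> * Q) * (Q - b)" using p by (simp add: k2_def Y_def divide_simps) (simp add: Q_def algebra_simps)
qed

definition dB :: "nat \<Rightarrow> complex \<times> real" where
  "dB k = (D0 * of_real (be k - al k) - 2 * \<i> * of_real (ga k) * D0, - s * (al k + be k) / 2)"

lemma B_split: "B k = (E, t) + dB k"
  by (simp add: B_def dB_def)

text \<open>The signs \<open>e1 k\<close> and \<open>e2 k\<close> reduce the sixteen cells to four
  cases in the positive quadrant. There \<open>ids\<close> selects the branch, and
  \<open>frame_app\<close> turns its coefficients into the gradient \<open>B k\<close>.\<close>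

lemma F_cell:
  assumes x: "x \<in> poly (ls k)"
  shows "\<exists>b. \<forall>x\<in>poly (ls k). F x = app (B k) x + b"
proof -
  define c1 where "c1 = (if k < 4 then e1 k * A else if k < 8 then 0 else if k < 12 then e1 k * \<tau> * Q / \<Delta> else 0)"
  define c2 where "c2 = (if k < 4 then 0 else if k < 8 then e2 k * \<tau> / \<sigma> else if k < 12 then e2 k * \<tau> * P / \<Delta> else 0)"
  have "fX (cnj \<nu> * x) = al k * Re (cnj \<nu> * x) + ga k * Im (cnj \<nu> * x) + c1 \<and>
        fY (cnj \<nu> * x) = ga k * Re (cnj \<nu> * x) + be k * Im (cnj \<nu> * x) + c2" if x: "x \<in> poly (ls k)" for x
  proof -
    define \<xi> where "\<xi> = Re (cnj \<nu> * x)"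
    define \<eta> where "\<eta> = Im (cnj \<nu> * x)"
    define a where "a = e1 k * \<xi>"
    define b where "b = e2 k * \<eta>"
    define X where "X = A - a"
    define Y where "Y = 1 - b"
    have c: "0 < a" "0 < b" "0 < X" "0 < Y"
      "if k < 4 then X < \<tau> * Y else if k < 8 then Y < \<sigma> * X
     else if k < 12 then \<tau> * Y < X \<and> \<sigma> * X < Y \<and> 1 < a / P + b / Q else a / P + b / Q < 1"
      using x unfolding in_cell by (auto simp: Let_def a_def b_def X_def Y_def \<xi>_def \<eta>_def split: if_splits)
    have xa: "\<xi> = e1 k * a" "\<eta> = e2 k * b" using e12[of k] by (auto simp: a_def b_def)
    have xa': "a * e1 k = \<xi>" "b * e2 k = \<eta>" using xa by simp_all
    have ab: "\<bar>\<xi>\<bar> = a" "\<bar>\<eta>\<bar> = b" using e12(1,2)[of k] c(1,2) by (auto simp: xa)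
    define cx where "cx = \<tau> * (Y - \<sigma> * X) / \<Delta>"
    define cy where "cy = \<tau> * (X - \<tau> * Y) / \<Delta>"
    define f where "f = min (max 0 (min X cx)) (k1 * a)"
    define h where "h = min (max 0 (min (\<tau> / \<sigma> * Y) cy)) (k2 * b)"
    have kp: "0 < k1 * a" "0 < k2 * b" using c pos by auto
    have fX: "fX (cnj \<nu> * x) = e1 k * f"
    proof -
      have "mX (cnj \<nu> * x) = max 0 (min X cx)"
        by (simp only: mX_def cX_def \<xi>_def[symmetric] \<eta>_def[symmetric] ab X_def Y_def cx_def)
      moreover have "k1 * Re (cnj \<nu> * x) = e1 k * (k1 * a)" unfolding \<xi>_def[symmetric] by (subst xa(1)) simp
      ultimately have "fX (cnj \<nu> * x) = max (- max 0 (min X cx)) (min (max 0 (min X cx)) (e1 k * (k1 * a)))"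
        by (simp only: fX_def)
      also have "\<dots> = e1 k * f" unfolding f_def using e12(1)[of k] kp by (intro clamp_sign) auto
      finally show ?thesis .
    qed
    have fY: "fY (cnj \<nu> * x) = e2 k * h"
    proof -
      have "mY (cnj \<nu> * x) = max 0 (min (\<tau> / \<sigma> * Y) cy)"
        by (simp only: mY_def cY_def \<xi>_def[symmetric] \<eta>_def[symmetric] ab X_def Y_def cy_def)
      moreover have "k2 * Im (cnj \<nu> * x) = e2 k * (k2 * b)" unfolding \<eta>_def[symmetric] by (subst xa(2)) simp
      ultimately have "fY (cnj \<nu> * x) = max (- max 0 (min (\<tau> / \<sigma> * Y) cy)) (min (max 0 (min (\<tau> / \<sigma> * Y) cy)) (e2 k * (k2 * b)))"
        by (simp only: fY_def)
      also have "\<dots> = e2 k * h" unfolding h_def using e12(2)[of k] kp by (intro clamp_sign) auto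
      finally show ?thesis .
    qed
    note I = ids(1-4)[where a = a and b = b, folded X_def Y_def, folded cx_def cy_def]
      ids(5)[of a, folded X_def] ids(6)[of b, folded Y_def]
    have pc: "0 < \<tau> * Q / \<Delta>" "0 < \<tau> * P / \<Delta>" "0 < \<tau> / (\<sigma> * \<Delta>)" "0 < \<tau> / (\<sigma> * Q)" "0 < \<tau> / \<Delta>" "0 < \<tau> / \<sigma> * Y"
      using pos tau sigma c by simp_all
    have "e1 k * f = al k * \<xi> + ga k * \<eta> + c1 \<and> e2 k * h = ga k * \<xi> + be k * \<eta> + c2"
    proof -
      consider "k < 4" | "4 \<le> k" "k < 8" | "8 \<le> k" "k < 12" | "12 \<le> k" by linarith
      then show ?thesis
      proof cases
        case 1
        then have XY: "X < \<tau> * Y" using c by simp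
        have "(X - \<tau> * Y) / \<Delta> \<le> 0" using XY pos(1) by (intro divide_nonpos_pos) auto
        then have x1: "X \<le> cx" using I(3) by linarith
        have x2: "X \<le> k1 * a"
        proof -
          have "\<tau> * Y < \<tau> * 1" using c(2) tau by (intro mult_strict_left_mono) (auto simp: Y_def)
          then have "P - a \<le> 0" using XY by (simp add: P_def X_def)
          then have "A * (P - a) / P \<le> 0" using pos by (intro divide_nonpos_pos mult_nonneg_nonpos) auto
          then show ?thesis using I(5) by linarith
        qed
        have x3: "cy \<le> 0" unfolding cy_def using XY pos tau by (intro divide_nonpos_pos mult_nonneg_nonpos) auto
        have "f = X" unfolding f_def using x1 x2 c(3) by linarith
        moreover have "h = 0" unfolding h_def using x3 kp(2) by linarith
        ultimately show ?thesis using 1 xa(1) by (simp add: al_def ga_def be_def c1_def c2_def X_def right_diff_distrib)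
      next
        case 2
        then have XY: "Y < \<sigma> * X" using c by simp
        have "\<tau> / (\<sigma> * \<Delta>) * (Y - \<sigma> * X) \<le> 0" using XY pc by (intro mult_nonneg_nonpos) auto
        then have x1: "\<tau> / \<sigma> * Y \<le> cy" using I(4) by linarith
        have x2: "\<tau> / \<sigma> * Y \<le> k2 * b"
        proof -
          have "\<sigma> * X < \<sigma> * A" using c(1) sigma by (intro mult_strict_left_mono) (auto simp: X_def)
          then have "Q - b \<le> 0" using XY by (simp add: Q_def Y_def)
          then have "\<tau> / (\<sigma> * Q) * (Q - b) \<le> 0" using pc by (intro mult_nonneg_nonpos) auto
          then show ?thesis using I(6) by linarith
        qed
        have x3: "cx \<le> 0" unfolding cx_def using XY pos tau by (intro divide_nonpos_pos mult_nonneg_nonpos) auto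
        have "f = 0" unfolding f_def using x3 kp(1) by linarith
        moreover have "h = \<tau> / \<sigma> * Y" unfolding h_def using x1 x2 pc(6) by linarith
        ultimately show ?thesis using 2 xa(2) by (simp add: al_def ga_def be_def c1_def c2_def Y_def right_diff_distrib)
      next
        case 3
        then have XY: "\<tau> * Y < X" "\<sigma> * X < Y" "1 < a / P + b / Q" using c by auto
        have "0 < \<tau> * Q / \<Delta> * (a / P + b / Q - 1)" using XY by (intro mult_pos_pos[OF pc(1)]) auto
        then have x1: "cx < k1 * a" using I(1) by linarith
        have "0 < \<tau> * P / \<Delta> * (a / P + b / Q - 1)" using XY by (intro mult_pos_pos[OF pc(2)]) auto
        then have x2: "cy < k2 * b" using I(2) by linarith
        have "0 < (X - \<tau> * Y) / \<Delta>" using XY pos by (intro divide_pos_pos) auto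
        then have x3: "cx < X" using I(3) by linarith
        have "0 < \<tau> / (\<sigma> * \<Delta>) * (Y - \<sigma> * X)" using XY by (intro mult_pos_pos[OF pc(3)]) auto
        then have x4: "cy < \<tau> / \<sigma> * Y" using I(4) by linarith
        have x5: "0 < cx" unfolding cx_def using XY pos tau by (intro divide_pos_pos mult_pos_pos) auto
        have x6: "0 < cy" unfolding cy_def using XY pos tau by (intro divide_pos_pos mult_pos_pos) auto
        have "f = cx" unfolding f_def using x1 x3 x5 by linarith
        moreover have "h = cy" unfolding h_def using x2 x4 x6 by linarith
        moreover have "e1 k * cx = \<tau> * \<sigma> / \<Delta> * \<xi> - e1 k * e2 k * \<tau> / \<Delta> * \<eta> + e1 k * \<tau> * Q / \<Delta>"
        proof -
          have "e1 k * cx = (e1 k * \<tau> * Q - e1 k * \<tau> * b + \<tau> * \<sigma> * (e1 k * a)) / \<Delta>"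
            by (simp add: cx_def X_def Y_def Q_def algebra_simps)
          then show ?thesis by (simp add: xa'(1) b_def diff_divide_distrib add_divide_distrib algebra_simps)
        qed
        moreover have "e2 k * cy = - e1 k * e2 k * \<tau> / \<Delta> * \<xi> + \<tau>\<^sup>2 / \<Delta> * \<eta> + e2 k * \<tau> * P / \<Delta>"
        proof -
          have "e2 k * cy = (e2 k * \<tau> * P - e2 k * \<tau> * a + \<tau>\<^sup>2 * (e2 k * b)) / \<Delta>"
            by (simp add: cy_def X_def Y_def P_def power2_eq_square algebra_simps)
          then show ?thesis by (simp add: xa'(2) a_def diff_divide_distrib add_divide_distrib algebra_simps)
        qed
        ultimately show ?thesis using 3 by (simp add: al_def ga_def be_def c1_def c2_def)
      next
        case 4
        then have W: "a / P + b / Q < 1" using c by simp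
        have "0 < a / P" "0 < b / Q" using c pos by auto
        then have "a / P < 1" "b / Q < 1" using W by linarith+
        then have aP: "a < P" "b < Q" using pos by (simp_all add: divide_less_eq)
        have "\<tau> * Q / \<Delta> * (a / P + b / Q - 1) < 0" using W by (intro mult_pos_neg[OF pc(1)]) auto
        then have x1: "k1 * a < cx" using I(1) by linarith
        have "\<tau> * P / \<Delta> * (a / P + b / Q - 1) < 0" using W by (intro mult_pos_neg[OF pc(2)]) auto
        then have x2: "k2 * b < cy" using I(2) by linarith
        have "0 < A * (P - a) / P" using aP pos by (intro divide_pos_pos mult_pos_pos) auto
        then have x3: "k1 * a < X" using I(5) by linarith
        have "0 < \<tau> / (\<sigma> * Q) * (Q - b)" using aP by (intro mult_pos_pos[OF pc(4)]) auto
        then have x4: "k2 * b < \<tau> / \<sigma> * Y" using I(6) by linarith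
        have "f = k1 * a" unfolding f_def using x1 x3 kp by linarith
        moreover have "h = k2 * b" unfolding h_def using x2 x4 kp by linarith
        ultimately show ?thesis using 4 by (simp add: al_def ga_def be_def c1_def c2_def xa)
      qed
    qed
    then show ?thesis using fX fY by (simp add: \<xi>_def \<eta>_def)
  qed
  then have fxy: "fX (cnj \<nu> * x) = al k * Re (cnj \<nu> * x) + ga k * Im (cnj \<nu> * x) + c1"
        "fY (cnj \<nu> * x) = ga k * Re (cnj \<nu> * x) + be k * Im (cnj \<nu> * x) + c2" if "x \<in> poly (ls k)" for x
    using that by blast+
  have "F x = app (B k) x + of_real s * (of_real c2 * \<nu> - of_real c1 * (\<i> * \<nu>))" if "x \<in> poly (ls k)" for x
    unfolding F_def fxy[OF that] frame_app[OF n] B_split app_plus dB_def D0_def by (simp add: add.assoc)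
  then show ?thesis by blast
qed

text \<open>The signs of the coordinates determine \<open>k mod 4\<close>. Within a quadrant the two
  outer triangles are disjoint because \<open>\<tau> * \<sigma> < 1\<close>, and the inner one lies
  in \<open>a < P\<close>, \<open>b < Q\<close>, whereas each outer one violates one of these
  bounds.\<close>

lemma cell_disj:
  assumes "k < 16" "l < 16" "x \<in> poly (ls k)" "x \<in> poly (ls l)"
  shows "k = l"
proof -
  define \<xi> where "\<xi> = Re (cnj \<nu> * x)"
  define \<eta> where "\<eta> = Im (cnj \<nu> * x)"
  have ss: "e1 k = e1 l" "e2 k = e2 l"
    using assms(3,4) unfolding in_cell by (auto simp: Let_def e1_def e2_def split: if_splits)
  then have par: "even k = even l" "even (k div 2) = even (l div 2)" by (auto simp: e1_def e2_def split: if_splits)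
  have m4: "k mod 4 = l mod 4"
    using par by presburger
  define a where "a = e1 k * \<xi>"
  define b where "b = e2 k * \<eta>"
  have c: "0 < a" "0 < b" "a < A" "b < 1"
    "if k < 4 then A - a < \<tau> * (1 - b) else if k < 8 then 1 - b < \<sigma> * (A - a)
     else if k < 12 then \<tau> * (1 - b) < A - a \<and> \<sigma> * (A - a) < 1 - b \<and> 1 < a / P + b / Q
     else a / P + b / Q < 1"
    "if l < 4 then A - a < \<tau> * (1 - b) else if l < 8 then 1 - b < \<sigma> * (A - a)
     else if l < 12 then \<tau> * (1 - b) < A - a \<and> \<sigma> * (A - a) < 1 - b \<and> 1 < a / P + b / Q
     else a / P + b / Q < 1"
    using assms(3,4) unfolding in_cell a_def b_def \<xi>_def \<eta>_def ss by (auto simp: Let_def ss)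
  have i12: "\<not> (A - a < \<tau> * (1 - b) \<and> 1 - b < \<sigma> * (A - a))"
  proof
    assume h: "A - a < \<tau> * (1 - b) \<and> 1 - b < \<sigma> * (A - a)"
    then have "\<tau> * (1 - b) < \<tau> * (\<sigma> * (A - a))" using tau by (intro mult_strict_left_mono) auto
    also have "\<dots> = (\<tau> * \<sigma>) * (A - a)" by simp
    also have "\<dots> \<le> 1 * (A - a)" using pos c by (intro mult_right_mono) auto
    finally show False using h by simp
  qed
  have ap: "a / P + b / Q < 1 \<Longrightarrow> a < P \<and> b < Q"
  proof -
    assume W: "a / P + b / Q < 1"
    have "0 < a / P" "0 < b / Q" using c pos by auto
    then have "a / P < 1" "b / Q < 1" using W by linarith+
    then show "a < P \<and> b < Q" using pos by (simp_all add: divide_less_eq)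
  qed
  have i13: "\<not> (A - a < \<tau> * (1 - b) \<and> a < P)"
  proof
    assume h: "A - a < \<tau> * (1 - b) \<and> a < P"
    have "\<tau> * (1 - b) < \<tau> * 1" using c tau by (intro mult_strict_left_mono) auto
    then show False using h by (simp add: P_def)
  qed
  have i23: "\<not> (1 - b < \<sigma> * (A - a) \<and> b < Q)"
  proof
    assume h: "1 - b < \<sigma> * (A - a) \<and> b < Q"
    have "\<sigma> * (A - a) < \<sigma> * A" using c sigma by (intro mult_strict_left_mono) auto
    then show False using h by (simp add: Q_def)
  qed
  have d: "4 \<le> i \<Longrightarrow> i < 8 \<Longrightarrow> i div 4 = 1" "8 \<le> i \<Longrightarrow> i < 12 \<Longrightarrow> i div 4 = 2"
    "12 \<le> i \<Longrightarrow> i < 16 \<Longrightarrow> i div 4 = 3" for i :: nat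
    by (rule div_nat_eqI; simp)+
  consider "k < 4" | "4 \<le> k" "k < 8" | "8 \<le> k" "k < 12" | "12 \<le> k" by linarith
  then have "k div 4 = l div 4"
  proof cases
    case 1
    then have "l < 4" using c i12 i13 ap by (auto split: if_splits)
    then show ?thesis using 1 by simp
  next
    case 2
    then have "4 \<le> l \<and> l < 8" using c i12 i23 ap by (auto split: if_splits)
    then show ?thesis using 2 d by simp
  next
    case 3
    then have "8 \<le> l \<and> l < 12" using c by (auto split: if_splits)
    then show ?thesis using 3 d by simp
  next
    case 4
    then have "12 \<le> l" using c i13 i23 ap by (auto split: if_splits)
    then show ?thesis using 4 assms(1,2) d by simp
  qed
  then show ?thesis using m4 by (metis div_mult_mod_eq)
qed

lemma n0: "\<nu> \<noteq> 0" using n by auto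

lemma ls_nonzero: "l \<in> set (ls k) \<Longrightarrow> fst l \<noteq> 0"
  using pos e12(5,6)[of k] tau sigma unfolding ls_def by (auto simp: aff_zero_iff[OF n0] split: if_splits)

lemma cell_rect: "poly (ls k) \<subseteq> rect \<nu> A 1"
proof
  fix x assume x: "x \<in> poly (ls k)"
  have "\<bar>Re (cnj \<nu> * x)\<bar> < A \<and> \<bar>Im (cnj \<nu> * x)\<bar> < 1"
    using x unfolding in_cell by (auto simp: Let_def e1_def e2_def split: if_splits)
  then show "x \<in> rect \<nu> A 1" using pos(4) by (subst rect_iff) auto
qed

text \<open>What the open cells omit lies on the finitely many lines that bound them.\<close>

lemma cell_cover: "rect \<nu> A 1 - (\<Union>k<16. poly (ls k)) \<in> null_sets lborel"
proof -
  let ?N = "\<Union>k<16. \<Union>l\<in>set (ls k). {x. half l x = 0}"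
  have N: "?N \<in> null_sets lborel"
    using ls_nonzero half_line_null by (intro null_sets_UN' null_sets.finite_UN) auto
  have "rect \<nu> A 1 - (\<Union>k<16. poly (ls k)) \<subseteq> ?N"
  proof (rule ccontr)
    assume "\<not> ?thesis"
    then obtain x where x: "x \<in> rect \<nu> A 1" "\<And>k. k < 16 \<Longrightarrow> x \<notin> poly (ls k)"
      "\<And>k l. k < 16 \<Longrightarrow> l \<in> set (ls k) \<Longrightarrow> half l x \<noteq> 0" by blast
    define \<xi> where "\<xi> = Re (cnj \<nu> * x)"
    define \<eta> where "\<eta> = Im (cnj \<nu> * x)"
    have h: "half (aff \<nu> \<alpha> \<beta> c) x = \<alpha> * \<xi> + \<beta> * \<eta> + c" for \<alpha> \<beta> c by (simp only: half_aff \<xi>_def \<eta>_def)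
    define q where "q = (if 0 < \<xi> then 0 else 1) + (if 0 < \<eta> then 0 else 2 :: nat)"
    have q: "q < 4" by (simp add: q_def)
    have e: "e1 (q + 4 * j) = e1 q" "e2 (q + 4 * j) = e2 q" for j
    proof -
      have "(q + 4 * j) div 2 = q div 2 + 2 * j" by simp
      then show "e1 (q + 4 * j) = e1 q" "e2 (q + 4 * j) = e2 q" by (simp_all add: e1_def e2_def)
    qed
    have "\<xi> \<noteq> 0" "\<eta> \<noteq> 0" using x(3)[of 0 "aff \<nu> (e1 0) 0 0"] x(3)[of 0 "aff \<nu> 0 (e2 0) 0"] e12[of 0] by (auto simp: ls_def h)
    define a where "a = e1 q * \<xi>"
    define b where "b = e2 q * \<eta>"
    have ab: "0 < a" "0 < b" "a = \<bar>\<xi>\<bar>" "b = \<bar>\<eta>\<bar>"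
      using \<open>\<xi> \<noteq> 0\<close> \<open>\<eta> \<noteq> 0\<close> by (auto simp: a_def b_def e1_def e2_def q_def)
    have le: "a \<le> A" "b \<le> 1" using x(1) pos(4) by (auto simp: ab rect_iff \<xi>_def \<eta>_def)
    have nz: "half l x \<noteq> 0" if "l \<in> set (ls (q + 4 * j))" "j < 4" for l j
      by (rule x(3)[OF _ that(1)]) (use that(2) q in arith)
    have "A - a \<noteq> 0" using nz[of "aff \<nu> (- e1 q) 0 A" 0] by (simp add: ls_def h a_def)
    moreover have "1 - b \<noteq> 0" using nz[of "aff \<nu> 0 (- e2 q) 1" 0] by (simp add: ls_def h b_def)
    ultimately have lt: "a < A" "b < 1" using le by linarith+
    have t1: "A - a \<noteq> \<tau> * (1 - b)" using nz[of "aff \<nu> (e1 q) (- \<tau> * e2 q) (\<tau> - A)" 0] q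
      by (simp add: ls_def h a_def b_def algebra_simps)
    have t2: "1 - b \<noteq> \<sigma> * (A - a)" using nz[of "aff \<nu> (- \<sigma> * e1 q) (e2 q) (\<sigma> * A - 1)" 1] q e[of 1]
      by (simp add: ls_def h a_def b_def algebra_simps)
    have t3: "a / P + b / Q \<noteq> 1" using nz[of "aff \<nu> (- e1 q / P) (- e2 q / Q) 1" 3] q e[of 3]
      by (simp add: ls_def h a_def b_def algebra_simps)
    have cell: "x \<in> poly (ls (q + 4 * j)) \<longleftrightarrow> (if j = 0 then A - a < \<tau> * (1 - b) else if j = 1 then 1 - b < \<sigma> * (A - a)
     else if j = 2 then \<tau> * (1 - b) < A - a \<and> \<sigma> * (A - a) < 1 - b \<and> 1 < a / P + b / Q
     else a / P + b / Q < 1)" if "j < 4" for j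
    proof -
      have j: "q + 4 * j < 4 \<longleftrightarrow> j = 0" "q + 4 * j < 8 \<longleftrightarrow> j = 0 \<or> j = 1" "q + 4 * j < 12 \<longleftrightarrow> j = 0 \<or> j = 1 \<or> j = 2"
        using q that by arith+
      show ?thesis unfolding in_cell e \<xi>_def[symmetric] \<eta>_def[symmetric] a_def[symmetric] b_def[symmetric] Let_def
        using ab lt by (auto simp: j)
    qed
    have no: "x \<notin> poly (ls (q + 4 * j))" if "j < 4" for j
      by (rule x(2)) (use that q in arith)
    show False using no[of 0] no[of 1] no[of 2] no[of 3] cell[of 0] cell[of 1] cell[of 2] cell[of 3] t1 t2 t3 by simp
  qed
  then show ?thesis using N rect_meas poly_open
    by (intro null_sets_subset[OF N]) (auto intro!: sets.Diff sets.finite_UN)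
qed

lemma F_off: "x \<notin> rect \<nu> A 1 \<Longrightarrow> F x = app (E, t) x"
proof -
  assume "x \<notin> rect \<nu> A 1"
  then have o: "A \<le> \<bar>Re (cnj \<nu> * x)\<bar> \<or> 1 \<le> \<bar>Im (cnj \<nu> * x)\<bar>" using pos(4) by (subst (asm) rect_iff) auto
  define X where "X = A - \<bar>Re (cnj \<nu> * x)\<bar>"
  define Y where "Y = 1 - \<bar>Im (cnj \<nu> * x)\<bar>"
  have o': "X \<le> 0 \<or> Y \<le> 0" using o by (auto simp: X_def Y_def)
  have cx: "cX (cnj \<nu> * x) = \<tau> * (Y - \<sigma> * X) / \<Delta>" "cY (cnj \<nu> * x) = \<tau> * (X - \<tau> * Y) / \<Delta>"
    by (simp_all only: cX_def cY_def X_def Y_def)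
  have "min X (cX (cnj \<nu> * x)) \<le> 0"
  proof (cases "X \<le> 0")
    case False
    then have "Y - \<sigma> * X \<le> 0" using o' sigma by (auto intro: order_trans[of _ 0])
    then have "cX (cnj \<nu> * x) \<le> 0" unfolding cx using tau pos by (intro divide_nonpos_pos mult_nonneg_nonpos) auto
    then show ?thesis by linarith
  qed simp
  then have mx: "mX (cnj \<nu> * x) = 0" unfolding mX_def X_def[symmetric] by linarith
  have "min (\<tau> / \<sigma> * Y) (cY (cnj \<nu> * x)) \<le> 0"
  proof (cases "Y \<le> 0")
    case True
    then have "\<tau> / \<sigma> * Y \<le> 0" using tau sigma by (intro mult_nonneg_nonpos) auto
    then show ?thesis by linarith
  next
    case False
    then have "X - \<tau> * Y \<le> 0" using o' tau by (auto intro: order_trans[of _ 0])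
    then have "cY (cnj \<nu> * x) \<le> 0" unfolding cx using tau pos by (intro divide_nonpos_pos mult_nonneg_nonpos) auto
    then show ?thesis by linarith
  qed
  then have my: "mY (cnj \<nu> * x) = 0" unfolding mY_def Y_def[symmetric] by linarith
  show ?thesis unfolding F_def fX_def fY_def mx my by (simp add: min_def max_def)
qed

lemma Lam_nonneg: "0 \<le> \<Lambda>"
  unfolding \<Lambda>_def using pos tau sigma by (intro mult_nonneg_nonneg add_nonneg_nonneg) auto

text \<open>Minima and maxima preserve Lipschitz constants, so it is enough to estimate every branch
  by the larger constants \<open>M1\<close> and \<open>M2\<close>.\<close>

lemma F_lip:
  assumes "norm E + \<bar>t\<bar> + \<Lambda> \<le> L"
  shows "L-lipschitz_on UNIV F"
proof (rule lipschitz_onI)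
  have "0 \<le> \<Lambda>" by (rule Lam_nonneg)
  then show "0 \<le> L" using assms by (meson abs_ge_zero add_nonneg_nonneg norm_ge_zero order_trans)
  fix x y :: complex
  define d where "d = norm (x - y)"
  define u where "u = cnj \<nu> * x"
  define v where "v = cnj \<nu> * y"
  have uv: "norm (u - v) = d" using n by (simp add: u_def v_def d_def right_diff_distrib[symmetric] norm_mult)
  have re: "\<bar>Re u - Re v\<bar> \<le> d" "\<bar>Im u - Im v\<bar> \<le> d"
    using abs_Re_le_cmod[of "u - v"] abs_Im_le_cmod[of "u - v"] uv by auto
  have d0: "0 \<le> d" by (simp add: d_def)
  define M1 where "M1 = (1 + \<tau> * (1 + \<sigma>) / \<Delta> + k1) * d"
  define M2 where "M2 = (\<tau> / \<sigma> + \<tau> * (1 + \<tau>) / \<Delta> + k2) * d"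
  have nn: "0 \<le> \<tau> * (1 + \<sigma>) / \<Delta>" "0 \<le> k1" "0 \<le> \<tau> / \<sigma>" "0 \<le> \<tau> * (1 + \<tau>) / \<Delta>" "0 \<le> k2"
    using pos tau sigma by auto
  have nd: "0 \<le> \<tau> * (1 + \<sigma>) / \<Delta> * d" "0 \<le> k1 * d" "0 \<le> \<tau> / \<sigma> * d" "0 \<le> \<tau> * (1 + \<tau>) / \<Delta> * d" "0 \<le> k2 * d"
    using nn d0 by (intro mult_nonneg_nonneg; simp)+
  have M: "1 * d \<le> M1" "\<tau> * (1 + \<sigma>) / \<Delta> * d \<le> M1" "k1 * d \<le> M1" "0 \<le> M1"
    "\<tau> / \<sigma> * d \<le> M2" "\<tau> * (1 + \<tau>) / \<Delta> * d \<le> M2" "k2 * d \<le> M2" "0 \<le> M2"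
    unfolding M1_def M2_def distrib_right using nd d0 by linarith+
  have mul: "\<bar>k * p - k * q\<bar> \<le> k * D" if "0 \<le> k" "\<bar>p - q\<bar> \<le> D" for k p q D :: real
    using that by (simp add: right_diff_distrib[symmetric] abs_mult mult_left_mono)
  have cx: "\<bar>cX u - cX v\<bar> \<le> \<tau> * (1 + \<sigma>) / \<Delta> * d"
  proof -
    have p: "\<bar>\<bar>Im u\<bar> - \<bar>Im v\<bar>\<bar> \<le> d" by (rule order_trans[OF abs_triangle_ineq3 re(2)])
    have q: "\<bar>\<bar>Re u\<bar> - \<bar>Re v\<bar>\<bar> \<le> d" by (rule order_trans[OF abs_triangle_ineq3 re(1)])
    have k: "0 \<le> \<sigma>" "0 \<le> \<tau> / \<Delta>" using tau sigma pos by auto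
    have "\<bar>((1 - \<bar>Im u\<bar>) - \<sigma> * (A - \<bar>Re u\<bar>)) - ((1 - \<bar>Im v\<bar>) - \<sigma> * (A - \<bar>Re v\<bar>))\<bar> \<le> d + \<sigma> * d"
      unfolding right_diff_distrib by (rule abs_comb[OF p mul[OF k(1) q]])
    from mul[OF k(2) this] have "\<bar>cX u - cX v\<bar> \<le> \<tau> / \<Delta> * (d + \<sigma> * d)" by (simp only: cX_def times_divide_eq_left)
    also have "\<dots> = \<tau> * (1 + \<sigma>) / \<Delta> * d" by (simp add: distrib_left distrib_right add_divide_distrib mult.assoc)
    finally show ?thesis .
  qed
  have cy: "\<bar>cY u - cY v\<bar> \<le> \<tau> * (1 + \<tau>) / \<Delta> * d"
  proof -
    have p: "\<bar>\<bar>Re u\<bar> - \<bar>Re v\<bar>\<bar> \<le> d" by (rule order_trans[OF abs_triangle_ineq3 re(1)])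
    have q: "\<bar>\<bar>Im u\<bar> - \<bar>Im v\<bar>\<bar> \<le> d" by (rule order_trans[OF abs_triangle_ineq3 re(2)])
    have k: "0 \<le> \<tau>" "0 \<le> \<tau> / \<Delta>" using tau sigma pos by auto
    have "\<bar>((A - \<bar>Re u\<bar>) - \<tau> * (1 - \<bar>Im u\<bar>)) - ((A - \<bar>Re v\<bar>) - \<tau> * (1 - \<bar>Im v\<bar>))\<bar> \<le> d + \<tau> * d"
      unfolding right_diff_distrib by (rule abs_comb[OF p mul[OF k(1) q]])
    from mul[OF k(2) this] have "\<bar>cY u - cY v\<bar> \<le> \<tau> / \<Delta> * (d + \<tau> * d)" by (simp only: cY_def times_divide_eq_left)
    also have "\<dots> = \<tau> * (1 + \<tau>) / \<Delta> * d" by (simp add: distrib_left distrib_right add_divide_distrib mult.assoc)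
    finally show ?thesis .
  qed
  have "\<bar>(A - \<bar>Re u\<bar>) - (A - \<bar>Re v\<bar>)\<bar> \<le> M1" using re(1) M(1) by linarith
  then have mx: "\<bar>mX u - mX v\<bar> \<le> M1"
    unfolding mX_def using cx M by (intro minmax_lip) auto
  have "\<bar>\<tau> / \<sigma> * (1 - \<bar>Im u\<bar>) - \<tau> / \<sigma> * (1 - \<bar>Im v\<bar>)\<bar> \<le> \<tau> / \<sigma> * d"
    using re(2) nn by (intro mul) auto
  then have my: "\<bar>mY u - mY v\<bar> \<le> M2"
    unfolding mY_def using cy M by (intro minmax_lip) auto
  have "\<bar>k1 * Re u - k1 * Re v\<bar> \<le> M1" using mul[OF nn(2) re(1)] M by linarith
  then have fx: "\<bar>fX u - fX v\<bar> \<le> M1" unfolding fX_def using mx by (intro minmax_lip) auto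
  have "\<bar>k2 * Im u - k2 * Im v\<bar> \<le> M2" using mul[OF nn(5) re(2)] M by linarith
  then have fy: "\<bar>fY u - fY v\<bar> \<le> M2" unfolding fY_def using my by (intro minmax_lip) auto
  have "F x - F y = app (E, t) (x - y) + of_real s * (of_real (fY u - fY v) * \<nu> - of_real (fX u - fX v) * (\<i> * \<nu>))"
    by (simp add: F_def app_diff u_def v_def algebra_simps)
  then have "norm (F x - F y) \<le> norm (app (E, t) (x - y)) + norm (of_real s * (of_real (fY u - fY v) * \<nu> - of_real (fX u - fX v) * (\<i> * \<nu>)))"
    by (simp add: norm_triangle_ineq)
  also have "norm (of_real s * (of_real (fY u - fY v) * \<nu> - of_real (fX u - fX v) * (\<i> * \<nu>)))
    \<le> \<bar>s\<bar> * (\<bar>fY u - fY v\<bar> + \<bar>fX u - fX v\<bar>)"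
    using norm_triangle_ineq4[of "of_real (fY u - fY v) * \<nu>" "of_real (fX u - fX v) * (\<i> * \<nu>)"] n
    unfolding norm_mult by (simp add: norm_mult mult_left_mono del: of_real_diff)
  also have "\<bar>s\<bar> * (\<bar>fY u - fY v\<bar> + \<bar>fX u - fX v\<bar>) \<le> \<bar>s\<bar> * (M2 + M1)"
    using fx fy by (intro mult_left_mono add_mono) auto
  also have "\<bar>s\<bar> * (M2 + M1) = \<Lambda> * d" by (simp add: M1_def M2_def \<Lambda>_def algebra_simps)
  also have "norm (app (E, t) (x - y)) \<le> (norm E + \<bar>t\<bar>) * d" using app_norm[of "(E, t)" "x - y"] by (simp add: d_def)
  finally have "norm (F x - F y) \<le> (norm E + \<bar>t\<bar> + \<Lambda>) * d" by (simp add: algebra_simps)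
  also have "\<dots> \<le> L * d" using assms d0 by (intro mult_right_mono) auto
  finally show "dist (F x) (F y) \<le> L * dist x y" by (simp add: dist_norm d_def)
qed

lemma dB_norm: "k < 16 \<Longrightarrow> norm (dB k) \<le> \<Lambda>"
proof -
  assume k: "k < 16"
  have nD: "norm D0 = \<bar>s\<bar> / 2" using n by (simp add: D0_def norm_mult norm_power)
  have e: "\<bar>e1 k * e2 k * \<tau> / \<Delta>\<bar> = \<tau> / \<Delta>" using e12(1,2)[of k] tau pos by (auto simp: abs_mult)
  have nn: "0 < \<tau> * \<sigma> / \<Delta>" "0 < \<tau> / \<Delta>" "0 < \<tau>\<^sup>2 / \<Delta>" "0 < \<tau> / \<sigma>" "0 < k1" "0 < k2"
    using pos tau sigma by auto
  have s1: "\<tau> * (1 + \<sigma>) / \<Delta> = \<tau> / \<Delta> + \<tau> * \<sigma> / \<Delta>" "\<tau> * (1 + \<tau>) / \<Delta> = \<tau> / \<Delta> + \<tau>\<^sup>2 / \<Delta>"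
    by (simp_all add: distrib_left add_divide_distrib power2_eq_square)
  have g: "\<bar>al k\<bar> + \<bar>be k\<bar> + \<bar>ga k\<bar> \<le> (1 + \<tau> * (1 + \<sigma>) / \<Delta> + k1) + (\<tau> / \<sigma> + \<tau> * (1 + \<tau>) / \<Delta> + k2)"
    unfolding s1 al_def be_def ga_def using nn e by auto
  have "norm (dB k) \<le> norm (fst (dB k)) + \<bar>snd (dB k)\<bar>"
    using norm_Pair_le[of "fst (dB k)" "snd (dB k)"] by simp
  also have "norm (fst (dB k)) \<le> norm (D0 * of_real (be k - al k)) + norm (2 * \<i> * of_real (ga k) * D0)"
    unfolding dB_def fst_conv by (rule norm_triangle_ineq4)
  also have "\<dots> = \<bar>s\<bar> / 2 * \<bar>be k - al k\<bar> + \<bar>s\<bar> * \<bar>ga k\<bar>" by (simp add: norm_mult nD del: of_real_diff)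
  also have "\<bar>snd (dB k)\<bar> = \<bar>s\<bar> / 2 * \<bar>al k + be k\<bar>" by (simp add: dB_def abs_mult)
  also have "\<bar>s\<bar> / 2 * \<bar>be k - al k\<bar> + \<bar>s\<bar> * \<bar>ga k\<bar> + \<bar>s\<bar> / 2 * \<bar>al k + be k\<bar>
    = \<bar>s\<bar> * ((\<bar>be k - al k\<bar> + \<bar>al k + be k\<bar>) / 2 + \<bar>ga k\<bar>)" by (simp add: algebra_simps)
  also have "\<dots> \<le> \<bar>s\<bar> * (\<bar>al k\<bar> + \<bar>be k\<bar> + \<bar>ga k\<bar>)" proof (intro mult_left_mono)
    show "(\<bar>be k - al k\<bar> + \<bar>al k + be k\<bar>) / 2 + \<bar>ga k\<bar> \<le> \<bar>al k\<bar> + \<bar>be k\<bar> + \<bar>ga k\<bar>"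
      using abs_triangle_ineq4[of "be k" "al k"] abs_triangle_ineq[of "al k" "be k"] by (simp add: field_simps)
  qed simp
  also have "\<dots> \<le> \<Lambda>" unfolding \<Lambda>_def using g by (intro mult_left_mono) auto
  finally show ?thesis by simp
qed

section \<open>Areas of the cells\<close>

text \<open>Carries \<open>half_box_lower\<close> to an arbitrary quadrant: a box in the
  sign-adjusted coordinates is a box in the frame, and the point reflection in its centre has the
  same form in both.\<close>

lemma signed_box:
  assumes le: "p1 \<le> p2" "q1 \<le> q2" and X: "X \<in> sets borel" "emeasure lborel X \<noteq> \<infinity>" and l: "fst l \<noteq> 0"
    and refl: "\<And>x y. p1 < e1 k * Re (cnj \<nu> * x) \<Longrightarrow> e1 k * Re (cnj \<nu> * x) < p2 \<Longrightarrow>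
       q1 < e2 k * Im (cnj \<nu> * x) \<Longrightarrow> e2 k * Im (cnj \<nu> * x) < q2 \<Longrightarrow> half l x \<noteq> 0 \<Longrightarrow>
       e1 k * Re (cnj \<nu> * y) = p1 + p2 - e1 k * Re (cnj \<nu> * x) \<Longrightarrow>
       e2 k * Im (cnj \<nu> * y) = q1 + q2 - e2 k * Im (cnj \<nu> * x) \<Longrightarrow> x \<in> X \<or> y \<in> X"
  shows "(p2 - p1) * (q2 - q1) / 2 \<le> measure lborel X"
proof -
  define l1 where "l1 = (if e1 k = 1 then p1 else - p2)"
  define u1 where "u1 = (if e1 k = 1 then p2 else - p1)"
  define l2 where "l2 = (if e2 k = 1 then q1 else - q2)"
  define u2 where "u2 = (if e2 k = 1 then q2 else - q1)"
  define z where "z = \<nu> * Complex (l1 + u1) (l2 + u2)"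
  have vv: "cnj \<nu> * \<nu> = 1" using n complex_norm_square[of \<nu>] by (simp add: mult.commute)
  have z: "cnj \<nu> * (z - x) = Complex (l1 + u1) (l2 + u2) - cnj \<nu> * x" for x
    using vv by (simp add: z_def right_diff_distrib mult.assoc[symmetric])
  have "(u1 - l1) * (u2 - l2) / 2 \<le> measure lborel X"
  proof (rule half_box_lower[OF n _ _ X(1) _ _ l])
    fix x
    assume h: "l1 < Re (cnj \<nu> * x)" "Re (cnj \<nu> * x) < u1" "l2 < Im (cnj \<nu> * x)" "Im (cnj \<nu> * x) < u2" "half l x \<noteq> 0"
    show "x \<in> X \<or> z - x \<in> X"
    proof -
      obtain r q where r: "Re (cnj \<nu> * x) = r" and q: "Im (cnj \<nu> * x) = q" by blast
      have zr: "Re (cnj \<nu> * (z - x)) = l1 + u1 - r" "Im (cnj \<nu> * (z - x)) = l2 + u2 - q"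
        by (simp_all only: z minus_complex.sel complex.sel r q)
      have 1: "p1 < e1 k * r" "e1 k * r < p2" "e1 k * (l1 + u1 - r) = p1 + p2 - e1 k * r"
        using h(1,2) e12(1)[of k] unfolding r by (auto simp: l1_def u1_def)
      have 2: "q1 < e2 k * q" "e2 k * q < q2" "e2 k * (l2 + u2 - q) = q1 + q2 - e2 k * q"
        using h(3,4) e12(2)[of k] unfolding q by (auto simp: l2_def u2_def)
      show ?thesis by (rule refl[OF _ _ _ _ h(5)]) (simp_all only: zr r q 1 2)
    qed
  qed (use le X in \<open>auto simp: l1_def u1_def l2_def u2_def emeasure_eq_ennreal_measure\<close>)
  moreover have "(u1 - l1) * (u2 - l2) = (p2 - p1) * (q2 - q1)"
    by (simp add: l1_def u1_def l2_def u2_def)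
  ultimately show ?thesis by simp
qed

lemma rect_emeasure: "emeasure lborel (rect \<nu> A 1) = ennreal (4 * A)"
  using rect_measure[of \<nu> A 1] n pos by simp

lemma cell_finite: "emeasure lborel (poly (ls k)) \<noteq> \<infinity>"
  using emeasure_mono[OF cell_rect, of lborel k] rect_emeasure rect_meas by (auto simp: top_unique)

lemma area_side:
  assumes k: "k < 4"
  shows "\<tau> / 2 \<le> measure lborel (poly (ls k))"
proof -
  have "(A - (A - \<tau>)) * (1 - 0) / 2 \<le> measure lborel (poly (ls k))"
  proof (rule signed_box[where k = k and l = "aff \<nu> (e1 k) (- \<tau> * e2 k) (\<tau> - A)"])
    fix x y
    assume h: "A - \<tau> < e1 k * Re (cnj \<nu> * x)" "e1 k * Re (cnj \<nu> * x) < A" "0 < e2 k * Im (cnj \<nu> * x)"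
      "e2 k * Im (cnj \<nu> * x) < 1" "half (aff \<nu> (e1 k) (- \<tau> * e2 k) (\<tau> - A)) x \<noteq> 0"
      "e1 k * Re (cnj \<nu> * y) = A - \<tau> + A - e1 k * Re (cnj \<nu> * x)" "e2 k * Im (cnj \<nu> * y) = 0 + 1 - e2 k * Im (cnj \<nu> * x)"
    define a where "a = e1 k * Re (cnj \<nu> * x)"
    define b where "b = e2 k * Im (cnj \<nu> * x)"
    have "a - \<tau> * b + (\<tau> - A) \<noteq> 0" using h(5) unfolding half_aff by (simp add: a_def b_def algebra_simps)
    then have c: "A - a < \<tau> * (1 - b) \<or> A - (A - \<tau> + A - a) < \<tau> * (1 - (0 + 1 - b))"
      by (simp add: right_diff_distrib) linarith
    have h': "A - \<tau> < a" "a < A" "0 < b" "b < 1" using h(1-4) by (simp_all only: a_def b_def)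
    have "x \<in> poly (ls k)" if "A - a < \<tau> * (1 - b)"
      unfolding in_cell Let_def a_def[symmetric] b_def[symmetric] using h' that k tau by simp
    moreover have "y \<in> poly (ls k)" if "A - (A - \<tau> + A - a) < \<tau> * (1 - (0 + 1 - b))"
      unfolding in_cell Let_def h(6,7) a_def[symmetric] b_def[symmetric] using h' that k tau by simp
    ultimately show "x \<in> poly (ls k) \<or> y \<in> poly (ls k)" using c by blast
  qed (use cell_finite poly_open tau e12[of k] aff_zero_iff[OF n0] in auto)
  then show ?thesis by simp
qed

lemma area_inner:
  assumes k: "12 \<le> k"
  shows "P * Q / 2 \<le> measure lborel (poly (ls k))"
proof -
  have "(P - 0) * (Q - 0) / 2 \<le> measure lborel (poly (ls k))"
  proof (rule signed_box[where k = k and l = "aff \<nu> (- e1 k / P) (- e2 k / Q) 1"])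
    fix x y
    assume h: "0 < e1 k * Re (cnj \<nu> * x)" "e1 k * Re (cnj \<nu> * x) < P" "0 < e2 k * Im (cnj \<nu> * x)"
      "e2 k * Im (cnj \<nu> * x) < Q" "half (aff \<nu> (- e1 k / P) (- e2 k / Q) 1) x \<noteq> 0"
      "e1 k * Re (cnj \<nu> * y) = 0 + P - e1 k * Re (cnj \<nu> * x)" "e2 k * Im (cnj \<nu> * y) = 0 + Q - e2 k * Im (cnj \<nu> * x)"
    define a where "a = e1 k * Re (cnj \<nu> * x)"
    define b where "b = e2 k * Im (cnj \<nu> * x)"
    have PQ: "P < A" "Q < 1" using tau sigma pos by (auto simp: P_def Q_def)
    have d: "(P - a) / P = 1 - a / P" "(Q - b) / Q = 1 - b / Q" using pos by (simp_all add: diff_divide_distrib)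
    have "- e / P * r + - f / Q * q + 1 = 1 - e * r / P - f * q / Q" for e f r q by simp
    then have "1 - a / P - b / Q \<noteq> 0" using h(5) unfolding half_aff a_def b_def by simp
    then have c: "a / P + b / Q < 1 \<or> (0 + P - a) / P + (0 + Q - b) / Q < 1"
      by (simp add: d) linarith
    have h': "0 < a" "a < P" "0 < b" "b < Q" using h(1-4) by (simp_all only: a_def b_def)
    have "x \<in> poly (ls k)" if "a / P + b / Q < 1"
      unfolding in_cell Let_def a_def[symmetric] b_def[symmetric] using h' that k PQ by simp
    moreover have "y \<in> poly (ls k)" if "(0 + P - a) / P + (0 + Q - b) / Q < 1"
      unfolding in_cell Let_def h(6,7) a_def[symmetric] b_def[symmetric] using h' that k PQ by simp
    ultimately show "x \<in> poly (ls k) \<or> y \<in> poly (ls k)" using c by blast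
  qed (use cell_finite poly_open pos e12[of k] aff_zero_iff[OF n0] in auto)
  then show ?thesis by simp
qed

text \<open>Only lower bounds are computed, for the finished triangles and for the inner ones, each
  of which is half of a box. Disjointness and the total area \<open>4 * A\<close> then bound the
  other cells from above, without a computation for the intermediate triangles.\<close>

lemma area_rest: "(\<Sum>k\<in>{4..<12}. measure lborel (poly (ls k))) \<le> 4 * A - 2 * \<tau> - 2 * (P * Q)"
  "(\<Sum>k\<in>{4..<12}. measure lborel (poly (ls k))) + (\<Sum>k\<in>{12..<16}. measure lborel (poly (ls k))) \<le> 4 * A - 2 * \<tau>"
proof -
  let ?m = "\<lambda>k. measure lborel (poly (ls k))"
  have "(\<Sum>k<16. ?m k) = measure lborel (\<Union>k<16. poly (ls k))"
    using cell_disj cell_finite poly_open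
    by (intro measure_finite_Union[symmetric]) (auto simp: disjoint_family_on_def)
  also have "\<dots> \<le> measure lborel (rect \<nu> A 1)"
    using cell_rect rect_emeasure rect_meas by (intro measure_mono_fmeasurable) (auto simp: fmeasurable_def poly_open)
  also have "\<dots> = 4 * A" using rect_emeasure pos by (simp add: measure_def)
  finally have tot: "(\<Sum>k<16. ?m k) \<le> 4 * A" .
  have s: "(\<Sum>k<16. ?m k) = (\<Sum>k\<in>{0..<4}. ?m k) + (\<Sum>k\<in>{4..<12}. ?m k) + (\<Sum>k\<in>{12..<16}. ?m k)"
    unfolding lessThan_atLeast0 by (simp add: sum.atLeastLessThan_concat)
  have "(\<Sum>k\<in>{0..<4::nat}. \<tau> / 2) \<le> (\<Sum>k\<in>{0..<4}. ?m k)" by (intro sum_mono area_side) auto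
  moreover have "(\<Sum>k\<in>{12..<16::nat}. P * Q / 2) \<le> (\<Sum>k\<in>{12..<16}. ?m k)" by (intro sum_mono area_inner) auto
  ultimately show "(\<Sum>k\<in>{4..<12}. ?m k) \<le> 4 * A - 2 * \<tau> - 2 * (P * Q)" using s tot by simp
  have "(\<Sum>k\<in>{0..<4::nat}. \<tau> / 2) \<le> (\<Sum>k\<in>{0..<4}. ?m k)" by (intro sum_mono area_side) auto
  then show "(\<Sum>k\<in>{4..<12}. ?m k) + (\<Sum>k\<in>{12..<16}. ?m k) \<le> 4 * A - 2 * \<tau>" using s tot by simp
qed

lemma rect_bounded: "x \<in> rect \<nu> A 1 \<Longrightarrow> norm x < 2 + e" if "0 < e" for e
proof -
  assume "x \<in> rect \<nu> A 1"
  then have "\<bar>Re (cnj \<nu> * x)\<bar> \<le> A" "\<bar>Im (cnj \<nu> * x)\<bar> \<le> 1" using pos(4) by (auto simp: rect_iff)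
  then have "norm (cnj \<nu> * x) \<le> 2" using cmod_le[of "cnj \<nu> * x"] A1 by linarith
  then show ?thesis using n that by (simp add: norm_mult)
qed

text \<open>\<open>\<omega>1\<close> and \<open>\<omega>2\<close> bound the weight per area of the
  children in the cells \<open>4 \<le> k < 12\<close> and \<open>12 \<le> k < 16\<close>. The total
  is split as \<open>\<omega>1 - \<omega>2\<close> on the former plus \<open>\<omega>2\<close> on
  all unfinished cells, so that both parts of \<open>area_rest\<close> apply with nonnegative
  factors. The numbers 64 and 32 are 8 half-planes times 8 and 4 cells, and 18 is 2 * (8 +
  1).\<close>

lemma rect_patch:
  assumes th: "0 < \<theta>" "\<theta> < 1" and L: "norm E + \<bar>t\<bar> + \<Lambda> \<le> L"
    and fin: "E + D0 \<in> K3"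
    and ch: "\<And>k. 4 \<le> k \<Longrightarrow> k < 16 \<Longrightarrow> (B k, rect (\<nu>' k) (a k) (a' k), wk k) \<in> S"
    and sh: "\<And>k. 4 \<le> k \<Longrightarrow> k < 16 \<Longrightarrow> norm (\<nu>' k) = 1 \<and> 0 < a k \<and> 0 < a' k \<and> 0 \<le> wk k"
    and rk1: "\<And>k x. 4 \<le> k \<Longrightarrow> k < 12 \<Longrightarrow> x \<in> rect \<nu> A 1 \<Longrightarrow> norm (rk (\<nu>' k) (a k) (a' k) x) < R1"
    and rk2: "\<And>k x. 12 \<le> k \<Longrightarrow> k < 16 \<Longrightarrow> x \<in> rect \<nu> A 1 \<Longrightarrow> norm (rk (\<nu>' k) (a k) (a' k) x) < R2"
    and w1: "\<And>k. 4 \<le> k \<Longrightarrow> k < 12 \<Longrightarrow> wk k \<le> \<omega>1 * (4 * a k * a' k) \<and> wk k \<le> W1"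
    and w2: "\<And>k. 12 \<le> k \<Longrightarrow> k < 16 \<Longrightarrow> wk k \<le> \<omega>2 * (4 * a k * a' k) \<and> wk k \<le> W2"
    and om: "0 \<le> \<omega>2" "\<omega>2 \<le> \<omega>1" and et: "0 \<le> eta \<theta>"
    and w: "16 * (\<Lambda> * (18 * mb 3)) + mb 3 + (\<omega>1 - \<omega>2) * (4 * A - 2 * \<tau> - 2 * (P * Q)) + \<omega>2 * (4 * A - 2 * \<tau>)
      + 64 * (mb R1 * eta \<theta> * W1) + 32 * (mb R2 * eta \<theta> * W2) \<le> w"
  shows "\<exists>d. patch S \<theta> L ((E, t), rect \<nu> A 1, w) d"
proof -
  have "\<exists>b. \<forall>x\<in>poly (ls k). F x = app (B k) x + b" for k
    by (cases "poly (ls k) = {}") (use F_cell in blast)+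
  then obtain b where b: "\<And>k x. x \<in> poly (ls k) \<Longrightarrow> F x = app (B k) x + b k" by metis
  have nE: "norm (E, t) \<le> norm E + \<bar>t\<bar>" using norm_Pair_le[of E t] by simp
  define r where "r k = (if k < 12 then R1 else R2)" for k :: nat
  let ?m = "\<lambda>k. measure lborel (poly (ls k))"
  let ?T = "\<lambda>k. (?m k / (4 * a k * a' k) + 8 * mb (r k) * eta \<theta>) * wk k"
  have T: "?T k \<le> \<omega> * ?m k + 8 * (mb (r k) * eta \<theta> * W)"
    if "4 \<le> k" "k < 16" "wk k \<le> \<omega> * (4 * a k * a' k)" "wk k \<le> W" for k \<omega> W
  proof -
    have p: "0 < 4 * a k * a' k" "0 \<le> wk k" "wk k \<le> W" using sh[OF that(1,2)] that(4) by auto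
    have "?m k / (4 * a k * a' k) * wk k \<le> ?m k / (4 * a k * a' k) * (\<omega> * (4 * a k * a' k))"
      using that p by (intro mult_left_mono) auto
    moreover have "y / q * (\<omega> * q) = \<omega> * y" if "0 < q" for y q :: real using that by simp
    note this[OF p(1), of "?m k"]
    moreover have "8 * mb (r k) * eta \<theta> * wk k \<le> 8 * mb (r k) * eta \<theta> * W" using p mb(1) et by (intro mult_left_mono) auto
    ultimately show ?thesis by (simp add: distrib_right)
  qed
  have "(\<Sum>k\<in>{4..<16}. ?T k) = (\<Sum>k\<in>{4..<12}. ?T k) + (\<Sum>k\<in>{12..<16}. ?T k)"
    by (simp add: sum.atLeastLessThan_concat)
  also have "\<dots> \<le> (\<Sum>k\<in>{4..<12}. \<omega>1 * ?m k + 8 * (mb R1 * eta \<theta> * W1)) + (\<Sum>k\<in>{12..<16}. \<omega>2 * ?m k + 8 * (mb R2 * eta \<theta> * W2))"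
  proof (intro add_mono sum_mono)
    fix k assume "k \<in> {4..<12::nat}"
    then show "?T k \<le> \<omega>1 * ?m k + 8 * (mb R1 * eta \<theta> * W1)" using T[of k \<omega>1 W1] w1[of k] by (simp add: r_def)
  next
    fix k assume "k \<in> {12..<16::nat}"
    then show "?T k \<le> \<omega>2 * ?m k + 8 * (mb R2 * eta \<theta> * W2)" using T[of k \<omega>2 W2] w2[of k] by (simp add: r_def)
  qed
  also have "\<dots> = (\<omega>1 - \<omega>2) * (\<Sum>k\<in>{4..<12}. ?m k) + \<omega>2 * ((\<Sum>k\<in>{4..<12}. ?m k) + (\<Sum>k\<in>{12..<16}. ?m k))
      + 64 * (mb R1 * eta \<theta> * W1) + 32 * (mb R2 * eta \<theta> * W2)"
    by (simp only: sum.distrib sum_distrib_left[symmetric]) (simp add: algebra_simps)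
  also have "\<dots> \<le> (\<omega>1 - \<omega>2) * (4 * A - 2 * \<tau> - 2 * (P * Q)) + \<omega>2 * (4 * A - 2 * \<tau>)
      + 64 * (mb R1 * eta \<theta> * W1) + 32 * (mb R2 * eta \<theta> * W2)"
    using mult_left_mono[OF area_rest(1), of "\<omega>1 - \<omega>2"] mult_left_mono[OF area_rest(2), of \<omega>2] om by simp
  finally have W: "(\<Sum>k\<in>{4..<16}. ?T k) \<le> (\<omega>1 - \<omega>2) * (4 * A - 2 * \<tau> - 2 * (P * Q)) + \<omega>2 * (4 * A - 2 * \<tau>)
      + 64 * (mb R1 * eta \<theta> * W1) + 32 * (mb R2 * eta \<theta> * W2)" .
  have dk: "norm (dB k) \<le> \<Lambda>" if "k < 16" for k using dB_norm that .
  show ?thesis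
  proof (rule poly_patch[where F = F and ls = ls and B = B and b = b and N = 16 and NF = "{4..<16}" and m = ?m
        and \<nu> = \<nu>' and a = a and a' = a' and wk = wk and Q = \<Lambda> and R = 3 and r = r])
    show "norm (app (E, t) h) \<le> L * norm h" for h
    proof -
      have "norm (app (E, t) h) \<le> (norm E + \<bar>t\<bar>) * norm h" using app_norm[of "(E, t)" h] by simp
      also have "\<dots> \<le> L * norm h" using L Lam_nonneg by (intro mult_right_mono) auto
      finally show ?thesis .
    qed
    show "norm (E, t) \<le> L" using nE L Lam_nonneg by linarith
    show "rect \<nu> A 1 \<subseteq> ball 0 3" using rect_bounded[of 1] by auto
    show "length (ls k) \<le> 8" for k by (simp add: ls_def)
    show "norm (B k) \<le> L" if "k < 16" for k
      using norm_triangle_ineq[of "(E, t)" "dB k"] dk[OF that] nE L unfolding B_split by linarith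
    show "norm (B k - (E, t)) \<le> \<Lambda>" if "k < 16" for k using dk[OF that] by (simp add: B_split)
    show "fst (B k) \<in> K3" if "k < 16" "k \<notin> {4..<16}" for k
      using that fin by (simp add: B_def be_def al_def ga_def)
    show "real 16 * (\<Lambda> * (2 * (8 * mb 3 + mb 3))) + mb 3 + (\<Sum>k\<in>{4..<16}. ?T k) \<le> w"
      using W w by simp
    show "rk (\<nu>' k) (a k) (a' k) x \<in> ball 0 (r k)" if "k \<in> {4..<16}" "x \<in> rect \<nu> A 1" for k x
      using rk1[of k x] rk2[of k x] that by (simp add: r_def)
    show "(B k, rect (\<nu>' k) (a k) (a' k), wk k) \<in> S" "0 \<le> wk k" if "k \<in> {4..<16}" for k
      using that ch[of k] sh[of k] by auto
    show "norm (\<nu>' k) = 1 \<and> 0 < a k \<and> 0 < a' k" if "k \<in> {4..<16}" for k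
      using that sh[of k] by auto
    show "F x = app (B k) x + b k" if "x \<in> poly (ls k)" for k x using b[OF that] .
    show "poly (ls k) \<subseteq> rect \<nu> A 1" for k by (rule cell_rect)
    show "k = l" if "k < 16" "l < 16" "x \<in> poly (ls k)" "x \<in> poly (ls l)" for k l x using cell_disj that .
    show "rect \<nu> A 1 \<in> sets borel" by (rule rect_meas)
    show "L-lipschitz_on UNIV F" using F_lip[OF L] .
    show "F x = app (E, t) x" if "x \<notin> rect \<nu> A 1" for x using F_off that .
  qed (use th cell_cover in auto)
qed

end

section \<open>Runs of bricks\<close>

text \<open>The unit vector for which the finished cells of a brick change the symmetric part by
  \<open>D\<close>. Changing the sign \<zeta> turns it by a right angle, up to sign: these are the
  two rank-one directions belonging to \<open>D\<close>, with opposite skew parts.\<close>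

definition frm :: "real \<Rightarrow> complex \<Rightarrow> complex" where
  "frm \<zeta> D = csqrt (- \<i> * of_real \<zeta> * D / of_real (norm D))"

text \<open>Never zero, so that it always selects one of the two frames.\<close>

definition sg :: "real \<Rightarrow> real" where "sg t = (if 0 \<le> t then 1 else - 1)"

lemma sg: "sg t = 1 \<or> sg t = - 1" "\<bar>sg t\<bar> = 1"
  by (auto simp: sg_def)

text \<open>A step of length \<open>q\<close> against the sign of \<open>t\<close> either lowers the
  modulus by \<open>q\<close> or overshoots zero by at most \<open>q\<close>. This is how the skew
  part is kept bounded.\<close>

lemma sg_diff: "0 \<le> q \<Longrightarrow> \<bar>t - sg t * q\<bar> \<le> max (\<bar>t\<bar> - q) q"
  by (auto simp: sg_def)

lemma frm:
  assumes "D \<noteq> 0" "\<bar>\<zeta>\<bar> = 1"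
  shows "norm (frm \<zeta> D) = 1" "of_real (\<zeta> * norm D) * \<i> * (frm \<zeta> D)\<^sup>2 = D"
proof -
  have sq: "(frm \<zeta> D)\<^sup>2 = - \<i> * of_real \<zeta> * D / of_real (norm D)" by (simp add: frm_def)
  have "norm ((frm \<zeta> D)\<^sup>2) = 1" unfolding sq using assms by (simp add: norm_mult norm_divide)
  then show "norm (frm \<zeta> D) = 1" using norm_ge_zero[of "frm \<zeta> D"] by (simp add: norm_power power2_eq_1_iff)
  have "\<zeta> * \<zeta> = 1" using assms(2) by (metis abs_mult_self_eq mult_1)
  then have "of_real \<zeta> * of_real \<zeta> = (1::complex)" by (metis of_real_1 of_real_mult)
  then have "of_real (\<zeta> * norm D) * \<i> * (- \<i> * of_real \<zeta> * D / of_real (norm D)) = D"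
    using assms(1) by (simp add: field_simps)
  then show "of_real (\<zeta> * norm D) * \<i> * (frm \<zeta> D)\<^sup>2 = D" by (simp only: sq)
qed

lemma rk_norm:
  assumes "norm \<nu> = 1" "0 < a" "0 < b"
  shows "norm (rk \<nu> a b x) \<le> norm x * (1 / (2 * a) + 1 / (2 * b))"
proof -
  have n: "norm (cnj \<nu> * x) = norm x" using assms by (simp add: norm_mult)
  have "\<bar>Re (cnj \<nu> * x)\<bar> \<le> norm x" "\<bar>Im (cnj \<nu> * x)\<bar> \<le> norm x"
    using abs_Re_le_cmod[of "cnj \<nu> * x"] abs_Im_le_cmod[of "cnj \<nu> * x"] unfolding n by auto
  then have "\<bar>Re (rk \<nu> a b x)\<bar> \<le> norm x / (2 * a)" "\<bar>Im (rk \<nu> a b x)\<bar> \<le> norm x / (2 * b)"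
    unfolding rk_def complex.sel abs_divide using assms by (auto intro!: divide_right_mono)
  then show ?thesis using cmod_le[of "rk \<nu> a b x"] by (simp add: distrib_left)
qed

text \<open>The bound 5 does not depend on \<open>A\<close>. A change of \<open>D\<close> by the
  relative amount \<open>z\<close> of order \<open>A\<close> turns the frame by an angle of order
  \<open>A\<close>; the side of half-length 1 then extends only by a multiple of \<open>A\<close>
  across the new rectangle, whose half-width is 3/4 * A. This makes the collar constants uniform
  along a run of ever thinner rectangles.\<close>

lemma frm_close:
  assumes D: "D \<noteq> 0" and chi: "\<bar>\<zeta>\<bar> = 1" and A: "0 < A" "A \<le> 1 / 50" and z: "norm z \<le> 4 * A"
    and x: "x \<in> rect (frm \<zeta> D) A 1"
  shows "norm (rk (frm \<zeta> (D * (1 - z))) (3 / 4 * A) 1 x) < 5"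
proof -
  have z1: "norm z \<le> 2 / 25" using z A by linarith
  have o: "23 / 25 \<le> norm (1 - z)" using norm_triangle_ineq2[of 1 z] z1 by simp
  then have z0: "1 - z \<noteq> 0" by auto
  define \<nu> where "\<nu> = frm \<zeta> D"
  define \<nu>' where "\<nu>' = frm \<zeta> (D * (1 - z))"
  define q where "q = \<nu>' * cnj \<nu>"
  have n: "norm \<nu> = 1" "norm \<nu>' = 1" using frm(1) D chi z0 by (auto simp: \<nu>_def \<nu>'_def)
  have nq: "norm q = 1" using n by (simp add: q_def norm_mult)
  have vv: "\<nu> * cnj \<nu> = 1" "q * cnj q = 1" using n nq by (simp_all add: complex_norm_square[symmetric])
  have cc: "of_real \<zeta> * of_real \<zeta> = (1::complex)"
    using chi by (metis abs_mult_self_eq mult_1 of_real_1 of_real_mult)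
  have "q\<^sup>2 = \<nu>'\<^sup>2 * cnj (\<nu>\<^sup>2)" by (simp add: q_def power_mult_distrib)
  also have "\<dots> = (of_real \<zeta> * of_real \<zeta>) * (D * cnj D) * (1 - z) / (of_real (norm D) * of_real (norm D) * of_real (norm (1 - z)))"
    by (simp add: \<nu>_def \<nu>'_def frm_def norm_mult mult_ac)
  also have "\<dots> = (1 - z) / of_real (norm (1 - z))"
    using D by (simp add: cc complex_norm_square[symmetric] power2_eq_square)
  finally have q2: "q\<^sup>2 = (1 - z) / of_real (norm (1 - z))" .
  \<comment> \<open>The square of \<open>q\<close> is known independently of the branch of the root,
    and since \<open>q - cnj q\<close> is imaginary it determines the modulus of
    \<open>Im q\<close>.\<close>
  have "q\<^sup>2 - 1 = q * (q - cnj q)" using vv(2) by (simp add: power2_eq_square algebra_simps)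
  also have "q - cnj q = 2 * \<i> * of_real (Im q)" by (simp add: complex_eq_iff)
  finally have im: "norm (q\<^sup>2 - 1) = 2 * \<bar>Im q\<bar>" using nq by (simp add: norm_mult)
  have "q\<^sup>2 - 1 = ((1 - z) - of_real (norm (1 - z))) / of_real (norm (1 - z))"
    unfolding q2 using z0 by (simp add: field_simps)
  then have "norm (q\<^sup>2 - 1) = norm ((1 - z) - of_real (norm (1 - z))) / norm (1 - z)" by (simp add: norm_divide)
  also have "norm ((1 - z) - of_real (norm (1 - z))) \<le> 2 * norm z"
  proof -
    have "(1 - z) - of_real (norm (1 - z)) = (of_real (1 - norm (1 - z))) - z" by simp
    then have "norm ((1 - z) - of_real (norm (1 - z))) \<le> \<bar>1 - norm (1 - z)\<bar> + norm z"
      using norm_triangle_ineq4[of "of_real (1 - norm (1 - z))" z] by (simp only: norm_of_real)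
    moreover have "\<bar>1 - norm (1 - z)\<bar> \<le> norm z" using norm_triangle_ineq3[of 1 "1 - z"] by simp
    ultimately show ?thesis by linarith
  qed
  finally have "norm (q\<^sup>2 - 1) \<le> 2 * norm z / norm (1 - z)" using o by (simp add: divide_right_mono)
  also have "\<dots> \<le> 2 * norm z / (23 / 25)" using o by (intro divide_left_mono) auto
  \<comment> \<open>This is the sine of the turning angle; it multiplies the long coordinate
    \<open>Im y\<close> in the estimate of the new transversal coordinate.\<close>
  finally have iq: "\<bar>Im q\<bar> \<le> 44 / 10 * A" using im z A by simp
  define y where "y = cnj \<nu> * x"
  have yx: "cnj \<nu>' * x = cnj q * y" using vv(1) by (simp add: q_def y_def)
  have ry: "\<bar>Re y\<bar> \<le> A" "\<bar>Im y\<bar> \<le> 1" using x A by (auto simp: rect_iff y_def \<nu>_def)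
  have rq: "\<bar>Re q\<bar> \<le> 1" "\<bar>Im q\<bar> \<le> 1" using abs_Re_le_cmod[of q] abs_Im_le_cmod[of q] nq by auto
  have p: "\<bar>Re q * Re y\<bar> \<le> 1 * A" "\<bar>Im q * Im y\<bar> \<le> (44 / 10 * A) * 1" "\<bar>Re q * Im y\<bar> \<le> 1 * 1" "\<bar>Im q * Re y\<bar> \<le> 1 * A"
    unfolding abs_mult using rq ry iq A by (intro mult_mono; simp)+
  have "Re (cnj q * y) = Re q * Re y + Im q * Im y" "Im (cnj q * y) = Re q * Im y - Im q * Re y" by simp_all
  then have R: "\<bar>Re (cnj \<nu>' * x)\<bar> \<le> 54 / 10 * A" "\<bar>Im (cnj \<nu>' * x)\<bar> \<le> 102 / 100"
    unfolding yx using p A by linarith+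
  have "\<bar>Re (rk \<nu>' (3 / 4 * A) 1 x)\<bar> \<le> (54 / 10 * A) / (2 * (3 / 4 * A))"
    unfolding rk_def complex.sel abs_divide using divide_right_mono[OF R(1), of "2 * (3 / 4 * A)"] A by (simp only: abs_of_pos)
  also have "\<dots> = 36 / 10" using A by simp
  finally have "\<bar>Re (rk \<nu>' (3 / 4 * A) 1 x)\<bar> \<le> 36 / 10" .
  moreover have "\<bar>Im (rk \<nu>' (3 / 4 * A) 1 x)\<bar> \<le> 51 / 100"
    unfolding rk_def complex.sel abs_divide using R by simp
  ultimately show ?thesis using cmod_le[of "rk \<nu>' (3 / 4 * A) 1 x"] by (simp add: \<nu>'_def)
qed

context rectangle begin

definition yk :: "nat \<Rightarrow> complex" where "yk k = of_real (be k - al k) - 2 * \<i> * of_real (ga k)"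

lemma B_alt: "B k = (E + D0 * yk k, t - s * (al k + be k) / 2)"
  by (simp add: B_def yk_def algebra_simps)

end

section \<open>Runs of thinner and thinner bricks\<close>

text \<open>In generation \<open>m\<close> the half-width is
  \<open>\<epsilon> * (3 / 4) ^ m\<close>. A brick of half-width \<open>A\<close> moves the gradient
  of the cells that continue the run by at most \<open>12 * A\<close>, and summing the geometric
  series gives \<open>48 * \<epsilon> * (1 - (3 / 4) ^ m)\<close>. The sign of the frame is that of
  \<open>t0\<close> throughout, so that consecutive frames are close. The weight is area times
  \<omega>, plus a constant \<open>W\<close> that pays for the run itself.\<close>

definition Run :: "complex \<Rightarrow> real \<Rightarrow> complex \<Rightarrow> real \<Rightarrow> real \<Rightarrow> real \<Rightarrow> real \<Rightarrow> state set" where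
  "Run E0 t0 e \<delta> \<epsilon> \<omega> W = {((E, t), rect (frm (sg t0) (e - E)) (\<epsilon> * (3 / 4) ^ m) 1, 4 * (\<epsilon> * (3 / 4) ^ m) * \<omega> + W) |E t m.
     norm (E - E0) \<le> \<delta> + 48 * \<epsilon> * (1 - (3 / 4) ^ m) \<and> \<bar>t - t0\<bar> \<le> \<delta> + 48 * \<epsilon> * (1 - (3 / 4) ^ m)}"

text \<open>For \<sigma> = 1 the inner cells change the symmetric part by \<open>k2 - k1\<close>
  times \<open>D0\<close>; the equation prescribes this step beyond the old gradient as \<mu>. At
  \<open>c\<close> the first quotient equals 1 + \<mu> and the second is at most 1, so the
  intermediate value theorem applies.\<close>

lemma tau_exists:
  fixes A \<mu> :: real
  assumes A: "0 < A" "A \<le> 1 / 2" and mu: "0 < \<mu>"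
  shows "\<exists>\<tau>. 0 < \<tau> \<and> \<tau> < A \<and> \<tau> / (A - \<tau>) - \<tau> * A / (1 - A) = \<mu>"
proof -
  define c where "c = A * (1 + \<mu>) / (2 + \<mu>)"
  have c: "0 \<le> c" "c < A" using A mu by (auto simp: c_def field_simps)
  let ?f = "\<lambda>\<tau>. \<tau> / (A - \<tau>) - \<tau> * A / (1 - A)"
  have "A - c = A / (2 + \<mu>)" using mu by (simp add: c_def field_simps)
  then have "c / (A - c) = 1 + \<mu>" using A mu by (simp add: c_def)
  moreover have "c * A / (1 - A) \<le> 1"
  proof -
    have "c * A \<le> (1 / 2) * (1 / 2)" using A c by (intro mult_mono) auto
    then show ?thesis using A by (simp add: divide_le_eq)
  qed
  ultimately have "\<mu> \<le> ?f c" by simp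
  moreover have "?f 0 \<le> \<mu>" using mu by simp
  moreover have "continuous_on {0..c} ?f" using c A by (intro continuous_intros) auto
  ultimately obtain \<tau> where t: "0 \<le> \<tau>" "\<tau> \<le> c" "?f \<tau> = \<mu>" using IVT'[of ?f 0 \<mu> c] c by blast
  then have "\<tau> \<noteq> 0" using mu by auto
  then have "0 < \<tau>" "\<tau> < A" using t c by auto
  then show ?thesis using t(3) by blast
qed

text \<open>The hypothesis \<open>orc\<close> supplies the states for the inner cells, whose
  gradient is near the point beyond \<open>E0\<close> on the line from \<open>e\<close>. The cells
  \<open>4 \<le> k < 12\<close> stay in the run: their area is at most 51/25 * A, and a rectangle of
  the next generation has area 3 * A, so \<open>W\<close> is reproduced with the factor 17/25. The
  remaining 8/25 * W pays for the gradient jumps and the surplus.\<close>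

lemma run_patch:
  assumes th: "0 < \<theta>" "\<theta> < 1" and e: "e \<in> K3" and mu: "0 < \<mu>" and eps: "0 < \<epsilon>" "\<epsilon> \<le> 1 / 50" and d0: "0 \<le> \<delta>"
    and far: "\<delta> + 48 * \<epsilon> < norm (e - E0)" "norm (e - E0) + \<delta> + 48 * \<epsilon> \<le> 3"
    and L: "norm E0 + \<bar>t0\<bar> + 2 * (\<delta> + 48 * \<epsilon>) + 6 * (\<mu> + 4) \<le> L"
    and S: "Run E0 t0 e \<delta> \<epsilon> \<omega> W \<subseteq> S"
    and orc: "\<And>E' t'. norm (E' - (E0 - of_real \<mu> * (e - E0))) \<le> (1 + \<mu>) * (\<delta> + 60 * \<epsilon>) \<Longrightarrow>
      \<bar>t' - (t0 - sg t0 * (\<mu> * norm (e - E0)))\<bar> \<le> (1 + \<mu>) * (\<delta> + 60 * \<epsilon>) \<Longrightarrow>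
      \<exists>\<nu> a w. ((E', t'), rect \<nu> a 1, w) \<in> S \<and> norm \<nu> = 1 \<and> a2 \<le> a \<and> a \<le> 1 \<and> 0 \<le> w \<and> w \<le> \<omega> * (4 * a)"
    and a2: "0 < a2" and om: "0 \<le> \<omega>" "0 \<le> W" and et: "0 \<le> eta \<theta>"
    and C: "16 * (6 * (\<mu> + 4) * (18 * mb 3)) + mb 3 + 64 * (mb 5 * eta \<theta> * (4 * \<omega> + W))
       + 32 * (mb (2 / a2 + 4) * eta \<theta> * (4 * \<omega>)) \<le> 8 / 25 * W"
    and \<sigma>: "\<sigma> \<in> Run E0 t0 e \<delta> \<epsilon> \<omega> W"
  shows "\<exists>d. patch S \<theta> L \<sigma> d"
proof -
  obtain E t m where \<sigma>': "\<sigma> = ((E, t), rect (frm (sg t0) (e - E)) (\<epsilon> * (3 / 4) ^ m) 1, 4 * (\<epsilon> * (3 / 4) ^ m) * \<omega> + W)"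
    and E: "norm (E - E0) \<le> \<delta> + 48 * \<epsilon> * (1 - (3 / 4) ^ m)" "\<bar>t - t0\<bar> \<le> \<delta> + 48 * \<epsilon> * (1 - (3 / 4) ^ m)"
    using \<sigma> unfolding Run_def by blast
  define A where "A = \<epsilon> * (3 / 4) ^ m"
  have pw: "0 < (3 / 4 :: real) ^ m" "(3 / 4 :: real) ^ m \<le> 1" by (auto simp: power_le_one)
  have A01: "0 < A" "A \<le> \<epsilon>" using eps pw mult_left_mono[OF pw(2), of \<epsilon>] by (auto simp: A_def)
  then have A: "0 < A" "A \<le> \<epsilon>" "A \<le> 1 / 50" using eps by auto
  have E1: "norm (E - E0) \<le> \<delta> + 48 * \<epsilon> - 48 * A" "\<bar>t - t0\<bar> \<le> \<delta> + 48 * \<epsilon> - 48 * A"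
    using E by (simp_all add: A_def algebra_simps)
  define \<zeta> where "\<zeta> = sg t0"
  have chi: "\<bar>\<zeta>\<bar> = 1" by (simp add: \<zeta>_def sg)
  define D where "D = e - E"
  have DE: "\<bar>norm D - norm (e - E0)\<bar> \<le> norm (E - E0)"
    using norm_triangle_ineq3[of D "e - E0"] by (simp add: D_def norm_minus_commute)
  then have "norm (e - E0) - (\<delta> + 48 * \<epsilon>) < norm D" "norm D \<le> 3" using E1 far A by linarith+
  then have D: "D \<noteq> 0" "norm D \<le> 3" using far by auto
  obtain \<tau> where \<tau>: "0 < \<tau>" "\<tau> < A" "\<tau> / (A - \<tau>) - \<tau> * A / (1 - A) = \<mu>"
    using tau_exists[OF A(1) _ mu] A by auto
  define \<nu> where "\<nu> = frm \<zeta> D"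
  define s where "s = 2 * (\<zeta> * norm D)"
  have sD: "\<bar>s\<bar> = 2 * norm D" by (simp add: s_def abs_mult chi)
  interpret R: rectangle \<nu> A \<tau> 1 s t E
    using frm(1)[OF D(1) chi] \<tau> A by unfold_locales (auto simp: \<nu>_def)
  have D0: "R.D0 = D" using frm(2)[OF D(1) chi] unfolding R.D0_def by (simp add: s_def \<nu>_def)
  have k2: "R.k2 \<le> A / 2" "0 < R.k2"
  proof -
    have "\<tau> * A \<le> A * (1 / 50)" using \<tau> A by (intro mult_mono) auto
    also have "\<dots> \<le> A / 2 * (1 - A)"
    proof -
      have "A * A \<le> A * (1 / 50)" using A by (intro mult_left_mono) auto
      then have "A / 2 * A \<le> A / 100" by simp
      then show ?thesis using A unfolding right_diff_distrib by linarith
    qed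
    finally show "R.k2 \<le> A / 2" using A by (simp add: R.k2_def R.Q_def divide_le_eq)
  qed (rule R.pos)
  have k1: "R.k1 = \<mu> + R.k2" using \<tau>(3) by (simp add: R.k1_def R.k2_def R.P_def R.Q_def)
  have De: "49 / 50 \<le> R.\<Delta>" using \<tau> A by (simp add: R.\<Delta>_def)
  have over: "x / R.\<Delta> \<le> 50 / 49 * x" if "0 \<le> x" for x
    using divide_left_mono[OF De that] R.pos(1) by simp
  have tt: "0 \<le> \<tau> * \<tau>" "\<tau> * \<tau> \<le> \<tau>" using \<tau> A mult_left_mono[of \<tau> 1 \<tau>] by auto
  have Lam: "R.\<Lambda> \<le> 6 * (\<mu> + 4)"
  proof -
    have "\<tau> * (1 + 1) / R.\<Delta> \<le> 50 / 49 * (2 * \<tau>)" "\<tau> * (1 + \<tau>) / R.\<Delta> \<le> 50 / 49 * (2 * \<tau>)"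
    proof -
      have a: "\<tau> * (1 + \<tau>) \<le> 2 * \<tau>" "0 \<le> \<tau> * (1 + \<tau>)" "\<tau> * (1 + 1) = 2 * \<tau>"
        using tt \<tau> unfolding distrib_left by linarith+
      show "\<tau> * (1 + 1) / R.\<Delta> \<le> 50 / 49 * (2 * \<tau>)" unfolding a(3) using \<tau> by (intro over) auto
      show "\<tau> * (1 + \<tau>) / R.\<Delta> \<le> 50 / 49 * (2 * \<tau>)"
        by (rule order_trans[OF over[OF a(2)]]) (intro mult_left_mono a(1), simp)
    qed
    then have "(1 + \<tau> * (1 + 1) / R.\<Delta> + R.k1) + (\<tau> / 1 + \<tau> * (1 + \<tau>) / R.\<Delta> + R.k2) \<le> \<mu> + 4"
      using k1 k2 \<tau> A by linarith
    then have "R.\<Lambda> \<le> \<bar>s\<bar> * (\<mu> + 4)" unfolding R.\<Lambda>_def by (intro mult_left_mono) auto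
    also have "\<dots> \<le> 6 * (\<mu> + 4)" using sD D mu by (intro mult_right_mono) auto
    finally show ?thesis .
  qed
  define A' where "A' = \<epsilon> * (3 / 4) ^ Suc m"
  have A': "A' = 3 / 4 * A" by (simp add: A'_def A_def)
  define w where "w = 4 * A' * \<omega> + W"
  have y: "norm (R.yk k) \<le> 4 * A" "\<bar>R.al k + R.be k\<bar> \<le> 4 * A" if "4 \<le> k" "k < 12" for k
  proof -
    have t1: "\<tau> / R.\<Delta> \<le> 50 / 49 * \<tau>" "\<tau> * \<tau> / R.\<Delta> \<le> 50 / 49 * \<tau>" "0 \<le> \<tau> / R.\<Delta>" "0 \<le> \<tau> * \<tau> / R.\<Delta>"
      using over[of \<tau>] order_trans[OF over[OF tt(1)] mult_left_mono[OF tt(2)]] tt \<tau> De by auto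
    have t2: "\<tau> * \<tau> / R.\<Delta> \<le> \<tau> / R.\<Delta>" using tt(2) De by (intro divide_right_mono) auto
    show "\<bar>R.al k + R.be k\<bar> \<le> 4 * A"
    proof (cases "k < 8")
      case True
      then have "R.al k + R.be k = - \<tau>" using that by (simp add: R.al_def R.be_def)
      then show ?thesis using \<tau> by simp
    next
      case False
      then have "R.al k + R.be k = \<tau> / R.\<Delta> + \<tau> * \<tau> / R.\<Delta>" using that by (simp add: R.al_def R.be_def power2_eq_square)
      then show ?thesis using t1 \<tau> by linarith
    qed
    have "norm (R.yk k) \<le> \<bar>R.be k - R.al k\<bar> + 2 * \<bar>R.ga k\<bar>"
      unfolding R.yk_def using norm_triangle_ineq4[of "of_real (R.be k - R.al k)" "2 * \<i> * of_real (R.ga k)"]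
      by (simp add: norm_mult del: of_real_diff)
    moreover have "\<bar>R.ga k\<bar> \<le> \<tau> / R.\<Delta>" using R.e12(1)[of k] R.e12(2)[of k] t1 by (auto simp: R.ga_def abs_mult)
    moreover have "R.be k - R.al k = - \<tau>"
    proof (cases "k < 8")
      case False
      have "\<tau> * \<tau> - \<tau> = - \<tau> * R.\<Delta>" by (simp add: R.\<Delta>_def algebra_simps)
      then show ?thesis using False that R.pos(1)
        by (simp add: R.al_def R.be_def power2_eq_square diff_divide_distrib[symmetric])
    qed (use that in \<open>simp add: R.al_def R.be_def\<close>)
    ultimately show "norm (R.yk k) \<le> 4 * A" using t1 \<tau> by linarith
  qed
  have ga12: "R.ga k = 0" "R.al k = R.k1" "R.be k = R.k2" if "12 \<le> k" for k using that by (simp_all add: R.ga_def R.al_def R.be_def)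
  define E2 where "E2 = E - of_real \<mu> * D"
  \<comment> \<open>Here \<open>k1 + k2 = \<mu> + 2 * k2\<close>: the intended drift is
    \<open>\<mu> * norm D\<close> against the sign of \<open>t0\<close>, and the term with
    \<open>k2\<close> is an error of order \<open>A\<close>.\<close>
  define t2 where "t2 = t - \<zeta> * norm D * (\<mu> + 2 * R.k2)"
  have B12: "R.B k = (E2, t2)" if "12 \<le> k" for k
    unfolding R.B_alt R.yk_def ga12[OF that] D0 k1 by (simp add: E2_def t2_def s_def)
  have in1: "(R.B k, rect (frm \<zeta> (e - fst (R.B k))) A' 1, w) \<in> S" if "4 \<le> k" "k < 12" for k
  proof -
    have m: "48 * \<epsilon> * (1 - (3 / 4) ^ Suc m) = 48 * \<epsilon> - 36 * A" by (simp add: A_def algebra_simps)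
    have "norm (D * R.yk k) \<le> 3 * (4 * A)" unfolding norm_mult using D y[OF that] by (intro mult_mono) auto
    then have n1: "norm (fst (R.B k) - E0) \<le> \<delta> + 48 * \<epsilon> * (1 - (3 / 4) ^ Suc m)"
      unfolding m using E1(1) norm_triangle_ineq[of "E - E0" "D * R.yk k"] by (simp add: R.B_alt D0 algebra_simps)
    have "\<bar>s * (R.al k + R.be k) / 2\<bar> = norm D * \<bar>R.al k + R.be k\<bar>" by (simp add: abs_mult sD)
    also have "\<dots> \<le> 3 * (4 * A)" using D y[OF that] by (intro mult_mono) auto
    finally have "\<bar>s * (R.al k + R.be k) / 2\<bar> \<le> 3 * (4 * A)" .
    then have n2: "\<bar>snd (R.B k) - t0\<bar> \<le> \<delta> + 48 * \<epsilon> * (1 - (3 / 4) ^ Suc m)"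
      unfolding m using E1(2) by (simp add: R.B_alt)
    have "((fst (R.B k), snd (R.B k)), rect (frm \<zeta> (e - fst (R.B k))) A' 1, w) \<in> Run E0 t0 e \<delta> \<epsilon> \<omega> W"
      unfolding Run_def mem_Collect_eq w_def A'_def \<zeta>_def
      by (rule exI[of _ "fst (R.B k)"], rule exI[of _ "snd (R.B k)"], rule exI[of _ "Suc m"], rule conjI, rule HOL.refl, rule conjI, rule n1, rule n2)
    then show ?thesis using S by auto
  qed
  have sg_le: "(\<mu> + 1) * (\<delta> + 48 * \<epsilon>) + \<epsilon> * 3 \<le> (1 + \<mu>) * (\<delta> + 60 * \<epsilon>)"
    using mu eps mult_nonneg_nonneg[of \<mu> \<epsilon>] by (simp add: algebra_simps)
  obtain \<nu>2 a w2 where o: "((E2, t2), rect \<nu>2 a 1, w2) \<in> S" "norm \<nu>2 = 1" "a2 \<le> a" "a \<le> 1" "0 \<le> w2" "w2 \<le> \<omega> * (4 * a)"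
  proof -
    have "E2 - (E0 - of_real \<mu> * (e - E0)) = of_real (1 + \<mu>) * (E - E0)" by (simp add: E2_def D_def algebra_simps)
    then have "norm (E2 - (E0 - of_real \<mu> * (e - E0))) = (1 + \<mu>) * norm (E - E0)"
      using mu by (simp only: norm_mult norm_of_real abs_of_pos add_pos_pos zero_less_one)
    also have "\<dots> \<le> (1 + \<mu>) * (\<delta> + 60 * \<epsilon>)" using mu E1 A eps by (intro mult_left_mono) auto
    finally have 1: "norm (E2 - (E0 - of_real \<mu> * (e - E0))) \<le> (1 + \<mu>) * (\<delta> + 60 * \<epsilon>)" .
    have "t2 - (t0 - \<zeta> * (\<mu> * norm (e - E0))) = (t - t0) - \<zeta> * (\<mu> * (norm D - norm (e - E0))) - \<zeta> * (2 * (norm D * R.k2))"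
      by (simp add: t2_def algebra_simps)
    also have "\<bar>\<dots>\<bar> \<le> \<bar>t - t0\<bar> + \<bar>\<zeta> * (\<mu> * (norm D - norm (e - E0)))\<bar> + \<bar>\<zeta> * (2 * (norm D * R.k2))\<bar>" by linarith
    also have "\<bar>\<zeta> * (\<mu> * (norm D - norm (e - E0)))\<bar> \<le> \<mu> * (\<delta> + 48 * \<epsilon>)"
      unfolding abs_mult chi using mu DE E1 A by (simp add: mult_left_mono)
    also have "\<bar>\<zeta> * (2 * (norm D * R.k2))\<bar> \<le> 3 * \<epsilon>"
    proof -
      have "norm D * R.k2 \<le> 3 * (A / 2)" using D k2 by (intro mult_mono) auto
      then show ?thesis unfolding abs_mult chi using k2 A by simp
    qed
    finally have "\<bar>t2 - (t0 - \<zeta> * (\<mu> * norm (e - E0)))\<bar> \<le> (1 + \<mu>) * (\<delta> + 60 * \<epsilon>)"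
      using E1 A sg_le by (simp add: algebra_simps)
    then show ?thesis using orc[OF 1] that unfolding \<zeta>_def by blast
  qed
  have a: "0 < a" using o a2 by linarith
  \<comment> \<open>The next rectangle has area \<open>3 * A\<close>, so this is its weight per
    area.\<close>
  define \<omega>1 where "\<omega>1 = \<omega> + W / (3 * A)"
  have w_eq: "\<omega>1 * (4 * A' * 1) = w" using A by (simp add: \<omega>1_def w_def A' distrib_right)
  have nz: "e - fst (R.B k) \<noteq> 0" "e - fst (R.B k) = D * (1 - R.yk k)" if "4 \<le> k" "k < 12" for k
  proof -
    show "e - fst (R.B k) = D * (1 - R.yk k)" by (simp add: R.B_alt D0 algebra_simps D_def)
    moreover have "R.yk k \<noteq> 1" using y(1)[OF that] A by auto
    ultimately show "e - fst (R.B k) \<noteq> 0" using D by auto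
  qed
  have Weq: "W / (3 * A) * (4 * A - 2 * \<tau> - 2 * (R.P * R.Q)) \<le> 17 / 25 * W"
  proof -
    have "R.P * R.Q = A - \<tau> - (A - \<tau>) * A" by (simp add: R.P_def R.Q_def algebra_simps)
    moreover have "(A - \<tau>) * A \<le> A * (1 / 50)" using A \<tau> by (intro mult_mono) auto
    ultimately have "4 * A - 2 * \<tau> - 2 * (R.P * R.Q) \<le> 51 / 25 * A" by linarith
    then have "W / (3 * A) * (4 * A - 2 * \<tau> - 2 * (R.P * R.Q)) \<le> W / (3 * A) * (51 / 25 * A)"
      using om A by (intro mult_left_mono) auto
    then show ?thesis using A by simp
  qed
  have mbL: "16 * (R.\<Lambda> * (18 * mb 3)) \<le> 16 * (6 * (\<mu> + 4) * (18 * mb 3))"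
    using Lam mb(1) by (intro mult_left_mono mult_right_mono) auto
  have ww: "16 * (R.\<Lambda> * (18 * mb 3)) + mb 3 + (\<omega>1 - \<omega>) * (4 * A - 2 * \<tau> - 2 * (R.P * R.Q)) + \<omega> * (4 * A - 2 * \<tau>)
      + 64 * (mb 5 * eta \<theta> * (4 * \<omega> + W)) + 32 * (mb (2 / a2 + 4) * eta \<theta> * (4 * \<omega>)) \<le> 4 * A * \<omega> + W"
  proof -
    have "\<omega> * (4 * A - 2 * \<tau>) \<le> \<omega> * (4 * A)" using om \<tau> by (intro mult_left_mono) auto
    then have 1: "\<omega> * (4 * A - 2 * \<tau>) \<le> 4 * A * \<omega>" by (simp only: mult.commute)
    have 2: "\<omega>1 - \<omega> = W / (3 * A)" by (simp add: \<omega>1_def)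
    have "l + m + x + y + p + q \<le> y' + W" if "l \<le> l'" "x \<le> 17 / 25 * W" "y \<le> y'" "l' + m + p + q \<le> 8 / 25 * W"
      for l l' m x y y' p q using that by linarith
    from this[OF mbL Weq 1 C] show ?thesis unfolding 2 .
  qed
  have "\<exists>d. patch S \<theta> L ((E, t), rect \<nu> A 1, 4 * A * \<omega> + W) d"
  proof (rule R.rect_patch[where \<nu>' = "\<lambda>k. if k < 12 then frm \<zeta> (e - fst (R.B k)) else \<nu>2" and a = "\<lambda>k. if k < 12 then A' else a"
        and a' = "\<lambda>k. 1" and wk = "\<lambda>k. if k < 12 then w else w2" and ?\<omega>1.0 = \<omega>1 and ?\<omega>2.0 = \<omega> and ?W1.0 = "4 * \<omega> + W" and ?W2.0 = "4 * \<omega>"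
        and ?R1.0 = 5 and ?R2.0 = "2 / a2 + 4", OF th])
    show "norm E + \<bar>t\<bar> + R.\<Lambda> \<le> L"
      using norm_triangle_ineq[of E0 "E - E0"] E1 A eps L Lam by simp
    show "E + R.D0 \<in> K3" using e by (simp add: D0 D_def)
    fix k :: nat
    show "norm (if k < 12 then frm \<zeta> (e - fst (R.B k)) else \<nu>2) = 1 \<and> 0 < (if k < 12 then A' else a) \<and> (0::real) < 1 \<and> 0 \<le> (if k < 12 then w else w2)"
      if "4 \<le> k" "k < 16"
      using frm(1)[OF nz(1) chi] that o a A A' om by (auto simp: w_def)
    show "(R.B k, rect (if k < 12 then frm \<zeta> (e - fst (R.B k)) else \<nu>2) (if k < 12 then A' else a) 1, if k < 12 then w else w2) \<in> S"
      if "4 \<le> k" "k < 16"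
      using in1[OF that(1)] B12[of k] o(1) by (cases "k < 12") auto
    show "(if k < 12 then w else w2) \<le> \<omega>1 * (4 * (if k < 12 then A' else a) * 1) \<and> (if k < 12 then w else w2) \<le> 4 * \<omega> + W"
      if "4 \<le> k" "k < 12"
    proof -
      have "A' * \<omega> \<le> 1 * \<omega>" using A A' om by (intro mult_right_mono) auto
      then show ?thesis using that w_eq by (simp add: w_def)
    qed
    show "(if k < 12 then w else w2) \<le> \<omega> * (4 * (if k < 12 then A' else a) * 1) \<and> (if k < 12 then w else w2) \<le> 4 * \<omega>"
      if "12 \<le> k" "k < 16"
    proof -
      have "\<omega> * a \<le> \<omega> * 1" using om o by (intro mult_left_mono) auto
      then show ?thesis using that o by simp
    qed
    fix x assume x: "x \<in> rect \<nu> A 1"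
    show "norm (rk (if k < 12 then frm \<zeta> (e - fst (R.B k)) else \<nu>2) (if k < 12 then A' else a) 1 x) < 5"
      if "4 \<le> k" "k < 12"
      using frm_close[OF D(1) chi A(1,3) y(1)[OF that], of x] x[unfolded \<nu>_def] that by (simp add: nz(2) A')
    show "norm (rk (if k < 12 then frm \<zeta> (e - fst (R.B k)) else \<nu>2) (if k < 12 then A' else a) 1 x) < 2 / a2 + 4"
      if "12 \<le> k" "k < 16"
    proof -
      have "1 / (2 * a) \<le> 1 / (2 * a2)" using a2 o by (intro divide_left_mono) auto
      moreover have "norm (rk \<nu>2 a 1 x) \<le> norm x * (1 / (2 * a) + 1 / (2 * 1))" using o a by (intro rk_norm) auto
      moreover have "\<dots> \<le> 3 * (1 / (2 * a) + 1 / (2 * 1))" using R.rect_bounded[of 1 x] x a by (intro mult_right_mono) auto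
      moreover have "0 < 1 / a2" using a2 by simp
      moreover have "2 / a2 = 4 * (1 / (2 * a2))" by simp
      ultimately have "norm (rk \<nu>2 a 1 x) < 2 / a2 + 4" by argo
      then show ?thesis using that by simp
    qed
  qed (use om et ww A in \<open>auto simp: \<omega>1_def\<close>)
  then show ?thesis by (simp add: \<sigma>' A_def \<nu>_def \<zeta>_def D_def)
qed

section \<open>The system of states\<close>

lemma K3_inner: "e \<in> K3 \<Longrightarrow> e' \<in> K3 \<Longrightarrow> Re (cnj e * e') = (if e = e' then 1 else - 1 / 2)"
  unfolding K3_def by (elim insertE emptyE; hypsubst; simp add: complex_eq_iff)

lemma K3_norm: "e \<in> K3 \<Longrightarrow> norm e = 1"
  by (auto simp: K3_def cmod_def power_divide)

text \<open>Coordinates of \<open>E\<close> in a cone spanned by two wells. The sum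
  \<open>a + b\<close> is the gauge of the triangle, as \<open>rp_psi\<close> shows; the order
  \<open>b \<le> a\<close> makes \<open>a = 0\<close> happen only at the origin.\<close>

definition rp :: "complex \<Rightarrow> complex \<Rightarrow> complex \<Rightarrow> real \<Rightarrow> real \<Rightarrow> bool" where
  "rp E e e' a b \<longleftrightarrow> e \<in> K3 \<and> e' \<in> K3 \<and> e \<noteq> e' \<and> 0 \<le> b \<and> b \<le> a \<and> E = of_real a * e + of_real b * e'"

lemma rp_ex: "\<exists>e e' a b. rp E e e' a b"
proof -
  have sw: "\<exists>e e' a b. rp E e e' a b"
    if "e \<in> K3" "e' \<in> K3" "e \<noteq> e'" "0 \<le> a" "0 \<le> b" "E = of_real a * e + of_real b * e'" for e e' a b
  proof (cases "b \<le> a")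
    case True
    then show ?thesis using that unfolding rp_def by blast
  next
    case False
    then have "rp E e' e b a" using that unfolding rp_def by (simp add: add.commute)
    then show ?thesis by blast
  qed
  define x where "x = Re E"
  define y where "y = Im E / sqrt 3"
  have E: "E = Complex x (y * sqrt 3)" by (simp add: x_def y_def complex_eq_iff)
  have s3: "sqrt 3 \<noteq> 0" by simp
  \<comment> \<open>The coefficients of \<open>E\<close> with respect to the three pairs of wells;
    at least one pair is nonnegative.\<close>
  have "(0 \<le> x + y \<and> 0 \<le> 2 * y) \<or> (0 \<le> x - y \<and> 0 \<le> - 2 * y) \<or> (0 \<le> y - x \<and> 0 \<le> - x - y)" by argo
  then show ?thesis
  proof (elim disjE)
    assume "0 \<le> x + y \<and> 0 \<le> 2 * y"
    then show ?thesis by (intro sw[of 1 "Complex (-1/2) (sqrt 3 / 2)" "x + y" "2 * y"]) (auto simp: K3_def E complex_eq_iff)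
  next
    assume "0 \<le> x - y \<and> 0 \<le> - 2 * y"
    then show ?thesis by (intro sw[of 1 "Complex (-1/2) (- sqrt 3 / 2)" "x - y" "- 2 * y"]) (auto simp: K3_def E complex_eq_iff)
  next
    assume "0 \<le> y - x \<and> 0 \<le> - x - y"
    then show ?thesis by (intro sw[of "Complex (-1/2) (sqrt 3 / 2)" "Complex (-1/2) (- sqrt 3 / 2)" "y - x" "- x - y"])
       (auto simp: K3_def E complex_eq_iff algebra_simps)
  qed
qed

text \<open>The well outside the pair has inner product -1/2 with both wells of the pair, so it
  yields exactly \<open>a + b\<close>; the two wells of the pair yield no more.\<close>

lemma rp_psi:
  assumes "rp E e e' a b"
  shows "k \<in> K3 \<Longrightarrow> - 2 * Re (cnj k * E) \<le> a + b" "\<exists>k\<in>K3. - 2 * Re (cnj k * E) = a + b"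
proof -
  note r = assms[unfolded rp_def]
  have I: "Re (cnj k * E) = a * Re (cnj k * e) + b * Re (cnj k * e')" for k
    using r by (simp add: distrib_left mult.left_commute)
  show "- 2 * Re (cnj k * E) \<le> a + b" if "k \<in> K3"
    unfolding I using K3_inner[OF that, of e] K3_inner[OF that, of e'] r by auto
  have "\<exists>k\<in>K3. k \<noteq> e \<and> k \<noteq> e'" if "e \<in> K3" "e' \<in> K3"
    using that unfolding K3_def by (elim insertE emptyE; hypsubst; simp) (simp_all add: complex_eq_iff)
  then obtain k where k: "k \<in> K3" "k \<noteq> e" "k \<noteq> e'" using r by blast
  have "- 2 * Re (cnj k * E) = a + b"
    unfolding I using K3_inner[OF k(1), of e] K3_inner[OF k(1), of e'] r k by auto
  then show "\<exists>k\<in>K3. - 2 * Re (cnj k * E) = a + b" using k by blast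
qed

section \<open>States near the centre\<close>

text \<open>One fixed shape of area 8/3, so that \<omega> is the weight per area. The finished cells
  always go to the well 1.\<close>

definition Ball :: "real \<Rightarrow> real \<Rightarrow> state set" where
  "Ball T \<omega> = {((E, t), rect (frm (sg t) (1 - E)) (2 / 3) 1, 8 / 3 * \<omega>) |E t. norm E \<le> 1 / 25 \<and> \<bar>t\<bar> \<le> T}"

text \<open>For \<open>A = 2 / 3\<close>, \<open>\<tau> = 1 / 6\<close>, \<open>\<sigma> = 1\<close>
  one has \<open>k1 = k2\<close>, so the inner cells carry \<open>E\<close> again and return to
  \<open>Ball\<close>, with the skew part moved against its sign. The finished cells take area at
  least 1/3, and the cells that leave \<open>Ball\<close> have area at most 2. So the third of
  \<omega> that is saved has to pay for the costs and for the excess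
  \<open>\<omega>s - \<omega>\<close> on area 2.\<close>

lemma ball_patch:
  assumes th: "0 < \<theta>" "\<theta> < 1" and S: "Ball T \<omega> \<subseteq> S" and T: "1 \<le> T" and om: "0 \<le> \<omega>" "\<omega> \<le> \<omega>s" and et: "0 \<le> eta \<theta>"
    and orc: "\<And>E' t'. (\<And>k. k \<in> K3 \<Longrightarrow> - 2 * Re (cnj k * E') \<le> 3 / 4) \<Longrightarrow> \<exists>k\<in>K3. \<bar>t'\<bar> \<le> T + (- 2 * Re (cnj k * E')) - 1 / 25 \<Longrightarrow>
      \<exists>\<nu> a w. ((E', t'), rect \<nu> a 1, w) \<in> S \<and> norm \<nu> = 1 \<and> a2 \<le> a \<and> a \<le> 1 \<and> 0 \<le> w \<and> w \<le> \<omega>s * (4 * a)"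
    and a2: "0 < a2" and L: "T + 10 \<le> L"
    and C: "16 * (6 * (18 * mb 3)) + mb 3 + (\<omega>s - \<omega>) * 2 + 64 * (mb (2 / a2 + 4) * eta \<theta> * (4 * \<omega>s))
       + 32 * (mb 7 * eta \<theta> * (4 * \<omega>)) \<le> 1 / 3 * \<omega>"
    and \<sigma>: "\<sigma> \<in> Ball T \<omega>"
  shows "\<exists>d. patch S \<theta> L \<sigma> d"
proof -
  obtain E t where \<sigma>': "\<sigma> = ((E, t), rect (frm (sg t) (1 - E)) (2 / 3) 1, 8 / 3 * \<omega>)" and E: "norm E \<le> 1 / 25" and t: "\<bar>t\<bar> \<le> T"
    using \<sigma> unfolding Ball_def by blast
  define \<zeta> where "\<zeta> = sg t"
  have chi: "\<bar>\<zeta>\<bar> = 1" by (simp add: \<zeta>_def sg)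
  define D where "D = 1 - E"
  have nD: "24 / 25 \<le> norm D" "norm D \<le> 26 / 25"
    using norm_triangle_ineq2[of 1 E] norm_triangle_ineq4[of 1 E] E by (auto simp: D_def)
  then have D: "D \<noteq> 0" by auto
  define \<nu> where "\<nu> = frm \<zeta> D"
  have n\<nu>: "norm \<nu> = 1" using frm(1)[OF D chi] by (simp add: \<nu>_def)
  define s where "s = 2 * (\<zeta> * norm D)"
  have sD: "\<bar>s\<bar> = 2 * norm D" by (simp add: s_def abs_mult chi)
  interpret R: rectangle \<nu> "2 / 3" "1 / 6" 1 s t E
    using n\<nu> by unfold_locales auto
  have D0: "R.D0 = D" using frm(2)[OF D chi] unfolding R.D0_def by (simp add: s_def \<nu>_def)
  have val: "R.\<Delta> = 5 / 6" "R.P = 1 / 2" "R.Q = 1 / 3" "R.k1 = 1 / 3" "R.k2 = 1 / 3"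
    by (simp_all add: R.\<Delta>_def R.P_def R.Q_def R.k1_def R.k2_def)
  have Lam: "R.\<Lambda> \<le> 6" using sD nD by (simp add: R.\<Lambda>_def val)
  have yk1: "R.yk k = - 1 / 6" "R.al k + R.be k = - 1 / 6" if "4 \<le> k" "k < 8" for k
    using that by (simp_all add: R.yk_def R.al_def R.be_def R.ga_def)
  have yk2: "R.yk k = Complex (- 1 / 6) (2 / 5) \<or> R.yk k = Complex (- 1 / 6) (- 2 / 5)" "R.al k + R.be k = 7 / 30" if "8 \<le> k" "k < 12" for k
    using that R.e12(1)[of k] R.e12(2)[of k]
    by (auto simp: R.yk_def R.al_def R.be_def R.ga_def val complex_eq_iff power2_eq_square)
  have ga12: "R.ga k = 0" "R.al k = 1 / 3" "R.be k = 1 / 3" if "12 \<le> k" for k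
    using that by (simp_all add: R.ga_def R.al_def R.be_def val)
  define t2 where "t2 = t - \<zeta> * (2 / 3 * norm D)"
  have B12: "R.B k = (E, t2)" if "12 \<le> k" for k
    unfolding R.B_alt R.yk_def ga12[OF that] D0 by (simp add: t2_def s_def)
  have t2: "\<bar>t2\<bar> \<le> T"
    using sg_diff[of "2 / 3 * norm D" t] nD t T by (auto simp: t2_def \<zeta>_def)
  have st: "t - s * c / 2 = t - \<zeta> * (c * norm D)" for c by (simp add: s_def)
  have ex: "\<exists>\<nu> a w. (R.B k, rect \<nu> a 1, w) \<in> S \<and> norm \<nu> = 1 \<and> a2 \<le> a \<and> a \<le> 1 \<and> 0 \<le> w \<and> w \<le> \<omega>s * (4 * a)" if k: "4 \<le> k" "k < 12" for k
  proof -
    have E': "fst (R.B k) = R.yk k + E * (1 - R.yk k)" by (simp add: R.B_alt D0 D_def algebra_simps)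
    have ny: "norm (1 - R.yk k) \<le> 13 / 10"
    proof (cases "k < 8")
      case False
      then have "norm (1 - R.yk k) = sqrt ((7 / 6)\<^sup>2 + (2 / 5)\<^sup>2)" using yk2(1)[of k] k by (auto simp: cmod_def)
      also have "\<dots> \<le> 13 / 10" by (rule real_le_lsqrt) (auto simp: power2_eq_square)
      finally show ?thesis .
    qed (use yk1(1)[of k] k in simp)
    have small: "\<bar>Re (cnj j * (E * (1 - R.yk k)))\<bar> \<le> 13 / 250" if "j \<in> K3" for j
    proof -
      have "\<bar>Re (cnj j * (E * (1 - R.yk k)))\<bar> \<le> norm (cnj j * (E * (1 - R.yk k)))" by (rule abs_Re_le_cmod)
      also have "\<dots> = norm E * norm (1 - R.yk k)" using K3_norm[OF that] by (simp add: norm_mult)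
      also have "\<dots> \<le> 1 / 25 * (13 / 10)" using E ny by (intro mult_mono) auto
      finally show ?thesis by simp
    qed
    have split: "Re (cnj j * fst (R.B k)) = Re (cnj j * R.yk k) + Re (cnj j * (E * (1 - R.yk k)))" for j
      unfolding E' by (simp only: distrib_left plus_complex.sel)
    have s0: "0 \<le> sqrt 3" by simp
    have s3: "sqrt 3 \<le> 174 / 100" by (rule real_le_lsqrt) (auto simp: power2_eq_square)
    have yK: "- 2 * Re (cnj j * R.yk k) \<le> 56 / 100" if "j \<in> K3" for j
    proof (cases "k < 8")
      case True
      then show ?thesis using yk1(1)[OF k(1)] that by (auto simp: K3_def)
    next
      case False
      have "- (25 / 6) - 10 * sqrt 3 \<le> 14" using s0 by linarith
      then show ?thesis using False yk2(1)[of k] k that s3 by (auto simp: K3_def)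
    qed
    \<comment> \<open>The value 56/100 at the centre and the error 13/125 due to \<open>E\<close>
      add up to less than 3/4, the gauge allowed for states that leave \<open>Ball\<close>.\<close>
    have up: "- 2 * Re (cnj j * fst (R.B k)) \<le> 3 / 4" if "j \<in> K3" for j
      using split[of j] small[OF that] yK[OF that] by linarith
    have one: "1 \<in> K3" by (simp add: K3_def)
    have "Re (R.yk k) = - 1 / 6" using yk1(1)[of k] yk2(1)[of k] k by (cases "k < 8") auto
    then have lo: "1 / 3 - 13 / 125 \<le> - 2 * Re (cnj 1 * fst (R.B k))"
      using split[of 1] small[OF one] by (simp only: complex_cnj_one mult_1) argo
    \<comment> \<open>The well 1 shows that the gauge is at least 1/3 - 13/125. After subtracting
      1/25 this still exceeds 13/75, the largest possible increase of the skew part.\<close>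
    have "\<bar>snd (R.B k)\<bar> \<le> T + (- 2 * Re (cnj 1 * fst (R.B k))) - 1 / 25"
    proof (cases "k < 8")
      case True
      then have "snd (R.B k) = t + \<zeta> * (1 / 6 * norm D)" unfolding R.B_alt snd_conv st using yk1(2)[of k] k by simp
      moreover have "\<bar>\<zeta> * (1 / 6 * norm D)\<bar> \<le> 13 / 75" unfolding abs_mult chi using nD by simp
      ultimately show ?thesis using lo t by linarith
    next
      case False
      then have "snd (R.B k) = t - \<zeta> * (7 / 30 * norm D)" unfolding R.B_alt snd_conv st using yk2(2)[of k] k by simp
      then show ?thesis using sg_diff[of "7 / 30 * norm D" t] nD lo t T by (auto simp: \<zeta>_def)
    qed
    then have "\<exists>j\<in>K3. \<bar>snd (R.B k)\<bar> \<le> T + (- 2 * Re (cnj j * fst (R.B k))) - 1 / 25"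
      by (rule bexI[where x = 1, OF _ one])
    from orc[OF up this] show ?thesis by (simp only: prod.collapse)
  qed
  then obtain \<nu>' a w where c: "\<And>k. 4 \<le> k \<Longrightarrow> k < 12 \<Longrightarrow> (R.B k, rect (\<nu>' k) (a k) 1, w k) \<in> S \<and> norm (\<nu>' k) = 1 \<and> a2 \<le> a k \<and> a k \<le> 1 \<and> 0 \<le> w k \<and> w k \<le> \<omega>s * (4 * a k)"
    by metis
  define \<nu>2 where "\<nu>2 = frm (sg t2) (1 - E)"
  have n2: "norm \<nu>2 = 1" using frm(1)[of "1 - E" "sg t2"] D sg by (simp add: \<nu>2_def D_def)
  have in2: "((E, t2), rect \<nu>2 (2 / 3) 1, 8 / 3 * \<omega>) \<in> S"
  proof -
    have "((E, t2), rect \<nu>2 (2 / 3) 1, 8 / 3 * \<omega>) \<in> Ball T \<omega>"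
      unfolding Ball_def mem_Collect_eq \<nu>2_def
      by (rule exI[of _ E], rule exI[of _ t2], rule conjI, rule HOL.refl, rule conjI, rule E, rule t2)
    then show ?thesis using S by blast
  qed
  have rk: "norm (rk \<nu>0 b 1 x) < 2 / b0 + 4" if x: "x \<in> rect \<nu> (2 / 3) 1" and b: "norm \<nu>0 = 1" "b0 \<le> b" "0 < b0" for \<nu>0 b b0 x
  proof -
    have b': "0 < b" using b by linarith
    have "1 / (2 * b) \<le> 1 / (2 * b0)" using b b' by (intro divide_left_mono) auto
    moreover have "norm (rk \<nu>0 b 1 x) \<le> norm x * (1 / (2 * b) + 1 / (2 * 1))" using b b' by (intro rk_norm) auto
    moreover have "\<dots> \<le> 3 * (1 / (2 * b) + 1 / (2 * 1))" using R.rect_bounded[of 1 x] x b' by (intro mult_right_mono) auto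
    moreover have "0 < 1 / (2 * b0)" using b by simp
    moreover have "2 / b0 = 4 * (1 / (2 * b0))" by simp
    ultimately show ?thesis by argo
  qed
  have ww: "16 * (R.\<Lambda> * (18 * mb 3)) + mb 3 + (\<omega>s - \<omega>) * (4 * (2 / 3) - 2 * (1 / 6) - 2 * (R.P * R.Q)) + \<omega> * (4 * (2 / 3) - 2 * (1 / 6))
      + 64 * (mb (2 / a2 + 4) * eta \<theta> * (4 * \<omega>s)) + 32 * (mb 7 * eta \<theta> * (4 * \<omega>)) \<le> 8 / 3 * \<omega>"
  proof -
    have 1: "16 * (R.\<Lambda> * (18 * mb 3)) \<le> 16 * (6 * (18 * mb 3))"
      using Lam mb(1) by (intro mult_left_mono mult_right_mono) auto
    have 2: "(\<omega>s - \<omega>) * (4 * (2 / 3) - 2 * (1 / 6) - 2 * (R.P * R.Q)) = (\<omega>s - \<omega>) * 2" by (simp add: val)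
    have "l + m + x + \<omega> * (4 * (2 / 3) - 2 * (1 / 6)) + p + q \<le> 8 / 3 * \<omega>" if "l \<le> l'" "l' + m + x + p + q \<le> 1 / 3 * \<omega>"
      for l l' m x p q using that by (simp add: field_simps)
    from this[OF 1 C] show ?thesis unfolding 2 .
  qed
  have "\<exists>d. patch S \<theta> L ((E, t), rect \<nu> (2 / 3) 1, 8 / 3 * \<omega>) d"
  proof (rule R.rect_patch[where \<nu>' = "\<lambda>k. if k < 12 then \<nu>' k else \<nu>2" and a = "\<lambda>k. if k < 12 then a k else 2 / 3"
        and a' = "\<lambda>k. 1" and wk = "\<lambda>k. if k < 12 then w k else 8 / 3 * \<omega>" and ?\<omega>1.0 = \<omega>s and ?\<omega>2.0 = \<omega> and ?W1.0 = "4 * \<omega>s" and ?W2.0 = "4 * \<omega>"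
        and ?R1.0 = "2 / a2 + 4" and ?R2.0 = 7, OF th])
    show "norm E + \<bar>t\<bar> + R.\<Lambda> \<le> L" using E t L Lam by linarith
    show "E + R.D0 \<in> K3" by (simp add: D0 D_def K3_def)
    fix k :: nat
    show "norm (if k < 12 then \<nu>' k else \<nu>2) = 1 \<and> 0 < (if k < 12 then a k else 2 / 3) \<and> (0::real) < 1 \<and> 0 \<le> (if k < 12 then w k else 8 / 3 * \<omega>)"
      if "4 \<le> k" "k < 16" using c[of k] n2 that a2 om by auto
    show "(R.B k, rect (if k < 12 then \<nu>' k else \<nu>2) (if k < 12 then a k else 2 / 3) 1, if k < 12 then w k else 8 / 3 * \<omega>) \<in> S"
      if "4 \<le> k" "k < 16"
      using c[OF that(1)] B12[of k] in2 by (cases "k < 12") auto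
    show "(if k < 12 then w k else 8 / 3 * \<omega>) \<le> \<omega>s * (4 * (if k < 12 then a k else 2 / 3) * 1) \<and> (if k < 12 then w k else 8 / 3 * \<omega>) \<le> 4 * \<omega>s"
      if "4 \<le> k" "k < 12"
    proof -
      have "\<omega>s * (4 * a k) \<le> \<omega>s * (4 * 1)" using c[OF that] om by (intro mult_left_mono) auto
      then have "w k \<le> 4 * \<omega>s" using c[OF that] by linarith
      then show ?thesis using that c[OF that] by simp
    qed
    show "(if k < 12 then w k else 8 / 3 * \<omega>) \<le> \<omega> * (4 * (if k < 12 then a k else 2 / 3) * 1) \<and> (if k < 12 then w k else 8 / 3 * \<omega>) \<le> 4 * \<omega>"
      if "12 \<le> k" "k < 16" using that om by simp
    fix x assume x: "x \<in> rect \<nu> (2 / 3) 1"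
    show "norm (rk (if k < 12 then \<nu>' k else \<nu>2) (if k < 12 then a k else 2 / 3) 1 x) < 2 / a2 + 4"
      if "4 \<le> k" "k < 12"
      using rk[OF x, of "\<nu>' k" a2 "a k"] c[OF that] a2 that by simp
    show "norm (rk (if k < 12 then \<nu>' k else \<nu>2) (if k < 12 then a k else 2 / 3) 1 x) < 7"
      if "12 \<le> k" "k < 16"
      using rk[OF x, of "\<nu>2" "2 / 3" "2 / 3"] n2 that by simp
  qed (use om et ww in auto)
  then show ?thesis by (simp add: \<sigma>' \<nu>_def \<zeta>_def D_def)
qed

section \<open>Runs that lead to the centre\<close>

text \<open>Parameters of two successive runs for gradients of gauge at most \<psi>. The factor 1 +
  \<mu> by which a step beyond the old gradient magnifies errors is at most 1 / (1 - \<psi>); two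
  steps explain the square in the condition on \<epsilon>. The tolerance \<rho> absorbs all errors
  and is at most the radius 1/25 used in \<open>Ball\<close>. The condition on \<open>T\<close>
  leaves room for skew parts that overshoot zero.\<close>

locale family =
  fixes T \<rho> \<psi> \<epsilon> \<omega>0 WR WG \<theta> L :: real
  assumes th: "0 < \<theta>" "\<theta> < 1" and et: "0 \<le> eta \<theta>" and rho: "0 < \<rho>" "\<rho> \<le> 1 / 25" and psi: "0 < \<psi>" "\<psi> < 1" "2 * \<rho> \<le> 1 - \<psi>"
    and eps: "0 < \<epsilon>" "\<epsilon> \<le> 1 / 50" "120 * (1 / (1 - \<psi>))\<^sup>2 * \<epsilon> \<le> \<rho>" and T: "2 * (1 / (1 - \<psi>)) + 1 \<le> T"
    and om: "0 \<le> \<omega>0" "0 \<le> WR" "0 \<le> WG"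
    and L: "T + 4 + 6 * (1 / (1 - \<psi>) + 4) \<le> L"
begin

definition "\<kappa> = 1 / (1 - \<psi>)"
text \<open>A bound for the error with which the inner cells of \<open>Gen\<close> enter
  \<open>Ray\<close>.\<close>

definition "\<delta> = 60 * (\<kappa> * \<epsilon>)"
text \<open>Weight per area at the start of a run, where the rectangle has area
  \<open>4 * \<epsilon>\<close>.\<close>

definition "\<omega>R = \<omega>0 + WR / (4 * \<epsilon>)"
definition "\<omega>G = \<omega>R + WG / (4 * \<epsilon>)"
text \<open>\<open>Gen\<close> steps away from \<open>e\<close> and so reaches the segment between 0
  and the second well \<open>e'\<close>; \<open>Ray\<close> starts on such a segment, steps away
  from its well and reaches 0. In both the skew part may be as large as \<open>T\<close> plus the
  gauge of the base point, less the tolerance.\<close>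

definition "Ray = \<Union>{Run (of_real g * e) t0 e \<delta> \<epsilon> \<omega>0 WR |e g t0. e \<in> K3 \<and> 0 < g \<and> g \<le> \<psi> \<and> \<bar>t0\<bar> \<le> T + g - \<rho>}"
definition "Gen = \<Union>{Run E0 t0 e 0 \<epsilon> \<omega>R WG |E0 e e' a b t0. rp E0 e e' a b \<and> 0 < b \<and> a + b \<le> \<psi> \<and> \<bar>t0\<bar> \<le> T + (a + b) - \<rho>}"

lemma kap: "1 \<le> \<kappa>" "120 * \<kappa> * (\<kappa> * \<epsilon>) \<le> \<rho>" "120 * (\<kappa> * \<epsilon>) \<le> \<rho>" "\<epsilon> \<le> \<kappa> * \<epsilon>" "2 * \<kappa> + 1 \<le> T" "0 \<le> \<omega>R" "\<omega>0 \<le> \<omega>R"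
  "\<omega>R \<le> \<omega>G"
proof -
  show k: "1 \<le> \<kappa>" using psi by (simp add: \<kappa>_def)
  show k2: "120 * \<kappa> * (\<kappa> * \<epsilon>) \<le> \<rho>" using eps(3) by (simp add: \<kappa>_def power2_eq_square mult_ac)
  show "\<epsilon> \<le> \<kappa> * \<epsilon>" using k eps by simp
  have "1 * (\<kappa> * \<epsilon>) \<le> \<kappa> * (\<kappa> * \<epsilon>)" using k eps by (intro mult_right_mono) auto
  then show "120 * (\<kappa> * \<epsilon>) \<le> \<rho>" using k2 by linarith
  show "2 * \<kappa> + 1 \<le> T" using T by (simp add: \<kappa>_def)
  show "0 \<le> \<omega>R" "\<omega>0 \<le> \<omega>R" "\<omega>R \<le> \<omega>G" using om eps by (auto simp: \<omega>R_def \<omega>G_def)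
qed

lemma quot: "0 < a \<Longrightarrow> a \<le> \<psi> \<Longrightarrow> 0 < a / (1 - a) \<and> 1 + a / (1 - a) \<le> \<kappa>"
proof -
  assume a: "0 < a" "a \<le> \<psi>"
  have "1 + a / (1 - a) = 1 / (1 - a)" using a psi by (simp add: field_simps)
  also have "\<dots> \<le> \<kappa>" unfolding \<kappa>_def using a psi by (intro divide_left_mono) auto
  finally show ?thesis using a psi by simp
qed

lemma mbC: "\<mu> \<le> \<kappa> \<Longrightarrow> 16 * (6 * (\<kappa> + 4) * (18 * mb 3)) + m + x + y \<le> z \<Longrightarrow> 16 * (6 * (\<mu> + 4) * (18 * mb 3)) + m + x + y \<le> z"
proof -
  assume "\<mu> \<le> \<kappa>" and z: "16 * (6 * (\<kappa> + 4) * (18 * mb 3)) + m + x + y \<le> z"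
  then have "16 * (6 * (\<mu> + 4) * (18 * mb 3)) \<le> 16 * (6 * (\<kappa> + 4) * (18 * mb 3))"
    using mb(1) by (intro mult_left_mono mult_right_mono) auto
  then show ?thesis using z by linarith
qed

text \<open>The choice \<mu> = g / (1 - g) sends \<open>of_real g * e\<close> to 0. The drift is
  then \<mu> * (1 - g) = g, exactly the part of the allowance \<open>T + g\<close> that is
  lost.\<close>

lemma ray_patch:
  assumes S: "Ball T \<omega>0 \<subseteq> S" "Ray \<subseteq> S" and \<sigma>: "\<sigma> \<in> Ray"
    and C: "16 * (6 * (\<kappa> + 4) * (18 * mb 3)) + mb 3 + 64 * (mb 5 * eta \<theta> * (4 * \<omega>0 + WR)) + 32 * (mb 7 * eta \<theta> * (4 * \<omega>0)) \<le> 8 / 25 * WR"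
  shows "\<exists>d. patch S \<theta> L \<sigma> d"
proof -
  obtain e g t0 where \<sigma>': "\<sigma> \<in> Run (of_real g * e) t0 e \<delta> \<epsilon> \<omega>0 WR" and g: "e \<in> K3" "0 < g" "g \<le> \<psi>" "\<bar>t0\<bar> \<le> T + g - \<rho>"
    using \<sigma> unfolding Ray_def by blast
  have sub: "Run (of_real g * e) t0 e \<delta> \<epsilon> \<omega>0 WR \<subseteq> S" using S(2) g unfolding Ray_def by blast
  define \<mu> where "\<mu> = g / (1 - g)"
  have mu: "0 < \<mu>" "1 + \<mu> \<le> \<kappa>" using quot[of g] g by (auto simp: \<mu>_def)
  have g1: "0 < 1 - g" using g psi by simp
  have mg: "\<mu> * (1 - g) = g" using g1 by (simp add: \<mu>_def)
  have e1: "e - of_real g * e = of_real (1 - g) * e" by (simp add: algebra_simps)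
  have ne: "norm (e - of_real g * e) = 1 - g" unfolding e1 using g1 K3_norm[OF g(1)] by (simp only: norm_mult norm_of_real) simp
  have B0: "of_real g * e - of_real \<mu> * (e - of_real g * e) = 0"
    unfolding e1 using mg by (simp add: mult.assoc[symmetric] of_real_mult[symmetric] del: of_real_mult of_real_diff)
  have d: "0 \<le> \<delta>" "\<delta> + 48 * \<epsilon> \<le> \<rho>" "\<delta> + 60 * \<epsilon> \<le> 120 * (\<kappa> * \<epsilon>)" unfolding \<delta>_def using kap eps by linarith+
  have far: "(1 + \<mu>) * (\<delta> + 60 * \<epsilon>) \<le> \<rho>"
  proof -
    have "(1 + \<mu>) * (\<delta> + 60 * \<epsilon>) \<le> \<kappa> * (120 * (\<kappa> * \<epsilon>))" using mu d eps by (intro mult_mono) auto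
    then show ?thesis using kap(2) by (simp add: mult_ac)
  qed
  have seven: "2 / (2 / 3) + 4 = (7::real)" by simp
  show ?thesis
  proof (rule run_patch[OF th g(1) mu(1) eps(1,2) d(1) _ _ _ sub _ _ om(1,2) et _ \<sigma>', where ?a2.0 = "2 / 3"])
    show "\<delta> + 48 * \<epsilon> < norm (e - of_real g * e)" "norm (e - of_real g * e) + \<delta> + 48 * \<epsilon> \<le> 3"
      using d g psi rho unfolding ne by linarith+
    have "norm (of_real g * e) \<le> 1" using g psi K3_norm[OF g(1)] by (simp add: norm_mult)
    then show "norm (of_real g * e) + \<bar>t0\<bar> + 2 * (\<delta> + 48 * \<epsilon>) + 6 * (\<mu> + 4) \<le> L"
    proof -
      have "\<bar>t0\<bar> \<le> T + 1" "2 * (\<delta> + 48 * \<epsilon>) \<le> 1" "6 * (\<mu> + 4) \<le> 6 * (\<kappa> + 4)" using g psi rho d(2) mu(2) by auto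
      then show ?thesis using \<open>norm (of_real g * e) \<le> 1\<close> L[folded \<kappa>_def] by linarith
    qed
    fix E' t' assume h: "norm (E' - (of_real g * e - of_real \<mu> * (e - of_real g * e))) \<le> (1 + \<mu>) * (\<delta> + 60 * \<epsilon>)"
      "\<bar>t' - (t0 - sg t0 * (\<mu> * norm (e - of_real g * e)))\<bar> \<le> (1 + \<mu>) * (\<delta> + 60 * \<epsilon>)"
    have 1: "norm E' \<le> 1 / 25" using h(1) far rho unfolding B0 by simp
    have "\<bar>t0 - sg t0 * g\<bar> \<le> T - \<rho>" using sg_diff[of g t0] g psi kap rho by (auto simp: max_def split: if_splits)
    then have 2: "\<bar>t'\<bar> \<le> T" using h(2) far unfolding ne mg by linarith
    have "((E', t'), rect (frm (sg t') (1 - E')) (2 / 3) 1, 8 / 3 * \<omega>0) \<in> Ball T \<omega>0"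
      unfolding Ball_def mem_Collect_eq
      by (rule exI[of _ E'], rule exI[of _ t'], rule conjI, rule HOL.refl, rule conjI, rule 1, rule 2)
    moreover have "1 - E' \<noteq> 0" using 1 by auto
    ultimately show "\<exists>\<nu> a w. ((E', t'), rect \<nu> a 1, w) \<in> S \<and> norm \<nu> = 1 \<and> 2 / 3 \<le> a \<and> a \<le> 1 \<and> 0 \<le> w \<and> w \<le> \<omega>0 * (4 * a)"
      using S(1) frm(1)[of "1 - E'" "sg t'"] sg om by (intro exI[of _ "frm (sg t') (1 - E')"] exI[of _ "2 / 3"] exI[of _ "8 / 3 * \<omega>0"]) auto
  next
    show "16 * (6 * (\<mu> + 4) * (18 * mb 3)) + mb 3 + 64 * (mb 5 * eta \<theta> * (4 * \<omega>0 + WR)) +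
      32 * (mb (2 / (2 / 3) + 4) * eta \<theta> * (4 * \<omega>0)) \<le> 8 / 25 * WR"
      unfolding seven by (rule mbC[OF _ C]) (use mu in linarith)
  qed simp
qed

text \<open>The choice \<mu> = a / (1 - a) cancels the component along \<open>e\<close> and leaves
  \<open>of_real g * e'\<close> with g = b / (1 - a), again of gauge at most \<psi>. The drift is at
  least \<mu> * (1 - (a + b)) = a + b - g, the loss of gauge; if it overshoots zero, it is still at
  most \<open>2 * \<kappa>\<close>, hence below \<open>T\<close>.\<close>

lemma gen_patch:
  assumes S: "Ray \<subseteq> S" "Gen \<subseteq> S" and \<sigma>: "\<sigma> \<in> Gen"
    and C: "16 * (6 * (\<kappa> + 4) * (18 * mb 3)) + mb 3 + 64 * (mb 5 * eta \<theta> * (4 * \<omega>R + WG)) + 32 * (mb (2 / \<epsilon> + 4) * eta \<theta> * (4 * \<omega>R)) \<le> 8 / 25 * WG"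
  shows "\<exists>d. patch S \<theta> L \<sigma> d"
proof -
  obtain E0 e e' a b t0 where \<sigma>': "\<sigma> \<in> Run E0 t0 e 0 \<epsilon> \<omega>R WG" and r: "rp E0 e e' a b" "0 < b" "a + b \<le> \<psi>" "\<bar>t0\<bar> \<le> T + (a + b) - \<rho>"
    using \<sigma> unfolding Gen_def by blast
  have sub: "Run E0 t0 e 0 \<epsilon> \<omega>R WG \<subseteq> S" using S(2) r unfolding Gen_def by blast
  note r' = r(1)[unfolded rp_def]
  define \<mu> where "\<mu> = a / (1 - a)"
  define g where "g = b / (1 - a)"
  have a: "0 < a" "a \<le> \<psi>" "0 < 1 - a" using r' r psi by auto
  have mu: "0 < \<mu>" "1 + \<mu> \<le> \<kappa>" using quot[of a] a by (auto simp: \<mu>_def)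
  have g: "0 < g" "g \<le> \<psi>"
  proof -
    have "b \<le> \<psi> - a" using r by simp
    also have "\<dots> \<le> \<psi> * (1 - a)" using a psi mult_right_mono[of \<psi> 1 a] by (simp add: algebra_simps)
    finally show "g \<le> \<psi>" using a by (simp add: g_def divide_le_eq)
  qed (use r a in \<open>simp add: g_def\<close>)
  have B0: "E0 - of_real \<mu> * (e - E0) = of_real g * e'"
  proof -
    have "a - \<mu> * (1 - a) = 0" "b + \<mu> * b = g" using a by (simp_all add: \<mu>_def g_def field_simps)
    moreover have "E0 - of_real \<mu> * (e - E0) = of_real (a - \<mu> * (1 - a)) * e + of_real (b + \<mu> * b) * e'"
      using r' by (simp add: algebra_simps)
    ultimately show ?thesis by simp
  qed
  have n0: "norm E0 \<le> a + b"
    using norm_triangle_ineq[of "of_real a * e" "of_real b * e'"] r' K3_norm by (simp add: norm_mult)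
  have n1: "1 - (a + b) \<le> norm (e - E0)" "norm (e - E0) \<le> 2"
    using norm_triangle_ineq2[of e E0] norm_triangle_ineq4[of e E0] n0 K3_norm[of e] r' r psi by auto
  define q where "q = \<mu> * norm (e - E0)"
  have q: "a + b - g \<le> q" "q \<le> 2 * \<kappa>" "0 \<le> q"
  proof -
    have "a + b - g = \<mu> * (1 - (a + b))" using a by (simp add: \<mu>_def g_def field_simps)
    also have "\<dots> \<le> q" unfolding q_def using n1 mu by (intro mult_left_mono) auto
    finally show "a + b - g \<le> q" .
    have "q \<le> \<kappa> * 2" unfolding q_def using n1 mu by (intro mult_mono) auto
    then show "q \<le> 2 * \<kappa>" by simp
  qed (use mu in \<open>simp add: q_def\<close>)
  define t1 where "t1 = t0 - sg t0 * q"
  have t1: "\<bar>t1\<bar> \<le> T + g - \<rho>" using sg_diff[of q t0] q r kap rho g by (auto simp: t1_def)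
  have far: "(1 + \<mu>) * (0 + 60 * \<epsilon>) \<le> \<delta>"
  proof -
    have "(1 + \<mu>) * (60 * \<epsilon>) \<le> \<kappa> * (60 * \<epsilon>)" using mu eps by (intro mult_right_mono) auto
    then show ?thesis by (simp add: \<delta>_def mult_ac)
  qed
  have d: "\<delta> \<le> \<rho>" "48 * \<epsilon> \<le> \<rho>" unfolding \<delta>_def using kap eps by linarith+
  show ?thesis
  proof (rule run_patch[OF th _ mu(1) eps(1,2) _ _ _ _ sub _ eps(1) kap(6) om(3) et _ \<sigma>'])
    show "e \<in> K3" using r' by simp
    show "0 + 48 * \<epsilon> < norm (e - E0)" "norm (e - E0) + 0 + 48 * \<epsilon> \<le> 3"
      using d n1 r psi rho by linarith+
    show "norm E0 + \<bar>t0\<bar> + 2 * (0 + 48 * \<epsilon>) + 6 * (\<mu> + 4) \<le> L"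
    proof -
      have "\<bar>t0\<bar> \<le> T + 1" "2 * (0 + 48 * \<epsilon>) \<le> 1" "6 * (\<mu> + 4) \<le> 6 * (\<kappa> + 4)" "norm E0 \<le> 1"
        using r psi rho d(2) mu(2) n0 by auto
      then show ?thesis using L[folded \<kappa>_def] by linarith
    qed
    fix E' t' assume h: "norm (E' - (E0 - of_real \<mu> * (e - E0))) \<le> (1 + \<mu>) * (0 + 60 * \<epsilon>)"
      "\<bar>t' - (t0 - sg t0 * (\<mu> * norm (e - E0)))\<bar> \<le> (1 + \<mu>) * (0 + 60 * \<epsilon>)"
    have 1: "norm (E' - of_real g * e') \<le> \<delta> + 48 * \<epsilon> * (1 - (3 / 4) ^ 0)" "\<bar>t' - t1\<bar> \<le> \<delta> + 48 * \<epsilon> * (1 - (3 / 4) ^ 0)"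
      using h far unfolding B0 q_def[symmetric] t1_def[symmetric] by auto
    have "((E', t'), rect (frm (sg t1) (e' - E')) (\<epsilon> * (3 / 4) ^ 0) 1, 4 * (\<epsilon> * (3 / 4) ^ 0) * \<omega>0 + WR) \<in> Run (of_real g * e') t1 e' \<delta> \<epsilon> \<omega>0 WR"
      unfolding Run_def mem_Collect_eq
      by (rule exI[of _ E'], rule exI[of _ t'], rule exI[of _ 0], rule conjI, rule HOL.refl, rule conjI, rule 1, rule 1)
    then have "((E', t'), rect (frm (sg t1) (e' - E')) (\<epsilon> * (3 / 4) ^ 0) 1, 4 * (\<epsilon> * (3 / 4) ^ 0) * \<omega>0 + WR) \<in> Ray"
      using r' g t1 unfolding Ray_def by blast
    then have 2: "((E', t'), rect (frm (sg t1) (e' - E')) \<epsilon> 1, 4 * \<epsilon> * \<omega>0 + WR) \<in> S" using S(1) by auto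
    have "norm E' \<le> norm (of_real g * e') + \<delta>" using 1(1) norm_triangle_ineq[of "of_real g * e'" "E' - of_real g * e'"] by simp
    also have "norm (of_real g * e') = g" using g K3_norm[of e'] r' by (simp add: norm_mult)
    finally have "norm E' < 1" using g d psi rho by linarith
    then have "e' - E' \<noteq> 0" using K3_norm[of e'] r' by auto
    then have 3: "norm (frm (sg t1) (e' - E')) = 1" using frm(1) sg by blast
    have 4: "4 * \<epsilon> * \<omega>0 + WR = \<omega>R * (4 * \<epsilon>)" using eps(1) by (simp add: \<omega>R_def distrib_right)
    show "\<exists>\<nu> a w. ((E', t'), rect \<nu> a 1, w) \<in> S \<and> norm \<nu> = 1 \<and> \<epsilon> \<le> a \<and> a \<le> 1 \<and> 0 \<le> w \<and> w \<le> \<omega>R * (4 * a)"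
      by (rule exI[of _ "frm (sg t1) (e' - E')"], rule exI[of _ \<epsilon>], rule exI[of _ "4 * \<epsilon> * \<omega>0 + WR"])
        (use 2 3 4 eps om kap(6) in simp)
  next
    show "16 * (6 * (\<mu> + 4) * (18 * mb 3)) + mb 3 + 64 * (mb 5 * eta \<theta> * (4 * \<omega>R + WG)) +
      32 * (mb (2 / \<epsilon> + 4) * eta \<theta> * (4 * \<omega>R)) \<le> 8 / 25 * WG"
      by (rule mbC[OF _ C]) (use mu in linarith)
  qed simp
qed

text \<open>Entry into the system: the given gradient is taken as the exact base point of a run in
  generation 0. The cases are the origin, a segment towards a well, and a point with two positive
  coordinates.\<close>

lemma start:
  assumes E: "\<And>k. k \<in> K3 \<Longrightarrow> - 2 * Re (cnj k * E) \<le> \<psi>" and t: "\<exists>k\<in>K3. \<bar>t\<bar> \<le> T + (- 2 * Re (cnj k * E)) - \<rho>"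
  shows "\<exists>\<nu> a w. ((E, t), rect \<nu> a 1, w) \<in> Ball T \<omega>0 \<union> Ray \<union> Gen \<and> norm \<nu> = 1 \<and> \<epsilon> \<le> a \<and> a \<le> 1 \<and> 0 \<le> w \<and> w \<le> \<omega>G * (4 * a)"
proof -
  obtain e e' a b where r: "rp E e e' a b" using rp_ex by blast
  note r' = r[unfolded rp_def]
  have ab: "a + b \<le> \<psi>" using rp_psi(2)[OF r] E by metis
  have tb: "\<bar>t\<bar> \<le> T + (a + b) - \<rho>" using rp_psi(1)[OF r] t by (meson add_left_mono diff_right_mono order_trans)
  have nE: "norm E \<le> a + b"
    using norm_triangle_ineq[of "of_real a * e" "of_real b * e'"] r' K3_norm by (simp add: norm_mult)
  have eE: "e - E \<noteq> 0" using nE ab psi K3_norm[of e] r' by auto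
  have wr: "4 * \<epsilon> * \<omega>0 + WR = \<omega>R * (4 * \<epsilon>)" "4 * \<epsilon> * \<omega>R + WG = \<omega>G * (4 * \<epsilon>)"
    using eps(1) by (simp_all add: \<omega>R_def \<omega>G_def distrib_left mult.commute)
  show ?thesis
  proof (cases "a = 0")
    case True
    then have z: "E = 0" "b = 0" using r' by auto
    have 1: "norm E \<le> 1 / 25" "\<bar>t\<bar> \<le> T" using z tb rho True by auto
    have "((E, t), rect (frm (sg t) (1 - E)) (2 / 3) 1, 8 / 3 * \<omega>0) \<in> Ball T \<omega>0"
      unfolding Ball_def mem_Collect_eq
      by (rule exI[of _ E], rule exI[of _ t], rule conjI, rule HOL.refl, rule conjI, rule 1, rule 1)
    then show ?thesis using frm(1)[of "1 - E" "sg t"] sg om eps kap z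
      by (intro exI[of _ "frm (sg t) (1 - E)"] exI[of _ "2 / 3"] exI[of _ "8 / 3 * \<omega>0"]) auto
  next
    case False
    then have a: "0 < a" using r' by auto
    show ?thesis
    proof (cases "b = 0")
      case True
      have d: "0 \<le> \<delta>" using kap eps by (simp add: \<delta>_def)
      have 1: "norm (E - of_real a * e) \<le> \<delta> + 48 * \<epsilon> * (1 - (3 / 4) ^ 0)" "\<bar>t - t\<bar> \<le> \<delta> + 48 * \<epsilon> * (1 - (3 / 4) ^ 0)" using True r' d by auto
      have "((E, t), rect (frm (sg t) (e - E)) (\<epsilon> * (3 / 4) ^ 0) 1, 4 * (\<epsilon> * (3 / 4) ^ 0) * \<omega>0 + WR) \<in> Run (of_real a * e) t e \<delta> \<epsilon> \<omega>0 WR"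
        unfolding Run_def mem_Collect_eq
        by (rule exI[of _ E], rule exI[of _ t], rule exI[of _ 0], rule conjI, rule HOL.refl, rule conjI, rule 1, rule 1)
      moreover have "\<bar>t\<bar> \<le> T + a - \<rho>" "a \<le> \<psi>" using tb ab True by auto
      ultimately have "((E, t), rect (frm (sg t) (e - E)) (\<epsilon> * (3 / 4) ^ 0) 1, 4 * (\<epsilon> * (3 / 4) ^ 0) * \<omega>0 + WR) \<in> Ray"
        using r' a unfolding Ray_def by blast
      moreover have "4 * \<epsilon> * \<omega>0 + WR \<le> \<omega>G * (4 * \<epsilon>)" unfolding wr(1) using kap eps by (intro mult_right_mono) auto
      ultimately show ?thesis using frm(1)[OF eE sg(2)] om eps
        by (intro exI[of _ "frm (sg t) (e - E)"] exI[of _ \<epsilon>] exI[of _ "4 * \<epsilon> * \<omega>0 + WR"]) auto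
    next
      case False
      then have b: "0 < b" using r' by auto
      have 1: "norm (E - E) \<le> 0 + 48 * \<epsilon> * (1 - (3 / 4) ^ 0)" "\<bar>t - t\<bar> \<le> 0 + 48 * \<epsilon> * (1 - (3 / 4) ^ 0)" by auto
      have "((E, t), rect (frm (sg t) (e - E)) (\<epsilon> * (3 / 4) ^ 0) 1, 4 * (\<epsilon> * (3 / 4) ^ 0) * \<omega>R + WG) \<in> Run E t e 0 \<epsilon> \<omega>R WG"
        unfolding Run_def mem_Collect_eq
        by (rule exI[of _ E], rule exI[of _ t], rule exI[of _ 0], rule conjI, rule HOL.refl, rule conjI, rule 1, rule 1)
      then have "((E, t), rect (frm (sg t) (e - E)) (\<epsilon> * (3 / 4) ^ 0) 1, 4 * (\<epsilon> * (3 / 4) ^ 0) * \<omega>R + WG) \<in> Gen"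
        using r b ab tb unfolding Gen_def by blast
      then show ?thesis using frm(1)[OF eE sg(2)] om eps kap wr(2)
        by (intro exI[of _ "frm (sg t) (e - E)"] exI[of _ \<epsilon>] exI[of _ "4 * \<epsilon> * \<omega>R + WG"]) auto
    qed
  qed
qed

end

section \<open>Choice of the weights and of the exponent\<close>

lemma patch_mono: "patch S \<theta> L \<sigma> d \<Longrightarrow> S \<subseteq> S' \<Longrightarrow> patch S' \<theta> L \<sigma> d"
  unfolding patch_def by (cases d) auto

text \<open>After \<open>W\<close> has absorbed its own occurrence, 8/25 - 1/100 = 31/100 of it
  remains, which can pay for \<open>x\<close>, \<open>y\<close> and \<omega> of any size.\<close>

lemma weight_exists:
  fixes x y \<omega> m h :: real
  assumes "0 \<le> x" "0 \<le> y" "0 \<le> \<omega>" "0 \<le> m * h" "64 * (m * h) \<le> 1 / 100"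
  shows "\<exists>W\<ge>0. x + 64 * (m * h * (4 * \<omega> + W)) + y \<le> 8 / 25 * W"
proof (intro exI conjI)
  let ?W = "(x + y + \<omega>) / (31 / 100)"
  show W: "0 \<le> ?W" using assms by simp
  have "64 * (m * h) * (4 * \<omega> + ?W) \<le> 1 / 100 * (4 * \<omega> + ?W)" using assms W by (intro mult_right_mono) auto
  then have "64 * (m * h * (4 * \<omega> + ?W)) \<le> 1 / 100 * (4 * \<omega> + ?W)" by (simp add: mult.assoc)
  moreover have "x + 1 / 100 * (4 * \<omega> + ?W) + y \<le> 8 / 25 * ?W" using assms by simp
  ultimately show "x + 64 * (m * h * (4 * \<omega> + ?W)) + y \<le> 8 / 25 * ?W" by linarith
qed

lemma eta_nonneg: "0 < \<theta> \<Longrightarrow> \<theta> < 1 \<Longrightarrow> 0 \<le> eta \<theta>"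
proof -
  assume th: "0 < \<theta>" "\<theta> < 1"
  have "0 \<le> (2 powr (real j * \<theta>) - 1) * (4 / 2 ^ j)" for j :: nat using th ge_one_powr_ge_zero[of 2 "real j * \<theta>"] by simp
  then show ?thesis unfolding eta_def using eta_sums[OF th(2)] by (intro suminf_nonneg) (auto simp: sums_iff)
qed

text \<open>Two families share one \<open>Ball\<close>: \<open>U\<close>, with gauge bound 3/4,
  takes what leaves the centre, and \<open>M\<close> is adapted to \<open>E\<close> and only entered
  at the start. In the loop through \<open>U\<close> the excess \<omega>G - \<omega>0 depends on
  \<open>W\<close> and \<open>\<epsilon>u\<close> but not on \<omega>0, so \<omega>0 can be chosen
  to pay for it. The weights of \<open>M\<close> require of \<theta> only that
  \<open>64 * (mb 5 * eta \<theta>)\<close> be at most 1/100, which is already arranged for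
  \<open>U\<close>.\<close>

theorem states_exist:
  "\<exists>\<theta>. 0 < \<theta> \<and> \<theta> < 1 \<and> (\<forall>E t. (\<forall>k\<in>K3. - 2 * Re (cnj k * E) < 1) \<longrightarrow>
     (\<exists>S L \<nu> a w. ((E, t), rect \<nu> a 1, w) \<in> S \<and> norm \<nu> = 1 \<and> 0 < a \<and> 0 \<le> w \<and> norm E + \<bar>t\<bar> \<le> L \<and>
       (\<forall>\<sigma>\<in>S. \<exists>d. patch S \<theta> L \<sigma> d)))"
proof -
  \<comment> \<open>With \<psi> = 3/4 and \<rho> = 1/25 the condition of the family,
    \<open>120 * 4\<^sup>2 * \<epsilon>u \<le> 1 / 25\<close>, is an equality.\<close>
  define \<epsilon>u :: real where "\<epsilon>u = 1 / 48000"
  \<comment> \<open>Here 48 = 6 * (4 + 4), since the magnification factor of the universal family is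
    4.\<close>
  define c where "c = 16 * (48 * (18 * mb 3)) + mb 3"
  have c0: "0 \<le> c" using mb(1)[of 3] by (simp add: c_def)
  \<comment> \<open>The factors 25 / 8 here and 3 in \<open>\<omega>0\<close> invert those of the
    run and ball inequalities, the summand 2 covers the terms with \<open>eta \<theta>\<close>, and
    \<open>W / \<epsilon>u\<close> is twice \<open>\<omega>G - \<omega>0\<close>.\<close>
  define W where "W = 25 / 8 * (c + 2)"
  define \<omega>0 where "\<omega>0 = 3 * (c + 2 + W / \<epsilon>u)"
  define \<omega>R where "\<omega>R = \<omega>0 + W / (4 * \<epsilon>u)"
  define \<omega>G where "\<omega>G = \<omega>R + W / (4 * \<epsilon>u)"
  have nn: "0 \<le> W" "0 \<le> \<omega>0" "0 \<le> \<omega>R" "\<omega>0 \<le> \<omega>G" "0 \<le> \<omega>G" using c0 by (auto simp: W_def \<omega>0_def \<omega>R_def \<omega>G_def \<epsilon>u_def)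
  define m where "m = mb 5 + mb 7 + mb (2 / \<epsilon>u + 4)"
  define Z where "Z = (m + 1) * (4 * \<omega>G + W + 1)"
  \<comment> \<open>With 6400 = 64 * 100 each surplus term of the universal family becomes at most
    1/100.\<close>
  define big where "big = 6400 * Z"
  have mb0: "0 \<le> mb R" for R by (rule mb)
  have m0: "0 \<le> m" "mb 5 \<le> m" "mb 7 \<le> m" "mb (2 / \<epsilon>u + 4) \<le> m" using mb0 by (auto simp: m_def add_nonneg_nonneg)
  have big: "0 < big" using m0 nn unfolding big_def Z_def by (intro mult_pos_pos) auto
  obtain \<theta> where th: "0 < \<theta>" "\<theta> < 1" "eta \<theta> < 1 / big" using eta_small[of "1 / big"] big by auto
  have et: "0 \<le> eta \<theta>" using eta_nonneg th by blast
  have le1: "64 * (mb R * eta \<theta> * X) \<le> 1 / 100" if "mb R \<le> m" "0 \<le> X" "X \<le> 4 * \<omega>G + W + 1" for R X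
  proof -
    have "mb R * X \<le> Z" unfolding Z_def using that m0 nn by (intro mult_mono) auto
    then have "6400 * (mb R * X) \<le> big" by (simp add: big_def)
    then have "6400 * (mb R * X) * eta \<theta> \<le> big * (1 / big)" using et th big by (intro mult_mono) auto
    then show ?thesis using big by (simp add: mult_ac)
  qed
  show ?thesis
  proof (rule exI[of _ \<theta>], intro conjI allI impI)
    show "0 < \<theta>" "\<theta> < 1" by (rule th)+
    fix E t assume K: "\<forall>k\<in>K3. - 2 * Re (cnj k * E) < 1"
    obtain e e' a b where r: "rp E e e' a b" using rp_ex by blast
    note r' = r[unfolded rp_def]
    define \<psi> where "\<psi> = max (1 / 2) (a + b)"
    have psi: "1 / 2 \<le> \<psi>" "0 < \<psi>" "\<psi> < 1" "a + b \<le> \<psi>" using rp_psi(2)[OF r] K by (auto simp: \<psi>_def)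
    define \<rho> where "\<rho> = min (1 / 25) ((1 - \<psi>) / 2)"
    have rho: "0 < \<rho>" "\<rho> \<le> 1 / 25" "2 * \<rho> \<le> 1 - \<psi>" using psi by (simp_all add: \<rho>_def min_def field_simps)
    define \<kappa> where "\<kappa> = 1 / (1 - \<psi>)"
    have kap: "1 \<le> \<kappa>" using psi by (simp add: \<kappa>_def)
    define \<epsilon> where "\<epsilon> = min (1 / 50) (\<rho> / (120 * \<kappa>\<^sup>2))"
    have k2: "0 < 120 * \<kappa>\<^sup>2" using kap by simp
    have eps: "0 < \<epsilon>" "\<epsilon> \<le> 1 / 50" using rho k2 by (auto simp: \<epsilon>_def)
    have "\<epsilon> \<le> \<rho> / (120 * \<kappa>\<^sup>2)" by (simp add: \<epsilon>_def)
    then have eps3: "120 * \<kappa>\<^sup>2 * \<epsilon> \<le> \<rho>" using k2 by (simp add: pos_le_divide_eq mult.commute)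
    \<comment> \<open>The universal family needs 9 = 2 * 4 + 1, the adapted one 2 * \<kappa> + 1;
      the summand \<bar>t\<bar> admits the given skew part.\<close>
    define T where "T = \<bar>t\<bar> + 2 * \<kappa> + 9"
    define L where "L = T + 100 + 6 * (\<kappa> + 4)"
    have t5: "64 * (mb 5 * eta \<theta>) \<le> 1 / 100" using le1[of 5 1] m0 nn by simp
    have mbe: "0 \<le> mb R * eta \<theta>" for R using mb0 et by simp
    have xpos: "0 \<le> 16 * (6 * (\<kappa> + 4) * (18 * mb 3)) + mb 3" using kap mb0[of 3] by simp
    obtain WR where WR: "0 \<le> WR" "16 * (6 * (\<kappa> + 4) * (18 * mb 3)) + mb 3 + 64 * (mb 5 * eta \<theta> * (4 * \<omega>0 + WR)) +
        32 * (mb 7 * eta \<theta> * (4 * \<omega>0)) \<le> 8 / 25 * WR"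
    proof -
      have "0 \<le> 32 * (mb 7 * eta \<theta> * (4 * \<omega>0))" by (intro mult_nonneg_nonneg mbe) (use nn in auto)
      from weight_exists[OF xpos this nn(2) mbe t5] show ?thesis using that by blast
    qed
    define \<omega>R' where "\<omega>R' = \<omega>0 + WR / (4 * \<epsilon>)"
    have oR: "0 \<le> \<omega>R'" using WR nn eps by (simp add: \<omega>R'_def)
    obtain WG where WG: "0 \<le> WG" "16 * (6 * (\<kappa> + 4) * (18 * mb 3)) + mb 3 + 64 * (mb 5 * eta \<theta> * (4 * \<omega>R' + WG)) +
        32 * (mb (2 / \<epsilon> + 4) * eta \<theta> * (4 * \<omega>R')) \<le> 8 / 25 * WG"
    proof -
      have "0 \<le> 32 * (mb (2 / \<epsilon> + 4) * eta \<theta> * (4 * \<omega>R'))" by (intro mult_nonneg_nonneg mbe) (use oR in auto)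
      from weight_exists[OF xpos this oR mbe t5] show ?thesis using that by blast
    qed
    interpret M: family T \<rho> \<psi> \<epsilon> \<omega>0 WR WG \<theta> L
      using th et rho psi eps eps3 nn WR WG by unfold_locales (auto simp: T_def L_def \<kappa>_def)
    interpret U: family T "1 / 25" "3 / 4" \<epsilon>u \<omega>0 W W \<theta> L
      using th et nn kap by unfold_locales (auto simp: T_def L_def \<epsilon>u_def power2_eq_square)
    have Uk: "U.\<kappa> = 4" "U.\<omega>R = \<omega>R" "U.\<omega>G = \<omega>G"
      by (simp_all add: U.\<kappa>_def U.\<omega>R_def U.\<omega>G_def \<omega>R_def \<omega>G_def)
    have Mk: "M.\<kappa> = \<kappa>" "M.\<omega>R = \<omega>R'" by (simp_all add: M.\<kappa>_def M.\<omega>R_def \<omega>R'_def \<kappa>_def)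
    define S where "S = Ball T \<omega>0 \<union> U.Ray \<union> U.Gen \<union> M.Ray \<union> M.Gen"
    have oo: "4 * \<omega>0 + W \<le> 4 * \<omega>G + W + 1" "4 * \<omega>R + W \<le> 4 * \<omega>G + W + 1" "4 * \<omega>0 \<le> 4 * \<omega>G + W + 1"
       "4 * \<omega>R \<le> 4 * \<omega>G + W + 1" "4 * \<omega>G \<le> 4 * \<omega>G + W + 1"
      using nn by (auto simp: \<omega>G_def \<omega>R_def \<epsilon>u_def)
    have "\<exists>d. patch S \<theta> L \<sigma> d" if "\<sigma> \<in> S" for \<sigma>
    proof -
      consider "\<sigma> \<in> Ball T \<omega>0" | "\<sigma> \<in> U.Ray" | "\<sigma> \<in> U.Gen" | "\<sigma> \<in> M.Ray" | "\<sigma> \<in> M.Gen" using \<open>\<sigma> \<in> S\<close> by (auto simp: S_def)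
      then show ?thesis
      proof cases
        case 1
        show ?thesis
        proof (rule ball_patch[OF th(1,2) _ _ nn(2,4) et _ _ _ _ 1, where ?a2.0 = \<epsilon>u])
          show "16 * (6 * (18 * mb 3)) + mb 3 + (\<omega>G - \<omega>0) * 2 + 64 * (mb (2 / \<epsilon>u + 4) * eta \<theta> * (4 * \<omega>G)) +
            32 * (mb 7 * eta \<theta> * (4 * \<omega>0)) \<le> 1 / 3 * \<omega>0"
          proof -
            have "16 * (6 * (18 * mb 3)) + mb 3 \<le> c" using mb0[of 3] by (simp add: c_def)
            moreover have "(\<omega>G - \<omega>0) * 2 = W / \<epsilon>u" by (simp add: \<omega>G_def \<omega>R_def)
            moreover have "64 * (mb (2 / \<epsilon>u + 4) * eta \<theta> * (4 * \<omega>G)) \<le> 1 / 100" "64 * (mb 7 * eta \<theta> * (4 * \<omega>0)) \<le> 1 / 100"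
              by (intro le1; use m0 oo nn in simp)+
            ultimately show ?thesis by (simp add: \<omega>0_def)
          qed
          fix E' t' assume "\<And>k. k \<in> K3 \<Longrightarrow> - 2 * Re (cnj k * E') \<le> 3 / 4" "\<exists>k\<in>K3. \<bar>t'\<bar> \<le> T + (- 2 * Re (cnj k * E')) - 1 / 25"
          then have "\<exists>\<nu> a w. ((E', t'), rect \<nu> a 1, w) \<in> Ball T \<omega>0 \<union> U.Ray \<union> U.Gen \<and> norm \<nu> = 1 \<and> \<epsilon>u \<le> a \<and> a \<le> 1 \<and> 0 \<le> w \<and> w \<le> U.\<omega>G * (4 * a)"
            by (rule U.start)
          then show "\<exists>\<nu> a w. ((E', t'), rect \<nu> a 1, w) \<in> S \<and> norm \<nu> = 1 \<and> \<epsilon>u \<le> a \<and> a \<le> 1 \<and> 0 \<le> w \<and> w \<le> \<omega>G * (4 * a)"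
            unfolding Uk S_def by blast
        qed (use kap in \<open>auto simp: S_def T_def L_def \<epsilon>u_def\<close>)
      next
        case 2
        have "16 * (6 * (4 + 4) * (18 * mb 3)) + mb 3 + 64 * (mb 5 * eta \<theta> * (4 * \<omega>0 + W)) + 32 * (mb 7 * eta \<theta> * (4 * \<omega>0)) \<le> 8 / 25 * W"
          using le1[of 5 "4 * \<omega>0 + W"] le1[of 7 "4 * \<omega>0"] m0 oo nn by (simp add: W_def c_def)
        then show ?thesis using 2 by (intro U.ray_patch) (auto simp: S_def Uk)
      next
        case 3
        have "16 * (6 * (4 + 4) * (18 * mb 3)) + mb 3 + 64 * (mb 5 * eta \<theta> * (4 * \<omega>R + W)) + 32 * (mb (2 / \<epsilon>u + 4) * eta \<theta> * (4 * \<omega>R)) \<le> 8 / 25 * W"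
          using le1[of 5 "4 * \<omega>R + W"] le1[of "2 / \<epsilon>u + 4" "4 * \<omega>R"] m0 oo nn by (simp add: W_def c_def)
        then show ?thesis using 3 by (intro U.gen_patch) (auto simp: S_def Uk)
      next
        case 4
        then show ?thesis using WR(2) by (intro M.ray_patch) (auto simp: S_def Mk)
      next
        case 5
        then show ?thesis using WG(2) by (intro M.gen_patch) (auto simp: S_def Mk)
      qed
    qed
    moreover have "\<exists>\<nu> a w. ((E, t), rect \<nu> a 1, w) \<in> Ball T \<omega>0 \<union> M.Ray \<union> M.Gen \<and> norm \<nu> = 1 \<and> \<epsilon> \<le> a \<and> a \<le> 1 \<and> 0 \<le> w \<and> w \<le> M.\<omega>G * (4 * a)"
    proof (rule M.start)
      show "- 2 * Re (cnj k * E) \<le> \<psi>" if "k \<in> K3" for k using rp_psi(1)[OF r that] psi by linarith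
      obtain k where k: "k \<in> K3" "- 2 * Re (cnj k * E) = a + b" using rp_psi(2)[OF r] by blast
      then show "\<exists>k\<in>K3. \<bar>t\<bar> \<le> T + (- 2 * Re (cnj k * E)) - \<rho>" using r' rho kap by (intro bexI[of _ k]) (auto simp: T_def)
    qed
    then obtain \<nu> a' w where f: "((E, t), rect \<nu> a' 1, w) \<in> S" "norm \<nu> = 1" "\<epsilon> \<le> a'" "0 \<le> w" unfolding S_def by blast
    moreover have "norm E + \<bar>t\<bar> \<le> L"
    proof -
      have "norm E \<le> a + b"
        using norm_triangle_ineq[of "of_real a * e" "of_real b * e'"] r' K3_norm by (simp add: norm_mult)
      then show ?thesis using psi kap by (simp add: L_def T_def)
    qed
    ultimately show "\<exists>S L \<nu> a w. ((E, t), rect \<nu> a 1, w) \<in> S \<and> norm \<nu> = 1 \<and> 0 < a \<and> 0 \<le> w \<and> norm E + \<bar>t\<bar> \<le> L \<and> (\<forall>\<sigma>\<in>S. \<exists>d. patch S \<theta> L \<sigma> d)"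
      using eps by (intro exI[of _ S] exI[of _ L] exI[of _ \<nu>] exI[of _ a'] exI[of _ w]) auto
  qed
qed

section \<open>Lipschitz domains\<close>

text \<open>The domain becomes one more state: the unperturbed linear map with \<Omega> as a single
  cell, to be filled with rectangles for \<open>(E, t)\<close>. Since the rectangle is supplied by
  \<open>states_exist\<close>, the collar is required for every linear image of \<Omega>.\<close>

theorem domain_solution:
  "\<exists>\<theta>. 0 < \<theta> \<and> \<theta> < 1 \<and> (\<forall>\<Omega> E t. open \<Omega> \<longrightarrow> bounded \<Omega> \<longrightarrow>
     (\<forall>\<kappa> \<kappa>i. linear \<kappa> \<longrightarrow> linear \<kappa>i \<longrightarrow> (\<forall>y. \<kappa> (\<kappa>i y) = y) \<longrightarrow> (\<forall>y. \<kappa>i (\<kappa> y) = y) \<longrightarrow> (\<exists>C\<ge>0. collar (\<kappa> ` \<Omega>) C)) \<longrightarrow>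
     (\<forall>k\<in>K3. - 2 * Re (cnj k * E) < 1) \<longrightarrow>
     (\<exists>v G L w. L-lipschitz_on UNIV v \<and> 0 \<le> w \<and> (\<forall>x. x \<notin> \<Omega> \<longrightarrow> v x = app (E, t) x \<and> G x = (E, t)) \<and>
       G \<in> borel_measurable borel \<and> (\<forall>x. norm (G x) \<le> L) \<and>
       (AE x in lborel. x \<in> \<Omega> \<longrightarrow> fst (G x) \<in> K3 \<and> (\<exists>e>0. \<forall>y\<in>ball x e. v y = v x + app (G x) (y - x))) \<and>
       (\<forall>h. (\<integral>\<^sup>+x. ennreal (norm (G (x + h) - G x)) \<partial>lborel) \<le> ennreal (w * norm h powr \<theta>))))"
proof -
  obtain \<theta> where th: "0 < \<theta>" "\<theta> < 1" and ex: "\<And>E t. \<forall>k\<in>K3. - 2 * Re (cnj k * E) < 1 \<Longrightarrow>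
     \<exists>S L \<nu> a w. ((E, t), rect \<nu> a 1, w) \<in> S \<and> norm \<nu> = 1 \<and> 0 < a \<and> 0 \<le> w \<and> norm E + \<bar>t\<bar> \<le> L \<and> (\<forall>\<sigma>\<in>S. \<exists>d. patch S \<theta> L \<sigma> d)"
    using states_exist by blast
  show ?thesis
  proof (rule exI[of _ \<theta>], intro conjI allI impI)
    show "0 < \<theta>" "\<theta> < 1" by (rule th)+
    fix \<Omega> :: "complex set" and E :: complex and t :: real
    assume \<Omega>: "open \<Omega>" "bounded \<Omega>" and K: "\<forall>k\<in>K3. - 2 * Re (cnj k * E) < 1"
      and col: "\<forall>\<kappa> \<kappa>i. linear \<kappa> \<longrightarrow> linear \<kappa>i \<longrightarrow> (\<forall>y. \<kappa> (\<kappa>i y) = y) \<longrightarrow> (\<forall>y. \<kappa>i (\<kappa> y) = y) \<longrightarrow> (\<exists>C\<ge>0. collar (\<kappa> ` \<Omega>) C)"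
    obtain S L \<nu> a w where S: "((E, t), rect \<nu> a 1, w) \<in> S" and sh: "norm \<nu> = 1" "0 < a" "0 \<le> w" "norm E + \<bar>t\<bar> \<le> L"
      and pat: "\<And>\<sigma>. \<sigma> \<in> S \<Longrightarrow> \<exists>d. patch S \<theta> L \<sigma> d" using ex[OF K, of t] by blast
    obtain C where C: "0 \<le> C" "collar \<Omega> C"
      using col[rule_format, of "\<lambda>x. x" "\<lambda>x. x"] by (auto simp: linear_iff)
    obtain C' where C': "0 \<le> C'" "collar (rk \<nu> a 1 ` \<Omega>) C'"
      using col[rule_format, of "rk \<nu> a 1" "rki \<nu> a 1"] rk_lin rk_inv[of \<nu> a 1] sh by auto
    define m where "m = measure lborel \<Omega>"
    have m: "emeasure lborel \<Omega> = ennreal m" "0 \<le> m"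
      using emeasure_bounded_finite[OF \<Omega>(2)] by (auto simp: m_def emeasure_eq_ennreal_measure)
    define W where "W = m + (m / (4 * a) + C' * eta \<theta>) * w"
    have W0: "0 \<le> W" using m sh C' eta_nonneg[OF th] by (simp add: W_def)
    define S' where "S' = insert ((E, t), \<Omega>, W) S"
    have SS: "((E, t), rect \<nu> a 1, w) \<in> S'" using S by (simp add: S'_def)
    have one: "{..<1::nat} = {0}" by auto
    have nL: "norm (E, t) \<le> L" using norm_Pair_le[of E t] sh by simp
    have "\<exists>d. patch S' \<theta> L ((E, t), \<Omega>, W) d"
    proof (rule cells_patch[where X = "\<lambda>_. \<Omega>" and N = 1 and NF = "{0}" and C' = "\<lambda>_. C'" and C = "\<lambda>_. C" and m = "\<lambda>_. m"
          and q = "\<lambda>_. Complex (1/2) (1/2)" and \<kappa> = "\<lambda>_. rk \<nu> a 1" and \<kappa>i = "\<lambda>_. rki \<nu> a 1" and md = "\<lambda>_. 4 * a"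
          and Dk = "\<lambda>_. rect \<nu> a 1" and wk = "\<lambda>_. w" and B = "\<lambda>_. (E, t)" and b = "\<lambda>_. 0" and F = "app (E, t)" and c = m, OF th])
      show lin: "norm (app (E, t) h) \<le> L * norm h" for h
      proof -
        have "norm (app (E, t) h) \<le> (norm E + \<bar>t\<bar>) * norm h" using app_norm[of "(E, t)" h] by simp
        also have "\<dots> \<le> L * norm h" using sh by (intro mult_right_mono) auto
        finally show ?thesis .
      qed
      have "0 \<le> L" using nL by (meson norm_ge_zero order_trans)
      then show "L-lipschitz_on UNIV (app (E, t))"
        using lin by (intro lipschitz_onI) (auto simp: dist_norm app_diff[symmetric])
      show "rect \<nu> a 1 = {x. rk \<nu> a 1 x + Complex (1/2) (1/2) \<in> sq 0 0 0}" by (rule rect_def)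
      show "linear (rk \<nu> a 1) \<and> linear (rki \<nu> a 1) \<and> (\<forall>y. rk \<nu> a 1 (rki \<nu> a 1 y) = y) \<and> (\<forall>y. rki \<nu> a 1 (rk \<nu> a 1 y) = y)"
        using rk_lin rk_inv sh by simp
      show "emeasure lborel (rect \<nu> a 1) = ennreal (4 * a) \<and> 0 < 4 * a" using sh rect_measure by simp
      show "norm (E, t) \<le> L" "norm (E, t) \<le> L" by (rule nL)+
      show "\<Omega> \<in> sets borel" using \<Omega>(1) by (rule borel_open)
      show "open \<Omega>" by (rule \<Omega>(1))
      show "\<Omega> \<subseteq> \<Omega>" by (rule order_refl)
      show "app (E, t) x = app (E, t) x" for x by (rule HOL.refl)
      show "app (E, t) x = app (E, t) x + 0" for x by (rule add_0_right[symmetric])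
      show "k = l" if "k < 1" "l < (1::nat)" for k l using that by linarith
      show "\<Omega> - (\<Union>k<1::nat. \<Omega>) \<in> null_sets lborel" unfolding one by (simp only: UN_insert UN_empty Un_empty_right Diff_cancel null_sets.empty_sets)
      show "{0} \<subseteq> {..<1::nat}" unfolding one by (rule order_refl)
      show "fst (E, t) \<in> K3" if "k < 1" "k \<notin> {0}" for k :: nat using that by simp
      show "((E, t), rect \<nu> a 1, w) \<in> S'" by (rule SS)
      show "0 \<le> w" by (rule sh)
      show "collar (rk \<nu> a 1 ` \<Omega>) C' \<and> 0 \<le> C'" using C' by blast
      show "collar \<Omega> C \<and> 0 \<le> C" using C by blast
      show "emeasure lborel \<Omega> \<le> ennreal m \<and> 0 \<le> m" unfolding m(1) using m(2) by blast
      show "(\<Sum>k<1::nat. norm ((E, t) - (E, t)) * (2 * (C + m))) \<le> m" using m(2) by simp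
      show "emeasure lborel \<Omega> \<le> ennreal m" unfolding m(1) by (rule order_refl)
      show "0 \<le> m" by (rule m)
      show "m + (\<Sum>k\<in>{0::nat}. (m / (4 * a) + C' * eta \<theta>) * w) \<le> W" by (simp add: W_def)
    qed
    note root = this
    have "\<exists>d. patch S' \<theta> L \<sigma> d" if "\<sigma> \<in> S'" for \<sigma>
    proof (cases "\<sigma> \<in> S")
      case True
      from pat[OF this] obtain d where "patch S \<theta> L \<sigma> d" ..
      then have "patch S' \<theta> L \<sigma> d" by (rule patch_mono) (auto simp: S'_def)
      then show ?thesis ..
    next
      case False
      then have "\<sigma> = ((E, t), \<Omega>, W)" using that by (simp add: S'_def)
      then show ?thesis using root by simp
    qed
    note pat' = this
    have max: "max L (norm (E, t)) = L" using nL by simp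
    have root_in: "((E, t), \<Omega>, W) \<in> S'" by (simp add: S'_def)
    have "\<exists>v G. L-lipschitz_on UNIV v \<and> (\<forall>x. x \<notin> \<Omega> \<longrightarrow> v x = app (E, t) x \<and> G x = (E, t)) \<and>
       G \<in> borel_measurable borel \<and> (\<forall>x. norm (G x) \<le> L) \<and>
       (AE x in lborel. x \<in> \<Omega> \<longrightarrow> fst (G x) \<in> K3 \<and> (\<exists>e>0. \<forall>y\<in>ball x e. v y = v x + app (G x) (y - x))) \<and>
       (\<forall>h. (\<integral>\<^sup>+x. ennreal (norm (G (x + h) - G x)) \<partial>lborel) \<le> ennreal (W * norm h powr \<theta>))"
      by (rule patch_solution[OF th pat' root_in, unfolded max])
    then obtain v G where vG: "L-lipschitz_on UNIV v \<and> (\<forall>x. x \<notin> \<Omega> \<longrightarrow> v x = app (E, t) x \<and> G x = (E, t)) \<and>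
       G \<in> borel_measurable borel \<and> (\<forall>x. norm (G x) \<le> L) \<and>
       (AE x in lborel. x \<in> \<Omega> \<longrightarrow> fst (G x) \<in> K3 \<and> (\<exists>e>0. \<forall>y\<in>ball x e. v y = v x + app (G x) (y - x))) \<and>
       (\<forall>h. (\<integral>\<^sup>+x. ennreal (norm (G (x + h) - G x)) \<partial>lborel) \<le> ennreal (W * norm h powr \<theta>))" by (elim exE)
    show "\<exists>v G L w. L-lipschitz_on UNIV v \<and> 0 \<le> w \<and> (\<forall>x. x \<notin> \<Omega> \<longrightarrow> v x = app (E, t) x \<and> G x = (E, t)) \<and>
       G \<in> borel_measurable borel \<and> (\<forall>x. norm (G x) \<le> L) \<and>
       (AE x in lborel. x \<in> \<Omega> \<longrightarrow> fst (G x) \<in> K3 \<and> (\<exists>e>0. \<forall>y\<in>ball x e. v y = v x + app (G x) (y - x))) \<and>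
       (\<forall>h. (\<integral>\<^sup>+x. ennreal (norm (G (x + h) - G x)) \<partial>lborel) \<le> ennreal (w * norm h powr \<theta>))"
      by (rule exI[of _ v], rule exI[of _ G], rule exI[of _ L], rule exI[of _ W]) (use vG W0 in blast)
  qed
qed

section \<open>Boundary layers of Lipschitz domains\<close>

text \<open>Shifts along \<open>\<nu>\<close> leave the argument of \<open>\<gamma>\<close>
  unchanged and so move points straight out of the strip. The step \<open>2 * d\<close> is used
  because the strip is closed on both sides. Packing takes place in the image, in the direction of
  \<open>f \<nu>\<close>, so no formula for the change of area under \<open>f\<close>
  enters.\<close>

lemma graph_strip:
  fixes f :: "'a::euclidean_space \<Rightarrow> 'b::euclidean_space"
  assumes f: "linear f" "linear g" "\<And>x. g (f x) = x" "\<And>y. f (g y) = y" and \<nu>: "norm \<nu> = 1"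
    and \<gamma>: "L-lipschitz_on {y. y \<bullet> \<nu> = 0} (\<gamma> :: 'a \<Rightarrow> real)" and fb: "f ` ball x r \<subseteq> ball z R" and d: "0 < d"
  defines "X \<equiv> {y \<in> ball x r. 0 \<le> y \<bullet> \<nu> - \<gamma> (y - (y \<bullet> \<nu>) *\<^sub>R \<nu>) \<and> y \<bullet> \<nu> - \<gamma> (y - (y \<bullet> \<nu>) *\<^sub>R \<nu>) \<le> d}"
  shows "f ` X \<in> sets borel" "emeasure lborel (f ` X) \<le> ennreal (2 * d * norm (f \<nu>) * measure lborel (ball z (R + 2)))"
proof -
  define P where "P y = y - (y \<bullet> \<nu>) *\<^sub>R \<nu>" for y :: 'a
  have vv: "\<nu> \<bullet> \<nu> = 1" using \<nu> by (simp add: norm_eq_1)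
  have P0: "P y \<in> {y. y \<bullet> \<nu> = 0}" for y by (simp add: P_def inner_diff_left vv)
  have Pc: "continuous_on UNIV P" unfolding P_def by (intro continuous_intros)
  have gc: "continuous_on UNIV (\<lambda>y. \<gamma> (P y))"
    by (rule continuous_on_compose2[OF lipschitz_on_continuous_on[OF \<gamma>] Pc]) (use P0 in auto)
  have gl: "continuous_on UNIV g" using f(2) linear_conv_bounded_linear linear_continuous_on by blast
  have gm: "g \<in> borel_measurable borel" by (rule borel_measurable_continuous_onI[OF gl])
  have "X \<in> sets borel"
  proof -
    have cl: "closed {y. 0 \<le> y \<bullet> \<nu> - \<gamma> (P y) \<and> y \<bullet> \<nu> - \<gamma> (P y) \<le> d}"
      using gc by (intro closed_Collect_conj closed_Collect_le continuous_intros)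
    have "X = ball x r \<inter> {y. 0 \<le> y \<bullet> \<nu> - \<gamma> (P y) \<and> y \<bullet> \<nu> - \<gamma> (P y) \<le> d}" by (auto simp: X_def P_def)
    then show ?thesis using borel_closed[OF cl] by auto
  qed
  moreover have "f ` X = g -` X \<inter> space borel" using f(3,4) by (auto simp: image_iff) (metis f(4))+
  ultimately show bm: "f ` X \<in> sets borel" using measurable_sets[OF gm, of X] by simp
  have fn: "f \<nu> \<noteq> 0" using f(3)[of \<nu>] linear_0[OF f(2)] \<nu> by auto
  define D where "D = 2 * d * norm (f \<nu>)"
  have D: "0 < D" using fn d by (simp add: D_def)
  have "emeasure lborel (f ` X) \<le> ennreal (D * measure lborel (ball z (R + 2)))"
  proof (rule packing_bound[OF bm _ _ D, where u = "f \<nu> /\<^sub>R norm (f \<nu>)"])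
    show "f ` X \<subseteq> ball z R" using fb by (auto simp: X_def)
    show "norm (f \<nu> /\<^sub>R norm (f \<nu>)) = 1" using fn by simp
    fix y k assume y: "y \<in> f ` X" and k: "0 < (k::nat)"
    then obtain a where a: "a \<in> X" "y = f a" by auto
    have "y + (real k * D) *\<^sub>R (f \<nu> /\<^sub>R norm (f \<nu>)) = f (a + (real k * (2 * d)) *\<^sub>R \<nu>)"
      using fn by (simp add: a D_def linear_add[OF f(1)] linear_scale[OF f(1)])
    moreover have "a + (real k * (2 * d)) *\<^sub>R \<nu> \<notin> X"
    proof -
      have e: "P (a + c *\<^sub>R \<nu>) = P a" "(a + c *\<^sub>R \<nu>) \<bullet> \<nu> = a \<bullet> \<nu> + c" for c
        by (simp_all add: P_def inner_add_left vv algebra_simps)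
      have "1 * (2 * d) \<le> real k * (2 * d)" using k d by (intro mult_right_mono) auto
      moreover have "0 \<le> a \<bullet> \<nu> - \<gamma> (P a)" using a(1) by (simp add: X_def P_def)
      ultimately have "d < (a + (real k * (2 * d)) *\<^sub>R \<nu>) \<bullet> \<nu> - \<gamma> (P (a + (real k * (2 * d)) *\<^sub>R \<nu>))"
        unfolding e using d by linarith
      then show ?thesis unfolding X_def P_def[symmetric] by simp
    qed
    moreover have "f b \<in> f ` X \<Longrightarrow> b \<in> X" for b using f(3) by (metis image_iff)
    ultimately show "y + (real k * D) *\<^sub>R (f \<nu> /\<^sub>R norm (f \<nu>)) \<notin> f ` X" by metis
  qed
  then show "emeasure lborel (f ` X) \<le> ennreal (2 * d * norm (f \<nu>) * measure lborel (ball z (R + 2)))" by (simp add: D_def)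
qed

text \<open>Within the ball, a point above the graph belongs to the open set \<Omega>, and a point
  below it has a neighbourhood that misses \<Omega>.\<close>

lemma frontier_on_graph:
  fixes \<Omega> :: "'a::euclidean_space set"
  assumes o: "open \<Omega>" and r: "\<Omega> \<inter> ball x r = {y \<in> ball x r. y \<bullet> \<nu> > \<gamma> (y - (y \<bullet> \<nu>) *\<^sub>R \<nu>)}"
    and \<gamma>: "L-lipschitz_on {y. y \<bullet> \<nu> = 0} (\<gamma> :: 'a \<Rightarrow> real)" and \<nu>: "norm \<nu> = 1"
    and z: "z \<in> frontier \<Omega>" "z \<in> ball x r"
  shows "z \<bullet> \<nu> = \<gamma> (z - (z \<bullet> \<nu>) *\<^sub>R \<nu>)"
proof -
  define P where "P y = y - (y \<bullet> \<nu>) *\<^sub>R \<nu>" for y :: 'a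
  have vv: "\<nu> \<bullet> \<nu> = 1" using \<nu> by (simp add: norm_eq_1)
  have P0: "P y \<in> {y. y \<bullet> \<nu> = 0}" for y by (simp add: P_def inner_diff_left vv)
  have Pc: "continuous_on UNIV P" unfolding P_def by (intro continuous_intros)
  have gc: "continuous_on UNIV (\<lambda>y. \<gamma> (P y))"
    by (rule continuous_on_compose2[OF lipschitz_on_continuous_on[OF \<gamma>] Pc]) (use P0 in auto)
  have "z \<notin> \<Omega>" using z o by (simp add: frontier_def interior_open)
  have "z \<bullet> \<nu> \<le> \<gamma> (P z)"
  proof (rule ccontr)
    assume "\<not> z \<bullet> \<nu> \<le> \<gamma> (P z)"
    then have "z \<in> {y \<in> ball x r. y \<bullet> \<nu> > \<gamma> (y - (y \<bullet> \<nu>) *\<^sub>R \<nu>)}" using z(2) by (simp add: P_def)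
    then have "z \<in> \<Omega> \<inter> ball x r" by (simp only: r)
    then show False using \<open>z \<notin> \<Omega>\<close> by blast
  qed
  moreover have "\<not> z \<bullet> \<nu> < \<gamma> (P z)"
  proof
    assume lt: "z \<bullet> \<nu> < \<gamma> (P z)"
    define W where "W = ball x r \<inter> {y. y \<bullet> \<nu> < \<gamma> (P y)}"
    have "open {y. y \<bullet> \<nu> < \<gamma> (P y)}" using gc by (intro open_Collect_less continuous_intros)
    then have "open W" unfolding W_def by (intro open_Int open_ball)
    moreover have "z \<in> W" using lt z(2) by (simp add: W_def)
    moreover have "z \<in> closure \<Omega>" using z(1) by (simp add: frontier_def)
    ultimately have "W \<inter> \<Omega> \<noteq> {}" using open_Int_closure_eq_empty[of W \<Omega>] by blast
    then obtain y where "y \<in> \<Omega>" "y \<in> ball x r" "y \<bullet> \<nu> < \<gamma> (P y)" unfolding W_def by blast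
    then have "y \<in> \<Omega> \<inter> ball x r" by blast
    then have "y \<in> {y \<in> ball x r. y \<bullet> \<nu> > \<gamma> (y - (y \<bullet> \<nu>) *\<^sub>R \<nu>)}" by (simp only: r)
    then show False using \<open>y \<bullet> \<nu> < \<gamma> (P y)\<close> by (simp add: P_def)
  qed
  ultimately show ?thesis by (simp add: P_def)
qed

text \<open>Half radii leave room: points near a frontier point of the half ball are still in the
  ball in which the graph description is valid.\<close>

lemma lipschitz_domain_cover:
  fixes \<Omega> :: "'a::euclidean_space set"
  assumes "bounded_lipschitz_domain \<Omega>"
  shows "\<exists>I \<nu> r L \<gamma>. finite I \<and> frontier \<Omega> \<subseteq> (\<Union>x\<in>I. ball x (r x / 2)) \<and>
    (\<forall>x\<in>I. norm (\<nu> x :: 'a) = 1 \<and> 0 < (r x :: real) \<and> 0 \<le> (L x :: real) \<and> (L x)-lipschitz_on {y. y \<bullet> \<nu> x = 0} (\<gamma> x :: 'a \<Rightarrow> real) \<and>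
        \<Omega> \<inter> ball x (r x) = {y \<in> ball x (r x). y \<bullet> \<nu> x > \<gamma> x (y - (y \<bullet> \<nu> x) *\<^sub>R \<nu> x)})"
proof -
  have lb: "lipschitz_boundary \<Omega>" and b: "bounded \<Omega>" using assms by (auto simp: bounded_lipschitz_domain_def)
  define Q where "Q x w \<longleftrightarrow> norm (fst w) = 1 \<and> fst (snd w) > 0 \<and>
        (fst (snd (snd w)))-lipschitz_on {y. y \<bullet> fst w = 0} (snd (snd (snd w)) :: 'a \<Rightarrow> real) \<and>
        \<Omega> \<inter> ball x (fst (snd w)) = {y \<in> ball x (fst (snd w)). y \<bullet> fst w > snd (snd (snd w)) (y - (y \<bullet> fst w) *\<^sub>R fst w)}" for x w
  have "\<exists>w. Q x w" if "x \<in> frontier \<Omega>" for x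
  proof -
    from bspec[OF lb[unfolded lipschitz_boundary_def] that] obtain \<nu> r L \<gamma> where
      h: "norm \<nu> = 1 \<and> r > 0 \<and> L-lipschitz_on {y. y \<bullet> \<nu> = 0} (\<gamma> :: 'a \<Rightarrow> real) \<and>
        \<Omega> \<inter> ball x r = {y \<in> ball x r. y \<bullet> \<nu> > \<gamma> (y - (y \<bullet> \<nu>) *\<^sub>R \<nu>)}" by (elim exE)
    have "Q x (\<nu>, r, L, \<gamma>)" unfolding Q_def fst_conv snd_conv by (rule h)
    then show ?thesis ..
  qed
  then have "\<forall>x\<in>frontier \<Omega>. \<exists>w. Q x w" by (intro ballI)
  from bchoice[OF this] obtain f where f: "\<forall>x\<in>frontier \<Omega>. Q x (f x)" by (elim exE)
  define \<nu> where "\<nu> x = fst (f x)" for x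
  define r where "r x = fst (snd (f x))" for x
  define L where "L x = fst (snd (snd (f x)))" for x
  define \<gamma> where "\<gamma> x = snd (snd (snd (f x)))" for x
  have loc: "norm (\<nu> x) = 1 \<and> r x > 0 \<and> (L x)-lipschitz_on {y. y \<bullet> \<nu> x = 0} (\<gamma> x) \<and>
        \<Omega> \<inter> ball x (r x) = {y \<in> ball x (r x). y \<bullet> \<nu> x > \<gamma> x (y - (y \<bullet> \<nu> x) *\<^sub>R \<nu> x)}" if "x \<in> frontier \<Omega>" for x
    unfolding \<nu>_def r_def L_def \<gamma>_def by (rule bspec[OF f that, unfolded Q_def])
  have cpt: "compact (frontier \<Omega>)" using b by (rule compact_frontier_bounded)
  have 1: "open (ball x (r x / 2))" for x by simp
  have 2: "frontier \<Omega> \<subseteq> (\<Union>x\<in>frontier \<Omega>. ball x (r x / 2))"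
  proof
    fix x assume x: "x \<in> frontier \<Omega>"
    have "0 < r x" by (rule loc[OF x, THEN conjunct2, THEN conjunct1])
    then have "x \<in> ball x (r x / 2)" by simp
    then show "x \<in> (\<Union>x\<in>frontier \<Omega>. ball x (r x / 2))" using x by blast
  qed
  obtain I where I: "I \<subseteq> frontier \<Omega>" "finite I" "frontier \<Omega> \<subseteq> (\<Union>x\<in>I. ball x (r x / 2))"
    by (rule compactE_image[OF cpt, of "frontier \<Omega>" "\<lambda>x. ball x (r x / 2)"], rule 1, rule 2, rule that)
  show ?thesis
  proof (rule exI[of _ I], rule exI[of _ \<nu>], rule exI[of _ r], rule exI[of _ L], rule exI[of _ \<gamma>], intro conjI ballI)
    fix x assume "x \<in> I"
    then have x: "x \<in> frontier \<Omega>" by (rule subsetD[OF I(1)])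
    have l: "norm (\<nu> x) = 1" "0 < r x" "(L x)-lipschitz_on {y. y \<bullet> \<nu> x = 0} (\<gamma> x)"
      "\<Omega> \<inter> ball x (r x) = {y \<in> ball x (r x). y \<bullet> \<nu> x > \<gamma> x (y - (y \<bullet> \<nu> x) *\<^sub>R \<nu> x)}"
      by (rule loc[OF x, THEN conjunct1], rule loc[OF x, THEN conjunct2, THEN conjunct1],
        rule loc[OF x, THEN conjunct2, THEN conjunct2, THEN conjunct1], rule loc[OF x, THEN conjunct2, THEN conjunct2, THEN conjunct2])
    show "norm (\<nu> x) = 1" "0 < r x" "(L x)-lipschitz_on {y. y \<bullet> \<nu> x = 0} (\<gamma> x)"
      "\<Omega> \<inter> ball x (r x) = {y \<in> ball x (r x). y \<bullet> \<nu> x > \<gamma> x (y - (y \<bullet> \<nu> x) *\<^sub>R \<nu> x)}" by (fact l)+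
    show "0 \<le> L x" using lipschitz_on_nonneg[OF l(3)] .
  qed (fact I)+
qed

text \<open>Locally the frontier lies in arbitrarily thin strips along a graph. The fact is used at
  the end, where the local affine form is known in \<Omega> and in the exterior, but not on the
  frontier.\<close>

lemma frontier_null:
  fixes \<Omega> :: "'a::euclidean_space set"
  assumes "bounded_lipschitz_domain \<Omega>"
  shows "frontier \<Omega> \<in> null_sets lborel"
proof -
  have o: "open \<Omega>" using assms by (simp add: bounded_lipschitz_domain_def)
  from lipschitz_domain_cover[OF assms] obtain I \<nu> r L \<gamma> where
    c: "finite I \<and> frontier \<Omega> \<subseteq> (\<Union>x\<in>I. ball x (r x / 2)) \<and>
    (\<forall>x\<in>I. norm (\<nu> x :: 'a) = 1 \<and> 0 < (r x :: real) \<and> 0 \<le> (L x :: real) \<and> (L x)-lipschitz_on {y. y \<bullet> \<nu> x = 0} (\<gamma> x :: 'a \<Rightarrow> real) \<and>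
        \<Omega> \<inter> ball x (r x) = {y \<in> ball x (r x). y \<bullet> \<nu> x > \<gamma> x (y - (y \<bullet> \<nu> x) *\<^sub>R \<nu> x)})" by (elim exE)
  note I = c[THEN conjunct1] c[THEN conjunct2, THEN conjunct1]
  note loc = bspec[OF c[THEN conjunct2, THEN conjunct2]]
  have l1: "norm (\<nu> x) = 1" if "x \<in> I" for x by (rule loc[OF that, THEN conjunct1])
  have lr: "0 < r x" if "x \<in> I" for x by (rule loc[OF that, THEN conjunct2, THEN conjunct1])
  have l0: "0 \<le> L x" if "x \<in> I" for x by (rule loc[OF that, THEN conjunct2, THEN conjunct2, THEN conjunct1])
  have lg: "(L x)-lipschitz_on {y. y \<bullet> \<nu> x = 0} (\<gamma> x)" if "x \<in> I" for x
    by (rule loc[OF that, THEN conjunct2, THEN conjunct2, THEN conjunct2, THEN conjunct1])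
  have le: "\<Omega> \<inter> ball x (r x) = {y \<in> ball x (r x). y \<bullet> \<nu> x > \<gamma> x (y - (y \<bullet> \<nu> x) *\<^sub>R \<nu> x)}" if "x \<in> I" for x
    by (rule loc[OF that, THEN conjunct2, THEN conjunct2, THEN conjunct2, THEN conjunct2])
  have "emeasure lborel (frontier \<Omega> \<inter> ball x (r x)) = 0" if x: "x \<in> I" for x
  proof -
    have "emeasure lborel (frontier \<Omega> \<inter> ball x (r x)) \<le> ennreal e" if e: "0 < e" for e
    proof -
      define m where "m = measure lborel (ball x (r x + 2)) + 1"
      have m: "0 < m" by (simp add: m_def add_nonneg_pos)
      define d where "d = e / (2 * m)"
      have d: "0 < d" using e m by (simp add: d_def)
      let ?X = "{y \<in> ball x (r x). 0 \<le> y \<bullet> \<nu> x - \<gamma> x (y - (y \<bullet> \<nu> x) *\<^sub>R \<nu> x) \<and> y \<bullet> \<nu> x - \<gamma> x (y - (y \<bullet> \<nu> x) *\<^sub>R \<nu> x) \<le> d}"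
      have X: "id ` ?X \<in> sets borel" "emeasure lborel (id ` ?X) \<le> ennreal (2 * d * norm (id (\<nu> x)) * measure lborel (ball x (r x + 2)))"
      proof -
        have lin: "linear (id :: 'a \<Rightarrow> 'a)" by (simp add: linear_iff)
        have i: "id (id y) = y" for y :: 'a by simp
        have fb: "id ` ball x (r x) \<subseteq> ball x (r x)" by simp
        note g = graph_strip[OF lin lin i i l1[OF x] lg[OF x] fb d]
        show "id ` ?X \<in> sets borel" by (rule g(1))
        show "emeasure lborel (id ` ?X) \<le> ennreal (2 * d * norm (id (\<nu> x)) * measure lborel (ball x (r x + 2)))" by (rule g(2))
      qed
      have "frontier \<Omega> \<inter> ball x (r x) \<subseteq> ?X"
      proof
        fix z assume z: "z \<in> frontier \<Omega> \<inter> ball x (r x)"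
        have "z \<bullet> \<nu> x = \<gamma> x (z - (z \<bullet> \<nu> x) *\<^sub>R \<nu> x)"
          by (rule frontier_on_graph[OF o le[OF x] lg[OF x] l1[OF x] IntD1[OF z] IntD2[OF z]])
        then show "z \<in> ?X" using z d by simp
      qed
      then have "emeasure lborel (frontier \<Omega> \<inter> ball x (r x)) \<le> emeasure lborel ?X" using X(1) by (intro emeasure_mono) simp_all
      also have "\<dots> \<le> ennreal (2 * d * measure lborel (ball x (r x + 2)))" using X(2) l1[OF x] by simp
      also have "\<dots> \<le> ennreal (2 * d * m)" using d by (intro ennreal_leI mult_left_mono) (auto simp: m_def)
      also have "2 * d * m = e" using m by (simp add: d_def)
      finally show ?thesis .
    qed
    then have "emeasure lborel (frontier \<Omega> \<inter> ball x (r x)) \<le> 0 + ennreal e" if "0 < e" for e using that by simp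
    then have "emeasure lborel (frontier \<Omega> \<inter> ball x (r x)) \<le> 0" by (rule ennreal_le_epsilon)
    then show ?thesis by simp
  qed
  then have N: "(\<Union>x\<in>I. frontier \<Omega> \<inter> ball x (r x)) \<in> null_sets lborel"
    using I(1) by (intro null_sets.finite_UN) (auto simp: null_sets_def)
  have cov: "frontier \<Omega> \<subseteq> (\<Union>x\<in>I. frontier \<Omega> \<inter> ball x (r x))"
  proof
    fix z assume z: "z \<in> frontier \<Omega>"
    then obtain x where x: "x \<in> I" "z \<in> ball x (r x / 2)" using I(2) by blast
    have "z \<in> ball x (r x)" using x(2) lr[OF x(1)] by simp
    then show "z \<in> (\<Union>x\<in>I. frontier \<Omega> \<inter> ball x (r x))" using x(1) z by blast
  qed
  show ?thesis by (rule null_sets_subset[OF N _ cov]) simp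
qed

text \<open>The segment from a point of the layer to a point outside meets the frontier, locally a
  graph. Over a distance q the height changes by at most q and the projection by at most 2 * q, so
  the point lies at height at most (1 + 2 * L) * q above the graph; the factor \<open>k\<close>
  converts distances in the image into distances in the domain.\<close>

lemma lipschitz_domain_collar:
  fixes \<Omega> :: "'a::euclidean_space set" and f :: "'a \<Rightarrow> complex"
  assumes dom: "bounded_lipschitz_domain \<Omega>" and f: "linear f" "linear g" "\<And>x. g (f x) = x" "\<And>y. f (g y) = y"
  shows "\<exists>C\<ge>0. collar (f ` \<Omega>) C"
proof -
  have o: "open \<Omega>" and bd: "bounded \<Omega>" using dom by (auto simp: bounded_lipschitz_domain_def)
  from lipschitz_domain_cover[OF dom] obtain I \<nu> r L \<gamma> where
    c: "finite I \<and> frontier \<Omega> \<subseteq> (\<Union>x\<in>I. ball x (r x / 2)) \<and>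
    (\<forall>x\<in>I. norm (\<nu> x :: 'a) = 1 \<and> 0 < (r x :: real) \<and> 0 \<le> (L x :: real) \<and> (L x)-lipschitz_on {y. y \<bullet> \<nu> x = 0} (\<gamma> x :: 'a \<Rightarrow> real) \<and>
        \<Omega> \<inter> ball x (r x) = {y \<in> ball x (r x). y \<bullet> \<nu> x > \<gamma> x (y - (y \<bullet> \<nu> x) *\<^sub>R \<nu> x)})" by (elim exE)
  note I = c[THEN conjunct1] c[THEN conjunct2, THEN conjunct1]
  note loc = bspec[OF c[THEN conjunct2, THEN conjunct2]]
  have l1: "norm (\<nu> x) = 1" if "x \<in> I" for x by (rule loc[OF that, THEN conjunct1])
  have lr: "0 < r x" if "x \<in> I" for x by (rule loc[OF that, THEN conjunct2, THEN conjunct1])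
  have l0: "0 \<le> L x" if "x \<in> I" for x by (rule loc[OF that, THEN conjunct2, THEN conjunct2, THEN conjunct1])
  have lg: "(L x)-lipschitz_on {y. y \<bullet> \<nu> x = 0} (\<gamma> x)" if "x \<in> I" for x
    by (rule loc[OF that, THEN conjunct2, THEN conjunct2, THEN conjunct2, THEN conjunct1])
  have le: "\<Omega> \<inter> ball x (r x) = {y \<in> ball x (r x). y \<bullet> \<nu> x > \<gamma> x (y - (y \<bullet> \<nu> x) *\<^sub>R \<nu> x)}" if "x \<in> I" for x
    by (rule loc[OF that, THEN conjunct2, THEN conjunct2, THEN conjunct2, THEN conjunct2])
  obtain k where k: "0 < k" "\<And>y. norm (g y) \<le> norm y * k" using linear_bounded_pos[OF f(2)] by (auto simp: mult.commute)
  obtain c where c: "0 < c" "\<And>y. norm (f y) \<le> norm y * c" using linear_bounded_pos[OF f(1)] by (auto simp: mult.commute)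
  define rm where "rm = Min (insert 1 (r ` I))"
  have rm: "0 < rm" "\<And>x. x \<in> I \<Longrightarrow> rm \<le> r x" using I(1) lr by (auto simp: rm_def)
  define X where "X d x = {y \<in> ball x (r x). 0 \<le> y \<bullet> \<nu> x - \<gamma> x (y - (y \<bullet> \<nu> x) *\<^sub>R \<nu> x) \<and>
      y \<bullet> \<nu> x - \<gamma> x (y - (y \<bullet> \<nu> x) *\<^sub>R \<nu> x) \<le> (1 + 2 * L x) * (k * d)}" for d x
  define m where "m x = measure lborel (ball (f x) (c * r x + 2))" for x
  have Xb: "f ` X d x \<in> sets borel" "emeasure lborel (f ` X d x) \<le> ennreal (2 * ((1 + 2 * L x) * (k * d)) * norm (f (\<nu> x)) * m x)"
    if "x \<in> I" "0 < d" for d x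
  proof -
    have fb: "f ` ball x (r x) \<subseteq> ball (f x) (c * r x)"
    proof
      fix y assume "y \<in> f ` ball x (r x)"
      then obtain a where a: "y = f a" "norm (x - a) < r x" by (auto simp: dist_norm)
      have "dist (f x) y = norm (f (x - a))" using a f(1) by (simp add: dist_norm linear_diff)
      also have "\<dots> \<le> norm (x - a) * c" by (rule c)
      also have "\<dots> < r x * c" using a c by (intro mult_strict_right_mono) auto
      finally show "y \<in> ball (f x) (c * r x)" by (simp add: mult.commute)
    qed
    have p: "0 < (1 + 2 * L x) * (k * d)" using l0[OF that(1)] k that by (intro mult_pos_pos) auto
    note g = graph_strip[OF f l1[OF that(1)] lg[OF that(1)] fb p]
    show "f ` X d x \<in> sets borel" unfolding X_def by (rule g(1))
    show "emeasure lborel (f ` X d x) \<le> ennreal (2 * ((1 + 2 * L x) * (k * d)) * norm (f (\<nu> x)) * m x)"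
      unfolding X_def m_def by (rule g(2))
  qed
  have "bounded (f ` \<Omega>)" using bd f(1) by (simp add: bounded_linear_image linear_conv_bounded_linear)
  then obtain Rb where Rb: "f ` \<Omega> \<subseteq> ball 0 Rb" using bounded_subset_ballD by blast
  define M where "M = measure lborel (ball (0::complex) Rb)"
  define C where "C = (\<Sum>x\<in>I. 2 * ((1 + 2 * L x) * k) * norm (f (\<nu> x)) * m x) + M * (2 * k / rm)"
  have m0: "0 \<le> m x" "0 \<le> M" for x by (auto simp: m_def M_def)
  have C1: "0 \<le> (\<Sum>x\<in>I. 2 * ((1 + 2 * L x) * k) * norm (f (\<nu> x)) * m x)"
    using l0 k m0 by (intro sum_nonneg mult_nonneg_nonneg) auto
  have C2: "0 \<le> M * (2 * k / rm)" using m0 k rm by simp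
  have "collar (f ` \<Omega>) C"
    unfolding collar_def
  proof (intro allI impI)
    fix d :: real assume d: "0 < d"
    let ?N = "{y \<in> f ` \<Omega>. \<exists>y'. y' \<notin> f ` \<Omega> \<and> dist y y' \<le> d}"
    show "\<exists>B\<in>sets borel. ?N \<subseteq> B \<and> emeasure lborel B \<le> ennreal (C * d)"
    proof (cases "k * d < rm / 2")
      case False
      \<comment> \<open>Wide layers: a ball around the whole image serves, paid by the second
        summand of \<open>C\<close>.\<close>
      then have "1 \<le> 2 * k / rm * d" using rm by (simp add: field_simps)
      then have "M * 1 \<le> M * (2 * k / rm * d)" using m0 by (intro mult_left_mono) auto
      then have "M \<le> C * d" using mult_nonneg_nonneg[OF C1, of d] d by (simp add: C_def distrib_right mult.assoc)
      moreover have "emeasure lborel (ball (0::complex) Rb) = ennreal M"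
        unfolding M_def using emeasure_bounded_finite[of "ball (0::complex) Rb"] by (intro emeasure_eq_ennreal_measure) auto
      ultimately show ?thesis using Rb by (intro bexI[of _ "ball 0 Rb"]) (auto intro: ennreal_leI)
    next
      case True
      have "?N \<subseteq> (\<Union>x\<in>I. f ` X d x)"
      proof
        fix y assume "y \<in> ?N"
        then obtain a y' where a: "y = f a" "a \<in> \<Omega>" "y' \<notin> f ` \<Omega>" "dist y y' \<le> d" by auto
        have "g y' \<notin> \<Omega>" using a(3) f(4) by (metis image_eqI)
        moreover have "connected (closed_segment a (g y'))" by simp
        ultimately have "closed_segment a (g y') \<inter> frontier \<Omega> \<noteq> {}"
          using a(2) by (intro connected_Int_frontier) auto
        then obtain z where z: "z \<in> closed_segment a (g y')" "z \<in> frontier \<Omega>" by blast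
        have "norm (a - z) \<le> norm (a - g y')" using segment_bound(1)[OF z(1)] by (simp add: norm_minus_commute)
        also have "a - g y' = g (y - y')" using f(3) a(1) linear_diff[OF f(2)] by simp
        also have "norm \<dots> \<le> norm (y - y') * k" by (rule k)
        also have "\<dots> \<le> d * k" using a(4) k by (intro mult_right_mono) (auto simp: dist_norm)
        finally have az: "norm (a - z) \<le> k * d" by (simp add: mult.commute)
        obtain x where x: "x \<in> I" "z \<in> ball x (r x / 2)" using I(2) z(2) by blast
        have ax: "a \<in> ball x (r x)"
        proof -
          have "dist x a \<le> dist x z + dist z a" by (rule dist_triangle)
          moreover have "dist x z < r x / 2" using x(2) by simp
          moreover have "dist z a \<le> k * d" unfolding dist_norm norm_minus_commute[of z a] by (rule az)
          ultimately have "dist x a < r x" using True rm(2)[OF x(1)] by linarith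
          then show ?thesis by simp
        qed
        have zx: "z \<in> ball x (r x)" using x(2) lr[OF x(1)] by simp
        define P where "P y = y - (y \<bullet> \<nu> x) *\<^sub>R \<nu> x" for y :: 'a
        have vv: "\<nu> x \<bullet> \<nu> x = 1" using l1[OF x(1)] by (simp add: norm_eq_1)
        have P0: "P y \<in> {y. y \<bullet> \<nu> x = 0}" for y by (simp add: P_def inner_diff_left vv)
        have ze: "z \<bullet> \<nu> x = \<gamma> x (P z)" unfolding P_def by (rule frontier_on_graph[OF o le[OF x(1)] lg[OF x(1)] l1[OF x(1)] z(2) zx])
        have 1: "\<bar>(a - z) \<bullet> \<nu> x\<bar> \<le> norm (a - z)" using Cauchy_Schwarz_ineq2[of "a - z" "\<nu> x"] l1[OF x(1)] by simp
        have "P a - P z = (a - z) - ((a - z) \<bullet> \<nu> x) *\<^sub>R \<nu> x" by (simp add: P_def inner_diff_left algebra_simps)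
        then have "norm (P a - P z) \<le> norm (a - z) + \<bar>(a - z) \<bullet> \<nu> x\<bar>"
          using norm_triangle_ineq4[of "a - z" "((a - z) \<bullet> \<nu> x) *\<^sub>R \<nu> x"] l1[OF x(1)] by simp
        then have 2: "norm (P a - P z) \<le> 2 * (k * d)" using 1 az by linarith
        have "\<bar>\<gamma> x (P a) - \<gamma> x (P z)\<bar> \<le> L x * norm (P a - P z)"
          using lipschitz_onD[OF lg[OF x(1)] P0 P0, of a z] by (simp add: dist_norm)
        also have "\<dots> \<le> L x * (2 * (k * d))" using 2 l0[OF x(1)] by (intro mult_left_mono) auto
        finally have "a \<bullet> \<nu> x - \<gamma> x (P a) \<le> (1 + 2 * L x) * (k * d)"
          using 1 az ze by (simp add: inner_diff_left algebra_simps)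
        moreover have "a \<bullet> \<nu> x > \<gamma> x (P a)"
        proof -
          have "a \<in> \<Omega> \<inter> ball x (r x)" using ax a(2) by blast
          then have "a \<in> {y \<in> ball x (r x). y \<bullet> \<nu> x > \<gamma> x (y - (y \<bullet> \<nu> x) *\<^sub>R \<nu> x)}" by (simp only: le[OF x(1)])
          then show ?thesis by (simp add: P_def)
        qed
        ultimately have "a \<in> X d x" using ax by (simp add: X_def P_def)
        then show "y \<in> (\<Union>x\<in>I. f ` X d x)" using x(1) a(1) by blast
      qed
      moreover have "emeasure lborel (\<Union>x\<in>I. f ` X d x) \<le> ennreal (C * d)"
      proof -
        have "emeasure lborel (\<Union>x\<in>I. f ` X d x) \<le> (\<Sum>x\<in>I. emeasure lborel (f ` X d x))"
          using I(1) Xb(1) d by (intro emeasure_subadditive_finite) auto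
        also have "\<dots> \<le> (\<Sum>x\<in>I. ennreal (2 * ((1 + 2 * L x) * (k * d)) * norm (f (\<nu> x)) * m x))"
          using Xb(2) d by (intro sum_mono) auto
        also have "\<dots> = ennreal (\<Sum>x\<in>I. 2 * ((1 + 2 * L x) * (k * d)) * norm (f (\<nu> x)) * m x)"
          using l0 k d m0 by (intro sum_ennreal mult_nonneg_nonneg) auto
        also have "(\<Sum>x\<in>I. 2 * ((1 + 2 * L x) * (k * d)) * norm (f (\<nu> x)) * m x) = (\<Sum>x\<in>I. 2 * ((1 + 2 * L x) * k) * norm (f (\<nu> x)) * m x) * d"
          unfolding sum_distrib_right by (intro sum.cong HOL.refl) (simp add: algebra_simps)
        also have "ennreal \<dots> \<le> ennreal (C * d)"
          using C2 d by (intro ennreal_leI mult_right_mono) (auto simp: C_def)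
        finally show ?thesis .
      qed
      moreover have "(\<Union>x\<in>I. f ` X d x) \<in> sets borel" using I(1) Xb(1) d by auto
      ultimately show ?thesis by blast
    qed
  qed
  then show ?thesis using C1 C2 by (intro exI[of _ C]) (auto simp: C_def)
qed

section \<open>Matrices and fractional spaces\<close>

text \<open>The matrix of \<open>app A\<close> in real coordinates. Its range consists of all
  trace-free matrices, with \<open>fst A\<close> the symmetric and \<open>snd A\<close> the skew
  part.\<close>

definition mx :: "complex \<times> real \<Rightarrow> real^2^2" where
  "mx A = vector [vector [Re (fst A), Im (fst A) - snd A], vector [Im (fst A) + snd A, - Re (fst A)]]"

lemma mx_nth [simp]: "mx A $ 1 $ 1 = Re (fst A)" "mx A $ 1 $ 2 = Im (fst A) - snd A"
  "mx A $ 2 $ 1 = Im (fst A) + snd A" "mx A $ 2 $ 2 = - Re (fst A)"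
  by (simp_all add: mx_def)

lemma linear_mx: "linear mx"
  by (rule linearI) (simp_all add: vec_eq_iff forall_2 algebra_simps)

lemma norm_mx: "norm (mx A) \<le> 4 * norm A"
proof -
  have 1: "\<bar>Re (fst A)\<bar> \<le> norm A" "\<bar>Im (fst A)\<bar> \<le> norm A" "\<bar>snd A\<bar> \<le> norm A"
    using abs_Re_le_cmod[of "fst A"] abs_Im_le_cmod[of "fst A"] norm_fst_le[of "fst A" "snd A"] norm_snd_le[of "snd A" "fst A"] by auto
  have "norm (mx A) \<le> norm (mx A $ 1) + norm (mx A $ 2)"
    using L2_set_le_sum[of UNIV "\<lambda>i. norm (mx A $ i)"] by (simp add: norm_vec_def[of "mx A"] sum_2)
  moreover have "norm (mx A $ 1) \<le> sqrt ((Re (fst A))\<^sup>2 + (Im (fst A) - snd A)\<^sup>2)" "norm (mx A $ 2) \<le> sqrt ((Im (fst A) + snd A)\<^sup>2 + (Re (fst A))\<^sup>2)"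
    by (simp_all add: norm_vec_def L2_set_def sum_2)
  moreover have "sqrt ((Re (fst A))\<^sup>2 + (Im (fst A) - snd A)\<^sup>2) + sqrt ((Im (fst A) + snd A)\<^sup>2 + (Re (fst A))\<^sup>2) \<le> 4 * norm A"
  proof -
    let ?a = "Re (fst A)" and ?b = "Im (fst A)" and ?t = "snd A"
    have n: "(norm A)\<^sup>2 = ?a\<^sup>2 + ?b\<^sup>2 + ?t\<^sup>2" by (cases A) (simp add: norm_Pair cmod_power2)
    have "?a\<^sup>2 + (?b - ?t)\<^sup>2 \<le> (2 * norm A)\<^sup>2" "(?b + ?t)\<^sup>2 + ?a\<^sup>2 \<le> (2 * norm A)\<^sup>2"
    proof -
      have N: "(2 * norm A)\<^sup>2 = 4 * ?a\<^sup>2 + 4 * ?b\<^sup>2 + 4 * ?t\<^sup>2" by (simp add: power_mult_distrib n distrib_left)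
      have z: "0 \<le> (?b + ?t)\<^sup>2" "0 \<le> (?b - ?t)\<^sup>2" "0 \<le> ?a\<^sup>2" "0 \<le> ?b\<^sup>2" "0 \<le> ?t\<^sup>2" by simp_all
      have gen: "p + (q + r - m) \<le> 4 * p + 4 * q + 4 * r" "q + r + m + p \<le> 4 * p + 4 * q + 4 * r"
        if "0 \<le> q + r + m" "0 \<le> q + r - m" "0 \<le> p" "0 \<le> q" "0 \<le> r" for p q r m :: real using that by simp_all
      note z' = z[unfolded power2_diff power2_sum]
      show "?a\<^sup>2 + (?b - ?t)\<^sup>2 \<le> (2 * norm A)\<^sup>2" unfolding N power2_diff by (rule gen(1)[OF z'])
      show "(?b + ?t)\<^sup>2 + ?a\<^sup>2 \<le> (2 * norm A)\<^sup>2" unfolding N power2_sum by (rule gen(2)[OF z'])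
    qed
    then have "sqrt (?a\<^sup>2 + (?b - ?t)\<^sup>2) \<le> 2 * norm A" "sqrt ((?b + ?t)\<^sup>2 + ?a\<^sup>2) \<le> 2 * norm A"
      by (auto intro: real_le_lsqrt)
    then show ?thesis by linarith
  qed
  ultimately show ?thesis by linarith
qed

lemma c2v_app: "c2v (app A (v2c y)) = mx A *v y"
  by (simp add: vec_eq_iff forall_2 matrix_vector_mult_def sum_2 app_def v2c_def algebra_simps)

lemma K_mx: "sym_part (mx A) \<in> K \<longleftrightarrow> fst A \<in> K3"
proof -
  have s: "sym_part (mx A) $ 1 $ 1 = Re (fst A)" "sym_part (mx A) $ 1 $ 2 = Im (fst A)" "sym_part (mx A) $ 2 $ 1 = Im (fst A)"
    "sym_part (mx A) $ 2 $ 2 = - Re (fst A)"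
    by (simp_all add: sym_part_def transpose_def)
  show ?thesis
    unfolding K_def K3_def e1_def e2_def e3_def insert_iff empty_iff vec_eq_iff forall_2 s
    by (auto simp: complex_eq_iff field_simps)
qed

text \<open>The function \<open>l k\<close> is at most 1 on the hull. From a relatively interior
  point a small step in the direction of minus \<open>k\<close> stays in the hull and strictly
  increases \<open>l k\<close>, so the inequality is strict at the point itself.\<close>

lemma intconv_mx:
  assumes "sym_part M \<in> intconv K"
  obtains A where "M = mx A" "\<And>k. k \<in> K3 \<Longrightarrow> - 2 * Re (cnj k * fst A) < 1"
proof -
  have tr: "sym_part M \<in> tracefree_sym" and ex: "\<exists>T. open T \<and> sym_part M \<in> T \<and> tracefree_sym \<inter> T \<subseteq> convex hull K"
    using assms unfolding intconv_def interior_of_def openin_open by auto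
  obtain T where T: "open T" "sym_part M \<in> T" "tracefree_sym \<inter> T \<subseteq> convex hull K" using ex by blast
  define A where "A = (Complex (M $ 1 $ 1) ((M $ 1 $ 2 + M $ 2 $ 1) / 2), (M $ 2 $ 1 - M $ 1 $ 2) / 2)"
  have "trace M = 0"
    using tr by (simp add: tracefree_sym_def trace_def sym_part_def transpose_def sum_2)
  then have "M $ 2 $ 2 = - M $ 1 $ 1" by (simp add: trace_def sum_2)
  then have MA: "M = mx A" by (simp add: vec_eq_iff forall_2 A_def field_simps)
  define sy where "sy z = mx (z, 0)" for z
  have sA: "sym_part M = sy (fst A)"
    by (simp add: MA sy_def sym_part_def transpose_def vec_eq_iff forall_2)
  have lsy: "linear sy" unfolding sy_def by (rule linearI) (simp_all add: vec_eq_iff forall_2)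
  have tf: "sy z \<in> tracefree_sym" for z
    by (simp add: tracefree_sym_def sy_def transpose_def trace_def sum_2 vec_eq_iff forall_2)
  define l where "l k B = - 2 * (Re k * B $ 1 $ 1 + Im k * B $ 1 $ 2)" for k and B :: "real^2^2"
  have hull: "l k B \<le> 1" if "B \<in> convex hull K" "k \<in> K3" for k B
  proof -
    have "l k (u *\<^sub>R x + v *\<^sub>R y) = u * l k x + v * l k y" for u v x y by (simp add: l_def algebra_simps)
    then have "convex {B. l k B \<le> 1}" unfolding convex_def by (auto intro: convex_bound_le)
    moreover have "K \<subseteq> {B. l k B \<le> 1}"
      using that(2) by (auto simp: K_def K3_def l_def e1_def e2_def e3_def)
    ultimately show ?thesis using that(1) hull_minimal[of K "{B. l k B \<le> 1}" convex] by blast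
  qed
  have "- 2 * Re (cnj k * fst A) < 1" if k: "k \<in> K3" for k
  proof -
    have cs: "continuous_on UNIV (\<lambda>r::real. sy (fst A - of_real r * k))"
      using lsy by (intro linear_continuous_on_compose[of UNIV _ sy] continuous_intros) auto
    have "open ((\<lambda>r::real. sy (fst A - of_real r * k)) -` T)" using cs T(1) by (simp add: open_vimage)
    moreover have "0 \<in> (\<lambda>r::real. sy (fst A - of_real r * k)) -` T" using T(2) sA by simp
    ultimately obtain e where e: "0 < e" "ball 0 e \<subseteq> (\<lambda>r::real. sy (fst A - of_real r * k)) -` T" by (meson openE)
    have "e / 2 \<in> ball 0 e" using e(1) by (simp add: dist_norm)
    then have "sy (fst A - of_real (e / 2) * k) \<in> convex hull K" using e(2) T(3) tf by blast
    then have "l k (sy (fst A - of_real (e / 2) * k)) \<le> 1" using hull k by blast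
    moreover have "l k (sy (fst A - of_real (e / 2) * k)) = - 2 * Re (cnj k * fst A) + e * (Re k * Re k + Im k * Im k)"
      by (simp add: l_def sy_def algebra_simps)
    moreover have "Re k * Re k + Im k * Im k = 1" using cmod_power2[of k] K3_norm[OF k] by (simp add: power2_eq_square)
    ultimately show ?thesis using e(1) by simp
  qed
  then show ?thesis using that MA by blast
qed

lemma lborel_v2c: "distr lborel borel v2c = lborel"
proof -
  have "distr lborel borel v2c = distr (distr lborel borel c2v) borel v2c" by (simp add: lborel_c2v)
  also have "\<dots> = distr lborel borel (\<lambda>x. x)" by (subst distr_distr) (auto simp: o_def)
  finally show ?thesis by (simp add: distr_id2)
qed

lemma nn_integral_v2c: "f \<in> borel_measurable borel \<Longrightarrow> (\<integral>\<^sup>+y. f (v2c y) \<partial>lborel) = (\<integral>\<^sup>+x. f x \<partial>lborel)"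
  by (subst lborel_v2c[symmetric], subst nn_integral_distr) auto

lemma AE_v2c:
  assumes "AE x in lborel. P x" shows "AE y in lborel. P (v2c y)"
proof -
  obtain N where N: "N \<in> null_sets lborel" "{x. \<not> P x} \<subseteq> N" using assms by (auto simp: eventually_ae_filter)
  have "v2c -` N \<in> null_sets lborel"
  proof (rule null_setsI)
    have "N \<in> sets borel" using N by auto
    then have "emeasure lborel N = emeasure lborel (v2c -` N)"
      by (subst lborel_v2c[symmetric], subst emeasure_distr) auto
    then show "emeasure lborel (v2c -` N) = 0" using N by auto
    show "v2c -` N \<in> sets lborel" using measurable_sets[OF v2c_meas \<open>N \<in> sets borel\<close>] by simp
  qed
  then show ?thesis using N(2) by (auto simp: eventually_ae_filter intro!: bexI[of _ "v2c -` N"])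
qed

section \<open>From a translation bound to fractional regularity\<close>

text \<open>On the annulus between \<open>r (Suc k)\<close> and \<open>r k\<close> the integrand is
  comparable with its value at radius \<open>r k\<close>; the factor
  \<open>2 powr \<bar>\<alpha> - n\<bar>\<close> covers both signs of the exponent. The
  contributions form a geometric series with ratio \<open>2 powr (- \<alpha>)\<close>.\<close>

lemma kernel_finite:
  fixes \<alpha> :: real
  assumes R: "0 < R" and a: "0 < \<alpha>"
  shows "(\<integral>\<^sup>+h. ennreal (norm (h :: 'a::euclidean_space) powr (\<alpha> - real DIM('a)) * indicator (ball 0 R) h) \<partial>lborel) < \<infinity>"
proof -
  define n where "n = real DIM('a)"
  define c where "c = measure lborel (ball (0::'a) 1)"
  define q where "q = 2 powr (- \<alpha>)"
  have q: "0 < q" "q < 1" using a by (auto simp: q_def powr_less_one)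
  define r where "r k = R / 2 ^ k" for k :: nat
  have r: "0 < r k" for k using R by (simp add: r_def)
  define b where "b k = (2 powr \<bar>\<alpha> - n\<bar> * r k powr (\<alpha> - n)) * (r k ^ DIM('a) * c)" for k
  have c0: "0 \<le> c" by (simp add: c_def)
  have [measurable]: "ball (0::'a) (r k) \<in> sets borel" for k by simp
  have bq: "b k = 2 powr \<bar>\<alpha> - n\<bar> * c * R powr \<alpha> * q ^ k" for k
  proof -
    have "r k powr (\<alpha> - n) * r k ^ DIM('a) = r k powr \<alpha>"
      using r[of k] by (simp add: n_def powr_diff powr_realpow)
    also have "\<dots> = R powr \<alpha> * q ^ k"
    proof -
      have "(2 ^ k) powr \<alpha> = 2 powr (real k * \<alpha>)" by (simp add: powr_realpow[symmetric] powr_powr)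
      moreover have "q ^ k = 1 / 2 powr (real k * \<alpha>)"
        unfolding q_def by (simp add: powr_realpow[symmetric] powr_powr powr_minus_divide[symmetric] mult.commute)
      ultimately show ?thesis using R by (simp add: r_def powr_divide)
    qed
    finally show ?thesis by (simp add: b_def mult_ac)
  qed
  have pt: "ennreal (norm h powr (\<alpha> - n) * indicator (ball 0 R) h)
      \<le> (\<Sum>k. ennreal (2 powr \<bar>\<alpha> - n\<bar> * r k powr (\<alpha> - n)) * indicator (ball (0::'a) (r k)) h)" if h0: "h \<noteq> 0" for h :: 'a
  proof (cases "norm h < R")
    case True
    define k where "k = (LEAST k. r (Suc k) \<le> norm h)"
    have "\<exists>k. r (Suc k) \<le> norm h"
    proof -
      obtain k where "R / norm h < 2 ^ k" using real_arch_pow[of 2 "R / norm h"] by auto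
      then have "R / 2 ^ k < norm h" using h0 by (simp add: field_simps)
      moreover have "R / 2 ^ Suc k \<le> R / 2 ^ k" using R by (intro divide_left_mono) auto
      ultimately have "r (Suc k) \<le> norm h" unfolding r_def by linarith
      then show ?thesis ..
    qed
    then have k1: "r (Suc k) \<le> norm h" unfolding k_def by (rule LeastI_ex)
    have k2: "norm h < r k"
    proof (cases k)
      case 0
      then show ?thesis using True by (simp add: r_def)
    next
      case (Suc j)
      have "\<not> r (Suc j) \<le> norm h" by (rule not_less_Least) (simp add: k_def[symmetric] Suc)
      then show ?thesis using Suc by simp
    qed
    have up: "norm h powr (\<alpha> - n) \<le> 2 powr \<bar>\<alpha> - n\<bar> * r k powr (\<alpha> - n)"
    proof (cases "0 \<le> \<alpha> - n")
      case True
      have "norm h powr (\<alpha> - n) \<le> r k powr (\<alpha> - n)" using k2 True by (intro powr_mono2) auto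
      also have "\<dots> \<le> 2 powr \<bar>\<alpha> - n\<bar> * r k powr (\<alpha> - n)" using ge_one_powr_ge_zero[of 2 "\<bar>\<alpha> - n\<bar>"] by (simp add: mult_le_cancel_right1)
      finally show ?thesis .
    next
      case False
      have "norm h powr (\<alpha> - n) \<le> r (Suc k) powr (\<alpha> - n)" using k1 False r[of "Suc k"] by (intro powr_mono2') auto
      also have "r (Suc k) = r k / 2" by (simp add: r_def)
      also have "(r k / 2) powr (\<alpha> - n) = 2 powr \<bar>\<alpha> - n\<bar> * r k powr (\<alpha> - n)"
        using False r[of k] by (simp add: powr_divide powr_minus_divide[of 2 "n - \<alpha>", simplified])
      finally show ?thesis .
    qed
    have "ennreal (norm h powr (\<alpha> - n) * indicator (ball 0 R) h) \<le> ennreal (2 powr \<bar>\<alpha> - n\<bar> * r k powr (\<alpha> - n)) * indicator (ball (0::'a) (r k)) h"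
      using up True k2 by (simp add: ennreal_leI)
    also have "\<dots> \<le> (\<Sum>k. ennreal (2 powr \<bar>\<alpha> - n\<bar> * r k powr (\<alpha> - n)) * indicator (ball (0::'a) (r k)) h)"
    proof -
      define F where "F j = ennreal (2 powr \<bar>\<alpha> - n\<bar> * r j powr (\<alpha> - n)) * indicator (ball (0::'a) (r j)) h" for j
      have "sum F {k} \<le> suminf F" by (rule sum_le_suminf[OF summableI]) auto
      then have "F k \<le> (\<Sum>j. F j)" by simp
      then show ?thesis unfolding F_def .
    qed
    finally show ?thesis .
  qed simp
  have "(\<integral>\<^sup>+h. ennreal (norm (h::'a) powr (\<alpha> - n) * indicator (ball 0 R) h) \<partial>lborel)
    \<le> (\<integral>\<^sup>+h. (\<Sum>k. ennreal (2 powr \<bar>\<alpha> - n\<bar> * r k powr (\<alpha> - n)) * indicator (ball (0::'a) (r k)) h) \<partial>lborel)"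
  proof (rule nn_integral_mono_AE)
    have "AE h in lborel. (h::'a) \<noteq> 0" by (rule AE_lborel_singleton)
    then show "AE h in lborel. ennreal (norm h powr (\<alpha> - n) * indicator (ball 0 R) h)
      \<le> (\<Sum>k. ennreal (2 powr \<bar>\<alpha> - n\<bar> * r k powr (\<alpha> - n)) * indicator (ball (0::'a) (r k)) h)"
      by eventually_elim (rule pt)
  qed
  also have "\<dots> = (\<Sum>k. \<integral>\<^sup>+h. ennreal (2 powr \<bar>\<alpha> - n\<bar> * r k powr (\<alpha> - n)) * indicator (ball (0::'a) (r k)) h \<partial>lborel)"
    by (rule nn_integral_suminf) measurable
  also have "\<dots> = (\<Sum>k. ennreal (b k))"
  proof (rule suminf_cong)
    fix k
    have "emeasure lborel (ball (0::'a) (r k)) = ennreal (r k ^ DIM('a) * c)"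
    proof -
      have "emeasure lborel (ball (0::'a) (r k)) = ennreal (measure lborel (ball (0::'a) (r k)))"
        using emeasure_bounded_finite[of "ball (0::'a) (r k)"] by (intro emeasure_eq_ennreal_measure) auto
      also have "measure lborel (ball (0::'a) (r k)) = r k ^ DIM('a) * c"
        using r[of k] by (simp add: c_def content_ball mult.commute)
      finally show ?thesis .
    qed
    then show "(\<integral>\<^sup>+h. ennreal (2 powr \<bar>\<alpha> - n\<bar> * r k powr (\<alpha> - n)) * indicator (ball (0::'a) (r k)) h \<partial>lborel) = ennreal (b k)"
      using r[of k] c0 by (simp add: nn_integral_cmult_indicator b_def ennreal_mult'[symmetric])
  qed
  also have "\<dots> < \<infinity>"
  proof -
    have "summable b" unfolding bq using q by (intro summable_mult summable_geometric) auto
    moreover have "0 \<le> b k" for k using c0 r[of k] by (simp add: b_def)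
    ultimately have "(\<Sum>k. ennreal (b k)) = ennreal (\<Sum>k. b k)" by (intro suminf_ennreal2) auto
    then show ?thesis by simp
  qed
  finally show ?thesis by (simp add: n_def)
qed

text \<open>Boundedness reduces the power \<open>p\<close> to the first power at the price of
  \<open>(2 * B) powr (p - 1)\<close>. After the substitution y = x + h and Fubini the translation
  bound leaves the kernel |h|^(\<theta> - s * p - n), which is integrable near 0 because
  \<open>s * p < \<theta>\<close>.\<close>

lemma Wsp_of_translation_bound:
  fixes f :: "'a::euclidean_space \<Rightarrow> 'b::euclidean_space"
  assumes fm: "f \<in> borel_measurable borel" and bd: "\<And>x. norm (f x) \<le> B" and p: "1 < p" and s: "0 < s" and sp: "s * p < \<theta>"
    and w: "0 \<le> w" "\<And>h. (\<integral>\<^sup>+x. ennreal (norm (f (x + h) - f x)) \<partial>lborel) \<le> ennreal (w * norm h powr \<theta>)"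
  shows "f \<in> loc_space (Wsp_space s p) UNIV"
  unfolding loc_space_def mem_Collect_eq
proof (intro allI impI)
  fix V :: "'a set" assume V: "open V \<and> compact (closure V) \<and> closure V \<subseteq> UNIV"
  have "bounded V" using V compact_imp_bounded bounded_subset closure_subset by metis
  then obtain R0 where R0: "0 < R0" "V \<subseteq> ball 0 R0" using bounded_subset_ballD by blast
  define R where "R = 2 * R0"
  have R: "0 < R" using R0 by (simp add: R_def)
  have Vb: "V \<in> sets borel" using V by simp
  have Vl: "V \<in> sets lebesgue" using V by (simp add: borel_open)
  have B0: "0 \<le> B" using bd[of 0] norm_ge_zero order_trans by blast
  have fin: "emeasure lborel V < \<infinity>" using emeasure_bounded_finite[OF \<open>bounded V\<close>] by simp
  have conv: "(\<integral>\<^sup>+x. g x \<partial>lebesgue_on V) = (\<integral>\<^sup>+x. g x * indicator V x \<partial>lborel)" if "g \<in> borel_measurable borel" for g :: "'a \<Rightarrow> ennreal"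
  proof -
    have "(\<integral>\<^sup>+x. g x \<partial>lebesgue_on V) = (\<integral>\<^sup>+x. g x * indicator V x \<partial>lebesgue)"
      using Vl by (subst nn_integral_restrict_space) auto
    also have "\<dots> = (\<integral>\<^sup>+x. g x * indicator V x \<partial>lborel)"
      by (rule nn_integral_completion)
    finally show ?thesis .
  qed
  have fV: "f \<in> borel_measurable (lebesgue_on V)"
    using fm by (intro measurable_restrict_space1 measurable_completion) simp
  define n where "n = real DIM('a)"
  define \<beta> where "\<beta> = n + s * p"
  have [measurable]: "f \<in> borel_measurable borel" by (rule fm)
  have [measurable]: "V \<in> sets borel" "ball (0::'a) R \<in> sets borel" using Vb by simp_all
  have pb: "norm (f x - f y) powr p \<le> (2 * B) powr (p - 1) * norm (f x - f y)" for x y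
  proof (cases "f x = f y")
    case False
    then have "norm (f x - f y) powr p = norm (f x - f y) powr (p - 1) * norm (f x - f y)"
      using powr_add[of "norm (f x - f y)" "p - 1" 1] by simp
    also have "norm (f x - f y) \<le> 2 * B" using norm_triangle_ineq4[of "f x" "f y"] bd[of x] bd[of y] by linarith
    then have "norm (f x - f y) powr (p - 1) * norm (f x - f y) \<le> (2 * B) powr (p - 1) * norm (f x - f y)"
      using p by (intro mult_right_mono powr_mono2) auto
    finally show ?thesis .
  qed simp
  define C where "C = (2 * B) powr (p - 1)"
  have C0: "0 \<le> C" by (simp add: C_def)
  have Lp: "f \<in> Lp_space p V"
  proof -
    have "(\<integral>\<^sup>+x. ennreal (norm (f x) powr p) \<partial>lebesgue_on V) = (\<integral>\<^sup>+x. ennreal (norm (f x) powr p) * indicator V x \<partial>lborel)"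
      by (intro conv) measurable
    also have "\<dots> \<le> (\<integral>\<^sup>+x. ennreal (B powr p) * indicator V x \<partial>lborel)"
      using bd p by (intro nn_integral_mono mult_right_mono ennreal_leI powr_mono2) auto
    also have "\<dots> = ennreal (B powr p) * emeasure lborel V" using Vb by (intro nn_integral_cmult_indicator) simp
    also have "\<dots> < \<infinity>" using fin by (simp add: ennreal_mult_less_top)
    finally show ?thesis using fV by (simp add: Lp_space_def)
  qed
  let ?k = "\<lambda>x y. ennreal (norm (f x - f y) powr p / norm (x - y) powr \<beta>)"
  have "(\<integral>\<^sup>+x. (\<integral>\<^sup>+y. ?k x y \<partial>lebesgue_on V) \<partial>lebesgue_on V) = (\<integral>\<^sup>+x. (\<integral>\<^sup>+y. ?k x y * indicator V y \<partial>lborel) \<partial>lebesgue_on V)"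
    by (intro nn_integral_cong conv) measurable
  also have "\<dots> = (\<integral>\<^sup>+x. (\<integral>\<^sup>+y. ?k x y * indicator V y \<partial>lborel) * indicator V x \<partial>lborel)"
    using Vb by (intro conv) measurable
  also have "\<dots> \<le> (\<integral>\<^sup>+x. (\<integral>\<^sup>+y. ennreal (C * norm (f x - f y) * norm (x - y) powr (- \<beta>) * indicator (ball 0 R) (y - x)) \<partial>lborel) \<partial>lborel)"
  proof (rule nn_integral_mono)
    fix x :: 'a
    show "(\<integral>\<^sup>+y. ?k x y * indicator V y \<partial>lborel) * indicator V x
      \<le> (\<integral>\<^sup>+y. ennreal (C * norm (f x - f y) * norm (x - y) powr (- \<beta>) * indicator (ball 0 R) (y - x)) \<partial>lborel)"
    proof (cases "x \<in> V")
      case True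
      have "?k x y * indicator V y \<le> ennreal (C * norm (f x - f y) * norm (x - y) powr (- \<beta>) * indicator (ball 0 R) (y - x))" for y
      proof (cases "y \<in> V")
        case yV: True
        have "norm x < R0" "norm y < R0" using True yV R0(2) by auto
        then have "norm (y - x) < R" using norm_triangle_ineq4[of y x] by (simp add: R_def)
        moreover have "norm (f x - f y) powr p * norm (x - y) powr (- \<beta>) \<le> C * norm (f x - f y) * norm (x - y) powr (- \<beta>)"
          using pb[of x y] by (intro mult_right_mono) (auto simp: C_def)
        ultimately show ?thesis using yV by (simp add: powr_minus divide_inverse ennreal_leI)
      qed simp
      then show ?thesis using True by (auto intro!: nn_integral_mono)
    qed simp
  qed
  also have "\<dots> = (\<integral>\<^sup>+x. (\<integral>\<^sup>+h. ennreal (C * norm (f (x + h) - f x) * norm h powr (- \<beta>) * indicator (ball 0 R) h) \<partial>lborel) \<partial>lborel)"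
  proof (rule nn_integral_cong)
    fix x :: 'a
    have "(\<integral>\<^sup>+y. ennreal (C * norm (f x - f y) * norm (x - y) powr (- \<beta>) * indicator (ball 0 R) (y - x)) \<partial>lborel)
      = (\<integral>\<^sup>+y. ennreal (C * norm (f x - f y) * norm (x - y) powr (- \<beta>) * indicator (ball 0 R) (y - x)) \<partial>distr lborel borel ((+) x))"
      by (simp add: lborel_distr_plus)
    also have "\<dots> = (\<integral>\<^sup>+h. ennreal (C * norm (f x - f (x + h)) * norm (x - (x + h)) powr (- \<beta>) * indicator (ball 0 R) (x + h - x)) \<partial>lborel)"
      by (rule nn_integral_distr) measurable
    finally show "(\<integral>\<^sup>+y. ennreal (C * norm (f x - f y) * norm (x - y) powr (- \<beta>) * indicator (ball 0 R) (y - x)) \<partial>lborel)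
      = (\<integral>\<^sup>+h. ennreal (C * norm (f (x + h) - f x) * norm h powr (- \<beta>) * indicator (ball 0 R) h) \<partial>lborel)"
      by (simp add: norm_minus_commute)
  qed
  also have "\<dots> = (\<integral>\<^sup>+h. (\<integral>\<^sup>+x. ennreal (C * norm (f (x + h) - f x) * norm h powr (- \<beta>) * indicator (ball 0 R) h) \<partial>lborel) \<partial>lborel)"
    by (rule lborel_pair.Fubini') measurable
  also have "\<dots> \<le> (\<integral>\<^sup>+h. ennreal (C * w) * ennreal (norm (h::'a) powr ((\<theta> - s * p) - real DIM('a)) * indicator (ball 0 R) h) \<partial>lborel)"
  proof (rule nn_integral_mono)
    fix h :: 'a
    have "(\<integral>\<^sup>+x. ennreal (C * norm (f (x + h) - f x) * norm h powr (- \<beta>) * indicator (ball 0 R) h) \<partial>lborel)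
      = (\<integral>\<^sup>+x. ennreal (C * norm h powr (- \<beta>) * indicator (ball 0 R) h) * ennreal (norm (f (x + h) - f x)) \<partial>lborel)"
      using C0 by (intro nn_integral_cong) (simp add: ennreal_mult'[symmetric] mult_ac)
    also have "\<dots> = ennreal (C * norm h powr (- \<beta>) * indicator (ball 0 R) h) * (\<integral>\<^sup>+x. ennreal (norm (f (x + h) - f x)) \<partial>lborel)"
      by (rule nn_integral_cmult) measurable
    also have "\<dots> \<le> ennreal (C * norm h powr (- \<beta>) * indicator (ball 0 R) h) * ennreal (w * norm h powr \<theta>)"
      by (intro mult_left_mono w) auto
    also have "\<dots> = ennreal (C * w) * ennreal (norm h powr ((\<theta> - s * p) - real DIM('a)) * indicator (ball 0 R) h)"
    proof -
      have "norm h powr (- \<beta>) * norm h powr \<theta> = norm h powr ((\<theta> - s * p) - real DIM('a))"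
        by (simp add: powr_add[symmetric] \<beta>_def n_def algebra_simps)
      then have "C * norm h powr (- \<beta>) * indicator (ball 0 R) h * (w * norm h powr \<theta>) = C * w * (norm h powr ((\<theta> - s * p) - real DIM('a)) * indicator (ball 0 R) h)"
        by (metis (no_types, lifting) mult.assoc mult.commute)
      then show ?thesis using C0 w(1) by (simp add: ennreal_mult'[symmetric])
    qed
    finally show "(\<integral>\<^sup>+x. ennreal (C * norm (f (x + h) - f x) * norm h powr (- \<beta>) * indicator (ball 0 R) h) \<partial>lborel)
      \<le> ennreal (C * w) * ennreal (norm h powr ((\<theta> - s * p) - real DIM('a)) * indicator (ball 0 R) h)" .
  qed
  also have "\<dots> = ennreal (C * w) * (\<integral>\<^sup>+h. ennreal (norm h powr ((\<theta> - s * p) - real DIM('a)) * indicator (ball 0 R) (h::'a)) \<partial>lborel)"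
    by (rule nn_integral_cmult) measurable
  also have "\<dots> < \<infinity>"
    using kernel_finite[OF R, of "\<theta> - s * p", where 'a = 'a] sp by (simp add: ennreal_mult_less_top)
  finally show "f \<in> Wsp_space s p V"
    using Lp by (simp add: Wsp_space_def \<beta>_def n_def)
qed

section \<open>Weak gradients and conclusion\<close>

lemma integrable_compact_support:
  fixes f :: "'a::euclidean_space \<Rightarrow> real"
  assumes "f \<in> borel_measurable borel" "\<And>x. \<bar>f x\<bar> \<le> B * indicator (cball 0 r) x"
  shows "integrable lborel f"
proof (rule Bochner_Integration.integrable_bound)
  show "integrable lborel (\<lambda>x::'a. B * indicator (cball 0 r) x)"
    using emeasure_bounded_finite[of "cball (0::'a) r"] by (intro integrable_mult_right integrable_real_indicator) auto
  show "AE x in lborel. norm (f x) \<le> norm (B * indicator (cball 0 r) x)"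
    using assms(2) by (intro AE_I2) (metis abs_ge_self order_trans real_norm_def)
qed (use assms(1) in simp)

lemma locally_integrable_bounded:
  fixes f :: "'a::euclidean_space \<Rightarrow> 'b::euclidean_space"
  assumes f: "f \<in> borel_measurable borel" and b: "\<And>C. compact C \<Longrightarrow> \<exists>B. \<forall>x\<in>C. norm (f x) \<le> B"
  shows "locally_integrable_on U f"
  unfolding locally_integrable_on_def
proof (intro allI impI)
  fix C assume C: "compact C \<and> C \<subseteq> U"
  obtain B where B: "\<forall>x\<in>C. norm (f x) \<le> B" using b C by blast
  have Cm: "C \<in> lmeasurable" using C lmeasurable_compact by blast
  interpret finite_measure "lebesgue_on C" using Cm by (rule finite_measure_lebesgue_on)
  show "integrable (lebesgue_on C) f"
  proof (rule integrable_const_bound[where B = B])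
    show "AE x in lebesgue_on C. norm (f x) \<le> B" using B by (intro AE_I2) (simp add: space_restrict_space)
    show "f \<in> borel_measurable (lebesgue_on C)"
      using f by (intro measurable_restrict_space1 measurable_completion) simp
  qed
qed

lemma integral_lebesgue_on_support:
  fixes f :: "'a::euclidean_space \<Rightarrow> real"
  assumes f: "f \<in> borel_measurable borel" and U: "open U" and z: "\<And>x. x \<notin> U \<Longrightarrow> f x = 0"
  shows "(LINT x|lebesgue_on U. f x) = (LINT x|lborel. f x)"
proof -
  have "U \<in> sets lebesgue" using U by (simp add: borel_open)
  then have "(LINT x|lebesgue_on U. f x) = (LINT x|lebesgue. indicator U x *\<^sub>R f x)"
    by (intro integral_restrict_space) auto
  also have "(\<lambda>x. indicator U x *\<^sub>R f x) = f" using z by (auto simp: fun_eq_iff indicator_def)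
  also have "(LINT x|lebesgue. f x) = (LINT x|lborel. f x)" using f by (intro integral_completion) simp
  finally show ?thesis .
qed

text \<open>A forward difference quotient of the test function becomes a backward quotient of
  \<open>u\<close> by translation invariance, and both sides converge dominatedly: the quotients of
  \<open>u\<close> are bounded by \<open>L\<close>, those of the test function by the supremum of
  its derivative. Convergence along the steps 1 / (k + 1) is all that \<open>ae\<close> asks for,
  and the local affine form of the solution supplies it.\<close>

lemma lipschitz_weak_gradient:
  fixes u :: "real^'n \<Rightarrow> real^'m" and G :: "real^'n \<Rightarrow> real^'n^'m"
  assumes u: "L-lipschitz_on UNIV u" and G: "G \<in> borel_measurable borel" "\<And>x. norm (G x) \<le> B"
    and ae: "\<And>i j. AE x in lborel. (\<lambda>k. (u x $ i - u (x - (1 / real (Suc k)) *\<^sub>R axis j 1) $ i) / (1 / real (Suc k))) \<longlonglongrightarrow> G x $ i $ j"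
    and U: "open U"
  shows "has_weak_gradient u G U"
  unfolding has_weak_gradient_def
proof (intro conjI allI impI)
  have uc: "continuous_on UNIV u" using u by (rule lipschitz_on_continuous_on)
  have um: "u \<in> borel_measurable borel" using uc by (rule borel_measurable_continuous_onI)
  have ub: "\<exists>B. \<forall>x\<in>C. norm (u x) \<le> B" if "compact C" for C
    using compact_imp_bounded[OF compact_continuous_image[OF continuous_on_subset[OF uc] that]] by (auto simp: bounded_iff)
  show "locally_integrable_on U u" by (rule locally_integrable_bounded[OF um ub])
  show "locally_integrable_on U G" using G by (intro locally_integrable_bounded) auto
  fix \<phi> i j assume \<phi>: "test_function_on U \<phi>"
  define e :: "real^'n" where "e = axis j 1"
  have eB: "e \<in> Basis" "norm e = 1"
  proof -
    show B: "e \<in> Basis" unfolding e_def Basis_vec_def by auto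
    show "norm e = 1" by (rule norm_Basis[OF B])
  qed
  obtain C where C: "compact C" "C \<subseteq> U" "\<And>x. x \<notin> C \<Longrightarrow> \<phi> x = 0" using \<phi> by (auto simp: test_function_on_def)
  have C1: "C_diff (Suc 0) \<phi>" using \<phi> by (auto simp: test_function_on_def simp del: C_diff.simps)
  then have diff: "\<And>x. \<phi> differentiable (at x)" by simp
  define d where "d x = frechet_derivative \<phi> (at x) e" for x
  have dc: "continuous_on UNIV d" using C1 eB unfolding d_def by simp
  have dz: "d x = 0" if "x \<notin> C" for x
  proof -
    have "((\<lambda>x. 0) has_derivative (\<lambda>x. 0)) (at x)" by (rule has_derivative_const)
    then have "(\<phi> has_derivative (\<lambda>x. 0)) (at x)"
      by (rule has_derivative_transform_within_open[where s = "- C"]) (use C that compact_imp_closed in auto)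
    then have "frechet_derivative \<phi> (at x) = (\<lambda>x. 0)" by (rule frechet_derivative_at[symmetric])
    then show ?thesis by (simp add: d_def)
  qed
  obtain K0 where K0: "\<And>x. x \<in> C \<Longrightarrow> \<bar>d x\<bar> \<le> K0"
    using compact_imp_bounded[OF compact_continuous_image[OF continuous_on_subset[OF dc] C(1)]] by (auto simp: bounded_iff)
  define K where "K = max K0 0"
  have K: "\<bar>d x\<bar> \<le> K" "0 \<le> K" for x using K0[of x] dz[of x] by (cases "x \<in> C"; force simp: K_def)+
  have pc: "continuous_on UNIV \<phi>" using diff differentiable_imp_continuous_within by (auto simp: continuous_on_eq_continuous_within)
  have der: "((\<lambda>s. \<phi> (x + s *\<^sub>R e)) has_real_derivative d (x + s *\<^sub>R e)) (at s)" for x s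
  proof -
    have 1: "(\<phi> has_derivative frechet_derivative \<phi> (at (x + s *\<^sub>R e))) (at (x + s *\<^sub>R e))"
      using diff frechet_derivative_works by blast
    have 2: "((\<lambda>s. x + s *\<^sub>R e) has_derivative (\<lambda>s. s *\<^sub>R e)) (at s)" by (auto intro!: derivative_eq_intros)
    have "((\<lambda>s. \<phi> (x + s *\<^sub>R e)) has_derivative (\<lambda>r. frechet_derivative \<phi> (at (x + s *\<^sub>R e)) (r *\<^sub>R e))) (at s)"
      using has_derivative_compose[OF 2 1] by simp
    moreover have "frechet_derivative \<phi> (at (x + s *\<^sub>R e)) (r *\<^sub>R e) = d (x + s *\<^sub>R e) * r" for r
      using linear_scale[OF linear_frechet_derivative[OF diff]] by (simp add: d_def mult.commute)
    ultimately show ?thesis by (simp add: has_field_derivative_def)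
  qed
  define h where "h k = 1 / real (Suc k)" for k
  have h: "0 < h k" "h k \<le> 1" for k by (auto simp: h_def)
  have h0: "h \<longlonglongrightarrow> 0" unfolding h_def using LIMSEQ_inverse_real_of_nat by (simp add: divide_inverse)
  define q where "q k x = (\<phi> (x + h k *\<^sub>R e) - \<phi> x) / h k" for k x
  have ql: "(\<lambda>k. q k x) \<longlonglongrightarrow> d x" for x
  proof -
    have "((\<lambda>r. (\<phi> (x + (0 + r) *\<^sub>R e) - \<phi> (x + 0 *\<^sub>R e)) / r) \<longlongrightarrow> d (x + 0 *\<^sub>R e)) (at 0)"
      using der[of x 0] unfolding DERIV_def by simp
    moreover have "filterlim h (at 0) sequentially"
      using h0 h(1) by (auto simp: filterlim_at intro!: always_eventually) (metis less_irrefl)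
    ultimately show ?thesis unfolding q_def using filterlim_compose by force
  qed
  have qK: "\<bar>q k x\<bar> \<le> K" for k x
  proof -
    have "\<exists>z>0. z < h k \<and> \<phi> (x + h k *\<^sub>R e) - \<phi> (x + 0 *\<^sub>R e) = (h k - 0) * d (x + z *\<^sub>R e)"
      using h(1) der by (intro MVT2) auto
    then obtain z where "\<phi> (x + h k *\<^sub>R e) - \<phi> x = h k * d (x + z *\<^sub>R e)" by auto
    then have "q k x = d (x + z *\<^sub>R e)" using h(1)[of k] by (simp add: q_def)
    then show ?thesis using K by simp
  qed
  obtain r0 where r0: "C \<subseteq> ball 0 r0" using bounded_subset_ballD[OF compact_imp_bounded[OF C(1)]] by blast
  define r where "r = r0 + 1"
  have out: "x \<notin> cball 0 r \<Longrightarrow> \<phi> x = 0 \<and> q k x = 0 \<and> d x = 0" for x k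
  proof -
    assume x: "x \<notin> cball 0 r"
    then have "r0 + 1 < norm x" by (simp add: r_def)
    moreover have "norm x \<le> norm (x + h k *\<^sub>R e) + norm (h k *\<^sub>R e)" using norm_triangle_ineq4[of "x + h k *\<^sub>R e" "h k *\<^sub>R e"] by simp
    moreover have "norm (h k *\<^sub>R e) \<le> 1" using h[of k] eB by simp
    ultimately have "x \<notin> C" "x + h k *\<^sub>R e \<notin> C" using r0 by force+
    then show ?thesis using C(3) dz by (simp add: q_def)
  qed
  obtain Bu0 where Bu0: "\<forall>x\<in>cball 0 r. norm (u x) \<le> Bu0" using ub[OF compact_cball[of 0 r]] by (elim exE)
  define Bu where "Bu = max Bu0 0"
  have Bu: "\<bar>u x $ i\<bar> \<le> Bu" if "x \<in> cball 0 (r)" for x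
  proof -
    have "\<bar>u x $ i\<bar> \<le> norm (u x)" by (rule component_le_norm_cart)
    also have "\<dots> \<le> Bu0" using Bu0 that by blast
    finally show ?thesis by (simp add: Bu_def)
  qed
  have Bu': "0 \<le> Bu" by (simp add: Bu_def)
  have [measurable]: "u \<in> borel_measurable borel" "d \<in> borel_measurable borel" "\<phi> \<in> borel_measurable borel" "G \<in> borel_measurable borel"
    using um dc pc G by (auto intro: borel_measurable_continuous_onI)
  have cmp_meas: "(\<lambda>y::'b::euclidean_space ^ 'k. y $ l) \<in> borel_measurable borel" for l :: "'k::finite"
    by (rule borel_measurable_continuous_onI[OF linear_continuous_on[OF bounded_linear_vec_nth]])
  have [measurable]: "(\<lambda>x. u (f x) $ i) \<in> borel_measurable borel" if "f \<in> borel_measurable borel" for f :: "real^'n \<Rightarrow> real^'n"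
    by (rule measurable_compose[OF measurable_compose[OF that um] cmp_meas])
  have [measurable]: "(\<lambda>x. u x $ i) \<in> borel_measurable borel" by (rule measurable_compose[OF um cmp_meas])
  have [measurable]: "(\<lambda>x. G x $ i $ j) \<in> borel_measurable borel" by (rule measurable_compose[OF measurable_compose[OF G(1) cmp_meas] cmp_meas])
  have [measurable]: "q k \<in> borel_measurable borel" for k unfolding q_def by measurable
  have phiB: "\<exists>P\<ge>0. \<forall>x. \<bar>\<phi> x\<bar> \<le> P * indicator (cball 0 r) x"
  proof -
    obtain P where "\<And>x. x \<in> C \<Longrightarrow> \<bar>\<phi> x\<bar> \<le> P"
      using compact_imp_bounded[OF compact_continuous_image[OF continuous_on_subset[OF pc] C(1)]] by (auto simp: bounded_iff)
    then have "\<bar>\<phi> x\<bar> \<le> max P 0" for x using C(3)[of x] by (cases "x \<in> C") (force simp: max_def)+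
    then show ?thesis using out by (intro exI[of _ "max P 0"]) (auto simp: indicator_def)
  qed
  then obtain P where P: "0 \<le> P" "\<And>x. \<bar>\<phi> x\<bar> \<le> P * indicator (cball 0 r) x" by blast
  have L0: "0 \<le> L" using u by (rule lipschitz_on_nonneg)
  define v where "v k x = (u x $ i - u (x - h k *\<^sub>R e) $ i) / h k" for k x
  have [measurable]: "v k \<in> borel_measurable borel" for k unfolding v_def by measurable
  have vL: "\<bar>v k x\<bar> \<le> L" for k x
  proof -
    have "\<bar>(u x - u (x - h k *\<^sub>R e)) $ i\<bar> \<le> norm (u x - u (x - h k *\<^sub>R e))" by (rule component_le_norm_cart)
    then have "\<bar>u x $ i - u (x - h k *\<^sub>R e) $ i\<bar> \<le> norm (u x - u (x - h k *\<^sub>R e))" by simp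
    also have "\<dots> = dist (u x) (u (x - h k *\<^sub>R e))" by (simp only: dist_norm)
    also have "\<dots> \<le> L * dist x (x - h k *\<^sub>R e)" by (rule lipschitz_onD[OF u UNIV_I UNIV_I])
    also have "dist x (x - h k *\<^sub>R e) = h k" using h(1)[of k] eB by (simp add: dist_norm)
    finally show ?thesis using h(1)[of k] by (simp add: v_def divide_le_eq)
  qed
  have uq: "\<bar>u x $ i * q k x\<bar> \<le> (Bu * K) * indicator (cball 0 r) x" "\<bar>u x $ i * d x\<bar> \<le> (Bu * K) * indicator (cball 0 r) x" for k x
    using Bu[of x] Bu' qK[of k x] K(1)[of x] K(2) out[of x k] by (cases "x \<in> cball 0 r"; simp add: abs_mult mult_mono)+
  have vphi: "\<bar>v k x * \<phi> x\<bar> \<le> (L * P) * indicator (cball 0 r) x" for k x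
    using vL[of k x] P(2)[of x] L0 by (cases "x \<in> cball 0 r"; simp add: abs_mult mult_mono)
  have I1: "(\<lambda>k. LINT x|lborel. u x $ i * q k x) \<longlonglongrightarrow> (LINT x|lborel. u x $ i * d x)"
  proof (rule integral_dominated_convergence[where w = "\<lambda>x. (Bu * K) * indicator (cball 0 r) x"])
    show "integrable lborel (\<lambda>x::real^'n. (Bu * K) * indicator (cball 0 r) x)"
      using Bu' K(2) by (intro integrable_compact_support[where B = "Bu * K" and r = r]) (auto simp: indicator_def)
    show "AE x in lborel. (\<lambda>k. u x $ i * q k x) \<longlonglongrightarrow> u x $ i * d x" using ql by (intro AE_I2 tendsto_mult_left)
  qed (use uq in auto)
  have I2: "(\<lambda>k. LINT x|lborel. v k x * \<phi> x) \<longlonglongrightarrow> (LINT x|lborel. G x $ i $ j * \<phi> x)"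
  proof (rule integral_dominated_convergence[where w = "\<lambda>x. (L * P) * indicator (cball 0 r) x"])
    show "integrable lborel (\<lambda>x::real^'n. (L * P) * indicator (cball 0 r) x)"
      using L0 P(1) by (intro integrable_compact_support[where B = "L * P" and r = r]) (auto simp: indicator_def)
    show "AE x in lborel. (\<lambda>k. v k x * \<phi> x) \<longlonglongrightarrow> G x $ i $ j * \<phi> x"
      using ae[of i j] by eventually_elim (auto simp: v_def h_def e_def intro!: tendsto_mult_right)
  qed (use vphi in auto)
  \<comment> \<open>Discrete integration by parts: \<open>f\<close> contains the shifted
    \<open>u\<close>, and its translate contains the shifted test function.\<close>
  have eq: "(LINT x|lborel. u x $ i * q k x) = - (LINT x|lborel. v k x * \<phi> x)" for k
  proof -
    obtain B2 where B2: "\<forall>x\<in>cball 0 (r + 1). norm (u x) \<le> B2" using ub[OF compact_cball[of 0 "r + 1"]] by (elim exE)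
    define B3 where "B3 = max B2 0"
    have B3: "\<bar>u x $ i\<bar> \<le> B3" if "x \<in> cball 0 (r + 1)" for x
  proof -
    have "\<bar>u x $ i\<bar> \<le> norm (u x)" by (rule component_le_norm_cart)
    also have "\<dots> \<le> B2" using B2 that by blast
    finally show ?thesis by (simp add: B3_def)
  qed
  have B3': "0 \<le> B3" by (simp add: B3_def)
    define f where "f x = u (x - h k *\<^sub>R e) $ i * \<phi> x" for x
    have [measurable]: "f \<in> borel_measurable borel" unfolding f_def by measurable
    have int1: "integrable lborel f"
    proof (rule integrable_compact_support[where B = "B3 * P" and r = r])
      fix x show "\<bar>f x\<bar> \<le> B3 * P * indicator (cball 0 r) x"
      proof (cases "x \<in> cball 0 r")
        case True
        have "norm (x - h k *\<^sub>R e) \<le> norm x + norm (h k *\<^sub>R e)" by (rule norm_triangle_ineq4)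
        then have "x - h k *\<^sub>R e \<in> cball 0 (r + 1)" using True h[of k] eB by simp
        then show ?thesis using B3 B3' P(1) P(2)[of x] True by (simp add: f_def abs_mult mult_mono)
      qed (use P(2)[of x] in \<open>simp add: f_def\<close>)
    qed measurable
    have int2: "integrable lborel (\<lambda>x. u x $ i * \<phi> x)"
    proof (rule integrable_compact_support[where B = "Bu * P" and r = r])
      fix x show "\<bar>u x $ i * \<phi> x\<bar> \<le> Bu * P * indicator (cball 0 r) x"
        using Bu Bu' P(1) P(2)[of x] by (cases "x \<in> cball 0 r") (simp_all add: abs_mult mult_mono)
    qed measurable
    have tr: "(LINT x|lborel. f x) = (LINT x|lborel. f (h k *\<^sub>R e + x))"
    proof -
      have "(LINT x|lborel. f x) = (LINT x|distr lborel borel ((+) (h k *\<^sub>R e)). f x)" by (simp add: lborel_distr_plus)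
      also have "\<dots> = (LINT x|lborel. f (h k *\<^sub>R e + x))" by (rule integral_distr) measurable
      finally show ?thesis .
    qed
    have int3: "integrable lborel (\<lambda>x. f (h k *\<^sub>R e + x))"
    proof -
      have "integrable (distr lborel borel ((+) (h k *\<^sub>R e))) f" using int1 by (simp add: lborel_distr_plus)
      then show ?thesis by (subst (asm) integrable_distr_eq) auto
    qed
    have 1: "u x $ i * q k x = (f (h k *\<^sub>R e + x) - u x $ i * \<phi> x) / h k" for x
      unfolding f_def q_def add.commute[of "h k *\<^sub>R e" x] add_diff_cancel_right' times_divide_eq_right right_diff_distrib ..
    have gen: "(b * p - a * p) / c = - ((a - b) / c * p)" for a b c p :: real
      by (simp add: left_diff_distrib diff_divide_distrib)
    have 2: "(f x - u x $ i * \<phi> x) / h k = - (v k x * \<phi> x)" for x unfolding f_def v_def by (rule gen)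
    have "(LINT x|lborel. u x $ i * q k x) = (LINT x|lborel. (f (h k *\<^sub>R e + x) - u x $ i * \<phi> x) / h k)"
      by (simp only: 1)
    also have "\<dots> = ((LINT x|lborel. f (h k *\<^sub>R e + x)) - (LINT x|lborel. u x $ i * \<phi> x)) / h k"
      unfolding integral_divide_zero Bochner_Integration.integral_diff[OF int3 int2] ..
    also have "\<dots> = ((LINT x|lborel. f x) - (LINT x|lborel. u x $ i * \<phi> x)) / h k" by (simp only: tr)
    also have "\<dots> = (LINT x|lborel. (f x - u x $ i * \<phi> x) / h k)" unfolding integral_divide_zero Bochner_Integration.integral_diff[OF int1 int2] ..
    also have "\<dots> = (LINT x|lborel. - (v k x * \<phi> x))" by (simp only: 2)
    finally show ?thesis by simp
  qed
  have "(\<lambda>k. LINT x|lborel. u x $ i * q k x) \<longlonglongrightarrow> - (LINT x|lborel. G x $ i $ j * \<phi> x)"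
    unfolding eq by (rule tendsto_minus[OF I2])
  then have fin: "(LINT x|lborel. u x $ i * d x) = - (LINT x|lborel. G x $ i $ j * \<phi> x)" using I1 LIMSEQ_unique by blast
  have "(LINT x|lebesgue_on U. u x $ i * d x) = (LINT x|lborel. u x $ i * d x)"
    using dz C(2) U by (intro integral_lebesgue_on_support) auto
  moreover have "(LINT x|lebesgue_on U. G x $ i $ j * \<phi> x) = (LINT x|lborel. G x $ i $ j * \<phi> x)"
    using C U by (intro integral_lebesgue_on_support) auto
  ultimately show "(LINT x|lebesgue_on U. u x $ i * frechet_derivative \<phi> (at x) (axis j 1)) = - (LINT x|lebesgue_on U. G x $ i $ j * \<phi> x)"
    using fin by (simp add: d_def e_def)
qed

section \<open>Transfer from the complex plane to matrices\<close>

theorem theorem1: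
  shows "\<exists>\<theta>\<^sub>0 :: real \<Rightarrow> real. (\<forall>r. 0 < \<theta>\<^sub>0 r \<and> \<theta>\<^sub>0 r < 1) \<and>
    (\<forall>(\<Omega> :: (real^2) set) (M :: real^2^2).
       bounded_lipschitz_domain \<Omega> \<and> sym_part M \<in> intconv K \<longrightarrow>
       (\<exists>(u :: real^2 \<Rightarrow> real^2) (Du :: real^2 \<Rightarrow> real^2^2).
          u \<in> loc_space W1inf_space UNIV \<and>
          has_weak_gradient u Du UNIV \<and>
          (AE x in lebesgue. x \<notin> \<Omega> \<longrightarrow> Du x = M) \<and>
          (AE x in lebesgue. x \<in> \<Omega> \<longrightarrow> sym_part (Du x) \<in> K) \<and>
          Du \<in> Linf_space UNIV \<and>
          (\<forall>s p. 0 < s \<and> s < 1 \<and> 1 < p \<and>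
             s * p < \<theta>\<^sub>0 (infdist (sym_part M) (bdconv K) / infdist (sym_part M) K) \<longrightarrow>
             Du \<in> loc_space (Wsp_space s p) UNIV)))"
proof -
  obtain \<theta> where th: "0 < \<theta>" "\<theta> < 1" and sol: "\<And>\<Omega> E t. open \<Omega> \<Longrightarrow> bounded \<Omega> \<Longrightarrow>
     \<forall>\<kappa> \<kappa>i. linear \<kappa> \<longrightarrow> linear \<kappa>i \<longrightarrow> (\<forall>y. \<kappa> (\<kappa>i y) = y) \<longrightarrow> (\<forall>y. \<kappa>i (\<kappa> y) = y) \<longrightarrow> (\<exists>C\<ge>0. collar (\<kappa> ` \<Omega>) C) \<Longrightarrow>
     \<forall>k\<in>K3. - 2 * Re (cnj k * E) < 1 \<Longrightarrow>
     \<exists>v G L w. L-lipschitz_on UNIV v \<and> 0 \<le> w \<and> (\<forall>x. x \<notin> \<Omega> \<longrightarrow> v x = app (E, t) x \<and> G x = (E, t)) \<and>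
       G \<in> borel_measurable borel \<and> (\<forall>x. norm (G x) \<le> L) \<and>
       (AE x in lborel. x \<in> \<Omega> \<longrightarrow> fst (G x) \<in> K3 \<and> (\<exists>e>0. \<forall>y\<in>ball x e. v y = v x + app (G x) (y - x))) \<and>
       (\<forall>h. (\<integral>\<^sup>+x. ennreal (norm (G (x + h) - G x)) \<partial>lborel) \<le> ennreal (w * norm h powr \<theta>))"
    using domain_solution by blast
  show ?thesis
  proof (rule exI[of _ "\<lambda>_. \<theta>"], intro conjI allI impI)
    show "0 < \<theta>" "\<theta> < 1" by (rule th)+
    fix \<Omega> :: "(real^2) set" and M :: "real^2^2"
    assume asm: "bounded_lipschitz_domain \<Omega> \<and> sym_part M \<in> intconv K"
    then have dom: "bounded_lipschitz_domain \<Omega>" by simp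
    then have o: "open \<Omega>" and bd: "bounded \<Omega>" by (auto simp: bounded_lipschitz_domain_def)
    obtain A where A: "M = mx A" "\<And>k. k \<in> K3 \<Longrightarrow> - 2 * Re (cnj k * fst A) < 1"
      using intconv_mx asm by metis
    define \<Omega>' where "\<Omega>' = v2c ` \<Omega>"
    have mem: "v2c y \<in> \<Omega>' \<longleftrightarrow> y \<in> \<Omega>" for y unfolding \<Omega>'_def by (metis c2v_v2c image_iff)
    have cc: "continuous_on UNIV c2v" using linear_c2v linear_conv_bounded_linear linear_continuous_on by blast
    have "\<Omega>' = c2v -` \<Omega>" unfolding \<Omega>'_def by (auto simp: image_iff) (metis v2c_c2v)
    then have o': "open \<Omega>'" using cc o by (simp add: open_vimage)
    have bd': "bounded \<Omega>'" unfolding \<Omega>'_def using bd linear_v2c by (simp add: bounded_linear_image linear_conv_bounded_linear)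
    \<comment> \<open>A linear image of the transported domain is a linear image of \<Omega> itself,
      composed with the identification.\<close>
    have col: "\<exists>C\<ge>0. collar (\<kappa> ` \<Omega>') C" if k: "linear \<kappa>" "linear \<kappa>i" "\<forall>y. \<kappa> (\<kappa>i y) = y" "\<forall>y. \<kappa>i (\<kappa> y) = y" for \<kappa> \<kappa>i
    proof -
      have "linear (\<kappa> \<circ> v2c)" "linear (c2v \<circ> \<kappa>i)" using k linear_v2c linear_c2v linear_compose by blast+
      from lipschitz_domain_collar[OF dom this] show ?thesis using k by (simp add: \<Omega>'_def image_comp)
    qed
    obtain v G L w where v: "L-lipschitz_on UNIV v" "0 \<le> w" "\<And>x. x \<notin> \<Omega>' \<Longrightarrow> v x = app A x \<and> G x = A"
      and G: "G \<in> borel_measurable borel" "\<And>x. norm (G x) \<le> L"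
      and loc: "AE x in lborel. x \<in> \<Omega>' \<longrightarrow> fst (G x) \<in> K3 \<and> (\<exists>e>0. \<forall>y\<in>ball x e. v y = v x + app (G x) (y - x))"
      and tr: "\<And>h. (\<integral>\<^sup>+x. ennreal (norm (G (x + h) - G x)) \<partial>lborel) \<le> ennreal (w * norm h powr \<theta>)"
      using sol[OF o' bd', of "fst A" "snd A"] col A(2) by auto
    define u where "u y = c2v (v (v2c y))" for y
    define Du where "Du y = mx (G (v2c y))" for y
    have mxm: "mx \<in> borel_measurable borel"
      using linear_mx linear_conv_bounded_linear linear_continuous_on borel_measurable_continuous_onI by blast
    have Gv: "(\<lambda>y. G (v2c y)) \<in> borel_measurable borel" by (rule measurable_compose[OF v2c_meas G(1)])
    have Dm: "Du \<in> borel_measurable borel" unfolding Du_def by (rule measurable_compose[OF Gv mxm])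
    have DB: "norm (Du y) \<le> 4 * L" for y using norm_mx[of "G (v2c y)"] G(2)[of "v2c y"] by (simp add: Du_def)
    have uL: "L-lipschitz_on UNIV u"
    proof (rule lipschitz_onI)
      fix x y :: "real^2"
      have "dist (u x) (u y) = norm (c2v (v (v2c x) - v (v2c y)))" by (simp only: dist_norm u_def linear_diff[OF linear_c2v])
      also have "\<dots> = dist (v (v2c x)) (v (v2c y))" by (simp add: dist_norm)
      also have "\<dots> \<le> L * dist (v2c x) (v2c y)" using v(1) by (rule lipschitz_onD) auto
      also have "dist (v2c x) (v2c y) = norm (v2c (x - y))" by (simp only: dist_norm linear_diff[OF linear_v2c])
      finally show "dist (u x) (u y) \<le> L * dist x y" by (simp add: dist_norm)
    qed (use v(1) lipschitz_on_nonneg in blast)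
    have um: "u \<in> borel_measurable borel" using lipschitz_on_continuous_on[OF uL] by (rule borel_measurable_continuous_onI)
    \<comment> \<open>In \<Omega> the affine form comes from the construction, in the exterior the
      map is linear, and the frontier is a null set.\<close>
    have ae: "AE y in lborel. \<exists>e>0. \<forall>y'\<in>ball y e. u y' = u y + Du y *v (y' - y)"
    proof -
      have "AE y in lborel. y \<notin> frontier \<Omega>" using frontier_null[OF dom] by (rule AE_not_in)
      moreover have "AE y in lborel. v2c y \<in> \<Omega>' \<longrightarrow> fst (G (v2c y)) \<in> K3 \<and> (\<exists>e>0. \<forall>x\<in>ball (v2c y) e. v x = v (v2c y) + app (G (v2c y)) (x - v2c y))"
        by (rule AE_v2c[OF loc])
      ultimately show ?thesis
      proof eventually_elim
        case (elim y)
        have "\<exists>e>0. \<forall>x\<in>ball (v2c y) e. v x = v (v2c y) + app (G (v2c y)) (x - v2c y)"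
        proof (cases "y \<in> \<Omega>")
          case True
          then show ?thesis using elim mem by blast
        next
          case False
          then have "y \<in> - closure \<Omega>" using elim(1) o by (auto simp: frontier_def interior_open)
          moreover have "open (- closure \<Omega>)" by auto
          ultimately obtain e where e: "e > 0" "ball y e \<subseteq> - closure \<Omega>" using openE by blast
          have "v x = v (v2c y) + app (G (v2c y)) (x - v2c y)" if "x \<in> ball (v2c y) e" for x
          proof -
            have "dist y (c2v x) = norm (c2v (v2c y - x))" by (simp add: dist_norm linear_diff[OF linear_c2v])
            then have "c2v x \<in> ball y e" using that by (simp add: dist_norm)
            then have "c2v x \<notin> \<Omega>" using e(2) closure_subset by blast
            then have "x \<notin> \<Omega>'" using mem[of "c2v x"] by simp
            moreover have "v2c y \<notin> \<Omega>'" using False mem by simp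
            ultimately show ?thesis using v(3) by (simp add: app_diff)
          qed
          then show ?thesis using e(1) by blast
        qed
        then obtain e where e: "e > 0" "\<forall>x\<in>ball (v2c y) e. v x = v (v2c y) + app (G (v2c y)) (x - v2c y)" by blast
        have "u y' = u y + Du y *v (y' - y)" if "y' \<in> ball y e" for y'
        proof -
          have "dist (v2c y) (v2c y') = norm (v2c (y - y'))" by (simp add: dist_norm linear_diff[OF linear_v2c])
          then have "v2c y' \<in> ball (v2c y) e" using that by (simp add: dist_norm)
          then have "v (v2c y') = v (v2c y) + app (G (v2c y)) (v2c (y' - y))" using e(2) by (simp add: linear_diff[OF linear_v2c])
          then show ?thesis by (simp add: u_def Du_def linear_add[OF linear_c2v] c2v_app)
        qed
        then show ?case using e(1) by blast
      qed
    qed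
    have quot: "AE x in lborel. (\<lambda>k. (u x $ i - u (x - (1 / real (Suc k)) *\<^sub>R axis j 1) $ i) / (1 / real (Suc k))) \<longlonglongrightarrow> Du x $ i $ j" for i j
      using ae
    proof eventually_elim
      case (elim x)
      then obtain e where e: "e > 0" "\<And>y. y \<in> ball x e \<Longrightarrow> u y = u x + Du x *v (y - x)" by blast
      have "(\<lambda>k. 1 / real (Suc k)) \<longlonglongrightarrow> 0" using LIMSEQ_inverse_real_of_nat by (simp add: divide_inverse)
      then have "\<forall>\<^sub>F k in sequentially. 1 / real (Suc k) < e" using e(1) by (rule order_tendstoD)
      then have "\<forall>\<^sub>F k in sequentially. (u x $ i - u (x - (1 / real (Suc k)) *\<^sub>R axis j 1) $ i) / (1 / real (Suc k)) = Du x $ i $ j"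
      proof eventually_elim
        case (elim k)
        define h where "h = 1 / real (Suc k)"
        have h: "0 < h" "h < e" using elim by (auto simp: h_def)
        have mem: "x - h *\<^sub>R axis j 1 \<in> ball x e" using h by (simp add: dist_norm)
        have "u (x - h *\<^sub>R axis j 1) = u x + Du x *v ((x - h *\<^sub>R axis j 1) - x)" by (rule e(2)[OF mem])
        also have "(x - h *\<^sub>R axis j 1) - x = (- h) *\<^sub>R axis j 1" by simp
        also have "Du x *v ((- h) *\<^sub>R axis j 1) = (- h) *\<^sub>R column j (Du x)"
          by (simp only: matrix_vector_mult_scaleR matrix_vector_mult_basis)
        finally have "u x $ i - u (x - h *\<^sub>R axis j 1) $ i = h * Du x $ i $ j" by (simp add: column_def)
        then show ?case using h unfolding h_def[symmetric] by simp
      qed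
      then show ?case by (rule tendsto_eventually)
    qed
    have wg: "has_weak_gradient u Du V" if "open V" for V
      using that by (intro lipschitz_weak_gradient[OF uL Dm DB quot])
    have lm: "f \<in> borel_measurable (lebesgue_on V)" if "f \<in> borel_measurable borel" for f :: "real^2 \<Rightarrow> 'c::euclidean_space" and V
      using that by (intro measurable_restrict_space1 measurable_completion) simp
    have Dinf: "Du \<in> Linf_space V" for V
      unfolding Linf_space_def using lm[OF Dm] DB by (auto intro!: exI[of _ "4 * L"])
    have 1: "u \<in> loc_space W1inf_space UNIV"
      unfolding loc_space_def W1inf_space_def mem_Collect_eq
    proof (intro allI impI conjI)
      fix V :: "(real^2) set" assume V: "open V \<and> compact (closure V) \<and> closure V \<subseteq> UNIV"
      have "bounded (u ` closure V)"
        using V lipschitz_on_continuous_on[OF uL] by (meson compact_continuous_image compact_imp_bounded continuous_on_subset subset_UNIV)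
      then obtain c where "\<forall>x\<in>closure V. norm (u x) \<le> c" by (auto simp: bounded_iff)
      then have "\<forall>x\<in>V. norm (u x) \<le> c" using closure_subset by blast
      then show "u \<in> Linf_space V"
        unfolding Linf_space_def using lm[OF um] by (auto intro!: exI[of _ c] AE_I2 simp: space_restrict_space)
      show "\<exists>G\<in>Linf_space V. has_weak_gradient u G V" using Dinf wg V by blast
    qed
    have 3: "AE x in lebesgue. x \<notin> \<Omega> \<longrightarrow> Du x = M" using v(3) mem by (intro AE_I2) (auto simp: Du_def A(1))
    have 4: "AE x in lebesgue. x \<in> \<Omega> \<longrightarrow> sym_part (Du x) \<in> K"
    proof -
      have "AE y in lborel. v2c y \<in> \<Omega>' \<longrightarrow> fst (G (v2c y)) \<in> K3 \<and> (\<exists>e>0. \<forall>x\<in>ball (v2c y) e. v x = v (v2c y) + app (G (v2c y)) (x - v2c y))"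
        by (rule AE_v2c[OF loc])
      then have "AE x in lborel. x \<in> \<Omega> \<longrightarrow> sym_part (Du x) \<in> K"
        by eventually_elim (simp add: mem Du_def K_mx)
      then show ?thesis by (rule AE_completion)
    qed
    have 6: "Du \<in> loc_space (Wsp_space s p) UNIV" if "0 < s \<and> s < 1 \<and> 1 < p \<and> s * p < \<theta>" for s p
    proof (rule Wsp_of_translation_bound[OF Dm DB])
      show "(\<integral>\<^sup>+x. ennreal (norm (Du (x + h) - Du x)) \<partial>lborel) \<le> ennreal (4 * w * norm h powr \<theta>)" for h
      proof -
        have [measurable]: "G \<in> borel_measurable borel" by (rule G(1))
        have "(\<integral>\<^sup>+x. ennreal (norm (Du (x + h) - Du x)) \<partial>lborel) \<le> (\<integral>\<^sup>+x. ennreal 4 * ennreal (norm (G (v2c x + v2c h) - G (v2c x))) \<partial>lborel)"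
        proof (intro nn_integral_mono)
          fix x
          have "Du (x + h) - Du x = mx (G (v2c x + v2c h) - G (v2c x))"
            by (simp add: Du_def linear_diff[OF linear_mx] linear_add[OF linear_v2c])
          then show "ennreal (norm (Du (x + h) - Du x)) \<le> ennreal 4 * ennreal (norm (G (v2c x + v2c h) - G (v2c x)))"
            using norm_mx by (simp only: ennreal_mult'[symmetric] ennreal_leI zero_le_numeral)
        qed
        also have "\<dots> = (\<integral>\<^sup>+x. ennreal 4 * ennreal (norm (G (x + v2c h) - G x)) \<partial>lborel)"
          by (rule nn_integral_v2c[where f = "\<lambda>x. ennreal 4 * ennreal (norm (G (x + v2c h) - G x))"]) measurable
        also have "\<dots> = ennreal 4 * (\<integral>\<^sup>+x. ennreal (norm (G (x + v2c h) - G x)) \<partial>lborel)" by (rule nn_integral_cmult) measurable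
        also have "\<dots> \<le> ennreal 4 * ennreal (w * norm (v2c h) powr \<theta>)" by (intro mult_left_mono tr) auto
        also have "\<dots> = ennreal (4 * (w * norm (v2c h) powr \<theta>))" by (rule ennreal_mult'[symmetric]) simp
        also have "4 * (w * norm (v2c h) powr \<theta>) = 4 * w * norm h powr \<theta>" by (simp only: norm_v2c mult.assoc)
        finally show ?thesis .
      qed
    qed (use that v(2) in auto)
    show "\<exists>u Du. u \<in> loc_space W1inf_space UNIV \<and> has_weak_gradient u Du UNIV \<and>
          (AE x in lebesgue. x \<notin> \<Omega> \<longrightarrow> Du x = M) \<and> (AE x in lebesgue. x \<in> \<Omega> \<longrightarrow> sym_part (Du x) \<in> K) \<and>
          Du \<in> Linf_space UNIV \<and>
          (\<forall>s p. 0 < s \<and> s < 1 \<and> 1 < p \<and> s * p < \<theta> \<longrightarrow> Du \<in> loc_space (Wsp_space s p) UNIV)"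
      using 1 wg[OF open_UNIV] 3 4 Dinf 6 by (intro exI[of _ u] exI[of _ Du]) blast
  qed
qed

end
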